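(* For each $n\in\mathbb N$ let $\tilde\mu_n$ be a finite positive Borel measure on $[-1,1]$, $h_n$ a continuous real-valued function on $[-1,1]$, and $\tau_n(x)=\prod_{j=1}^{2n}(1-x/a_{n,j})$, where $\{a_{n,1},\dots,a_{n,2n}\}\subset\overline{\mathbb C}\setminus[-1,1]$ is a conjugate-symmetric multi-set (the points may coincide and may equal $\infty$, in which case $x/a_{n,j}$ is understood as $0$). Let $p_n(z)=\gamma_nz^n+\cdots$, $\gamma_n>0$, be the $n$-th orthonormal polynomial with respect to $\tau_n^{-1}e^{h_n}d\tilde\mu_n$, i.e. $\int p_n(x)x^m\frac{e^{h_n(x)}d\tilde\mu_n(x)}{\tau_n(x)}=0$ for $m\in\{0,\dots,n-1\}$ and $\int p_n^2(x)\frac{e^{h_n(x)}d\tilde\mu_n(x)}{\tau_n(x)}=1$. Assume that $(A)$ there exists a finite measure $\mu$ on $[-1,1]$ such that $\limsup_{n\to\infty}\int f\,d\tilde\mu_n\le\int f\,d\mu$ for every non-negative continuous function $f$ on $[-1,1]$; $(B)$ the Radon–Nikodym derivatives $\tilde v_n$ and $v$ (of the absolutely continuous parts) of $\tilde\mu_n$ and $\mu$ with respect to the arcsine distribution $\omega$ of $[-1,1]$ satisfy $\log\tilde v_n,\log v\in L^1(\omega)$ and $\|\log\tilde v_n-\log v\|_{L^1(\omega)}\to0$ as $n\to\infty$; $(C)$ the functions $h_n$ belong to $\mathcal K$, a fixed compact subset of $C[-1,1]$; $(D)$ $\sum_{j=1}^{2n}(1-|\phi(a_{n,j})|)\to\infty$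 as $n\to\infty$. Then $$2\widetilde G_n^2(z)\,\frac{p_n^2(z)}{\tau_n(z)}\,\prod_{j=1}^{2n}\frac{\phi(z)-\phi(a_{n,j})}{1-\overline{\phi(a_{n,j})}\phi(z)}=1+o_{\mathcal K}(1)$$ locally uniformly in $\overline{\mathbb C}\setminus[-1,1]$ as $n\to\infty$, where $\widetilde G_n(z)=G(e^{h_n}\tilde\mu_n,z)$. In particular, $$\widetilde G_n^2(\infty)\,\frac{\gamma_n^2}{2^{2n-1}}\prod_{j:\,a_{n,j}\ne\infty}\big(2a_{n,j}\phi(a_{n,j})\big)=1+o_{\mathcal K}(1)\quad\text{as } n\to\infty.$$
   Context: $d\omega(x)=\frac{dx}{\pi\sqrt{1-x^2}}$ on $[-1,1]$. $w(z)=\sqrt{z^2-1}$ is the branch holomorphic off $[-1,1]$ with $w(z)=z+O(1)$ at infinity, and $\phi(z)=z-w(z)$ is the conformal map of $\overline{\mathbb C}\setminus[-1,1]$ onto $\mathbb D$ with $\phi(\infty)=0$, $\phi(1)=1$. For a finite positive measure $\nu$ on $[-1,1]$ whose absolutely continuous part with respect to $\omega$ is $v\,d\omega$ with $\log v\in L^1(\omega)$, the Szegő function is $G(\nu,z)=\exp\left(\frac{w(z)}2\int_{-1}^1\frac{\log v(x)}{z-x}\,d\omega(x)\right)$, with $G(\nu,\infty)=\exp(\frac12\int\log v\,d\omega)$. The symbol $o_{\mathcal K}(1)$ denotes a quantity tending to $0$ as $n\to\infty$ (uniformly on compact subsets of $\overline{\mathbb C}\setminus[-1,1]$ when depending on $z$)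 at a rate that depends on $\mathcal K$ but not on the particular choice of $\{h_n\}\subset\mathcal K$. Removable singularities on the left-hand side of the first formula are removed. *)

theory Defs
  imports
    "HOL-Analysis.Analysis"
    "HOL-Complex_Analysis.Complex_Analysis"
    "HOL-Computational_Algebra.Polynomial"
begin

text \<open>The extended complex plane is the one-point compactification of \<^typ>\<open>complex\<close>: \<^term>\<open>Some z\<close>
  is the finite point \<open>z\<close> and \<^term>\<open>None\<close> is the point at infinity.\<close>

abbreviation csphere :: "complex option topology" where
  "csphere \<equiv> Alexandroff_compactification euclidean"

definition slit :: "complex set" where
  "slit = complex_of_real ` {-1..1}"

text \<open>The space \<open>C[-1,1]\<close> with the supremum metric; its elements are functions on the reals that are
  \<^term>\<open>undefined\<close> off \<open>[-1,1]\<close>.\<close>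

abbreviation C_interval :: "(real \<Rightarrow> real) metric" where
  "C_interval \<equiv> cfunspace (top_of_set {-1..1}) euclidean_metric"


subsection \<open>The map \<open>\<phi>\<close>\<close>

text \<open>The branch of the square root of \<open>z\<^sup>2 - 1\<close> that is holomorphic off \<open>[-1,1]\<close>; see \<open>w_branch\<close>
  and \<open>w_unique\<close> below.\<close>

definition w :: "complex \<Rightarrow> complex" where
  "w z = z * csqrt (1 - 1 / z\<^sup>2)"

fun phi :: "complex option \<Rightarrow> complex" where
  "phi None = 0"
| "phi (Some z) = z - w z"


subsection \<open>Measures and the Szego function\<close>

definition arcsine :: "real measure" where
  "arcsine = density lborel (\<lambda>x. ennreal (indicator {-1<..<1} x / (pi * sqrt (1 - x\<^sup>2))))"

definition finite_measure_on_interval :: "real measure \<Rightarrow> bool" where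
  "finite_measure_on_interval \<nu> \<longleftrightarrow>
     sets \<nu> = sets borel \<and> finite_measure \<nu> \<and> emeasure \<nu> (- {-1..1}) = 0"

definition mutually_singular :: "'a measure \<Rightarrow> 'a measure \<Rightarrow> bool" where
  "mutually_singular M N \<longleftrightarrow>
     (\<exists>A\<in>sets M \<inter> sets N. emeasure M A = 0 \<and> emeasure N (space N - A) = 0)"

definition is_ac_part :: "'a measure \<Rightarrow> 'a measure \<Rightarrow> 'a measure \<Rightarrow> bool" where
  "is_ac_part M N A \<longleftrightarrow>
     sets A = sets N \<and> absolutely_continuous M A \<and>
     (\<exists>S. sets S = sets N \<and> mutually_singular M S \<and>
          (\<forall>E\<in>sets N. emeasure N E = emeasure A E + emeasure S E))"

definition ac_part :: "'a measure \<Rightarrow> 'a measure \<Rightarrow> 'a measure" where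
  "ac_part M N = (THE A. is_ac_part M N A)"

definition ac_deriv :: "real measure \<Rightarrow> real \<Rightarrow> real" where
  "ac_deriv \<nu> x = enn2real (RN_deriv arcsine (ac_part arcsine \<nu>) x)"

text \<open>Since \<open>ln 0 = 0\<close> here, integrability of the logarithm must be accompanied by
  positivity almost everywhere.\<close>

definition log_integrable :: "real measure \<Rightarrow> bool" where
  "log_integrable \<nu> \<longleftrightarrow>
     (AE x in arcsine. 0 < ac_deriv \<nu> x) \<and> integrable arcsine (\<lambda>x. ln (ac_deriv \<nu> x))"

fun szego :: "real measure \<Rightarrow> complex option \<Rightarrow> complex" where
  "szego \<nu> None = exp (of_real ((LINT x|arcsine. ln (ac_deriv \<nu> x)) / 2))"
| "szego \<nu> (Some z) =
     exp (w z / 2 * (LINT x|arcsine. of_real (ln (ac_deriv \<nu> x)) / (z - of_real x)))"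


subsection \<open>Orthonormal polynomials with varying weights\<close>

text \<open>\<open>a\<close> enumerates the multi-set of interpolation nodes \<open>a 1, \<dots>, a (2 * n)\<close>.\<close>

definition tau :: "(nat \<Rightarrow> complex option) \<Rightarrow> nat \<Rightarrow> complex \<Rightarrow> complex" where
  "tau a n z = (\<Prod>j=1..2*n. case a j of None \<Rightarrow> 1 | Some b \<Rightarrow> 1 - z / b)"

definition exp_weighted :: "(real \<Rightarrow> real) \<Rightarrow> real measure \<Rightarrow> real measure" where
  "exp_weighted h \<nu> = density \<nu> (\<lambda>x. ennreal (exp (h x)))"

definition orthonormal_poly ::
  "(nat \<Rightarrow> complex option) \<Rightarrow> real measure \<Rightarrow> nat \<Rightarrow> complex poly \<Rightarrow> bool" where
  "orthonormal_poly a \<nu> n p \<longleftrightarrow>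
     degree p = n \<and> (\<exists>\<gamma>>0. lead_coeff p = complex_of_real \<gamma>) \<and>
     (\<forall>m<n. (LINT x|\<nu>. poly p (of_real x) * of_real x ^ m / tau a n (of_real x)) = 0) \<and>
     (LINT x|\<nu>. (poly p (of_real x))\<^sup>2 / tau a n (of_real x)) = 1"


text \<open>The pairs of sequences \<open>(h\<^sub>n)\<close> in \<open>K\<close> and \<open>(p\<^sub>n)\<close> over which the convergence has to be uniform.\<close>

definition admissible ::
  "(real \<Rightarrow> real) set \<Rightarrow> (nat \<Rightarrow> nat \<Rightarrow> complex option) \<Rightarrow> (nat \<Rightarrow> real measure)
     \<Rightarrow> ((nat \<Rightarrow> real \<Rightarrow> real) \<times> (nat \<Rightarrow> complex poly)) set" where
  "admissible K a \<nu> =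
     {(h, p). \<forall>n. h n \<in> K \<and> orthonormal_poly (a n) (exp_weighted (h n) (\<nu> n)) n (p n)}"


subsection \<open>Removal of singularities on the sphere\<close>

fun remove_sings_sphere :: "(complex \<Rightarrow> complex) \<Rightarrow> complex option \<Rightarrow> complex" where
  "remove_sings_sphere f (Some z) = remove_sings f z"
| "remove_sings_sphere f None = Lim at_infinity f"


subsection \<open>Characterisation of \<open>w\<close>\<close>

lemma w_square:
  assumes "z \<notin> slit"
  shows "(w z)\<^sup>2 = z\<^sup>2 - 1"
proof -
  have "z \<noteq> 0" using assms by (force simp: slit_def)
  then show ?thesis by (simp add: w_def power_mult_distrib field_simps)
qed

lemma w_holomorphic: "w holomorphic_on - slit"
proof -
  have "1 - 1 / z\<^sup>2 \<notin> \<real>\<^sub>\<le>\<^sub>0" if z: "z \<in> - slit" for z :: complex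
  proof
    assume "1 - 1 / z\<^sup>2 \<in> \<real>\<^sub>\<le>\<^sub>0"
    then obtain r where r: "1 - 1 / z\<^sup>2 = complex_of_real r" "r \<le> 0"
      by (auto elim!: nonpos_Reals_cases)
    have "z \<noteq> 0" using z by (force simp: slit_def)
    then have "z\<^sup>2 * (1 - complex_of_real r) = 1"
      unfolding r(1)[symmetric] by simp
    then have "z\<^sup>2 * complex_of_real (1 - r) = 1" by simp
    moreover have "complex_of_real (1 - r) \<noteq> 0" using r(2)
      by (simp only: of_real_eq_0_iff)
    ultimately have z2: "z\<^sup>2 = complex_of_real (1 / (1 - r))"
      by (simp add: field_simps)
    define s where "s = sqrt (1 / (1 - r))"
    have s: "0 \<le> s" "s \<le> 1" "s\<^sup>2 = 1 / (1 - r)" using r(2) by (auto simp: s_def)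
    have "z\<^sup>2 = (complex_of_real s)\<^sup>2"
      using z2 s(3) by (metis of_real_power)
    then have "z = complex_of_real s \<or> z = complex_of_real (- s)"
      by (simp add: power2_eq_iff)
    then show False using z s(1,2) by (auto simp: slit_def)
  qed
  moreover have "z \<noteq> 0" if "z \<in> - slit" for z using that by (force simp: slit_def)
  ultimately show ?thesis
    unfolding w_def by (intro holomorphic_intros) auto
qed

lemma w_at_infinity: "((\<lambda>z. w z - z) \<longlongrightarrow> 0) at_infinity"
proof -
  have inv: "((\<lambda>z::complex. 1 / z) \<longlongrightarrow> 0) at_infinity"
    using tendsto_inverse_0 by (simp add: divide_inverse)
  have "((\<lambda>z::complex. 1 - (1 / z)\<^sup>2) \<longlongrightarrow> 1 - 0\<^sup>2) at_infinity"
    by (intro tendsto_intros inv)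
  then have "((\<lambda>z::complex. 1 - 1 / z\<^sup>2) \<longlongrightarrow> 1) at_infinity"
    by (simp add: power_divide)
  then have sq: "((\<lambda>z::complex. csqrt (1 - 1 / z\<^sup>2)) \<longlongrightarrow> csqrt 1) at_infinity"
    by (rule isCont_tendsto_compose[rotated]) (simp add: continuous_at_csqrt)
  have "((\<lambda>z::complex. - (1 / z) / (csqrt (1 - 1 / z\<^sup>2) + 1)) \<longlongrightarrow> - 0 / (csqrt 1 + 1)) at_infinity"
    by (intro tendsto_intros inv sq) auto
  moreover have "\<forall>\<^sub>F z in at_infinity. - (1 / z) / (csqrt (1 - 1 / z\<^sup>2) + 1) = w z - z"
  proof -
    have "- (1 / z) / (csqrt (1 - 1 / z\<^sup>2) + 1) = w z - z" if "norm z \<ge> 2" for z :: complex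
    proof -
      have z: "z \<noteq> 0" using that by auto
      have ne: "csqrt (1 - 1 / z\<^sup>2) + 1 \<noteq> 0"
      proof
        assume "csqrt (1 - 1 / z\<^sup>2) + 1 = 0"
        then have "csqrt (1 - 1 / z\<^sup>2) = -1" by (simp add: eq_neg_iff_add_eq_0)
        moreover have "0 \<le> Re (csqrt (1 - 1 / z\<^sup>2))" by (rule Re_csqrt)
        ultimately show False by simp
      qed
      have "(w z - z) * (csqrt (1 - 1 / z\<^sup>2) + 1) = z * ((csqrt (1 - 1 / z\<^sup>2))\<^sup>2 - 1)"
        by (simp add: w_def power2_eq_square algebra_simps del: power2_csqrt)
      also have "\<dots> = z * (- (1 / z\<^sup>2))" by (simp only: power2_csqrt) simp
      also have "\<dots> = - (1 / z)" using z by (simp add: field_simps power2_eq_square)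
      finally show ?thesis using ne by (metis nonzero_mult_div_cancel_right)
    qed
    then show ?thesis unfolding eventually_at_infinity by blast
  qed
  ultimately show ?thesis by (simp add: tendsto_cong)
qed

lemma w_bigo: "(\<lambda>z. w z - z) \<in> O[at_infinity](\<lambda>_. 1)"
  using w_at_infinity by (intro bigoI_tendsto[where c = 0]) auto

lemmas w_branch = w_holomorphic w_square w_bigo

lemma w_unique:
  assumes "f holomorphic_on - slit" "\<And>z. z \<notin> slit \<Longrightarrow> (f z)\<^sup>2 = z\<^sup>2 - 1"
    and "(\<lambda>z. f z - z) \<in> O[at_infinity](\<lambda>_. 1)" and "z \<notin> slit"
  shows "f z = w z"
proof -
  have w0: "w u \<noteq> 0" if "u \<notin> slit" for u
  proof
    assume "w u = 0"
    with w_square[OF that] have "u\<^sup>2 = 1" by simp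
    then have "u = complex_of_real 1 \<or> u = complex_of_real (-1)" by (simp add: power2_eq_1_iff)
    with that show False unfolding slit_def by (metis atLeastAtMost_iff imageI le_numeral_extra(4)
          le_minus_one_simps(1) neg_le_iff_le order_refl zero_le_one order_trans)
  qed
  have pm: "f u / w u = 1 \<or> f u / w u = -1" if "u \<notin> slit" for u
  proof -
    have "(f u)\<^sup>2 = (w u)\<^sup>2" using assms(2) w_square that by simp
    then show ?thesis using w0[OF that] by (auto simp: power2_eq_iff)
  qed
  have convex: "convex slit" unfolding slit_def
    by (intro convex_linear_image) (auto simp: linear_iff scaleR_conv_of_real)
  have bdd: "bounded slit" unfolding slit_def
    by (intro compact_imp_bounded compact_continuous_image continuous_intros) auto
  have "connected (- slit)"
    using convex bdd by (intro connected_complement_bounded_convex) auto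
  moreover have "continuous_on (- slit) (\<lambda>u. f u / w u)"
    using w0 by (intro continuous_intros holomorphic_on_imp_continuous_on assms(1) w_holomorphic) auto
  moreover have "(\<lambda>u. f u / w u) ` (- slit) \<subseteq> {1, -1}" using pm by blast
  then have "finite ((\<lambda>u. f u / w u) ` (- slit))" by (rule finite_subset) simp
  ultimately have "(\<lambda>u. f u / w u) constant_on - slit"
    by (intro continuous_finite_range_constant)
  then obtain c where c: "\<And>u. u \<notin> slit \<Longrightarrow> f u / w u = c" by (auto simp: constant_on_def)
  show ?thesis
  proof (cases "c = 1")
    case True
    then show ?thesis using c[OF assms(4)] w0[OF assms(4)] by simp
  next
    case False
    then have f: "f u = - w u" if "u \<notin> slit" for u
      using c[OF that] pm[OF that] w0[OF that] by (auto simp: field_simps)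
    have "(\<lambda>z. (f z - z) + (w z - z)) \<in> O[at_infinity](\<lambda>_. 1)"
      using assms(3) w_bigo by (rule sum_in_bigo)
    moreover have "\<forall>\<^sub>F u in at_infinity. (f u - u) + (w u - u) = - 2 * u"
    proof -
      obtain B where "\<And>u. u \<in> slit \<Longrightarrow> norm u \<le> B" using bdd by (auto simp: bounded_iff)
      then have "u \<notin> slit" if "norm u \<ge> B + 1" for u using that by force
      then show ?thesis unfolding eventually_at_infinity
        by (intro exI[of _ "B + 1"]) (auto simp: f)
    qed
    ultimately have "(\<lambda>u::complex. - 2 * u) \<in> O[at_infinity](\<lambda>_. 1)"
      by (rule landau_o.big.in_cong[THEN iffD1, rotated])
    then obtain C where "\<forall>\<^sub>F u::complex in at_infinity. norm (- 2 * u) \<le> C * norm (1::complex)"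
      by (elim landau_o.bigE)
    then obtain R where R: "\<And>u::complex. norm u \<ge> R \<Longrightarrow> 2 * norm u \<le> C"
      by (auto simp: eventually_at_infinity norm_mult)
    define r where "r = max R 0 + max C 0 + 1"
    have "R \<le> norm (complex_of_real r)" "C < 2 * norm (complex_of_real r)"
      by (simp_all only: norm_of_real) (auto simp: r_def)
    then show ?thesis using R[of "complex_of_real r"] by simp
  qed
qed


subsection \<open>Lebesgue decomposition\<close>

lemma is_ac_part_unique:
  assumes "is_ac_part M N A" "is_ac_part M N B" "sets M = sets N"
  shows "A = B"
proof -
  obtain S where S: "sets A = sets N" "absolutely_continuous M A" "sets S = sets N"
      "mutually_singular M S" "\<And>E. E \<in> sets N \<Longrightarrow> emeasure N E = emeasure A E + emeasure S E"
    using assms(1) by (auto simp: is_ac_part_def)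
  obtain T where T: "sets B = sets N" "absolutely_continuous M B" "sets T = sets N"
      "mutually_singular M T" "\<And>E. E \<in> sets N \<Longrightarrow> emeasure N E = emeasure B E + emeasure T E"
    using assms(2) by (auto simp: is_ac_part_def)
  obtain X where X: "X \<in> sets N" "emeasure M X = 0" "emeasure S (space S - X) = 0"
    using S(3,4) by (auto simp: mutually_singular_def)
  obtain Y where Y: "Y \<in> sets N" "emeasure M Y = 0" "emeasure T (space T - Y) = 0"
    using T(3,4) by (auto simp: mutually_singular_def)
  have sp: "space S = space N" "space T = space N" "space A = space N" "space B = space N"
    using S T by (auto dest: sets_eq_imp_space_eq)
  have null: "X \<union> Y \<in> null_sets M"
    using X Y assms(3) by (intro null_sets.Un) auto
  show ?thesis
  proof (rule measure_eqI)
    show "sets A = sets B" using S T by simp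
    fix E assume "E \<in> sets A"
    then have E: "E \<in> sets N" using S by simp
    define F where "F = E - (X \<union> Y)"
    have F: "F \<in> sets N" using E X Y by (auto simp: F_def)
    have FN: "F \<subseteq> space N - X" "F \<subseteq> space N - Y" using sets.sets_into_space[OF E] by (auto simp: F_def)
    have "emeasure S F \<le> emeasure S (space S - X)"
      using FN S(3) X(1) sp by (intro emeasure_mono) (auto simp: S(3))
    then have S0: "emeasure S F = 0" using X(3) by simp
    have "emeasure T F \<le> emeasure T (space T - Y)"
      using FN T(3) Y(1) sp by (intro emeasure_mono) (auto simp: T(3))
    then have T0: "emeasure T F = 0" using Y(3) by simp
    have "emeasure A F = emeasure B F" using S(5)[OF F] T(5)[OF F] S0 T0 by simp
    moreover have "X \<union> Y \<in> null_sets A" "X \<union> Y \<in> null_sets B"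
      using null S(2) T(2) by (auto simp: absolutely_continuous_def)
    then have "emeasure A F = emeasure A E" "emeasure B F = emeasure B E"
      unfolding F_def using E S(1) T(1) by (auto intro!: emeasure_Diff_null_set)
    ultimately show "emeasure A E = emeasure B E" by simp
  qed
qed

lemma is_ac_part_exists:
  assumes "finite_measure N" "sets M = sets N"
  shows "\<exists>A. is_ac_part M N A"
proof -
  interpret finite_measure N by fact
  define s where "s = (SUP X\<in>null_sets M. emeasure N X)"
  have ne: "null_sets M \<noteq> {}" by auto
  obtain X where X: "range X \<subseteq> emeasure N ` null_sets M" "s = (SUP i::nat. X i)"
    using ennreal_SUP_countable_SUP[OF ne, of "emeasure N"] unfolding s_def by auto
  then have "\<forall>i. \<exists>Y\<in>null_sets M. X i = emeasure N Y" by auto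
  then obtain Y where Y: "\<And>i. Y i \<in> null_sets M" "\<And>i. X i = emeasure N (Y i)" by metis
  define Z where "Z = (\<Union>i. Y i)"
  have Z: "Z \<in> null_sets M" unfolding Z_def using Y by auto
  have ZN: "Z \<in> sets N" using Z assms(2) by auto
  have YN: "Y i \<in> sets N" for i using Y(1)[of i] assms(2) by auto
  have le: "emeasure N W \<le> emeasure N Z" if "W \<in> null_sets M" for W
  proof -
    have "emeasure N W \<le> s" unfolding s_def using that by (rule SUP_upper)
    also have "\<dots> \<le> emeasure N Z" unfolding X(2) Y(2)
      by (intro SUP_least emeasure_mono ZN) (auto simp: Z_def)
    finally show ?thesis .
  qed
  define A where "A = density N (indicator (space N - Z))"
  define S where "S = density N (indicator Z)"
  have eA: "emeasure A E = emeasure N (E - Z)" if "E \<in> sets N" for E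
  proof -
    have "(space N - Z) \<inter> E = E - Z" using sets.sets_into_space[OF that] by auto
    then show ?thesis unfolding A_def using that ZN
      by (simp add: emeasure_density indicator_inter_arith[symmetric])
  qed
  have eS: "emeasure S E = emeasure N (E \<inter> Z)" if "E \<in> sets N" for E
    unfolding S_def using that ZN
    by (simp add: emeasure_density indicator_inter_arith[symmetric] Int_commute)
  have "absolutely_continuous M A"
    unfolding absolutely_continuous_def
  proof
    fix E assume E: "E \<in> null_sets M"
    then have EN: "E \<in> sets N" using assms(2) by auto
    have "emeasure N (Z \<union> (E - Z)) = emeasure N Z + emeasure N (E - Z)"
      using EN ZN by (intro plus_emeasure[symmetric]) auto
    moreover have "emeasure N (Z \<union> (E - Z)) \<le> emeasure N Z"
      using E Z by (intro le) auto
    ultimately have "emeasure N (E - Z) = 0"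
      using emeasure_finite[of Z]
      by (metis add.right_neutral antisym ennreal_add_left_cancel infinity_ennreal_def le_iff_add)
    then show "E \<in> null_sets A" using EN eA[OF EN] by (auto simp: A_def)
  qed
  moreover have "mutually_singular M S"
    unfolding mutually_singular_def
    using Z ZN assms(2) eS[of "space N - Z"] by (intro bexI[of _ Z]) (auto simp: S_def Int_commute)
  moreover have "emeasure N E = emeasure A E + emeasure S E" if "E \<in> sets N" for E
  proof -
    have "emeasure N (E - Z) + emeasure N (E \<inter> Z) = emeasure N ((E - Z) \<union> (E \<inter> Z))"
      using that ZN by (intro plus_emeasure) auto
    moreover have "(E - Z) \<union> (E \<inter> Z) = E" by auto
    ultimately show ?thesis using eA eS that by simp
  qed
  ultimately show ?thesis
    unfolding is_ac_part_def by (intro exI[of _ A] conjI exI[of _ S]) (auto simp: A_def S_def)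
qed

lemma is_ac_part_ac_part:
  assumes "finite_measure N" "sets M = sets N"
  shows "is_ac_part M N (ac_part M N)"
  unfolding ac_part_def
  using is_ac_part_exists[OF assms] is_ac_part_unique[OF _ _ assms(2)] by (metis theI)

end

theory Submission
  imports Defs
begin

text \<open>
  Substitute \<open>z = (s + 1/s) / 2\<close> with \<open>s = \<phi>(z)\<close>. The left-hand side of the first formula becomes
  \<open>(G H)\<^sup>2\<close>, where \<open>G\<close> is the outer function of the weight and \<open>H(s)\<close> is a multiple of \<open>s\<^sup>n p\<^sub>n(z) / D(s)\<close>
  with \<open>D(s) = \<Prod> (1 - \<phi>(a\<^sub>j) s)\<close>; on the circle \<open>|H|\<^sup>2 = 2 p\<^sub>n\<^sup>2 / \<tau>\<^sub>n\<close> and \<open>H = cnj H \<cdot> b\<close>, where \<open>b\<close> is the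
  Blaschke product of the nodes. The value \<open>s = 0\<close> gives the second formula.

  By Szego's theorem there is a polynomial \<open>l\<close> with \<open>\<integral> e\<^sup>l d\<sigma> \<approx> 1\<close> and \<open>\<integral> (l + log \<sigma>') d\<omega> \<approx> 0\<close>; hypotheses
  (A) and (B) make the same \<open>l\<close> work for all large \<open>n\<close>, and (C) makes finitely many \<open>l\<close> suffice. Then
  \<open>u = e\<^sup>l \<sigma>'\<close> is close to \<open>1\<close> in the mean, \<open>log u\<close> is close to \<open>0\<close> in the mean, and the singular part
  of \<open>e\<^sup>l \<sigma>\<close> is small. Let \<open>T\<close> be outer with \<open>|T|\<^sup>2 = e\<^sup>l\<close> on the circle and \<open>f = H / T\<close>, so that
  \<open>f = cnj f \<cdot> U\<close> with the unimodular phase \<open>U = cnj T / T \<cdot> b\<close>; by (D) \<open>U\<close> tends to \<open>0\<close> weakly.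
  The extremality of \<open>p\<^sub>n\<close>, tested against a polynomial built from \<open>T\<close>, gives \<open>f(0) \<ge> 1 - o(1)\<close>, while
  \<open>\<integral> |f|\<^sup>2 u \<le> 2\<close>. If \<open>g\<close> is outer with \<open>|g|\<^sup>2 \<approx> u\<close>, expanding \<open>\<integral> |f g - 1 - U|\<^sup>2\<close> shows that \<open>f g\<close> is close to
  \<open>1 + U\<close> in \<open>L\<^sup>2\<close>, so \<open>f g \<rightarrow> 1\<close> inside the disc. Since \<open>g \<rightarrow> 1\<close> and \<open>G T \<rightarrow> 1\<close> there, \<open>G H \<rightarrow> 1\<close>.
\<close>

text \<open>Only integrals of the weights are controlled, so there is no pointwise comparison on
  \<open>[-1,1]\<close>. The target \<open>1 + U\<close> has mean square tending to 2, yet leaves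
  only 1 inside the disc because \<open>U\<close> dies weakly; this is why the bound 2 on the
  weighted norm of \<open>f\<close> fits \<open>f(0)\<close> near 1. The exponent \<open>l\<close>
  is a polynomial so that \<open>T = exp Q\<close> is zero-free and entire and \<open>T(1/s)\<close>
  continues off the circle: contours can then be moved inward, where \<open>b\<close> is small. A
  trial polynomial must have degree at most \<open>n\<close>, which \<open>T(1/s) N(s)\<close> does
  not give; reducing it modulo \<open>D\<close> repairs this at a cost proportional to the size of
  \<open>b\<close> near 0. The order of choices carries the uniformity: \<open>l\<close> comes from
  \<open>\<mu>\<close> and one member of \<open>K\<close>; the smallness \<eta> demanded of
  \<open>b\<close> depends on \<open>l\<close>, its half \<open>Q\<close>, \<delta> and the radius
  only; nodes, degree, weight and polynomial come last. The auxiliary \<open>g\<close> may depend on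
  all of them, since only its integrals enter. The tolerance is \<open>\<delta> ^ 4\<close> because
  two weighted arithmetic-geometric means each halve the exponent: mean errors are of order
  \<open>\<delta>\<^sup>2\<close>, values inside the disc of order \<delta>.\<close>

definition circ :: "real measure" where
  "circ = restrict_space lborel {0..1}"

definition ept :: "real \<Rightarrow> complex" where
  "ept t = cis (2 * pi * t)"

abbreviation ecos :: "real \<Rightarrow> real" where
  "ecos t \<equiv> cos (2 * pi * t)"

text \<open>The Schwarz kernel: for \<open>x = cos \<theta>\<close> it is the mean of \<open>(e\<^sup>i\<^sup>t + s) / (e\<^sup>i\<^sup>t - s)\<close> over \<open>t = \<plusminus>\<theta>\<close>, and
  \<open>pk (phi z) x = w z / (z - x)\<close>.\<close>

definition pk :: "complex \<Rightarrow> real \<Rightarrow> complex" where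
  "pk s x = (1 - s\<^sup>2) / (1 + s\<^sup>2 - 2 * s * of_real x)"

section \<open>Boundary points of the disc and normalised arc length\<close>

lemma norm_ept [simp]: "norm (ept t) = 1"
  by (simp add: ept_def)

lemma ept_nonzero [simp]: "ept t \<noteq> 0"
  by (simp add: ept_def)

lemma Re_ept [simp]: "Re (ept t) = ecos t"
  by (simp add: ept_def)

lemma continuous_on_ept [continuous_intros]: "continuous_on A ept"
  unfolding ept_def cis_conv_exp by (intro continuous_intros)

lemma cnj_ept: "cnj (ept t) = 1 / ept t"
  using complex_div_cnj[of 1 "ept t"] by simp

lemma space_circ [simp]: "space circ = {0..1}"
  by (simp add: circ_def space_restrict_space)

lemma prob_circ: "emeasure circ {0..1} = 1"
  by (simp add: circ_def emeasure_restrict_space)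

interpretation circ: finite_measure circ
  by (rule finite_measureI) (simp add: prob_circ)

lemma measure_circ [simp]: "measure circ {0..1} = 1"
  by (simp only: measure_def prob_circ enn2real_1)

lemma measurable_circ_continuous:
  "continuous_on {0..1} f \<Longrightarrow> f \<in> borel_measurable circ"
  unfolding circ_def
  using borel_measurable_continuous_on_restrict[of "{0..1}" f]
    measurable_cong_sets[OF sets_restrict_space_cong[OF sets_lborel, of "{0..1}"] refl[of "sets borel"]]
  by blast

lemma integrable_circ_continuous:
  fixes f :: "real \<Rightarrow> 'b::euclidean_space"
  assumes "continuous_on {0..1} f" shows "integrable circ f"
proof -
  have "compact (f ` {0..1})" by (intro compact_continuous_image assms) auto
  then have "bounded (f ` {0..1})" by (rule compact_imp_bounded)
  then obtain B where B: "\<And>y. y \<in> f ` {0..1} \<Longrightarrow> norm y \<le> B" unfolding bounded_iff by auto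
  have "AE t in circ. norm (f t) \<le> B" using B by (intro AE_I2) simp
  then show ?thesis by (rule circ.integrable_const_bound[OF _ measurable_circ_continuous[OF assms]])
qed

lemma integral_circ:
  fixes f :: "real \<Rightarrow> 'b::euclidean_space"
  assumes "continuous_on {0..1} f" shows "(LINT t|circ. f t) = integral {0..1} f"
proof -
  have "(LINT t|circ. f t) = (LINT t:{0..1}|lborel. f t)"
    unfolding circ_def set_lebesgue_integral_def by (subst integral_restrict_space) auto
  also have "\<dots> = integral {0..1} f"
    by (intro set_borel_integral_eq_integral borel_integrable_atLeastAtMost' assms)
  finally show ?thesis .
qed

subsection \<open>The arcsine distribution as an image of arc length\<close>

text \<open>Substitute \<open>x = cos (2 pi t)\<close> on the half circle where the cosine
  increases, then share the resulting factor 2 between both halves by symmetry. Non-negative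
  integrals avoid all integrability questions; taking indicators gives the equality of
  measures.\<close>

lemma nn_integral_arcsine:
  fixes f :: "real \<Rightarrow> ennreal"
  assumes [measurable]: "f \<in> borel_measurable borel"
  shows "(\<integral>\<^sup>+x. f x \<partial>arcsine) = (\<integral>\<^sup>+t. f (ecos t) \<partial>circ)"
proof -
  define g where "g x = f x * ennreal (indicator {-1<..<1} x / (pi * sqrt (1 - x\<^sup>2)))" for x
  have [measurable]: "g \<in> borel_measurable borel" unfolding g_def by measurable
  have "(\<integral>\<^sup>+x. f x \<partial>arcsine) = (\<integral>\<^sup>+x. g x \<partial>lborel)"
    unfolding arcsine_def g_def by (subst nn_integral_density) (auto simp: mult.commute)
  also have "\<dots> = (\<integral>\<^sup>+x. g x * indicator {-1..1} x \<partial>lborel)"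
    by (intro nn_integral_cong) (auto simp: g_def indicator_def)
  also have "\<dots> = (\<integral>\<^sup>+x. g x * indicator {ecos (1/2)..ecos 1} x \<partial>lborel)" by simp
  also have "\<dots> = (\<integral>\<^sup>+t. g (ecos t) * ennreal (- (2 * pi) * sin (2 * pi * t)) * indicator {1/2..1} t \<partial>lborel)"
  proof (rule nn_integral_substitution_aux)
    fix t :: real assume t: "t \<in> {1/2..1}"
    have "sin (2 * pi * t) = - sin (2 * pi * t - pi)" by (simp add: sin_diff)
    moreover have "0 \<le> sin (2 * pi * t - pi)"
      using t by (intro sin_ge_zero) (auto simp: field_simps)
    ultimately have "sin (2 * pi * t) \<le> 0" by simp
    then show "0 \<le> - (2 * pi) * sin (2 * pi * t)" by (simp add: mult_nonneg_nonpos)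
  qed (auto intro!: derivative_eq_intros continuous_intros)
  \<comment> \<open>The arcsine density cancels the derivative of the cosine up to the factor 2. At
    the two endpoints the density was set to 0, which only affects a null set.\<close>
  also have "\<dots> = (\<integral>\<^sup>+t. 2 * f (ecos t) * indicator {1/2..1} t \<partial>lborel)"
  proof (rule nn_integral_cong_AE)
    have "AE t in lborel. t \<notin> {1/2, 1::real}"
      by (intro AE_not_in) (auto intro!: countable_imp_null_set_lborel)
    then show "AE t in lborel. g (ecos t) * ennreal (- (2 * pi) * sin (2 * pi * t)) * indicator {1/2..1} t
        = 2 * f (ecos t) * indicator {1/2..1} t"
    proof eventually_elim
      case (elim t)
      show ?case
      proof (cases "t \<in> {1/2..1}")
        case True
        then have t: "1/2 < t" "t < 1" using elim by auto
        have "sin (2 * pi * t) = - sin (2 * pi * t - pi)" by (simp add: sin_diff)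
        moreover have "0 < sin (2 * pi * t - pi)"
          using t by (intro sin_gt_zero) (auto simp: field_simps)
        ultimately have s: "sin (2 * pi * t) < 0" by simp
        have sq: "sqrt (1 - (ecos t)\<^sup>2) = - sin (2 * pi * t)"
          using s by (simp add: sin_squared_eq[symmetric])
        have "(ecos t)\<^sup>2 < 1" using s sin_cos_squared_add[of "2 * pi * t"]
          by (smt (verit) zero_less_power2)
        then have c: "-1 < ecos t" "ecos t < 1" by (auto simp: abs_square_less_1 abs_less_iff)
        have "g (ecos t) * ennreal (- (2 * pi) * sin (2 * pi * t))
            = f (ecos t) * (ennreal (1 / (pi * (- sin (2 * pi * t)))) * ennreal (- (2 * pi) * sin (2 * pi * t)))"
          using c sq by (simp add: g_def mult.assoc)
        also have "ennreal (1 / (pi * (- sin (2 * pi * t)))) * ennreal (- (2 * pi) * sin (2 * pi * t)) = ennreal 2"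
          using s by (subst ennreal_mult[symmetric]) (auto simp: field_simps mult_nonneg_nonpos)
        finally show ?thesis using True by (simp add: mult.commute)
      qed simp
    qed
  qed
  also have "\<dots> = (\<integral>\<^sup>+t. f (ecos t) * indicator {1/2..1} t + f (ecos t) * indicator {1/2..1} t \<partial>lborel)"
    by (simp only: mult_2 distrib_right)
  also have "\<dots> = (\<integral>\<^sup>+t. f (ecos t) * indicator {1/2..1} t \<partial>lborel) + (\<integral>\<^sup>+t. f (ecos t) * indicator {1/2..1} t \<partial>lborel)" (is "_ = ?I + _")
    by (rule nn_integral_add) simp_all
  finally have twice: "(\<integral>\<^sup>+x. f x \<partial>arcsine) = ?I + ?I" .
  \<comment> \<open>The reflection \<open>t\<close> to \<open>1 - t\<close> leaves the cosine fixed
    and exchanges the two halves of the circle.\<close>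
  have "?I = (\<integral>\<^sup>+t. f (ecos (1 + (-1) * t)) * indicator {1/2..1} (1 + (-1) * t) \<partial>lborel)"
    by (subst nn_integral_real_affine[of _ "-1" 1]) auto
  also have "\<dots> = (\<integral>\<^sup>+t. f (ecos t) * indicator {0..1/2} t \<partial>lborel)"
    by (intro nn_integral_cong) (auto simp: indicator_def algebra_simps cos_diff)
  finally have "(\<integral>\<^sup>+x. f x \<partial>arcsine)
     = (\<integral>\<^sup>+t. f (ecos t) * indicator {0..1/2} t \<partial>lborel) + ?I"
    using twice by simp
  also have "\<dots> = (\<integral>\<^sup>+t. f (ecos t) * indicator {0..1/2} t + f (ecos t) * indicator {1/2..1} t \<partial>lborel)"
    by (rule nn_integral_add[symmetric]) simp_all
  also have "\<dots> = (\<integral>\<^sup>+t. f (ecos t) * indicator {0..1} t \<partial>lborel)"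
  proof (rule nn_integral_cong_AE)
    have "AE t in lborel. t \<notin> {1/2::real}"
      by (intro AE_not_in) (auto intro!: countable_imp_null_set_lborel)
    then show "AE t in lborel. f (ecos t) * indicator {0..1/2} t + f (ecos t) * indicator {1/2..1} t
        = f (ecos t) * indicator {0..1} t"
    proof eventually_elim
      case (elim t)
      then consider "t \<in> {0..<1/2}" | "t \<in> {1/2<..1}" | "t \<notin> {0..1}" by force
      then show ?case by cases (auto simp: indicator_def)
    qed
  qed
  also have "\<dots> = (\<integral>\<^sup>+t. f (ecos t) \<partial>circ)"
    unfolding circ_def by (subst nn_integral_restrict_space) auto
  finally show ?thesis .
qed

lemma sets_arcsine [measurable_cong, simp]: "sets arcsine = sets borel"
  by (simp add: arcsine_def)

lemma space_arcsine [simp]: "space arcsine = UNIV"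
  by (simp add: arcsine_def)

lemma measurable_ecos [measurable]: "ecos \<in> borel_measurable circ"
  by (intro measurable_circ_continuous continuous_intros)

lemma arcsine_eq_distr: "arcsine = distr circ borel ecos"
proof (rule measure_eqI)
  fix A assume "A \<in> sets arcsine"
  then have A [measurable]: "A \<in> sets borel" by simp
  have "emeasure arcsine A = (\<integral>\<^sup>+x. indicator A x \<partial>arcsine)" by simp
  also have "\<dots> = (\<integral>\<^sup>+t. indicator A (ecos t) \<partial>circ)" by (rule nn_integral_arcsine) auto
  also have "\<dots> = (\<integral>\<^sup>+x. indicator A x \<partial>distr circ borel ecos)"
    by (rule nn_integral_distr[symmetric]) auto
  finally show "emeasure arcsine A = emeasure (distr circ borel ecos) A" by simp
qed simp

lemma emeasure_arcsine_UNIV: "emeasure arcsine UNIV = 1"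
proof -
  have "emeasure arcsine UNIV = emeasure circ (ecos -` UNIV \<inter> space circ)"
    by (subst arcsine_eq_distr, rule emeasure_distr) measurable
  then show ?thesis by (simp only: vimage_UNIV Int_UNIV_left space_circ prob_circ)
qed

interpretation arcsine: finite_measure arcsine
  by (rule finite_measureI) (simp add: emeasure_arcsine_UNIV)

lemma measure_arcsine_UNIV [simp]: "measure arcsine UNIV = 1"
  by (simp only: measure_def emeasure_arcsine_UNIV enn2real_1)

lemma integral_arcsine:
  fixes f :: "real \<Rightarrow> 'b::{banach, second_countable_topology}"
  assumes "f \<in> borel_measurable borel"
  shows "(LINT x|arcsine. f x) = (LINT t|circ. f (ecos t))"
  unfolding arcsine_eq_distr by (rule integral_distr[OF measurable_ecos assms])

lemma integrable_arcsine_iff: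
  fixes f :: "real \<Rightarrow> 'b::{banach, second_countable_topology}"
  assumes "f \<in> borel_measurable borel"
  shows "integrable arcsine f \<longleftrightarrow> integrable circ (\<lambda>t. f (ecos t))"
  unfolding arcsine_eq_distr by (rule integrable_distr_eq[OF measurable_ecos assms])

lemma AE_arcsine_interval: "AE x in arcsine. x \<in> {-1<..<1}"
  unfolding arcsine_def by (subst AE_density) (auto simp: indicator_def)

subsection \<open>The Schwarz kernel\<close>

lemma pk_0 [simp]: "pk 0 x = 1"
  by (simp add: pk_def)

lemma pk_denominator:
  fixes s :: complex
  shows "1 + s\<^sup>2 - 2 * s * of_real (ecos t) = (1 - s * ept t) * (1 - s / ept t)"
proof -
  have c: "2 * complex_of_real (ecos t) = ept t + 1 / ept t"
    using complex_add_cnj[of "ept t"] by (simp add: cnj_ept)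
  have "2 * s * of_real (ecos t) = s * (2 * of_real (ecos t))" by simp
  also have "\<dots> = s * ept t + s / ept t" by (simp only: c distrib_left times_divide_eq_right mult_1_right)
  finally have e: "2 * s * of_real (ecos t) = s * ept t + s / ept t" .
  have "(s * ept t) * (s / ept t) = s\<^sup>2" by (simp add: power2_eq_square)
  then show ?thesis unfolding e by (simp only: left_diff_distrib right_diff_distrib mult_1_left mult_1_right) simp
qed

lemma pk_circ: "pk s (ecos t) = (1 - s\<^sup>2) * ept t / ((1 - s * ept t) * (ept t - s))"
proof -
  have "(1 - s * ept t) * (1 - s / ept t) = (1 - s * ept t) * (ept t - s) / ept t"
    by (simp add: field_simps)
  then show ?thesis by (simp add: pk_def pk_denominator)
qed

lemma obtain_circle_angle:
  assumes "-1 \<le> x" "x \<le> 1" obtains t where "t \<in> {0..1}" "x = ecos t"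
proof
  have "arccos x \<le> pi" "0 \<le> arccos x" using assms arccos_bounded by auto
  then show "arccos x / (2 * pi) \<in> {0..1}" by (auto simp: field_simps)
  show "x = ecos (arccos x / (2 * pi))" using assms by simp
qed

lemma pk_denominator_ge:
  fixes s :: complex
  assumes "norm s < 1" "-1 \<le> x" "x \<le> 1"
  shows "norm (1 + s\<^sup>2 - 2 * s * of_real x) \<ge> (1 - norm s)\<^sup>2"
proof -
  obtain t where x: "x = ecos t" using obtain_circle_angle assms(2,3) by blast
  have "norm (1 - s * ept t) \<ge> 1 - norm s" "norm (1 - s / ept t) \<ge> 1 - norm s"
    using norm_triangle_ineq2[of 1 "s * ept t"] norm_triangle_ineq2[of 1 "s / ept t"]
    by (auto simp: norm_mult norm_divide)
  then show ?thesis
    using assms(1) unfolding x pk_denominator norm_mult power2_eq_square[of "1 - norm s"]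
    by (intro mult_mono) auto
qed

lemma norm_pk_le:
  assumes "norm s \<le> r" "r < 1" "-1 \<le> x" "x \<le> 1"
  shows "norm (pk s x) \<le> 2 / (1 - r)\<^sup>2"
proof -
  have "norm (1 - s\<^sup>2) \<le> 1 + (norm s)\<^sup>2"
    using norm_triangle_ineq4[of 1 "s\<^sup>2"] by (simp add: norm_power)
  also have "\<dots> \<le> 2" using assms by (simp add: power_le_one)
  finally have 1: "norm (1 - s\<^sup>2) \<le> 2" .
  have "(1 - r)\<^sup>2 \<le> (1 - norm s)\<^sup>2" using assms by (intro power_mono) auto
  also have "\<dots> \<le> norm (1 + s\<^sup>2 - 2 * s * of_real x)"
    using assms by (intro pk_denominator_ge) auto
  finally have 2: "(1 - r)\<^sup>2 \<le> norm (1 + s\<^sup>2 - 2 * s * of_real x)" .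
  show ?thesis unfolding pk_def norm_divide
    using assms 1 2 by (intro frac_le) auto
qed

lemma pk_measurable [measurable]: "pk s \<in> borel_measurable borel"
  unfolding pk_def by measurable

lemma continuous_on_pk_ecos:
  assumes "norm s < 1" shows "continuous_on A (\<lambda>t. pk s (ecos t))"
proof -
  have "1 + s\<^sup>2 - 2 * s * of_real (ecos t) \<noteq> 0" for t
    using pk_denominator_ge[OF assms, of "ecos t"] assms by auto
  then show ?thesis unfolding pk_def by (intro continuous_intros) auto
qed

lemma circ_integral_contour:
  assumes "continuous_on (sphere 0 1) f"
  shows "(LINT t|circ. f (ept t)) = contour_integral (circlepath 0 1) (\<lambda>z. f z / z) / (2 * pi * \<i>)"
proof -
  have c: "continuous_on {0..1} (\<lambda>t. f (ept t))"
    by (intro continuous_on_compose2[OF assms] continuous_intros) auto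
  have cp: "circlepath 0 1 t = ept t" for t
    by (simp add: circlepath ept_def cis_conv_exp mult_ac)
  have "(LINT t|circ. f (ept t)) = integral {0..1} (\<lambda>t. f (ept t))" by (rule integral_circ[OF c])
  moreover have "contour_integral (circlepath 0 1) (\<lambda>z. f z / z)
      = integral {0..1} (\<lambda>t. (2 * pi * \<i>) * f (ept t))"
    unfolding contour_integral_integral
    by (intro integral_cong) (simp add: vector_derivative_circlepath cp, simp add: ept_def cis_conv_exp mult_ac)
  ultimately show ?thesis
    by simp
qed

text \<open>With \<open>z = ept t\<close> the kernel times \<open>dz / z\<close> is
  \<open>(1 - s^2) / ((1 - s z) (z - s)) dz\<close>. Its only pole in the closed disc is
  \<open>s\<close>, where the factor \<open>(1 - s^2) / (1 - s z)\<close> equals 1, so Cauchy's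
  formula returns \<open>f s\<close> itself and not merely a harmonic extension.\<close>

lemma schwarz_reproducing:
  assumes f: "f holomorphic_on ball 0 R" and R: "R > 1" and s: "norm s < 1"
  shows "(LINT t|circ. f (ept t) * pk s (ecos t)) = f s"
proof -
  define F where "F = (\<lambda>z. f z * ((1 - s\<^sup>2) / (1 - s * z)))"
  have ne: "s * z \<noteq> 1" if "norm z \<le> 1" for z
  proof
    assume "s * z = 1"
    then have "norm s * norm z = 1" by (metis norm_mult norm_one)
    moreover have "norm s * norm z \<le> norm s" using that by (simp add: mult_left_le)
    ultimately show False using s by simp
  qed
  have hF: "F holomorphic_on cball 0 1" unfolding F_def
    using R by (intro holomorphic_intros holomorphic_on_subset[OF f]) (auto simp: ne)
  have cont: "continuous_on (sphere 0 1) (\<lambda>z. F z * z / (z - s))"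
    using s by (intro continuous_intros continuous_on_subset[OF holomorphic_on_imp_continuous_on[OF hF]]) auto
  have "(LINT t|circ. f (ept t) * pk s (ecos t)) = (LINT t|circ. F (ept t) * ept t / (ept t - s))"
    by (intro Bochner_Integration.integral_cong) (auto simp: pk_circ F_def)
  also have "\<dots> = contour_integral (circlepath 0 1) (\<lambda>z. F z * z / (z - s) / z) / (2 * pi * \<i>)"
    by (rule circ_integral_contour[OF cont])
  also have "contour_integral (circlepath 0 1) (\<lambda>z. F z * z / (z - s) / z)
      = contour_integral (circlepath 0 1) (\<lambda>z. F z / (z - s))"
    by (intro contour_integral_cong) auto
  also have "\<dots> = 2 * pi * \<i> * F s"
    using Cauchy_integral_circlepath_simple[OF hF, of s] s by (simp add: contour_integral_unique)
  also have "2 * pi * \<i> * F s / (2 * pi * \<i>) = F s" by simp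
  also have "F s = f s"
  proof -
    have "1 - s\<^sup>2 \<noteq> 0" using ne[of s] s by (auto simp: power2_eq_square)
    then show ?thesis unfolding F_def by (simp add: power2_eq_square)
  qed
  finally show ?thesis .
qed

lemma circ_mean_value:
  assumes "f holomorphic_on ball 0 R" "R > 1"
  shows "(LINT t|circ. f (ept t)) = f 0"
  using schwarz_reproducing[OF assms, of 0] by simp

text \<open>Needed for functions with a singularity at 0, such as the phase. The contour shrinks
  only to radius \<rho> larger than \<open>norm s\<close>, so neither \<open>s\<close> nor
  \<open>1 / s\<close> is crossed and the integral is bounded by the values of \<open>f\<close> on
  the smaller circle.\<close>

lemma schwarz_annulus_bound:
  assumes f: "f holomorphic_on ball 0 R - {0}" and R: "R > 1"
    and s: "norm s \<le> r" and r: "r < \<rho>" and \<rho>: "\<rho> < 1"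
    and B: "\<And>z. norm z = \<rho> \<Longrightarrow> norm (f z) \<le> B"
  shows "norm (LINT t|circ. f (ept t) * pk s (ecos t)) \<le> 2 * B / ((1 - \<rho>) * (\<rho> - r))"
proof -
  have r0: "0 \<le> r" using s norm_ge_zero[of s] by linarith
  have rho0: "\<rho> > 0" using r r0 by simp
  \<comment> \<open>The cap \<open>1 / \<rho>\<close> keeps the pole \<open>1 / s\<close> outside
    the annulus.\<close>
  define R' where "R' = min R (1 / \<rho>)"
  have R': "R' > 1" "R' \<le> R" "R' \<le> 1 / \<rho>" using R \<rho> rho0 by (auto simp: R'_def)
  have ne: "s * z \<noteq> 1" if "norm z < R'" for z
  proof
    assume "s * z = 1"
    then have "norm s * norm z = 1" by (metis norm_mult norm_one)
    moreover have "norm s * norm z \<le> \<rho> * norm z" using s r by (intro mult_right_mono) auto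
    moreover have "\<rho> * norm z < \<rho> * (1 / \<rho>)" using that R' rho0 by (intro mult_strict_left_mono) auto
    ultimately show False using rho0 by simp
  qed
  define A where "A = {z::complex. r < norm z \<and> norm z < R'}"
  have A: "open A" unfolding A_def
    by (intro open_Collect_conj open_Collect_less continuous_intros)
  define F where "F = (\<lambda>z. f z * ((1 - s\<^sup>2) / ((1 - s * z) * (z - s))))"
  have hF: "F holomorphic_on A" unfolding F_def
    using R' s r0 by (intro holomorphic_intros holomorphic_on_subset[OF f]) (auto simp: ne A_def)
  have cont: "continuous_on (sphere 0 1) (\<lambda>z. F z * z)"
    using R' r \<rho> by (intro continuous_intros continuous_on_subset[OF holomorphic_on_imp_continuous_on[OF hF]])
      (auto simp: A_def)
  have "(LINT t|circ. f (ept t) * pk s (ecos t)) = (LINT t|circ. F (ept t) * ept t)"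
    by (intro Bochner_Integration.integral_cong) (auto simp: pk_circ F_def)
  also have "\<dots> = contour_integral (circlepath 0 1) (\<lambda>z. F z * z / z) / (2 * pi * \<i>)"
    by (rule circ_integral_contour[OF cont])
  also have "contour_integral (circlepath 0 1) (\<lambda>z. F z * z / z) = contour_integral (circlepath 0 1) F"
    by (intro contour_integral_cong) auto
  also have "\<dots> = contour_integral (circlepath 0 \<rho>) F"
  proof (rule Cauchy_theorem_homotopic_loops[OF _ A hF])
    show "homotopic_loops A (circlepath 0 1) (circlepath 0 \<rho>)"
    proof (rule homotopic_loops_linear)
      fix t :: real
      have e: "circlepath 0 1 t = of_real 1 * exp (2 * of_real pi * \<i> * of_real t)"
        "circlepath 0 \<rho> t = of_real \<rho> * exp (2 * of_real pi * \<i> * of_real t)"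
        by (auto simp: circlepath)
      show "closed_segment (circlepath 0 1 t) (circlepath 0 \<rho> t) \<subseteq> A"
      proof
        fix z assume "z \<in> closed_segment (circlepath 0 1 t) (circlepath 0 \<rho> t)"
        then obtain u where u: "0 \<le> u" "u \<le> 1"
          and z: "z = (1 - u) *\<^sub>R circlepath 0 1 t + u *\<^sub>R circlepath 0 \<rho> t"
          by (auto simp: closed_segment_def)
        have "z = of_real ((1 - u) + u * \<rho>) * exp (2 * of_real pi * \<i> * of_real t)"
          unfolding z e by (simp add: scaleR_conv_of_real algebra_simps)
        moreover have "0 \<le> (1 - u) + u * \<rho>" using u rho0 by simp
        moreover have "norm (exp (2 * of_real pi * \<i> * of_real t)) = 1"
          by (metis norm_exp_i_times mult.commute mult.left_commute of_real_mult of_real_numeral)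
        ultimately have nz: "norm z = (1 - u) + u * \<rho>"
          by (simp add: norm_mult del: of_real_add of_real_mult of_real_diff)
        have "\<rho> \<le> norm z" "norm z \<le> 1"
          unfolding nz using mult_right_mono[of u 1 "1 - \<rho>"] mult_nonneg_nonneg[of u "1 - \<rho>"] u \<rho>
          by (auto simp: algebra_simps)
        then show "z \<in> A" using r R' by (auto simp: A_def)
      qed
    qed auto
  qed auto
  finally have eq: "(LINT t|circ. f (ept t) * pk s (ecos t)) = contour_integral (circlepath 0 \<rho>) F / (2 * pi * \<i>)" .
  have B0: "0 \<le> B" using B[of "of_real \<rho>"] rho0 norm_ge_zero by (smt (verit) norm_of_real)
  have bd: "norm (F z) \<le> 2 * B / ((1 - \<rho>) * (\<rho> - r))" if "norm (z - 0) = \<rho>" for z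
  proof -
    have z: "norm z = \<rho>" using that by simp
    have 1: "norm (1 - s\<^sup>2) \<le> 2"
    proof -
      have "norm (1 - s\<^sup>2) \<le> 1 + (norm s)\<^sup>2"
        using norm_triangle_ineq4[of 1 "s\<^sup>2"] by (simp add: norm_power)
      also have "\<dots> \<le> 2" using s r \<rho> by (simp add: power_le_one)
      finally show ?thesis .
    qed
    have "norm s * norm z \<le> 1 * \<rho>" using s r \<rho> z by (intro mult_mono) auto
    then have 2: "1 - \<rho> \<le> norm (1 - s * z)"
      using norm_triangle_ineq2[of 1 "s * z"] by (simp add: norm_mult)
    have 3: "\<rho> - r \<le> norm (z - s)" using norm_triangle_ineq2[of z s] z s by simp
    have "norm (F z) = norm (f z) * norm (1 - s\<^sup>2) / (norm (1 - s * z) * norm (z - s))"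
      by (simp add: F_def norm_mult norm_divide)
    also have "\<dots> \<le> B * 2 / ((1 - \<rho>) * (\<rho> - r))"
      using B[OF z] 1 2 3 r \<rho> B0 by (intro frac_le mult_mono mult_pos_pos) auto
    finally show ?thesis by (simp add: mult.commute)
  qed
  have "sphere 0 \<rho> \<subseteq> A" using r \<rho> R' by (auto simp: A_def)
  then have 1: "F contour_integrable_on circlepath 0 \<rho>"
    using rho0 by (intro contour_integrable_holomorphic_simple[OF hF A]) auto
  have 2: "norm (contour_integral (circlepath 0 \<rho>) F) \<le> 2 * B / ((1 - \<rho>) * (\<rho> - r)) * (2 * pi * \<rho>)"
    using has_contour_integral_bound_circlepath[OF has_contour_integral_integral[OF 1] _ rho0 bd] B0 r \<rho> by simp
  have 3: "2 * B / ((1 - \<rho>) * (\<rho> - r)) * (2 * pi * \<rho>) \<le> 2 * B / ((1 - \<rho>) * (\<rho> - r)) * (2 * pi)"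
    using B0 r \<rho> by (intro mult_left_mono) auto
  have 4: "norm (complex_of_real (2 * pi) * \<i>) = 2 * pi" by (simp add: norm_mult)
  have "norm (LINT t|circ. f (ept t) * pk s (ecos t)) = norm (contour_integral (circlepath 0 \<rho>) F) / (2 * pi)"
    by (simp only: eq norm_divide 4)
  also have "\<dots> \<le> (2 * B / ((1 - \<rho>) * (\<rho> - r)) * (2 * pi)) / (2 * pi)"
    using order_trans[OF 2 3] by (rule divide_right_mono) simp
  also have "\<dots> = 2 * B / ((1 - \<rho>) * (\<rho> - r))"
    by (rule nonzero_mult_div_cancel_right) simp
  finally show ?thesis .
qed

subsection \<open>Approximation by polynomials in the mean\<close>

text \<open>One function must serve two measures, later a weight and the arcsine law. Regularity of
  each gives a closed set inside and an open set outside \<open>A\<close>; Urysohn's lemma is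
  applied to the union of the closed sets and the intersection of the open ones.\<close>

lemma indicator_continuous_approx:
  fixes A :: "real set"
  assumes "finite_measure M" and sM: "sets M = sets borel"
    and "finite_measure N" and sN: "sets N = sets borel"
    and A: "A \<in> sets borel" and e: "e > 0"
  obtains g where "continuous_on UNIV g" "\<And>x. 0 \<le> g x \<and> g x \<le> (1::real)"
    "(LINT x|M. \<bar>g x - indicator A x\<bar>) \<le> e" "(LINT x|N. \<bar>g x - indicator A x\<bar>) \<le> e"
proof -
  have ex: "\<exists>K U. K \<subseteq> A \<and> A \<subseteq> U \<and> closed K \<and> open U \<and> measure L (U - K) \<le> e"
    if "finite_measure L" "sets L = sets borel" for L :: "real measure"
  proof -
    interpret L: finite_measure L by fact
    have sp: "space L = UNIV" using that(2) by (metis sets_eq_imp_space_eq space_borel)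
    have fin: "emeasure L (space L) \<noteq> \<infinity>" by simp
    have "\<exists>K. K \<subseteq> A \<and> compact K \<and> measure L A \<le> measure L K + e / 2"
    proof (rule ccontr)
      assume "\<not> ?thesis"
      then have c: "measure L K + e / 2 \<le> measure L A" if "K \<subseteq> A" "compact K" for K using that by force
      have "emeasure L K \<le> ennreal (measure L A - e / 2)" if "K \<in> {K. K \<subseteq> A \<and> compact K}" for K
        using c[of K] that by (auto simp: L.emeasure_eq_measure intro!: ennreal_leI)
      then have "emeasure L A \<le> ennreal (measure L A - e / 2)"
        unfolding inner_regular[OF that(2) fin A] by (intro SUP_least)
      moreover have "0 \<le> measure L A - e / 2"
        using c[of "{}"] by simp
      ultimately show False using e by (simp add: L.emeasure_eq_measure)
    qed
    then obtain K where K: "K \<subseteq> A" "compact K" "measure L A \<le> measure L K + e / 2" by blast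
    have "\<exists>U. A \<subseteq> U \<and> open U \<and> measure L U \<le> measure L A + e / 2"
    proof (rule ccontr)
      assume "\<not> ?thesis"
      then have c: "measure L A + e / 2 \<le> measure L U" if "A \<subseteq> U" "open U" for U using that by force
      have "ennreal (measure L A + e / 2) \<le> emeasure L U" if "U \<in> {U. A \<subseteq> U \<and> open U}" for U
        using c[of U] that by (auto simp: L.emeasure_eq_measure intro!: ennreal_leI)
      then have "ennreal (measure L A + e / 2) \<le> emeasure L A"
        unfolding outer_regular[OF that(2) fin A] by (intro INF_greatest)
      then show False using e by (simp add: L.emeasure_eq_measure ennreal_le_iff)
    qed
    then obtain U where U: "A \<subseteq> U" "open U" "measure L U \<le> measure L A + e / 2" by blast
    have "measure L (U - K) = measure L U - measure L K"
      using K U that(2) by (intro L.finite_measure_Diff) (auto simp: compact_imp_closed)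
    then show ?thesis using K U compact_imp_closed by (intro exI[of _ K] exI[of _ U]) auto
  qed
  obtain K1 U1 where 1: "K1 \<subseteq> A" "A \<subseteq> U1" "closed K1" "open U1" "measure M (U1 - K1) \<le> e"
    using ex[OF assms(1,2)] by blast
  obtain K2 U2 where 2: "K2 \<subseteq> A" "A \<subseteq> U2" "closed K2" "open U2" "measure N (U2 - K2) \<le> e"
    using ex[OF assms(3,4)] by blast
  have "closedin (top_of_set UNIV) (K1 \<union> K2)" "closedin (top_of_set UNIV) (- (U1 \<inter> U2))"
    using 1 2 by auto
  moreover have "(K1 \<union> K2) \<inter> - (U1 \<inter> U2) = {}" using 1 2 by blast
  ultimately obtain g :: "real \<Rightarrow> real" where g: "continuous_on UNIV g"
    "\<And>x. x \<in> UNIV \<Longrightarrow> g x \<in> closed_segment 1 0" "\<And>x. x \<in> K1 \<union> K2 \<Longrightarrow> g x = 1"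
    "\<And>x. x \<in> - (U1 \<inter> U2) \<Longrightarrow> g x = 0"
    by (rule Urysohn_local[where a = "1::real" and b = "0::real"]) blast
  have g01: "0 \<le> g x \<and> g x \<le> 1" for x
    using g(2)[of x] by (auto simp: closed_segment_eq_real_ivl)
  have gm: "g \<in> borel_measurable borel" using g(1) by (rule borel_measurable_continuous_onI)
  have le: "(LINT x|L. \<bar>g x - indicator A x\<bar>) \<le> e"
    if "finite_measure L" "sets L = sets borel" "measure L (U - K) \<le> e" "closed K" "open U"
      and "\<And>x. x \<in> K \<Longrightarrow> g x = 1 \<and> x \<in> A" "\<And>x. x \<notin> U \<Longrightarrow> g x = 0 \<and> x \<notin> A"
    for L :: "real measure" and K U
  proof -
    interpret L: finite_measure L by fact
    have sp: "space L = UNIV" using that(2) by (metis sets_eq_imp_space_eq space_borel)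
    have [measurable]: "g \<in> borel_measurable L" "A \<in> sets L" "U - K \<in> sets L"
      using gm A that by (auto cong: measurable_cong_sets)
    have "(LINT x|L. \<bar>g x - indicator A x\<bar>) \<le> (LINT x|L. indicator (U - K) x)"
    proof (rule integral_mono)
      show "integrable L (\<lambda>x. \<bar>g x - indicator A x\<bar>)"
      proof (rule L.integrable_const_bound[of _ 1])
        show "AE x in L. norm \<bar>g x - indicator A x\<bar> \<le> 1"
        proof (rule AE_I2)
          fix x show "norm \<bar>g x - indicator A x\<bar> \<le> 1"
            using g01[of x] by (simp add: indicator_def abs_le_iff)
        qed
      qed measurable
      show "integrable L (\<lambda>x. indicator (U - K) x :: real)"
        by (intro integrable_real_indicator) (simp_all add: L.emeasure_eq_measure)
      show "\<bar>g x - indicator A x\<bar> \<le> indicator (U - K) x" for x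
        using that(6,7)[of x] g01[of x] by (auto simp: indicator_def)
    qed
    also have "\<dots> = measure L (U - K)" by (simp add: sp)
    finally show ?thesis using that(3) by simp
  qed
  show thesis
  proof (rule that[OF g(1) g01])
    show "(LINT x|M. \<bar>g x - indicator A x\<bar>) \<le> e"
      by (rule le[OF assms(1,2) 1(5,3,4)]) (use 1 2 g in auto)
    show "(LINT x|N. \<bar>g x - indicator A x\<bar>) \<le> e"
      by (rule le[OF assms(3,4) 2(5,3,4)]) (use 1 2 g in auto)
  qed
qed

text \<open>Induction over non-negative measurable functions, with the bounds \<open>0\<close> and
  \<open>k\<close> restored only at the end: clamping to \<open>[0,k]\<close> never increases the
  distance to a function with values there.\<close>

lemma bounded_measurable_continuous_approx:
  fixes f :: "real \<Rightarrow> real"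
  assumes M: "finite_measure M" and sM: "sets M = sets borel"
    and N: "finite_measure N" and sN: "sets N = sets borel"
    and f: "f \<in> borel_measurable borel" "\<And>x. 0 \<le> f x" "\<And>x. f x \<le> k" and e: "e > 0"
  shows "\<exists>g. continuous_on UNIV g \<and> (\<forall>x. 0 \<le> g x \<and> g x \<le> k)
    \<and> (LINT x|M. \<bar>g x - f x\<bar>) \<le> e \<and> (LINT x|N. \<bar>g x - f x\<bar>) \<le> e"
proof -
  interpret M: finite_measure M by fact
  interpret N: finite_measure N by fact
  \<comment> \<open>The approximant is only required to be bounded by some \<open>c\<close>, which
    suffices for integrability and survives sums and multiples; the sharp bounds would not survive
    the induction.\<close>
  define P where "P f \<longleftrightarrow> (\<forall>e>0. \<exists>g c. continuous_on UNIV g \<and> (\<forall>x. \<bar>g x\<bar> \<le> c)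
    \<and> (LINT x|M. \<bar>g x - f x\<bar>) \<le> e \<and> (LINT x|N. \<bar>g x - f x\<bar>) \<le> e)" for f :: "real \<Rightarrow> real"
  have k0: "0 \<le> k" using f(2,3)[of 0] by linarith
  have int: "integrable M u" "integrable N u"
    if "u \<in> borel_measurable borel" "\<And>x. \<bar>u x\<bar> \<le> c" for u :: "real \<Rightarrow> real" and c
  proof -
    have "u \<in> borel_measurable M" "u \<in> borel_measurable N"
      using that(1) by (simp_all add: measurable_cong_sets[OF sM refl] measurable_cong_sets[OF sN refl])
    then show "integrable M u" "integrable N u"
      using that by (auto intro!: M.integrable_const_bound[of _ c] N.integrable_const_bound[of _ c])
  qed
  have clamp: "\<exists>g. continuous_on UNIV g \<and> (\<forall>x. 0 \<le> g x \<and> g x \<le> k)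
      \<and> (LINT x|M. \<bar>g x - u x\<bar>) \<le> e \<and> (LINT x|N. \<bar>g x - u x\<bar>) \<le> e"
    if g: "continuous_on UNIV g" "\<And>x. \<bar>g x\<bar> \<le> c" "(LINT x|M. \<bar>g x - u x\<bar>) \<le> e" "(LINT x|N. \<bar>g x - u x\<bar>) \<le> e"
      and u: "u \<in> borel_measurable borel" "\<And>x. 0 \<le> u x" "\<And>x. u x \<le> k"
    for g u :: "real \<Rightarrow> real" and e c
  proof (intro exI conjI allI)
    let ?g = "\<lambda>x. max 0 (min k (g x))"
    have gm: "g \<in> borel_measurable borel" by (intro borel_measurable_continuous_onI g)
    show "continuous_on UNIV ?g" by (intro continuous_intros g)
    have i1: "integrable M (\<lambda>x. \<bar>?g x - u x\<bar>)" "integrable N (\<lambda>x. \<bar>?g x - u x\<bar>)"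
    proof -
      have "\<bar>\<bar>?g x - u x\<bar>\<bar> \<le> k" for x using u(2,3)[of x] k0 by (auto simp: max_def min_def)
      then show "integrable M (\<lambda>x. \<bar>?g x - u x\<bar>)" "integrable N (\<lambda>x. \<bar>?g x - u x\<bar>)"
        using gm u by (auto intro!: int[of _ k])
    qed
    have i2: "integrable M (\<lambda>x. \<bar>g x - u x\<bar>)" "integrable N (\<lambda>x. \<bar>g x - u x\<bar>)"
    proof -
      have "\<bar>\<bar>g x - u x\<bar>\<bar> \<le> c + k" for x using g(2)[of x] u(2,3)[of x] by linarith
      then show "integrable M (\<lambda>x. \<bar>g x - u x\<bar>)" "integrable N (\<lambda>x. \<bar>g x - u x\<bar>)"
        using gm u by (auto intro!: int[of _ "c + k"])
    qed
    have le: "\<bar>?g x - u x\<bar> \<le> \<bar>g x - u x\<bar>" for x using u(2,3)[of x] by (auto simp: max_def min_def)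
    show "(LINT x|M. \<bar>?g x - u x\<bar>) \<le> e" "(LINT x|N. \<bar>?g x - u x\<bar>) \<le> e"
      using integral_mono[OF i1(1) i2(1) le] integral_mono[OF i1(2) i2(2) le] g by auto
  qed (use k0 in auto)
  have diff: "integrable M (\<lambda>x. \<bar>g x - u x\<bar>)" "integrable N (\<lambda>x. \<bar>g x - u x\<bar>)"
    if "g \<in> borel_measurable borel" "u \<in> borel_measurable borel" "\<And>x. \<bar>g x\<bar> \<le> c" "\<And>x. \<bar>u x\<bar> \<le> d"
    for g u :: "real \<Rightarrow> real" and c d
  proof -
    have "\<bar>\<bar>g x - u x\<bar>\<bar> \<le> c + d" for x using that(3,4)[of x] by linarith
    then show "integrable M (\<lambda>x. \<bar>g x - u x\<bar>)" "integrable N (\<lambda>x. \<bar>g x - u x\<bar>)"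
      using that(1,2) by (auto intro!: int[of _ "c + d"])
  qed
  \<comment> \<open>Boundedness is carried as a premise of the induction; it passes to the summands,
    and to the members of a monotone sequence, because all functions are non-negative.\<close>
  have "(\<exists>k. \<forall>x. f x \<le> k) \<longrightarrow> P f" using f(1,2)
  proof (induction rule: borel_measurable_induct_real)
    case (set A)
    show ?case unfolding P_def
    proof (intro impI allI)
      fix e :: real assume "e > 0"
      then obtain g where g: "continuous_on UNIV g" "\<And>x. 0 \<le> g x \<and> g x \<le> (1::real)"
        "(LINT x|M. \<bar>g x - indicator A x\<bar>) \<le> e" "(LINT x|N. \<bar>g x - indicator A x\<bar>) \<le> e"
        using indicator_continuous_approx[OF M sM N sN set] by blast
      have "\<forall>x. \<bar>g x\<bar> \<le> 1" using g(2) by simp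
      with g show "\<exists>g c. continuous_on UNIV g \<and> (\<forall>x. \<bar>g x\<bar> \<le> c) \<and>
          (LINT x|M. \<bar>g x - indicator A x\<bar>) \<le> e \<and> (LINT x|N. \<bar>g x - indicator A x\<bar>) \<le> e"
        by blast
    qed
  next
    case (mult u c)
    show ?case
    proof (cases "c = 0")
      case True
      then show ?thesis unfolding P_def
        by (intro impI allI exI[of _ "\<lambda>_. 0"] exI[of _ 0]) auto
    next
      case False
      with mult have c: "c > 0" by simp
      show ?thesis
      proof
        assume "\<exists>k. \<forall>x. c * u x \<le> k"
        then obtain k where "\<And>x. c * u x \<le> k" by blast
        then have "\<forall>x. u x \<le> k / c" using c by (simp add: pos_le_divide_eq mult.commute)
        then have Pu: "P u" using mult by blast
        show "P (\<lambda>x. c * u x)" unfolding P_def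
        proof (intro allI impI)
          fix e :: real assume "e > 0"
          then have "e / c > 0" using c by simp
          then obtain g d where g: "continuous_on UNIV g" "\<forall>x. \<bar>g x\<bar> \<le> d"
            "(LINT x|M. \<bar>g x - u x\<bar>) \<le> e / c" "(LINT x|N. \<bar>g x - u x\<bar>) \<le> e / c"
            using Pu unfolding P_def by blast
          have eq: "\<bar>c * g x - c * u x\<bar> = c * \<bar>g x - u x\<bar>" for x
            using c by (simp add: abs_mult flip: right_diff_distrib)
          show "\<exists>g d. continuous_on UNIV g \<and> (\<forall>x. \<bar>g x\<bar> \<le> d) \<and>
             (LINT x|M. \<bar>g x - c * u x\<bar>) \<le> e \<and> (LINT x|N. \<bar>g x - c * u x\<bar>) \<le> e"
          proof (intro exI[of _ "\<lambda>x. c * g x"] exI[of _ "c * d"] conjI allI)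
            show "continuous_on UNIV (\<lambda>x. c * g x)" by (intro continuous_intros g)
            show "\<bar>c * g x\<bar> \<le> c * d" for x using g(2) c by (simp add: abs_mult)
          qed (use g c in \<open>simp_all add: eq pos_le_divide_eq mult.commute\<close>)
        qed
      qed
    qed
  next
    case (add u v)
    show ?case
    proof
      assume "\<exists>k. \<forall>x. v x + u x \<le> k"
      then obtain k where k: "\<And>x. v x + u x \<le> k" by blast
      have uk: "u x \<le> k" "v x \<le> k" for x using k[of x] add.hyps(2)[of x] add.hyps(4)[of x] by auto
      have uk': "\<bar>u x\<bar> \<le> k" "\<bar>v x\<bar> \<le> k" for x using uk[of x] add.hyps(2)[of x] add.hyps(4)[of x] by auto
      have Pu: "P u" "P v" using add uk by blast+
      show "P (\<lambda>x. v x + u x)" unfolding P_def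
      proof (intro allI impI)
        fix e :: real assume e: "e > 0"
        then have e2: "e / 2 > 0" by simp
        obtain g d where g: "continuous_on UNIV g" "\<forall>x. \<bar>g x\<bar> \<le> d"
          "(LINT x|M. \<bar>g x - u x\<bar>) \<le> e / 2" "(LINT x|N. \<bar>g x - u x\<bar>) \<le> e / 2"
          using Pu(1) e2 unfolding P_def by blast
        obtain h d' where h: "continuous_on UNIV h" "\<forall>x. \<bar>h x\<bar> \<le> d'"
          "(LINT x|M. \<bar>h x - v x\<bar>) \<le> e / 2" "(LINT x|N. \<bar>h x - v x\<bar>) \<le> e / 2"
          using Pu(2) e2 unfolding P_def by blast
        have gm: "g \<in> borel_measurable borel" "h \<in> borel_measurable borel"
          by (intro borel_measurable_continuous_onI g h)+
        have le: "\<bar>h x + g x - (v x + u x)\<bar> \<le> \<bar>h x - v x\<bar> + \<bar>g x - u x\<bar>" for x by linarith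
        have b1: "\<bar>h x + g x\<bar> \<le> d' + d" for x using g(2)[rule_format, of x] h(2)[rule_format, of x] by linarith
        have b2: "\<bar>v x + u x\<bar> \<le> k + k" for x using uk'[of x] by linarith
        note iv = diff[OF gm(2) add.hyps(3), of d' k] and iu = diff[OF gm(1) add.hyps(1), of d k]
        have m: "(\<lambda>x. h x + g x) \<in> borel_measurable borel" "(\<lambda>x. v x + u x) \<in> borel_measurable borel"
            using gm add.hyps(1,3) by (auto intro!: borel_measurable_add)
        note isum = diff[OF m b1 b2]
        have iv': "integrable M (\<lambda>x. \<bar>h x - v x\<bar>)" "integrable N (\<lambda>x. \<bar>h x - v x\<bar>)" using iv h uk' by auto
        have iu': "integrable M (\<lambda>x. \<bar>g x - u x\<bar>)" "integrable N (\<lambda>x. \<bar>g x - u x\<bar>)" using iu g uk' by auto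
        have "(LINT x|M. \<bar>h x + g x - (v x + u x)\<bar>) \<le> (LINT x|M. \<bar>h x - v x\<bar> + \<bar>g x - u x\<bar>)"
          by (intro integral_mono isum le Bochner_Integration.integrable_add iv' iu')
        moreover have "(LINT x|N. \<bar>h x + g x - (v x + u x)\<bar>) \<le> (LINT x|N. \<bar>h x - v x\<bar> + \<bar>g x - u x\<bar>)"
          by (intro integral_mono isum le Bochner_Integration.integrable_add iv' iu')
        ultimately have "(LINT x|M. \<bar>h x + g x - (v x + u x)\<bar>) \<le> e" "(LINT x|N. \<bar>h x + g x - (v x + u x)\<bar>) \<le> e"
          using g h iu' iv' by simp_all
        then show "\<exists>g d. continuous_on UNIV g \<and> (\<forall>x. \<bar>g x\<bar> \<le> d) \<and>
             (LINT x|M. \<bar>g x - (v x + u x)\<bar>) \<le> e \<and> (LINT x|N. \<bar>g x - (v x + u x)\<bar>) \<le> e"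
          using g h b1 by (intro exI[of _ "\<lambda>x. h x + g x"] exI[of _ "d' + d"]) (auto intro: continuous_intros)
      qed
    qed
  next
    case (seq U)
    show ?case
    proof
      assume "\<exists>k. \<forall>x. f x \<le> k"
      then obtain k where k: "\<And>x. f x \<le> k" by blast
      have Uf: "U i x \<le> f x" for i x
        using seq.hyps(3) seq.hyps(4)[of x] by (intro incseq_le) (auto simp: incseq_def le_fun_def)
      have Uk: "\<bar>U i x\<bar> \<le> k" for i x using Uf[of i x] seq.hyps(2)[of i x] k[of x] by linarith
      have fk: "\<bar>f x\<bar> \<le> k" for x using f(2)[of x] k[of x] by linarith
      have PU: "P (U i)" for i using seq.IH[of i] Uk[of i] by (meson abs_le_D1)
      show "P f" unfolding P_def
      proof (intro allI impI)
        fix e :: real assume e: "e > 0"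
        then have e2: "e / 2 > 0" by simp
        have conv: "(\<lambda>i. (LINT x|L. \<bar>U i x - f x\<bar>)) \<longlonglongrightarrow> 0" if L: "finite_measure L" "sets L = sets borel" for L
        proof -
          interpret L: finite_measure L by fact
          have m: "U i \<in> borel_measurable L" "f \<in> borel_measurable L" for i
            using seq.hyps(1) f(1) by (simp_all add: measurable_cong_sets[OF that(2) refl])
          have "(\<lambda>i. (LINT x|L. \<bar>U i x - f x\<bar>)) \<longlonglongrightarrow> (LINT x|L. 0)"
          proof (rule integral_dominated_convergence[where w = "\<lambda>_. 2 * k"])
            show "AE x in L. (\<lambda>i. \<bar>U i x - f x\<bar>) \<longlonglongrightarrow> 0"
              using seq.hyps(4) by (intro AE_I2 tendsto_rabs_zero) (simp add: LIM_zero)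
            show "AE x in L. norm \<bar>U i x - f x\<bar> \<le> 2 * k" for i
            proof (intro AE_I2)
              fix x show "norm \<bar>U i x - f x\<bar> \<le> 2 * k" using Uk[of i x] fk[of x] by simp
            qed
          qed (use m in auto)
          then show ?thesis by simp
        qed
        have "\<forall>\<^sub>F i in sequentially. (LINT x|M. \<bar>U i x - f x\<bar>) < e / 2 \<and> (LINT x|N. \<bar>U i x - f x\<bar>) < e / 2"
          using e by (intro eventually_conj order_tendstoD(2)[OF conv] M sM N sN) auto
        then obtain i where i: "(LINT x|M. \<bar>U i x - f x\<bar>) < e / 2" "(LINT x|N. \<bar>U i x - f x\<bar>) < e / 2"
          by (auto simp: eventually_sequentially)
        obtain g d where g: "continuous_on UNIV g" "\<forall>x. \<bar>g x\<bar> \<le> d"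
          "(LINT x|M. \<bar>g x - U i x\<bar>) \<le> e / 2" "(LINT x|N. \<bar>g x - U i x\<bar>) \<le> e / 2"
          using PU[of i] e2 unfolding P_def by blast
        have gm: "g \<in> borel_measurable borel" by (intro borel_measurable_continuous_onI g)
        have le: "\<bar>g x - f x\<bar> \<le> \<bar>g x - U i x\<bar> + \<bar>U i x - f x\<bar>" for x by linarith
        note i1 = diff[OF gm seq.hyps(1) g(2)[rule_format] Uk] and i2 = diff[OF seq.hyps(1) f(1) Uk fk]
          and i3 = diff[OF gm f(1) g(2)[rule_format] fk]
        have "(LINT x|M. \<bar>g x - f x\<bar>) \<le> (LINT x|M. \<bar>g x - U i x\<bar> + \<bar>U i x - f x\<bar>)"
          by (intro integral_mono le Bochner_Integration.integrable_add i1 i2 i3)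
        moreover have "(LINT x|N. \<bar>g x - f x\<bar>) \<le> (LINT x|N. \<bar>g x - U i x\<bar> + \<bar>U i x - f x\<bar>)"
          by (intro integral_mono le Bochner_Integration.integrable_add i1 i2 i3)
        ultimately have "(LINT x|M. \<bar>g x - f x\<bar>) \<le> e" "(LINT x|N. \<bar>g x - f x\<bar>) \<le> e"
          using i g i1 i2 by simp_all
        then show "\<exists>g d. continuous_on UNIV g \<and> (\<forall>x. \<bar>g x\<bar> \<le> d) \<and>
             (LINT x|M. \<bar>g x - f x\<bar>) \<le> e \<and> (LINT x|N. \<bar>g x - f x\<bar>) \<le> e"
          using g by blast
      qed
    qed
  qed
  then have "P f" using f(3) by blast
  then obtain g c where "continuous_on UNIV g" "\<forall>x. \<bar>g x\<bar> \<le> c"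
    "(LINT x|M. \<bar>g x - f x\<bar>) \<le> e" "(LINT x|N. \<bar>g x - f x\<bar>) \<le> e"
    using e unfolding P_def by blast
  then show ?thesis using f by (intro clamp[of g c]) auto
qed

text \<open>The shift by \<open>k\<close> makes the function non-negative for the previous lemma;
  Weierstrass then replaces the continuous approximant on \<open>[-1,1]\<close>, which carries both
  measures.\<close>

lemma bounded_measurable_poly_approx:
  fixes f :: "real \<Rightarrow> real"
  assumes M: "finite_measure M" "sets M = sets borel" "emeasure M (- {-1..1}) = 0"
    and N: "finite_measure N" "sets N = sets borel" "emeasure N (- {-1..1}) = 0"
    and f: "f \<in> borel_measurable borel" "\<And>x. \<bar>f x\<bar> \<le> k" and e: "e > 0"
  obtains p :: "real poly" where "\<And>x. x \<in> {-1..1} \<Longrightarrow> \<bar>poly p x\<bar> \<le> k + 1"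
    "(LINT x|M. \<bar>poly p x - f x\<bar>) \<le> e" "(LINT x|N. \<bar>poly p x - f x\<bar>) \<le> e"
proof -
  have fk: "0 \<le> f x + k" "f x + k \<le> 2 * k" for x using f(2)[of x] by linarith+
  have fm: "(\<lambda>x. f x + k) \<in> borel_measurable borel" using f by measurable
  have e2: "e / 2 > 0" using e by simp
  obtain g where g: "continuous_on UNIV g" "\<And>x. 0 \<le> g x" "\<And>x. g x \<le> 2 * k"
    "(LINT x|M. \<bar>g x - (f x + k)\<bar>) \<le> e / 2" "(LINT x|N. \<bar>g x - (f x + k)\<bar>) \<le> e / 2"
    using bounded_measurable_continuous_approx[OF M(1,2) N(1,2) fm fk e2] by blast
  define S where "S = measure M UNIV + measure N UNIV + 1"
  have S: "S > 0" "measure M UNIV \<le> S" "measure N UNIV \<le> S"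
    using measure_nonneg[of M UNIV] measure_nonneg[of N UNIV] unfolding S_def by linarith+
  \<comment> \<open>The 1 yields the uniform bound \<open>k + 1\<close>; the other entry makes the
    uniform error cost at most \<open>e / 2\<close> against either total mass.\<close>
  define d where "d = min 1 (e / (2 * S))"
  have d: "d > 0" "d \<le> 1" using e S by (auto simp: d_def)
  have dM: "d * S \<le> e / 2"
  proof -
    have "d * S \<le> e / (2 * S) * S" using S by (intro mult_right_mono) (auto simp: d_def)
    also have "\<dots> = e / 2" using S by simp
    finally show ?thesis .
  qed
  have gk: "continuous_on {-1..1} (\<lambda>x. g x - k)"
    by (intro continuous_intros continuous_on_subset[OF g(1)]) auto
  obtain q where q: "real_polynomial_function q" "\<And>x. x \<in> {-1..1} \<Longrightarrow> \<bar>g x - k - q x\<bar> < d"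
    by (rule Stone_Weierstrass_real_polynomial_function[OF compact_Icc gk d(1)]) blast
  obtain a n where q': "q = (\<lambda>x. \<Sum>i\<le>n. a i * x ^ i)"
    using q(1) unfolding real_polynomial_function_iff_sum by blast
  define p where "p = (\<Sum>i\<le>n. monom (a i) i)"
  have p: "poly p x = q x" for x unfolding p_def q' by (simp add: poly_sum poly_monom)
  have pg: "\<bar>poly p x - (g x - k)\<bar> \<le> d" if "x \<in> {-1..1}" for x using q(2)[OF that] p[of x] by linarith
  have le: "(LINT x|L. \<bar>poly p x - f x\<bar>) \<le> e"
    if L: "finite_measure L" "sets L = sets borel" "emeasure L (- {-1..1}) = 0"
      "(LINT x|L. \<bar>g x - (f x + k)\<bar>) \<le> e / 2" "measure L UNIV \<le> S" for L
  proof -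
    interpret L: finite_measure L by fact
    have sp: "space L = UNIV" using L(2) by (metis sets_eq_imp_space_eq space_borel)
    have AE: "AE x in L. x \<in> {-1..1}"
      using L(2,3) by (intro AE_I[of _ _ "- {-1..1}"]) auto
    have gm: "g \<in> borel_measurable borel" by (intro borel_measurable_continuous_onI g)
    have [measurable]: "g \<in> borel_measurable L" "f \<in> borel_measurable L" "poly p \<in> borel_measurable L"
      using gm f(1) borel_measurable_continuous_onI[OF continuous_on_poly[OF continuous_on_id], of p]
      by (simp_all add: measurable_cong_sets[OF L(2) refl])
    have i1: "integrable L (\<lambda>x. \<bar>g x - (f x + k)\<bar>)"
    proof (rule L.integrable_const_bound[of _ "2 * k"])
      show "AE x in L. norm \<bar>g x - (f x + k)\<bar> \<le> 2 * k"
      proof (intro AE_I2)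
        fix x show "norm \<bar>g x - (f x + k)\<bar> \<le> 2 * k" using fk[of x] g(2,3)[of x] by simp
      qed
    qed measurable
    have "(LINT x|L. \<bar>poly p x - f x\<bar>) \<le> (LINT x|L. d + \<bar>g x - (f x + k)\<bar>)"
    proof (rule integral_mono_AE)
      show "AE x in L. \<bar>poly p x - f x\<bar> \<le> d + \<bar>g x - (f x + k)\<bar>"
        using AE by eventually_elim (use pg in \<open>force simp: abs_le_iff\<close>)
      show "integrable L (\<lambda>x. \<bar>poly p x - f x\<bar>)"
      proof (rule L.integrable_const_bound[of _ "1 + 2 * k"])
        show "AE x in L. norm \<bar>poly p x - f x\<bar> \<le> 1 + 2 * k"
          using AE
        proof eventually_elim
          case (elim x)
          then show ?case using pg[of x] fk[of x] g(2,3)[of x] d by auto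
        qed
      qed measurable
    qed (use i1 in auto)
    also have "\<dots> = d * measure L UNIV + (LINT x|L. \<bar>g x - (f x + k)\<bar>)"
      using i1 by (simp add: sp)
    also have "d * measure L UNIV \<le> d * S"
      using d L(5) by (intro mult_left_mono) auto
    finally show ?thesis using dM L(4) by linarith
  qed
  show thesis
  proof (rule that[of p])
    show "\<bar>poly p x\<bar> \<le> k + 1" if "x \<in> {-1..1}" for x
      using pg[OF that] g(2,3)[of x] d by linarith
    show "(LINT x|M. \<bar>poly p x - f x\<bar>) \<le> e"
      by (intro le M g(4) S(2))
    show "(LINT x|N. \<bar>poly p x - f x\<bar>) \<le> e"
      by (intro le N g(5) S(3))
  qed
qed

subsection \<open>Absolutely continuous parts\<close>

lemma ac_deriv_measurable [measurable]: "ac_deriv \<nu> \<in> borel_measurable borel"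
proof -
  have "RN_deriv arcsine (ac_part arcsine \<nu>) \<in> borel_measurable borel"
    using borel_measurable_RN_deriv[of arcsine "ac_part arcsine \<nu>"]
    by (simp add: measurable_cong_sets[OF sets_arcsine refl])
  then show ?thesis unfolding ac_deriv_def by measurable
qed

lemma ac_deriv_nonneg [simp]: "0 \<le> ac_deriv \<nu> x"
  by (simp add: ac_deriv_def)

text \<open>Turns the abstract absolutely continuous part into a restriction: the singular part
  lives on a null set \<open>X\<close>, so off \<open>X\<close> the measure is its density. All
  later integrals are split along \<open>X\<close>.\<close>

lemma lebesgue_decomposition:
  assumes "finite_measure_on_interval \<nu>"
  obtains X where "X \<in> sets borel" "emeasure arcsine X = 0"
    "density \<nu> (indicator (- X)) = density arcsine (\<lambda>x. ennreal (ac_deriv \<nu> x))"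
proof -
  have s\<nu>: "sets \<nu> = sets borel" and "finite_measure \<nu>"
    using assms by (auto simp: finite_measure_on_interval_def)
  interpret \<nu>: finite_measure \<nu> by fact
  define A where "A = ac_part arcsine \<nu>"
  have "is_ac_part arcsine \<nu> A" unfolding A_def
    by (rule is_ac_part_ac_part[OF \<open>finite_measure \<nu>\<close>]) (simp add: s\<nu>)
  then obtain S where sA: "sets A = sets \<nu>" and ac: "absolutely_continuous arcsine A"
    and sS: "sets S = sets \<nu>" and sing: "mutually_singular arcsine S"
    and sum: "\<And>E. E \<in> sets \<nu> \<Longrightarrow> emeasure \<nu> E = emeasure A E + emeasure S E"
    unfolding is_ac_part_def by blast
  obtain X where X: "X \<in> sets borel" "emeasure arcsine X = 0" "emeasure S (space S - X) = 0"
    using sing s\<nu> unfolding mutually_singular_def by auto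
  have spS: "space S = UNIV" using sS s\<nu> by (metis sets_eq_imp_space_eq space_borel)
  have spA: "space A = UNIV" using sA s\<nu> by (metis sets_eq_imp_space_eq space_borel)
  have "emeasure A (space A) \<noteq> \<infinity>"
    using sum[of UNIV] \<nu>.emeasure_finite[of UNIV] s\<nu> spA by (auto simp: top_unique)
  then interpret A: finite_measure A by (rule finite_measureI)
  have sA': "sets A = sets arcsine" using sA s\<nu> by simp
  have dRN: "density arcsine (RN_deriv arcsine A) = A"
    by (rule arcsine.density_RN_deriv[OF ac sA'])
  \<comment> \<open>Finiteness almost everywhere means that \<open>enn2real\<close> in
    \<open>ac_deriv\<close> loses nothing.\<close>
  have fin: "AE x in arcsine. RN_deriv arcsine A x \<noteq> \<infinity>"
    by (rule arcsine.RN_deriv_finite[OF A.sigma_finite_measure_axioms ac sA'])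
  have dA: "density arcsine (\<lambda>x. ennreal (ac_deriv \<nu> x)) = A"
  proof -
    have "density arcsine (\<lambda>x. ennreal (ac_deriv \<nu> x)) = density arcsine (RN_deriv arcsine A)"
    proof (rule density_cong)
      show "AE x in arcsine. ennreal (ac_deriv \<nu> x) = RN_deriv arcsine A x"
        using fin by eventually_elim (simp add: ac_deriv_def A_def less_top)
    qed auto
    then show ?thesis using dRN by simp
  qed
  have "density \<nu> (indicator (- X)) = A"
  proof (rule measure_eqI)
    fix E assume "E \<in> sets (density \<nu> (indicator (- X)))"
    then have E: "E \<in> sets borel" using s\<nu> by simp
    have "emeasure (density \<nu> (indicator (- X))) E = emeasure \<nu> (- X \<inter> E)"
      using E X(1) s\<nu> by (simp add: emeasure_density indicator_inter_arith[symmetric])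
    also have "\<dots> = emeasure A (- X \<inter> E) + emeasure S (- X \<inter> E)"
      using E X(1) s\<nu> by (intro sum) auto
    also have "emeasure S (- X \<inter> E) = 0"
    proof -
      have "emeasure S (- X \<inter> E) \<le> emeasure S (space S - X)"
        using E X(1) s\<nu> sS spS by (intro emeasure_mono) auto
      then show ?thesis using X(3) by simp
    qed
    also have "emeasure A (- X \<inter> E) + 0 = emeasure A (E - X)" by (simp add: Diff_eq Int_commute)
    also have "\<dots> = emeasure A E"
    proof (rule emeasure_Diff_null_set)
      have "X \<in> null_sets arcsine" using X by auto
      then show "X \<in> null_sets A" using ac by (auto simp: absolutely_continuous_def)
      show "E \<in> sets A" using E sA s\<nu> by simp
    qed
    finally show "emeasure (density \<nu> (indicator (- X))) E = emeasure A E" .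
  qed (simp add: sA)
  then show thesis using that X dA by simp
qed

text \<open>The converse reading of the decomposition: any null set off which the measure has
  density \<open>v\<close> exhibits a Lebesgue decomposition, and this is unique.\<close>

lemma ac_deriv_eqI:
  assumes \<nu>: "finite_measure_on_interval \<nu>" and X: "X \<in> sets borel" "emeasure arcsine X = 0"
    and v: "v \<in> borel_measurable borel" "\<And>x. 0 \<le> v x"
    and eq: "density \<nu> (indicator (- X)) = density arcsine (\<lambda>x. ennreal (v x))"
  shows "AE x in arcsine. ac_deriv \<nu> x = v x"
proof -
  have s\<nu>: "sets \<nu> = sets borel" and f\<nu>: "finite_measure \<nu>"
    using \<nu> by (auto simp: finite_measure_on_interval_def)
  define A where "A = density arcsine (\<lambda>x. ennreal (v x))"
  have vm: "(\<lambda>x. ennreal (v x)) \<in> borel_measurable arcsine"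
    using v(1) by (simp add: measurable_cong_sets[OF sets_arcsine refl])
  have "is_ac_part arcsine \<nu> A"
    unfolding is_ac_part_def
  proof (intro conjI exI[of _ "density \<nu> (indicator X)"] ballI)
    show "sets A = sets \<nu>" by (simp add: A_def s\<nu>)
    show "absolutely_continuous arcsine A" unfolding A_def
      by (rule absolutely_continuousI_density[OF vm])
    show "mutually_singular arcsine (density \<nu> (indicator X))"
      unfolding mutually_singular_def
    proof (intro bexI[of _ X] conjI)
      have X': "X \<in> sets \<nu>" using X s\<nu> by simp
      have "emeasure (density \<nu> (indicator X)) (space \<nu> - X) = emeasure \<nu> (X \<inter> (space \<nu> - X))"
        using X' by (subst emeasure_density) (auto simp: indicator_inter_arith[symmetric])
      also have "X \<inter> (space \<nu> - X) = {}" by auto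
      finally show "emeasure (density \<nu> (indicator X)) (space (density \<nu> (indicator X)) - X) = 0"
        by simp
    qed (use X s\<nu> in auto)
    fix E assume "E \<in> sets \<nu>"
    then have E: "E \<in> sets borel" using s\<nu> by simp
    have "emeasure A E = emeasure \<nu> (- X \<inter> E)"
      using E X(1) s\<nu> unfolding A_def eq[symmetric]
      by (simp add: emeasure_density indicator_inter_arith[symmetric])
    moreover have "emeasure (density \<nu> (indicator X)) E = emeasure \<nu> (X \<inter> E)"
      using E X(1) s\<nu> by (simp add: emeasure_density indicator_inter_arith[symmetric])
    moreover have "emeasure \<nu> (- X \<inter> E) + emeasure \<nu> (X \<inter> E) = emeasure \<nu> ((- X \<inter> E) \<union> (X \<inter> E))"
      using E X(1) s\<nu> by (intro plus_emeasure) auto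
    moreover have "(- X \<inter> E) \<union> (X \<inter> E) = E" by auto
    ultimately show "emeasure \<nu> E = emeasure A E + emeasure (density \<nu> (indicator X)) E" by simp
  qed (simp add: s\<nu>)
  then have "ac_part arcsine \<nu> = A"
    using is_ac_part_ac_part[OF f\<nu>, of arcsine] by (intro is_ac_part_unique[of arcsine \<nu>]) (simp_all add: s\<nu>)
  then have "AE x in arcsine. ennreal (v x) = RN_deriv arcsine (ac_part arcsine \<nu>) x"
    using vm by (intro arcsine.RN_deriv_unique) (simp_all add: A_def)
  then show ?thesis
  proof eventually_elim
    case (elim x)
    have "ac_deriv \<nu> x = enn2real (ennreal (v x))" by (simp only: elim ac_deriv_def)
    then show ?case using v(2) by simp
  qed
qed

lemma
  assumes "finite_measure_on_interval \<nu>"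
  shows sets_on_interval: "sets \<nu> = sets borel" and finite_on_interval: "finite_measure \<nu>"
    and space_on_interval: "space \<nu> = UNIV" and AE_on_interval: "AE x in \<nu>. x \<in> {-1..1}"
proof -
  show s: "sets \<nu> = sets borel" and "finite_measure \<nu>"
    using assms by (auto simp: finite_measure_on_interval_def)
  show "space \<nu> = UNIV" using s by (metis sets_eq_imp_space_eq space_borel)
  show "AE x in \<nu>. x \<in> {-1..1}"
    using assms by (intro AE_I[of _ _ "- {-1..1}"]) (auto simp: finite_measure_on_interval_def)
qed

lemma measurable_on_interval:
  "finite_measure_on_interval \<nu> \<Longrightarrow> measurable \<nu> N = measurable borel N"
  by (rule measurable_cong_sets) (simp_all add: sets_on_interval)

lemma measurable_arcsine_eq: "measurable arcsine N = measurable borel N"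
  by (rule measurable_cong_sets) simp_all

lemma integrable_on_interval:
  fixes f :: "real \<Rightarrow> 'b::{banach, second_countable_topology}"
  assumes "finite_measure_on_interval \<nu>" "f \<in> borel_measurable borel" "\<And>x. x \<in> {-1..1} \<Longrightarrow> norm (f x) \<le> B"
  shows "integrable \<nu> f"
proof -
  interpret finite_measure \<nu> using assms(1) by (rule finite_on_interval)
  have "AE x in \<nu>. norm (f x) \<le> B" using AE_on_interval[OF assms(1)]
    by eventually_elim (use assms(3) in auto)
  then show ?thesis
    by (rule integrable_const_bound) (simp add: measurable_on_interval assms)
qed

lemma finite_measure_on_interval_arcsine: "finite_measure_on_interval arcsine"
proof -
  have "AE x in arcsine. x \<in> {-1..1}" using AE_arcsine_interval by eventually_elim auto
  then have "emeasure arcsine (- {-1..1}) = 0"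
    by (subst (asm) AE_iff_measurable[OF _ refl]) (auto simp: Compl_eq)
  then show ?thesis
    by (simp add: finite_measure_on_interval_def arcsine.finite_measure_axioms)
qed

lemmas integrable_arcsine_bounded = integrable_on_interval[OF finite_measure_on_interval_arcsine]

lemma integral_decomposition:
  fixes f :: "real \<Rightarrow> real"
  assumes \<nu>: "finite_measure_on_interval \<nu>" and X: "X \<in> sets borel"
    and eq: "density \<nu> (indicator (- X)) = density arcsine (\<lambda>x. ennreal (ac_deriv \<nu> x))"
    and f: "f \<in> borel_measurable borel" "integrable \<nu> f"
  shows "integrable arcsine (\<lambda>x. ac_deriv \<nu> x * f x)"
    "(LINT x|\<nu>. f x) = (LINT x|arcsine. ac_deriv \<nu> x * f x) + (LINT x|\<nu>. indicator X x * f x)"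
proof -
  have e1: "indicator (- X) = (\<lambda>x. ennreal (indicator (- X) x))" by (auto simp: indicator_def)
  have fm: "f \<in> borel_measurable \<nu>" "f \<in> borel_measurable arcsine"
    and im: "(indicator (- X) :: real \<Rightarrow> real) \<in> borel_measurable \<nu>" "(indicator X :: real \<Rightarrow> real) \<in> borel_measurable \<nu>"
    and vm: "ac_deriv \<nu> \<in> borel_measurable arcsine"
    using f(1) X by (simp_all add: measurable_on_interval[OF \<nu>] measurable_arcsine_eq)
  have i1: "integrable \<nu> (\<lambda>x. indicator (- X) x * f x)"
    by (rule Bochner_Integration.integrable_bound[OF f(2) borel_measurable_times[OF im(1) fm(1)]])
      (auto simp: indicator_def)
  have i2: "integrable \<nu> (\<lambda>x. indicator X x * f x)"
    by (rule Bochner_Integration.integrable_bound[OF f(2) borel_measurable_times[OF im(2) fm(1)]])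
      (auto simp: indicator_def)
  have "integrable (density \<nu> (indicator (- X))) f"
    unfolding e1 using i1 by (subst integrable_density[OF fm(1) im(1)]) auto
  then show "integrable arcsine (\<lambda>x. ac_deriv \<nu> x * f x)"
    unfolding eq by (subst (asm) integrable_density[OF fm(2) vm]) auto
  have "(LINT x|density \<nu> (indicator (- X)). f x) = (LINT x|\<nu>. indicator (- X) x * f x)"
    unfolding e1 by (subst integral_density[OF fm(1) im(1)]) auto
  moreover have "(LINT x|density arcsine (\<lambda>x. ennreal (ac_deriv \<nu> x)). f x) = (LINT x|arcsine. ac_deriv \<nu> x * f x)"
    by (subst integral_density[OF fm(2) vm]) auto
  ultimately have "(LINT x|arcsine. ac_deriv \<nu> x * f x) = (LINT x|\<nu>. indicator (- X) x * f x)"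
    using eq by simp
  moreover have "(LINT x|\<nu>. f x) = (LINT x|\<nu>. indicator (- X) x * f x + indicator X x * f x)"
    by (intro Bochner_Integration.integral_cong) (auto simp: indicator_def)
  ultimately show "(LINT x|\<nu>. f x) = (LINT x|arcsine. ac_deriv \<nu> x * f x) + (LINT x|\<nu>. indicator X x * f x)"
    using i1 i2 by simp
qed

lemma integrable_ac_deriv:
  assumes "finite_measure_on_interval \<nu>" shows "integrable arcsine (ac_deriv \<nu>)"
proof -
  obtain X where X0: "X \<in> sets borel" "emeasure arcsine X = 0"
    "density \<nu> (indicator (- X)) = density arcsine (\<lambda>x. ennreal (ac_deriv \<nu> x))"
    by (rule lebesgue_decomposition[OF assms])
  note X = X0(1,3)
  have i: "integrable \<nu> (\<lambda>_. 1::real)" by (rule integrable_on_interval[OF assms, of _ 1]) auto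
  have "integrable arcsine (\<lambda>x. ac_deriv \<nu> x * 1)"
    by (rule integral_decomposition(1)[OF assms X borel_measurable_const i])
  then show ?thesis by (simp only: mult_1_right)
qed

text \<open>The singular part contributes a non-negative amount, which is dropped.\<close>

lemma integral_ac_deriv_le:
  fixes f :: "real \<Rightarrow> real"
  assumes \<nu>: "finite_measure_on_interval \<nu>" and f: "f \<in> borel_measurable borel" "integrable \<nu> f"
    and nn: "\<And>x. x \<in> {-1..1} \<Longrightarrow> 0 \<le> f x"
  shows "integrable arcsine (\<lambda>x. ac_deriv \<nu> x * f x)" "(LINT x|arcsine. ac_deriv \<nu> x * f x) \<le> (LINT x|\<nu>. f x)"
proof -
  obtain X where X0: "X \<in> sets borel" "emeasure arcsine X = 0"
    "density \<nu> (indicator (- X)) = density arcsine (\<lambda>x. ennreal (ac_deriv \<nu> x))"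
    by (rule lebesgue_decomposition[OF \<nu>])
  note X = X0(1,3)
  have "AE x in \<nu>. 0 \<le> indicator X x * f x"
    using AE_on_interval[OF \<nu>] by eventually_elim (use nn in auto)
  then have "0 \<le> (LINT x|\<nu>. indicator X x * f x)" by (rule integral_nonneg_AE)
  then show "(LINT x|arcsine. ac_deriv \<nu> x * f x) \<le> (LINT x|\<nu>. f x)"
    using integral_decomposition(2)[OF \<nu> X f] by simp
  show "integrable arcsine (\<lambda>x. ac_deriv \<nu> x * f x)" by (rule integral_decomposition(1)[OF \<nu> X f])
qed

subsection \<open>Exponential weights\<close>

lemma finite_measure_on_interval_exp_weighted:
  assumes \<nu>: "finite_measure_on_interval \<nu>" and h: "h \<in> borel_measurable borel" "\<And>x. x \<in> {-1..1} \<Longrightarrow> h x \<le> B"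
  shows "finite_measure_on_interval (exp_weighted h \<nu>)"
proof -
  interpret finite_measure \<nu> using \<nu> by (rule finite_on_interval)
  have m: "(\<lambda>x. ennreal (exp (h x))) \<in> borel_measurable \<nu>" using h by (simp add: measurable_on_interval[OF \<nu>])
  have s: "sets (exp_weighted h \<nu>) = sets borel" by (simp add: exp_weighted_def sets_on_interval[OF \<nu>])
  have "emeasure (exp_weighted h \<nu>) (space (exp_weighted h \<nu>)) = (\<integral>\<^sup>+x. ennreal (exp (h x)) \<partial>\<nu>)"
    unfolding exp_weighted_def by (subst emeasure_density[OF m]) (auto intro!: nn_integral_cong)
  also have "\<dots> \<le> (\<integral>\<^sup>+x. ennreal (exp B) \<partial>\<nu>)"
    by (intro nn_integral_mono_AE eventually_mono[OF AE_on_interval[OF \<nu>]]) (auto intro!: ennreal_leI h)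
  also have "\<dots> < \<infinity>" by (simp add: less_top[symmetric] ennreal_mult_eq_top_iff)
  finally have "finite_measure (exp_weighted h \<nu>)" by (intro finite_measureI) simp
  moreover have "emeasure (exp_weighted h \<nu>) (- {-1..1}) = 0"
  proof -
    have "- {-1..1} \<in> null_sets \<nu>" using \<nu> by (auto simp: finite_measure_on_interval_def)
    then have "- {-1..1} \<in> null_sets (exp_weighted h \<nu>)"
      using absolutely_continuousI_density[OF m] by (auto simp: absolutely_continuous_def exp_weighted_def)
    then show ?thesis by auto
  qed
  ultimately show ?thesis using s by (simp add: finite_measure_on_interval_def)
qed

lemma integral_exp_weighted:
  fixes f :: "real \<Rightarrow> 'b::{banach, second_countable_topology}"
  assumes \<nu>: "finite_measure_on_interval \<nu>" and h: "h \<in> borel_measurable borel" and f: "f \<in> borel_measurable borel"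
  shows "(LINT x|exp_weighted h \<nu>. f x) = (LINT x|\<nu>. exp (h x) *\<^sub>R f x)"
  unfolding exp_weighted_def using assms
  by (subst integral_density) (auto simp: measurable_on_interval[OF \<nu>])

text \<open>The null set carrying the singular part of \<open>\<nu>\<close> also serves the weighted
  measure, so the densities simply multiply.\<close>

lemma ac_deriv_exp_weighted:
  assumes \<nu>: "finite_measure_on_interval \<nu>" and h: "h \<in> borel_measurable borel" "\<And>x. x \<in> {-1..1} \<Longrightarrow> h x \<le> B"
  shows "AE x in arcsine. ac_deriv (exp_weighted h \<nu>) x = exp (h x) * ac_deriv \<nu> x"
proof -
  obtain X where X: "X \<in> sets borel" "emeasure arcsine X = 0"
    and eq: "density \<nu> (indicator (- X)) = density arcsine (\<lambda>x. ennreal (ac_deriv \<nu> x))"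
    by (rule lebesgue_decomposition[OF \<nu>])
  have hm: "(\<lambda>x. ennreal (exp (h x))) \<in> borel_measurable \<nu>" "(\<lambda>x. ennreal (exp (h x))) \<in> borel_measurable arcsine"
    and im: "(indicator (- X) :: real \<Rightarrow> ennreal) \<in> borel_measurable \<nu>"
    and vm: "(\<lambda>x. ennreal (ac_deriv \<nu> x)) \<in> borel_measurable arcsine"
    using h(1) X by (simp_all add: measurable_on_interval[OF \<nu>] measurable_arcsine_eq)
  show ?thesis
  proof (rule ac_deriv_eqI[OF finite_measure_on_interval_exp_weighted[OF \<nu> h] X])
    show "(\<lambda>x. exp (h x) * ac_deriv \<nu> x) \<in> borel_measurable borel" using h(1) by measurable
    have "density (exp_weighted h \<nu>) (indicator (- X)) = density (density \<nu> (indicator (- X))) (\<lambda>x. ennreal (exp (h x)))"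
      unfolding exp_weighted_def by (simp add: density_density_eq hm im mult.commute)
    also have "\<dots> = density arcsine (\<lambda>x. ennreal (ac_deriv \<nu> x) * ennreal (exp (h x)))"
      unfolding eq by (rule density_density_eq[OF vm hm(2)])
    also have "\<dots> = density arcsine (\<lambda>x. ennreal (exp (h x) * ac_deriv \<nu> x))"
      by (simp add: ennreal_mult mult.commute)
    finally show "density (exp_weighted h \<nu>) (indicator (- X)) = density arcsine (\<lambda>x. ennreal (exp (h x) * ac_deriv \<nu> x))" .
  qed auto
qed

lemma log_exp_weighted:
  assumes \<nu>: "finite_measure_on_interval \<nu>" "log_integrable \<nu>"
    and h: "h \<in> borel_measurable borel" "\<And>x. x \<in> {-1..1} \<Longrightarrow> \<bar>h x\<bar> \<le> B"
  shows "log_integrable (exp_weighted h \<nu>)"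
    "AE x in arcsine. ln (ac_deriv (exp_weighted h \<nu>) x) = h x + ln (ac_deriv \<nu> x)"
proof -
  have hB: "\<And>x. x \<in> {-1..1} \<Longrightarrow> h x \<le> B" using h(2) by (auto simp: abs_le_iff)
  have ae: "AE x in arcsine. ac_deriv (exp_weighted h \<nu>) x = exp (h x) * ac_deriv \<nu> x"
    by (rule ac_deriv_exp_weighted[OF \<nu>(1) h(1) hB])
  have pos: "AE x in arcsine. 0 < ac_deriv \<nu> x" and int: "integrable arcsine (\<lambda>x. ln (ac_deriv \<nu> x))"
    using \<nu>(2) by (auto simp: log_integrable_def)
  show ln: "AE x in arcsine. ln (ac_deriv (exp_weighted h \<nu>) x) = h x + ln (ac_deriv \<nu> x)"
    using ae pos by eventually_elim (simp add: ln_mult)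
  have "integrable arcsine h" by (rule integrable_arcsine_bounded[OF h(1), of B]) (use h(2) in auto)
  then have "integrable arcsine (\<lambda>x. h x + ln (ac_deriv \<nu> x))" using int by simp
  then have "integrable arcsine (\<lambda>x. ln (ac_deriv (exp_weighted h \<nu>) x))"
    by (rule integrable_cong_AE_imp) (use ln in \<open>auto simp: measurable_arcsine_eq elim: eventually_mono\<close>)
  moreover have "AE x in arcsine. 0 < ac_deriv (exp_weighted h \<nu>) x"
    using ae pos by eventually_elim simp
  ultimately show "log_integrable (exp_weighted h \<nu>)" by (simp add: log_integrable_def)
qed

section \<open>Szego's extremal problem for the exponential weights\<close>

lemma exp_diff_le:
  fixes a b k :: real
  assumes "a \<le> k" "b \<le> k"
  shows "\<bar>exp a - exp b\<bar> \<le> exp k * \<bar>a - b\<bar>"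
proof -
  have *: "exp y - exp x \<le> exp k * (y - x)" if "x \<le> y" "y \<le> k" for x y :: real
  proof -
    have "1 - exp (x - y) \<le> y - x" using exp_ge_add_one_self[of "x - y"] by linarith
    then have "exp y * (1 - exp (x - y)) \<le> exp y * (y - x)" by (intro mult_left_mono) auto
    also have "\<dots> \<le> exp k * (y - x)" using that by (intro mult_right_mono) auto
    finally show ?thesis by (simp add: algebra_simps exp_diff)
  qed
  show ?thesis using *[of a b] *[of b a] assms by (cases "a \<le> b") (auto simp: abs_if)
qed

definition truncation :: "real \<Rightarrow> real \<Rightarrow> real" where
  "truncation k x = max (- k) (min k x)"

text \<open>The last two bounds are the majorants for dominated convergence: truncation does not
  increase the modulus, and its exponential exceeds the original one by at most 1.\<close>

lemma truncation_bounds: "0 \<le> k \<Longrightarrow> \<bar>truncation k x\<bar> \<le> k" "0 \<le> k \<Longrightarrow> truncation k x \<le> k" "\<bar>truncation k x\<bar> \<le> \<bar>k\<bar>"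
  "0 \<le> k \<Longrightarrow> \<bar>truncation k x\<bar> \<le> \<bar>x\<bar>" "0 \<le> k \<Longrightarrow> exp (truncation k x) \<le> exp x + 1"
proof -
  show "0 \<le> k \<Longrightarrow> exp (truncation k x) \<le> exp x + 1"
  proof -
    assume "0 \<le> k"
    then have "truncation k x \<le> max x 0" by (auto simp: truncation_def)
    then have "exp (truncation k x) \<le> exp (max x 0)" by simp
    also have "\<dots> \<le> exp x + 1" by (auto simp: max_def)
    finally show ?thesis .
  qed
qed (auto simp: truncation_def max_def min_def)

lemma truncation_measurable [measurable]: "truncation k \<in> borel_measurable borel"
  unfolding truncation_def by measurable

lemma truncation_tendsto: "(\<lambda>n. truncation (real n) x) \<longlonglongrightarrow> x"
proof (rule tendsto_eventually)
  obtain N :: nat where N: "\<bar>x\<bar> \<le> real N" using real_arch_simple by blast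
  show "\<forall>\<^sub>F n in sequentially. truncation (real n) x = x"
    using N by (intro eventually_sequentiallyI[of N]) (auto simp: truncation_def max_def min_def)
qed

lemma integrable_poly_on_interval:
  assumes "finite_measure_on_interval \<nu>" "continuous_on {-1..1} f" "f \<in> borel_measurable borel"
  shows "integrable \<nu> (f :: real \<Rightarrow> 'b::{banach, second_countable_topology})"
proof -
  have "compact (f ` {-1..1})" by (intro compact_continuous_image assms) auto
  then have "bounded (f ` {-1..1})" by (rule compact_imp_bounded)
  then obtain B where B: "\<And>y. y \<in> f ` {-1..1} \<Longrightarrow> norm y \<le> B" unfolding bounded_iff by auto
  show ?thesis by (rule integrable_on_interval[OF assms(1,3), of B]) (use B in auto)
qed

lemma measurable_poly [measurable]: "poly (p :: real poly) \<in> borel_measurable borel"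
  by (intro borel_measurable_continuous_onI continuous_intros)

text \<open>Truncate \<open>ln u\<close> at a level \<open>k\<close> that is good both for the
  logarithm and for its exponential, then approximate the bounded function by a polynomial. On the
  bounded range the exponential is Lipschitz, so one approximation gives both estimates.\<close>

lemma log_poly_approx:
  fixes u :: "real \<Rightarrow> real"
  assumes u: "u \<in> borel_measurable borel" "AE x in arcsine. 0 < u x" "integrable arcsine u"
    and ln: "integrable arcsine (\<lambda>x. ln (u x))" and e: "e > 0"
  obtains p :: "real poly" where "(LINT x|arcsine. \<bar>exp (poly p x) - u x\<bar>) \<le> e"
    "(LINT x|arcsine. \<bar>poly p x - ln (u x)\<bar>) \<le> e"
proof -
  note [simp] = measurable_arcsine_eq
  have um: "u \<in> borel_measurable arcsine" using u(1) by simp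
  have lnm: "(\<lambda>x. ln (u x)) \<in> borel_measurable borel" using u(1) by measurable
  define f where "f k x = truncation (real k) (ln (u x))" for k x
  have fm: "f k \<in> borel_measurable borel" for k unfolding f_def using lnm by measurable
  have fb: "\<bar>f k x\<bar> \<le> real k" for k x unfolding f_def by (rule truncation_bounds) simp
  have c1: "(\<lambda>k. LINT x|arcsine. \<bar>exp (f k x) - u x\<bar>) \<longlonglongrightarrow> (LINT x|arcsine. 0)"
  proof (rule integral_dominated_convergence[where w = "\<lambda>x. 2 * u x + 1"])
    show "integrable arcsine (\<lambda>x. 2 * u x + 1)" using u(3) by simp
    show "AE x in arcsine. (\<lambda>k. \<bar>exp (f k x) - u x\<bar>) \<longlonglongrightarrow> 0"
      using u(2)
    proof eventually_elim
      case (elim x)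
      have "(\<lambda>k. \<bar>exp (f k x) - u x\<bar>) \<longlonglongrightarrow> \<bar>exp (ln (u x)) - u x\<bar>"
        unfolding f_def by (intro tendsto_intros truncation_tendsto)
      then show ?case using elim by simp
    qed
    show "AE x in arcsine. norm \<bar>exp (f k x) - u x\<bar> \<le> 2 * u x + 1" for k
      using u(2)
    proof eventually_elim
      case (elim x)
      have "exp (f k x) \<le> exp (ln (u x)) + 1" unfolding f_def by (rule truncation_bounds) simp
      moreover have "0 < exp (f k x)" by simp
      moreover have "exp (ln (u x)) = u x" using elim by simp
      ultimately show ?case using elim unfolding real_norm_def by linarith
    qed
  qed (use fm u(1) in simp_all)
  have c2: "(\<lambda>k. LINT x|arcsine. \<bar>f k x - ln (u x)\<bar>) \<longlonglongrightarrow> (LINT x|arcsine. 0)"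
  proof (rule integral_dominated_convergence[where w = "\<lambda>x. 2 * \<bar>ln (u x)\<bar>"])
    show "integrable arcsine (\<lambda>x. 2 * \<bar>ln (u x)\<bar>)" using ln by simp
    show "AE x in arcsine. (\<lambda>k. \<bar>f k x - ln (u x)\<bar>) \<longlonglongrightarrow> 0"
    proof (rule AE_I2)
      fix x
      have "(\<lambda>k. \<bar>f k x - ln (u x)\<bar>) \<longlonglongrightarrow> \<bar>ln (u x) - ln (u x)\<bar>"
        unfolding f_def by (intro tendsto_intros truncation_tendsto)
      then show "(\<lambda>k. \<bar>f k x - ln (u x)\<bar>) \<longlonglongrightarrow> 0" by simp
    qed
    show "AE x in arcsine. norm \<bar>f k x - ln (u x)\<bar> \<le> 2 * \<bar>ln (u x)\<bar>" for k
    proof (rule AE_I2)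
      fix x
      have "\<bar>f k x\<bar> \<le> \<bar>ln (u x)\<bar>" unfolding f_def by (rule truncation_bounds) simp
      then show "norm \<bar>f k x - ln (u x)\<bar> \<le> 2 * \<bar>ln (u x)\<bar>" by simp
    qed
  qed (use fm lnm in simp_all)
  have "\<forall>\<^sub>F k in sequentially. (LINT x|arcsine. \<bar>exp (f k x) - u x\<bar>) < e / 2 \<and> (LINT x|arcsine. \<bar>f k x - ln (u x)\<bar>) < e / 2"
    using e by (intro eventually_conj order_tendstoD(2)[OF c1] order_tendstoD(2)[OF c2]) auto
  then obtain k where k: "(LINT x|arcsine. \<bar>exp (f k x) - u x\<bar>) < e / 2" "(LINT x|arcsine. \<bar>f k x - ln (u x)\<bar>) < e / 2"
    by (auto simp: eventually_sequentially)
  \<comment> \<open>Both the polynomial and the truncation are at most \<open>k + 1\<close>, where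
    the exponential has Lipschitz constant \<open>exp (k + 1)\<close>.\<close>
  define d where "d = e / (2 * exp (real k + 1))"
  have d: "d > 0" "d \<le> e / 2" "exp (real k + 1) * d = e / 2"
  proof -
    have "exp (real k + 1) \<ge> 1" by simp
    then show "d \<le> e / 2" using e unfolding d_def by (intro frac_le) auto
  qed (use e in \<open>auto simp: d_def\<close>)
  have em: "emeasure arcsine (- {-1..1}) = 0"
    using finite_measure_on_interval_arcsine by (simp add: finite_measure_on_interval_def)
  obtain p where p: "\<And>x. x \<in> {-1..1} \<Longrightarrow> \<bar>poly p x\<bar> \<le> real k + 1" "(LINT x|arcsine. \<bar>poly p x - f k x\<bar>) \<le> d"
    by (rule bounded_measurable_poly_approx[OF arcsine.finite_measure_axioms sets_arcsine em
          arcsine.finite_measure_axioms sets_arcsine em fm[of k] fb[of k] d(1)]) blast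
  have ip: "integrable arcsine (poly p)" "integrable arcsine (\<lambda>x. exp (poly p x))"
    by (intro integrable_poly_on_interval[OF finite_measure_on_interval_arcsine] continuous_intros; measurable)+
  have if': "integrable arcsine (f k)" "integrable arcsine (\<lambda>x. exp (f k x))"
  proof -
    have e: "(\<lambda>x. exp (f k x)) \<in> borel_measurable borel" using fm[of k] by measurable
    have b: "norm (exp (f k x)) \<le> exp (real k)" for x using fb[of k x] by auto
    show "integrable arcsine (f k)"
      by (rule integrable_arcsine_bounded[OF fm[of k], of "real k"]) (use fb[of k] in auto)
    show "integrable arcsine (\<lambda>x. exp (f k x))"
      by (rule integrable_arcsine_bounded[OF e b])
  qed
  have pe: "(LINT x|arcsine. \<bar>exp (poly p x) - exp (f k x)\<bar>) \<le> exp (real k + 1) * d"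
  proof -
    have "(LINT x|arcsine. \<bar>exp (poly p x) - exp (f k x)\<bar>) \<le> (LINT x|arcsine. exp (real k + 1) * \<bar>poly p x - f k x\<bar>)"
    proof (rule integral_mono_AE)
      show "AE x in arcsine. \<bar>exp (poly p x) - exp (f k x)\<bar> \<le> exp (real k + 1) * \<bar>poly p x - f k x\<bar>"
        using AE_on_interval[OF finite_measure_on_interval_arcsine]
      proof eventually_elim
        case (elim x)
        show ?case by (rule exp_diff_le) (use p(1)[OF elim] fb[of k x] in auto)
      qed
    qed (use ip if' in auto)
    also have "\<dots> = exp (real k + 1) * (LINT x|arcsine. \<bar>poly p x - f k x\<bar>)" by simp
    also have "\<dots> \<le> exp (real k + 1) * d" using p(2) by (intro mult_left_mono) auto
    finally show ?thesis .
  qed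
  show thesis
  proof (rule that)
    have "(LINT x|arcsine. \<bar>exp (poly p x) - u x\<bar>) \<le> (LINT x|arcsine. \<bar>exp (poly p x) - exp (f k x)\<bar> + \<bar>exp (f k x) - u x\<bar>)"
      using ip if' u(3) by (intro integral_mono) auto
    also have "\<dots> = (LINT x|arcsine. \<bar>exp (poly p x) - exp (f k x)\<bar>) + (LINT x|arcsine. \<bar>exp (f k x) - u x\<bar>)"
      using ip if' u(3) by (intro Bochner_Integration.integral_add) auto
    finally show "(LINT x|arcsine. \<bar>exp (poly p x) - u x\<bar>) \<le> e" using pe d(3) k(1) by linarith
    have "(LINT x|arcsine. \<bar>poly p x - ln (u x)\<bar>) \<le> (LINT x|arcsine. \<bar>poly p x - f k x\<bar> + \<bar>f k x - ln (u x)\<bar>)"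
      using ip if' ln by (intro integral_mono) auto
    also have "\<dots> = (LINT x|arcsine. \<bar>poly p x - f k x\<bar>) + (LINT x|arcsine. \<bar>f k x - ln (u x)\<bar>)"
      using ip if' ln by (intro Bochner_Integration.integral_add) auto
    finally show "(LINT x|arcsine. \<bar>poly p x - ln (u x)\<bar>) \<le> e" using p(2) d(2) k(2) by linarith
  qed
qed

text \<open>The approximation half of Szego's infimum theorem. The ideal exponent is
  \<open>- ln v\<close> on the absolutely continuous part and minus infinity on the singular part.
  The latter is harmless for the logarithmic integral because \<open>X\<close> is null for the
  arcsine law.\<close>

lemma szego_extremal_poly:
  assumes \<nu>: "finite_measure_on_interval \<nu>" and log: "log_integrable \<nu>" and e: "e > 0"
  obtains p :: "real poly" where "(LINT x|\<nu>. exp (poly p x)) \<le> 1 + e"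
    "(LINT x|arcsine. poly p x + ln (ac_deriv \<nu> x)) \<ge> - e"
proof -
  interpret \<nu>: finite_measure \<nu> using \<nu> by (rule finite_on_interval)
  have m\<nu>: "measurable \<nu> N = measurable borel N" for N :: "'x measure" by (rule measurable_on_interval[OF \<nu>])
  have pos: "AE x in arcsine. 0 < ac_deriv \<nu> x" and ln: "integrable arcsine (\<lambda>x. ln (ac_deriv \<nu> x))"
    using log by (auto simp: log_integrable_def)
  obtain X where X0: "X \<in> sets borel" "emeasure arcsine X = 0"
    "density \<nu> (indicator (- X)) = density arcsine (\<lambda>x. ennreal (ac_deriv \<nu> x))"
    by (rule lebesgue_decomposition[OF \<nu>])
  note X = X0(1,3)
  have AEX: "AE x in arcsine. x \<notin> X" using X0(1,2) by (intro AE_not_in) auto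
  \<comment> \<open>On \<open>X\<close> the exponent \<open>- k\<close> makes the singular mass
    decay like \<open>exp (- k)\<close>; elsewhere the exponential times the density is dominated by
    the density plus 1.\<close>
  define f where "f k x = (if x \<in> X then - real k else truncation (real k) (- ln (ac_deriv \<nu> x)))" for k x
  have fm: "f k \<in> borel_measurable borel" for k unfolding f_def using X0(1) by measurable
  have fb: "\<bar>f k x\<bar> \<le> real k" for k x unfolding f_def using truncation_bounds(1)[of "real k"] by auto
  have efm: "(\<lambda>x. exp (f k x)) \<in> borel_measurable borel" for k using fm by measurable
  have ef: "integrable \<nu> (\<lambda>x. exp (f k x))" for k
  proof (rule integrable_on_interval[OF \<nu> efm])
    fix x show "norm (exp (f k x)) \<le> exp (real k)" using fb[of k x] by auto
  qed
  have cx: "(\<lambda>k. LINT x|\<nu>. indicator X x * exp (f k x)) \<longlonglongrightarrow> 0"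
  proof -
    have "(\<lambda>k. exp (- real k) * measure \<nu> X) \<longlonglongrightarrow> 0 * measure \<nu> X"
    proof (intro tendsto_intros)
      have "(\<lambda>k. exp (- 1 :: real) ^ k) \<longlonglongrightarrow> 0" by (rule LIMSEQ_power_zero) simp
      then show "(\<lambda>k. exp (- real k)) \<longlonglongrightarrow> 0" by (simp flip: exp_of_nat_mult)
    qed
    moreover have "(LINT x|\<nu>. indicator X x * exp (f k x)) = exp (- real k) * measure \<nu> X" for k
    proof -
      have "(LINT x|\<nu>. indicator X x * exp (f k x)) = (LINT x|\<nu>. exp (- real k) * indicator X x)"
        by (intro Bochner_Integration.integral_cong) (auto simp: f_def indicator_def)
      also have "\<dots> = exp (- real k) * measure \<nu> X" using X0(1) by (simp add: sets_on_interval[OF \<nu>] space_on_interval[OF \<nu>])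
      finally show ?thesis .
    qed
    ultimately show ?thesis by simp
  qed
  have iv: "integrable arcsine (ac_deriv \<nu>)" by (rule integrable_ac_deriv[OF \<nu>])
  have c1: "(\<lambda>k. LINT x|arcsine. ac_deriv \<nu> x * exp (f k x)) \<longlonglongrightarrow> (LINT x|arcsine. 1)"
  proof (rule integral_dominated_convergence[where w = "\<lambda>x. ac_deriv \<nu> x + 1"])
    show "integrable arcsine (\<lambda>x. ac_deriv \<nu> x + 1)" using iv by simp
    show "AE x in arcsine. (\<lambda>k. ac_deriv \<nu> x * exp (f k x)) \<longlonglongrightarrow> 1"
      using pos AEX
    proof eventually_elim
      case (elim x)
      have "(\<lambda>k. ac_deriv \<nu> x * exp (truncation (real k) (- ln (ac_deriv \<nu> x)))) \<longlonglongrightarrow> ac_deriv \<nu> x * exp (- ln (ac_deriv \<nu> x))"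
        by (intro tendsto_intros truncation_tendsto)
      moreover have "ac_deriv \<nu> x * exp (- ln (ac_deriv \<nu> x)) = 1" using elim by (simp add: exp_minus)
      ultimately show ?case using elim by (simp add: f_def)
    qed
    show "AE x in arcsine. norm (ac_deriv \<nu> x * exp (f k x)) \<le> ac_deriv \<nu> x + 1" for k
      using pos AEX
    proof eventually_elim
      case (elim x)
      have "exp (f k x) \<le> exp (- ln (ac_deriv \<nu> x)) + 1"
        using elim truncation_bounds(5)[of "real k"] by (simp add: f_def)
      then have "ac_deriv \<nu> x * exp (f k x) \<le> ac_deriv \<nu> x * (exp (- ln (ac_deriv \<nu> x)) + 1)"
        by (intro mult_left_mono) auto
      also have "\<dots> = ac_deriv \<nu> x + 1" using elim by (simp add: exp_minus distrib_left)
      finally show ?case by simp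
    qed
  qed (use efm in \<open>simp_all add: measurable_arcsine_eq\<close>)
  have c2: "(\<lambda>k. LINT x|arcsine. f k x + ln (ac_deriv \<nu> x)) \<longlonglongrightarrow> (LINT x|arcsine. 0)"
  proof (rule integral_dominated_convergence[where w = "\<lambda>x. 2 * \<bar>ln (ac_deriv \<nu> x)\<bar>"])
    show "integrable arcsine (\<lambda>x. 2 * \<bar>ln (ac_deriv \<nu> x)\<bar>)" using ln by simp
    show "AE x in arcsine. (\<lambda>k. f k x + ln (ac_deriv \<nu> x)) \<longlonglongrightarrow> 0"
      using AEX
    proof eventually_elim
      case (elim x)
      have "(\<lambda>k. truncation (real k) (- ln (ac_deriv \<nu> x)) + ln (ac_deriv \<nu> x)) \<longlonglongrightarrow> - ln (ac_deriv \<nu> x) + ln (ac_deriv \<nu> x)"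
        by (intro tendsto_intros truncation_tendsto)
      then show ?case using elim by (simp add: f_def)
    qed
    show "AE x in arcsine. norm (f k x + ln (ac_deriv \<nu> x)) \<le> 2 * \<bar>ln (ac_deriv \<nu> x)\<bar>" for k
      using AEX
    proof eventually_elim
      case (elim x)
      have "\<bar>f k x\<bar> \<le> \<bar>- ln (ac_deriv \<nu> x)\<bar>" using elim truncation_bounds(4)[of "real k" "- ln (ac_deriv \<nu> x)"] by (simp add: f_def)
      then show ?case by simp
    qed
  qed (use fm in \<open>simp_all add: measurable_arcsine_eq\<close>)
  have "\<forall>\<^sub>F k in sequentially. (LINT x|\<nu>. indicator X x * exp (f k x)) < e / 4
      \<and> (LINT x|arcsine. ac_deriv \<nu> x * exp (f k x)) < 1 + e / 4 \<and> (LINT x|arcsine. f k x + ln (ac_deriv \<nu> x)) > - (e / 2)"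
    using e by (intro eventually_conj order_tendstoD[OF c1] order_tendstoD[OF c2] order_tendstoD[OF cx]) auto
  then obtain k where k: "(LINT x|\<nu>. indicator X x * exp (f k x)) < e / 4"
      "(LINT x|arcsine. ac_deriv \<nu> x * exp (f k x)) < 1 + e / 4" "(LINT x|arcsine. f k x + ln (ac_deriv \<nu> x)) > - (e / 2)"
    by (auto simp: eventually_sequentially)
  have k': "(LINT x|\<nu>. exp (f k x)) < 1 + e / 2"
    using integral_decomposition(2)[OF \<nu> X efm ef, of k] k by linarith
  define d where "d = e / (2 * exp (real k + 1))"
  have d: "d > 0" "d \<le> e / 2" "exp (real k + 1) * d = e / 2"
  proof -
    have "exp (real k + 1) \<ge> 1" by simp
    then show "d \<le> e / 2" using e unfolding d_def by (intro frac_le) auto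
  qed (use e in \<open>auto simp: d_def\<close>)
  have em: "emeasure arcsine (- {-1..1}) = 0" "emeasure \<nu> (- {-1..1}) = 0"
    using finite_measure_on_interval_arcsine \<nu> by (auto simp: finite_measure_on_interval_def)
  obtain p where p: "\<And>x. x \<in> {-1..1} \<Longrightarrow> \<bar>poly p x\<bar> \<le> real k + 1" "(LINT x|arcsine. \<bar>poly p x - f k x\<bar>) \<le> d"
    "(LINT x|\<nu>. \<bar>poly p x - f k x\<bar>) \<le> d"
    by (rule bounded_measurable_poly_approx[OF arcsine.finite_measure_axioms sets_arcsine em(1)
          \<nu>.finite_measure_axioms sets_on_interval[OF \<nu>] em(2) fm[of k] fb[of k] d(1)]) blast
  have ip: "integrable L (poly p)" "integrable L (\<lambda>x. exp (poly p x))" if "finite_measure_on_interval L" for L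
    by (intro integrable_poly_on_interval[OF that] continuous_intros; measurable)+
  have if': "integrable L (f k)" if "finite_measure_on_interval L" for L
    by (rule integrable_on_interval[OF that fm[of k], of "real k"]) (use fb in auto)
  show thesis
  proof (rule that)
    have "(LINT x|\<nu>. exp (poly p x)) \<le> (LINT x|\<nu>. exp (f k x) + exp (real k + 1) * \<bar>poly p x - f k x\<bar>)"
    proof (rule integral_mono_AE)
      show "AE x in \<nu>. exp (poly p x) \<le> exp (f k x) + exp (real k + 1) * \<bar>poly p x - f k x\<bar>"
        using AE_on_interval[OF \<nu>]
      proof eventually_elim
        case (elim x)
        have "\<bar>exp (poly p x) - exp (f k x)\<bar> \<le> exp (real k + 1) * \<bar>poly p x - f k x\<bar>"
          by (rule exp_diff_le) (use p(1)[OF elim] fb[of k x] in auto)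
        then show ?case by linarith
      qed
    qed (use ip[OF \<nu>] if'[OF \<nu>] ef in auto)
    also have "\<dots> = (LINT x|\<nu>. exp (f k x)) + exp (real k + 1) * (LINT x|\<nu>. \<bar>poly p x - f k x\<bar>)"
      using ip[OF \<nu>] if'[OF \<nu>] ef by (subst Bochner_Integration.integral_add) auto
    also have "exp (real k + 1) * (LINT x|\<nu>. \<bar>poly p x - f k x\<bar>) \<le> exp (real k + 1) * d"
      using p(3) by (intro mult_left_mono) auto
    finally show "(LINT x|\<nu>. exp (poly p x)) \<le> 1 + e" using k' d(3) by linarith
    note ia = ip(1)[OF finite_measure_on_interval_arcsine] if'[OF finite_measure_on_interval_arcsine]
    have "(LINT x|arcsine. f k x + ln (ac_deriv \<nu> x) - \<bar>poly p x - f k x\<bar>) \<le> (LINT x|arcsine. poly p x + ln (ac_deriv \<nu> x))"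
      using ia ln by (intro integral_mono) auto
    moreover have "(LINT x|arcsine. f k x + ln (ac_deriv \<nu> x) - \<bar>poly p x - f k x\<bar>)
       = (LINT x|arcsine. f k x + ln (ac_deriv \<nu> x)) - (LINT x|arcsine. \<bar>poly p x - f k x\<bar>)"
      using ia ln by (intro Bochner_Integration.integral_diff) auto
    ultimately show "(LINT x|arcsine. poly p x + ln (ac_deriv \<nu> x)) \<ge> - e" using p(2) d(2) k(3) by linarith
  qed
qed

text \<open>A quantitative equality case of Jensen's inequality. The mean of
  \<open>u - 1 - ln u\<close> is at most \<open>2 * \<delta> ^ 4\<close>, and this integrand
  dominates the square of \<open>sqrt u - 1\<close>; so \<open>u\<close> is near 1,
  \<open>ln u\<close> near 0, and hardly any mass remains for the singular part. The last conclusion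
  is the weak form in which this is used against the phase.\<close>

lemma near_extremal_estimates:
  fixes p :: "real poly"
  assumes \<nu>: "finite_measure_on_interval \<nu>" and log: "log_integrable \<nu>"
    and \<delta>: "0 < \<delta>" "\<delta> \<le> 1"
    and 1: "(LINT x|\<nu>. exp (poly p x)) \<le> 1 + \<delta> ^ 4"
    and 2: "(LINT x|arcsine. poly p x + ln (ac_deriv \<nu> x)) \<ge> - (\<delta> ^ 4)"
  defines "u \<equiv> \<lambda>x. ac_deriv \<nu> x * exp (poly p x)"
  shows "integrable arcsine u" "AE x in arcsine. 0 < u x" "u \<in> borel_measurable borel"
    "AE x in arcsine. ln (u x) = poly p x + ln (ac_deriv \<nu> x)"
    "integrable arcsine (\<lambda>x. ln (u x))"
    "(LINT x|arcsine. u x) \<le> 1 + \<delta> ^ 4"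
    "(LINT x|arcsine. ln (u x)) \<ge> - (\<delta> ^ 4)"
    "(LINT x|arcsine. \<bar>u x - 1\<bar>) \<le> 4 * \<delta>\<^sup>2"
    "(LINT x|arcsine. \<bar>ln (u x)\<bar>) \<le> 9 * \<delta>\<^sup>2"
    "\<And>\<psi>. \<psi> \<in> borel_measurable borel \<Longrightarrow> (\<And>x. x \<in> {-1..1} \<Longrightarrow> \<bar>\<psi> x\<bar> \<le> 1) \<Longrightarrow>
      \<bar>(LINT x|\<nu>. \<psi> x * exp (poly p x)) - (LINT x|arcsine. \<psi> x)\<bar> \<le> 6 * \<delta>\<^sup>2"
proof -
  have \<delta>4: "0 < \<delta> ^ 4" "\<delta> ^ 4 \<le> \<delta>\<^sup>2" "\<delta>\<^sup>2 \<le> 1" "0 < \<delta>\<^sup>2"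
    using \<delta> power_decreasing[of 2 4 \<delta>] by (auto simp: power_le_one)
  have pos: "AE x in arcsine. 0 < ac_deriv \<nu> x" and ln: "integrable arcsine (\<lambda>x. ln (ac_deriv \<nu> x))"
    using log by (auto simp: log_integrable_def)
  have ep: "(\<lambda>x. exp (poly p x)) \<in> borel_measurable borel" by measurable
  have iep: "integrable \<nu> (\<lambda>x. exp (poly p x))" by (intro integrable_poly_on_interval[OF \<nu> _ ep] continuous_intros)
  have ip: "integrable arcsine (poly p)"
    by (intro integrable_poly_on_interval[OF finite_measure_on_interval_arcsine] continuous_intros) measurable
  show um: "u \<in> borel_measurable borel" unfolding u_def by measurable
  show iu: "integrable arcsine u" unfolding u_def
    by (rule integral_ac_deriv_le(1)[OF \<nu> ep iep]) simp
  show upos: "AE x in arcsine. 0 < u x" using pos by eventually_elim (simp add: u_def)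
  show lu: "AE x in arcsine. ln (u x) = poly p x + ln (ac_deriv \<nu> x)"
    using pos by eventually_elim (simp add: u_def ln_mult)
  have i2: "integrable arcsine (\<lambda>x. poly p x + ln (ac_deriv \<nu> x))" using ip ln by simp
  show ilu: "integrable arcsine (\<lambda>x. ln (u x))"
    by (rule integrable_cong_AE_imp[OF i2]) (use um lu in \<open>auto simp: measurable_arcsine_eq elim: eventually_mono\<close>)
  show u1: "(LINT x|arcsine. u x) \<le> 1 + \<delta> ^ 4" unfolding u_def
    using integral_ac_deriv_le(2)[OF \<nu> ep iep] 1 by simp
  have "(LINT x|arcsine. ln (u x)) = (LINT x|arcsine. poly p x + ln (ac_deriv \<nu> x))"
    by (rule integral_cong_AE) (use um lu in \<open>auto simp: measurable_arcsine_eq\<close>)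
  then show lu1: "(LINT x|arcsine. ln (u x)) \<ge> - (\<delta> ^ 4)" using 2 by simp
  \<comment> \<open>With \<open>s = sqrt u\<close>, \<open>ln s \<le> s - 1\<close> gives
    \<open>(s - 1)^2 \<le> u - 1 - ln u\<close>. The factorisation
    \<open>u - 1 = (s - 1) (s + 1)\<close> and the weight \<open>\<delta>\<^sup>2\<close> in the
    arithmetic-geometric mean then integrate to
    \<open>\<delta>\<^sup>2 + 3 * \<delta>\<^sup>2\<close>.\<close>
  have bound: "AE x in arcsine. \<bar>u x - 1\<bar> \<le> (u x - 1 - ln (u x)) / (2 * \<delta>\<^sup>2) + \<delta>\<^sup>2 * (u x + 1)"
    using upos
  proof eventually_elim
    case (elim x)
    define s where "s = sqrt (u x)"
    have s: "s > 0" "u x = s\<^sup>2" using elim by (auto simp: s_def)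
    have "ln (u x) = 2 * ln s" using s by (simp add: ln_realpow)
    moreover have "ln s \<le> s - 1" using s by (intro ln_le_minus_one)
    ultimately have a: "(s - 1)\<^sup>2 \<le> u x - 1 - ln (u x)" using s by (simp add: power2_eq_square algebra_simps)
    have b: "(s + 1)\<^sup>2 \<le> 2 * (u x + 1)" using s sum_squares_bound[of s 1] by (simp add: power2_eq_square algebra_simps)
    have "\<bar>u x - 1\<bar> = \<bar>s - 1\<bar> * (s + 1)"
    proof -
      have "u x - 1 = (s - 1) * (s + 1)" using s by (simp add: power2_eq_square algebra_simps)
      then show ?thesis using s by (simp add: abs_mult)
    qed
    also have "\<dots> \<le> (s - 1)\<^sup>2 / (2 * \<delta>\<^sup>2) + \<delta>\<^sup>2 * (s + 1)\<^sup>2 / 2"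
    proof -
      have "0 \<le> (\<bar>s - 1\<bar> / \<delta> - \<delta> * (s + 1))\<^sup>2" by simp
      also have "\<dots> = (s - 1)\<^sup>2 / \<delta>\<^sup>2 + \<delta>\<^sup>2 * (s + 1)\<^sup>2 - 2 * (\<bar>s - 1\<bar> * (s + 1))"
        using \<delta> by (simp add: power2_diff power_divide power_mult_distrib)
      finally show ?thesis by (simp add: field_simps)
    qed
    also have "\<dots> \<le> (u x - 1 - ln (u x)) / (2 * \<delta>\<^sup>2) + \<delta>\<^sup>2 * (2 * (u x + 1)) / 2"
      using a b \<delta>4 by (intro add_mono divide_right_mono mult_left_mono) auto
    also have "\<delta>\<^sup>2 * (2 * (u x + 1)) / 2 = \<delta>\<^sup>2 * (u x + 1)" by (simp only: mult.left_commute[of _ 2])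
    finally show ?case .
  qed
  show L1: "(LINT x|arcsine. \<bar>u x - 1\<bar>) \<le> 4 * \<delta>\<^sup>2"
  proof -
    have "(LINT x|arcsine. \<bar>u x - 1\<bar>) \<le> (LINT x|arcsine. (u x - 1 - ln (u x)) / (2 * \<delta>\<^sup>2) + \<delta>\<^sup>2 * (u x + 1))"
      by (rule integral_mono_AE[OF _ _ bound]) (use iu ilu in auto)
    also have "\<dots> = ((LINT x|arcsine. u x) - 1 - (LINT x|arcsine. ln (u x))) / (2 * \<delta>\<^sup>2) + \<delta>\<^sup>2 * ((LINT x|arcsine. u x) + 1)"
      using iu ilu by simp
    also have "\<dots> \<le> (2 * \<delta> ^ 4) / (2 * \<delta>\<^sup>2) + \<delta>\<^sup>2 * 3"
      using u1 lu1 \<delta>4 by (intro add_mono divide_right_mono mult_left_mono) auto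
    also have "(2 * \<delta> ^ 4) / (2 * \<delta>\<^sup>2) = \<delta>\<^sup>2" using \<delta> by (simp add: power_eq_if power2_eq_square)
    finally show ?thesis by simp
  qed
  show "(LINT x|arcsine. \<bar>ln (u x)\<bar>) \<le> 9 * \<delta>\<^sup>2"
  proof -
    have "(LINT x|arcsine. \<bar>ln (u x)\<bar>) \<le> (LINT x|arcsine. 2 * \<bar>u x - 1\<bar> - ln (u x))"
    proof (rule integral_mono_AE)
      \<comment> \<open>Where the logarithm is negative this is immediate; where it is positive,
        \<open>ln u \<le> u - 1\<close> is used twice.\<close>
      show "AE x in arcsine. \<bar>ln (u x)\<bar> \<le> 2 * \<bar>u x - 1\<bar> - ln (u x)"
        using upos
      proof eventually_elim
        case (elim x)
        then show ?case using ln_le_minus_one[of "u x"] by (auto simp: abs_if)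
      qed
    qed (use iu ilu in auto)
    also have "\<dots> = 2 * (LINT x|arcsine. \<bar>u x - 1\<bar>) - (LINT x|arcsine. ln (u x))"
      using iu ilu by (subst Bochner_Integration.integral_diff) auto
    finally show ?thesis using L1 lu1 \<delta>4 by linarith
  qed
  fix \<psi> :: "real \<Rightarrow> real" assume \<psi>: "\<psi> \<in> borel_measurable borel" "\<And>x. x \<in> {-1..1} \<Longrightarrow> \<bar>\<psi> x\<bar> \<le> 1"
  obtain X where X0: "X \<in> sets borel" "emeasure arcsine X = 0"
    "density \<nu> (indicator (- X)) = density arcsine (\<lambda>x. ennreal (ac_deriv \<nu> x))"
    by (rule lebesgue_decomposition[OF \<nu>])
  note X = X0(1,3)
  have \<psi>m: "(\<lambda>x. \<psi> x * exp (poly p x)) \<in> borel_measurable borel" using \<psi>(1) by measurable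
  have AE\<psi>: "AE x in L. \<bar>\<psi> x\<bar> \<le> 1" if "finite_measure_on_interval L" for L
    using AE_on_interval[OF that] by eventually_elim (rule \<psi>(2))
  have i\<psi>: "integrable \<nu> (\<lambda>x. \<psi> x * exp (poly p x))"
    by (rule Bochner_Integration.integrable_bound[OF iep])
      (use \<psi>m AE\<psi>[OF \<nu>] in \<open>auto simp: measurable_on_interval[OF \<nu>] abs_mult mult_left_le_one_le elim!: eventually_mono\<close>)
  have i\<psi>u: "integrable arcsine (\<lambda>x. \<psi> x * u x)"
    using integral_decomposition(1)[OF \<nu> X \<psi>m i\<psi>] by (simp add: u_def mult_ac)
  have i\<psi>a: "integrable arcsine \<psi>" by (rule integrable_arcsine_bounded[OF \<psi>(1), of 1]) (use \<psi>(2) in auto)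
  have iX: "integrable \<nu> (\<lambda>x. indicator X x * exp (poly p x))"
  proof (rule Bochner_Integration.integrable_bound[OF iep])
    show "(\<lambda>x. indicator X x * exp (poly p x)) \<in> borel_measurable \<nu>"
      unfolding measurable_on_interval[OF \<nu>] using X0(1) by measurable
  qed (auto simp: indicator_def)
  \<comment> \<open>The absolutely continuous part already takes at least
    \<open>1 - \<delta> ^ 4\<close> of the total \<open>1 + \<delta> ^ 4\<close>, by
    \<open>1 + ln u \<le> u\<close>.\<close>
  have mX: "(LINT x|\<nu>. indicator X x * exp (poly p x)) \<le> 2 * \<delta>\<^sup>2"
  proof -
    have "(LINT x|arcsine. 1 + ln (u x)) \<le> (LINT x|arcsine. u x)"
    proof (rule integral_mono_AE)
      show "AE x in arcsine. 1 + ln (u x) \<le> u x"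
        using upos
      proof eventually_elim
        case (elim x)
        then show ?case using ln_le_minus_one[of "u x"] by simp
      qed
    qed (use iu ilu in auto)
    then have "1 - \<delta> ^ 4 \<le> (LINT x|arcsine. u x)" using ilu lu1 by simp
    moreover have "(LINT x|\<nu>. exp (poly p x)) = (LINT x|arcsine. u x) + (LINT x|\<nu>. indicator X x * exp (poly p x))"
      unfolding u_def by (rule integral_decomposition(2)[OF \<nu> X ep iep])
    ultimately show ?thesis using 1 \<delta>4 by linarith
  qed
  have i3: "integrable \<nu> (\<lambda>x. indicator X x * (\<psi> x * exp (poly p x)))"
  proof (rule Bochner_Integration.integrable_bound[OF i\<psi>])
    show "(\<lambda>x. indicator X x * (\<psi> x * exp (poly p x))) \<in> borel_measurable \<nu>"
      unfolding measurable_on_interval[OF \<nu>] using X0(1) \<psi>(1) by measurable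
  qed (auto simp: indicator_def)
  have b1: "\<bar>LINT x|\<nu>. indicator X x * (\<psi> x * exp (poly p x))\<bar> \<le> 2 * \<delta>\<^sup>2"
  proof -
    have "\<bar>LINT x|\<nu>. indicator X x * (\<psi> x * exp (poly p x))\<bar> \<le> (LINT x|\<nu>. \<bar>indicator X x * (\<psi> x * exp (poly p x))\<bar>)"
      by (rule integral_abs_bound)
    also have "\<dots> \<le> (LINT x|\<nu>. indicator X x * exp (poly p x))"
    proof (rule integral_mono_AE)
      show "AE x in \<nu>. \<bar>indicator X x * (\<psi> x * exp (poly p x))\<bar> \<le> indicator X x * exp (poly p x)"
        using AE\<psi>[OF \<nu>] by eventually_elim (auto simp: indicator_def abs_mult mult_left_le_one_le)
    qed (use i3 iX in auto)
    finally show ?thesis using mX by simp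
  qed
  have b2: "\<bar>LINT x|arcsine. \<psi> x * (u x - 1)\<bar> \<le> 4 * \<delta>\<^sup>2"
  proof -
    have i: "integrable arcsine (\<lambda>x. \<psi> x * (u x - 1))" using i\<psi>u i\<psi>a by (simp add: right_diff_distrib)
    have "\<bar>LINT x|arcsine. \<psi> x * (u x - 1)\<bar> \<le> (LINT x|arcsine. \<bar>\<psi> x * (u x - 1)\<bar>)"
      by (rule integral_abs_bound)
    also have "\<dots> \<le> (LINT x|arcsine. \<bar>u x - 1\<bar>)"
    proof (rule integral_mono_AE)
      show "AE x in arcsine. \<bar>\<psi> x * (u x - 1)\<bar> \<le> \<bar>u x - 1\<bar>"
        using AE\<psi>[OF finite_measure_on_interval_arcsine] by eventually_elim (auto simp: abs_mult mult_left_le_one_le)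
    qed (use i iu in auto)
    finally show ?thesis using L1 by simp
  qed
  have "(LINT x|\<nu>. \<psi> x * exp (poly p x)) = (LINT x|arcsine. ac_deriv \<nu> x * (\<psi> x * exp (poly p x))) + (LINT x|\<nu>. indicator X x * (\<psi> x * exp (poly p x)))"
    by (rule integral_decomposition(2)[OF \<nu> X \<psi>m i\<psi>])
  also have "(LINT x|arcsine. ac_deriv \<nu> x * (\<psi> x * exp (poly p x))) = (LINT x|arcsine. \<psi> x * u x)"
    by (intro Bochner_Integration.integral_cong) (auto simp: u_def)
  also have "\<dots> = (LINT x|arcsine. \<psi> x * (u x - 1)) + (LINT x|arcsine. \<psi> x)"
    using i\<psi>u i\<psi>a by (simp add: right_diff_distrib)
  finally show "\<bar>(LINT x|\<nu>. \<psi> x * exp (poly p x)) - (LINT x|arcsine. \<psi> x)\<bar> \<le> 6 * \<delta>\<^sup>2"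
    using b1 b2 by linarith
qed

subsection \<open>Polynomials in the Joukowski variable\<close>

abbreviation joukowski :: "complex \<Rightarrow> complex" where
  "joukowski s \<equiv> (s + 1 / s) / 2"

lemma joukowski_ept: "joukowski (ept t) = of_real (ecos t)"
proof -
  have "ept t + 1 / ept t = of_real (2 * ecos t)"
    using complex_add_cnj[of "ept t"] by (simp add: cnj_ept)
  then show ?thesis by simp
qed

text \<open>\<open>C\<close> is twice the Chebyshev polynomial of the first kind, built by the
  three-term recurrence. For \<open>m = 0\<close> it is the constant 2, hence the restriction on the
  leading coefficient.\<close>

lemma chebyshev_exists:
  "\<exists>C :: complex poly. (\<forall>s. s \<noteq> 0 \<longrightarrow> poly C (joukowski s) = s ^ m + (1 / s) ^ m)
     \<and> degree C \<le> m \<and> (m > 0 \<longrightarrow> coeff C m = 2 ^ m)"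
proof (induction m rule: induct_nat_012)
  case 0
  show ?case by (intro exI[of _ "[:2:]"]) auto
next
  case 1
  show ?case by (intro exI[of _ "[:0, 2:]"]) (auto simp: field_simps)
next
  case (ge2 m)
  obtain A where A: "\<And>s. s \<noteq> 0 \<Longrightarrow> poly A (joukowski s) = s ^ m + (1 / s) ^ m" "degree A \<le> m"
    using ge2 by blast
  obtain B :: "complex poly" where B: "\<And>s. s \<noteq> 0 \<Longrightarrow> poly B (joukowski s) = s ^ Suc m + (1 / s) ^ Suc m"
      "degree B \<le> Suc m" "coeff B (Suc m) = 2 ^ Suc m"
    using ge2 by blast
  let ?C = "[:0, 2:] * B - A"
  have c0: "coeff A (Suc (Suc m)) = 0" using A(2) by (intro coeff_eq_0) simp
  have "poly ?C (joukowski s) = s ^ Suc (Suc m) + (1 / s) ^ Suc (Suc m)" if "s \<noteq> 0" for s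
  proof -
    have "poly ?C (joukowski s) = (s + 1 / s) * (s ^ Suc m + (1 / s) ^ Suc m) - (s ^ m + (1 / s) ^ m)"
      using A(1)[OF that] B(1)[OF that] by simp
    also have "\<dots> = s ^ Suc (Suc m) + (1 / s) ^ Suc (Suc m)"
    proof -
      define y where "y = 1 / s"
      have "s * y = 1" using that by (simp add: y_def)
      then have "s * y ^ Suc m = y ^ m" "y * s ^ Suc m = s ^ m"
        by (simp_all add: mult.commute flip: mult.assoc)
      then show ?thesis unfolding y_def[symmetric]
        by (simp only: distrib_right distrib_left power_Suc[of _ "Suc m"]) simp
    qed
    finally show ?thesis .
  qed
  moreover have "degree ?C \<le> Suc (Suc m)"
  proof (intro degree_diff_le)
    show "degree ([:0, 2:] * B) \<le> Suc (Suc m)"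
      using degree_mult_le[of "[:0, 2:]" B] B(2) by simp
  qed (use A(2) in simp)
  moreover have "coeff ?C (Suc (Suc m)) = 2 ^ Suc (Suc m)" using B(3) c0 by simp
  ultimately show ?case by blast
qed

text \<open>The right-hand side is a Laurent polynomial of order at most \<open>n\<close> invariant
  under \<open>s\<close> to \<open>1 / s\<close>, hence a combination of doubled Chebyshev
  polynomials in the Joukowski variable. It turns the remainder of the Blaschke division into a
  trial polynomial of the right degree.\<close>

lemma laurent_symmetrisation:
  fixes P :: "complex poly"
  assumes n: "n > 0" and P: "degree P < 2 * n"
  obtains q :: "complex poly" where "degree q \<le> n" "coeff q n = 2 ^ n * coeff P (2 * n - 1)"
    "\<And>s. s \<noteq> 0 \<Longrightarrow> poly q (joukowski s) = s ^ n * (1 / s) * poly P (1 / s) + (1 / s) ^ n * s * poly P s"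
proof -
  obtain C :: "nat \<Rightarrow> complex poly" where C: "\<And>m s. s \<noteq> 0 \<Longrightarrow> poly (C m) (joukowski s) = s ^ m + (1 / s) ^ m"
    "\<And>m. degree (C m) \<le> m" "\<And>m. m > 0 \<Longrightarrow> coeff (C m) m = 2 ^ m"
    using chebyshev_exists by metis
  \<comment> \<open>This is the distance between \<open>i + 1\<close> and \<open>n\<close>. Among
    the admissible \<open>i\<close> only \<open>2 * n - 1\<close> reaches the value
    \<open>n\<close>, so only that coefficient enters the leading term.\<close>
  define d where "d i = (if Suc i \<le> n then n - Suc i else Suc i - n)" for i
  define q where "q = (\<Sum>i<2*n. smult (coeff P i) (C (d i)))"
  have dn: "d i < n" if "i < 2 * n" "i \<noteq> 2 * n - 1" for i using that n by (auto simp: d_def)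
  have dl: "d (2 * n - 1) = n" using n by (auto simp: d_def)
  show thesis
  proof (rule that[of q])
    show "degree q \<le> n" unfolding q_def
    proof (rule degree_sum_le)
      fix i assume "i \<in> {..<2*n}"
      then have "d i \<le> n" using dn[of i] dl by (cases "i = 2 * n - 1") auto
      then show "degree (smult (coeff P i) (C (d i))) \<le> n"
        using degree_smult_le[of "coeff P i" "C (d i)"] C(2)[of "d i"] by linarith
    qed simp
    have "coeff q n = (\<Sum>i<2*n. coeff P i * coeff (C (d i)) n)" by (simp add: q_def coeff_sum)
    also have "\<dots> = (\<Sum>i<2*n. if i = 2 * n - 1 then coeff P (2 * n - 1) * 2 ^ n else 0)"
    proof (rule sum.cong[OF refl])
      fix i assume i: "i \<in> {..<2*n}"
      show "coeff P i * coeff (C (d i)) n = (if i = 2 * n - 1 then coeff P (2 * n - 1) * 2 ^ n else 0)"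
      proof (cases "i = 2 * n - 1")
        case False
        then have "degree (C (d i)) < n" using C(2)[of "d i"] dn[of i] i by simp
        then show ?thesis using False by (simp add: coeff_eq_0)
      qed (use C(3)[OF n] dl in simp)
    qed
    also have "\<dots> = 2 ^ n * coeff P (2 * n - 1)" using n by (simp add: mult.commute)
    finally show "coeff q n = 2 ^ n * coeff P (2 * n - 1)" .
    fix s :: complex assume s: "s \<noteq> 0"
    have Psum: "poly P y = (\<Sum>i<2*n. coeff P i * y ^ i)" for y
    proof -
      have "poly P y = (\<Sum>i\<le>degree P. coeff P i * y ^ i)" by (rule poly_altdef)
      also have "\<dots> = (\<Sum>i<2*n. coeff P i * y ^ i)"
        using P by (intro sum.mono_neutral_left) (auto simp: coeff_eq_0)
      finally show ?thesis .
    qed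
    have pow: "s ^ d i + (1 / s) ^ d i = s ^ n * (1 / s) ^ Suc i + (1 / s) ^ n * s ^ Suc i" for i
    proof -
      define y where "y = 1 / s"
      have sy: "s ^ k * y ^ k = 1" for k
        using s by (simp add: y_def flip: power_mult_distrib)
      show ?thesis
      proof (cases "Suc i \<le> n")
        case True
        then have n': "n = d i + Suc i" by (simp add: d_def)
        have "s ^ n * y ^ Suc i = s ^ d i * (s ^ Suc i * y ^ Suc i)"
          "y ^ n * s ^ Suc i = y ^ d i * (s ^ Suc i * y ^ Suc i)"
          by (simp_all only: arg_cong[OF n', of "\<lambda>k. _ ^ k"] power_add mult_ac)
        then show ?thesis unfolding y_def[symmetric] sy by simp
      next
        case False
        then have i': "Suc i = d i + n" by (simp add: d_def)
        have "s ^ n * y ^ Suc i = y ^ d i * (s ^ n * y ^ n)"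
          "y ^ n * s ^ Suc i = s ^ d i * (s ^ n * y ^ n)"
          by (simp_all only: i' power_add mult_ac)
        then show ?thesis unfolding y_def[symmetric] sy by simp
      qed
    qed
    have "poly q (joukowski s) = (\<Sum>i<2*n. coeff P i * (s ^ d i + (1 / s) ^ d i))"
      by (simp add: q_def poly_sum C(1)[OF s])
    also have "\<dots> = (\<Sum>i<2*n. s ^ n * (1 / s) * (coeff P i * (1 / s) ^ i) + (1 / s) ^ n * s * (coeff P i * s ^ i))"
      by (intro sum.cong refl) (simp only: pow power_Suc distrib_left mult_ac)
    also have "\<dots> = s ^ n * (1 / s) * poly P (1 / s) + (1 / s) ^ n * s * poly P s"
      unfolding Psum sum.distrib sum_distrib_left ..
    finally show "poly q (joukowski s) = s ^ n * (1 / s) * poly P (1 / s) + (1 / s) ^ n * s * poly P s" .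
  qed
qed

abbreviation cpoly :: "real poly \<Rightarrow> complex poly" where
  "cpoly p \<equiv> map_poly complex_of_real p"

lemma poly_cpoly_cnj: "poly (cpoly p) (cnj s) = cnj (poly (cpoly p) s)"
  by (induction p) (simp_all add: map_poly_pCons)

lemma poly_cpoly_of_real [simp]: "poly (cpoly p) (of_real x) = of_real (poly p x)"
  by (induction p) (simp_all add: map_poly_pCons)

text \<open>\<open>Q\<close> is the power-series part of a symmetric Laurent polynomial, with half
  the constant term. On the circle \<open>l\<close> is then twice the real part of \<open>Q\<close>,
  so \<open>exp Q\<close> is the outer function of the weight \<open>exp l\<close>.\<close>

lemma analytic_half_exists:
  "\<exists>Q :: real poly. \<forall>s. s \<noteq> 0 \<longrightarrow> poly (cpoly l) (joukowski s) = poly (cpoly Q) s + poly (cpoly Q) (1 / s)"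
proof (induction l)
  case 0
  show ?case by (intro exI[of _ 0]) simp
next
  case (pCons a l)
  then obtain Q where Q: "\<And>s. s \<noteq> 0 \<Longrightarrow> poly (cpoly l) (joukowski s) = poly (cpoly Q) s + poly (cpoly Q) (1 / s)"
    by blast
  obtain q0 Q1 where Q1: "Q = pCons q0 Q1" by (cases Q)
  \<comment> \<open>Multiplying \<open>Q(s)\<close> by \<open>1 / s\<close> leaves a pole
    \<open>q0 / s\<close>; it is charged to \<open>R(1 / s)\<close>, which is the origin of the term
    \<open>q0 / 2\<close> times \<open>s\<close>.\<close>
  define R where "R = [:a / 2, q0 / 2:] + smult (1/2) (pCons 0 Q) + smult (1/2) Q1"
  have R: "poly (cpoly R) s = of_real a / 2 + of_real q0 / 2 * s + s * poly (cpoly Q) s / 2 + poly (cpoly Q1) s / 2" for s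
  proof -
    have "cpoly R = [:of_real a / 2, of_real q0 / 2:] + smult (1/2) (pCons 0 (cpoly Q)) + smult (1/2) (cpoly Q1)"
      unfolding R_def by (intro poly_eqI) (auto simp: coeff_map_poly coeff_pCons split: nat.splits)
    then show ?thesis by (simp add: distrib_left add_divide_distrib)
  qed
  show ?case
  proof (intro exI[of _ R] allI impI)
    fix s :: complex assume s: "s \<noteq> 0"
    have Qs: "poly (cpoly Q) s = of_real q0 + s * poly (cpoly Q1) s"
      "poly (cpoly Q) (1 / s) = of_real q0 + 1 / s * poly (cpoly Q1) (1 / s)"
      by (simp_all add: Q1 map_poly_pCons)
    have "poly (cpoly (pCons a l)) (joukowski s) = of_real a + joukowski s * (poly (cpoly Q) s + poly (cpoly Q) (1 / s))"
      using Q[OF s] by (simp add: map_poly_pCons)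
    also have "\<dots> = poly (cpoly R) s + poly (cpoly R) (1 / s)"
      unfolding R Qs using s by (simp add: field_simps)
    finally show "poly (cpoly (pCons a l)) (joukowski s) = poly (cpoly R) s + poly (cpoly R) (1 / s)" .
  qed
qed

text \<open>\<open>s\<^sup>n p((s + 1/s) / 2)\<close>, written so that it also makes sense at \<open>s = 0\<close>.\<close>

definition lift_poly :: "complex poly \<Rightarrow> nat \<Rightarrow> complex \<Rightarrow> complex" where
  "lift_poly p n s = (\<Sum>k\<le>n. coeff p k * ((s\<^sup>2 + 1) / 2) ^ k * s ^ (n - k))"

lemma lift_poly_eq:
  assumes "s \<noteq> 0" "degree p \<le> n" shows "lift_poly p n s = s ^ n * poly p (joukowski s)"
proof -
  have "poly p (joukowski s) = (\<Sum>k\<le>degree p. coeff p k * joukowski s ^ k)" by (rule poly_altdef)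
  also have "\<dots> = (\<Sum>k\<le>n. coeff p k * joukowski s ^ k)"
    using assms(2) by (intro sum.mono_neutral_left) (auto simp: coeff_eq_0)
  finally have "s ^ n * poly p (joukowski s) = (\<Sum>k\<le>n. s ^ n * (coeff p k * joukowski s ^ k))"
    by (simp add: sum_distrib_left)
  also have "\<dots> = lift_poly p n s" unfolding lift_poly_def
  proof (rule sum.cong[OF refl])
    fix k assume "k \<in> {..n}"
    then have n: "s ^ n = s ^ k * s ^ (n - k)" by (simp flip: power_add)
    have "(s\<^sup>2 + 1) / 2 = s * joukowski s" using assms(1) by (simp add: power2_eq_square field_simps)
    then show "s ^ n * (coeff p k * joukowski s ^ k) = coeff p k * ((s\<^sup>2 + 1) / 2) ^ k * s ^ (n - k)"
      by (simp only: n power_mult_distrib mult_ac)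
  qed
  finally show ?thesis by simp
qed

lemma lift_poly_0: "lift_poly p n 0 = coeff p n / 2 ^ n"
proof -
  have "lift_poly p n 0 = (\<Sum>k\<le>n. if k = n then coeff p n * (1 / 2) ^ n else 0)"
    unfolding lift_poly_def by (intro sum.cong) auto
  then show ?thesis by (simp add: power_one_over field_simps)
qed

lemma lift_poly_holomorphic [holomorphic_intros]: "lift_poly p n holomorphic_on A"
  unfolding lift_poly_def by (intro holomorphic_intros) simp_all

subsection \<open>Division by a Blaschke product\<close>

text \<open>As in Schwarz's lemma: on the circle of radius \<rho> division by \<open>s\<close> costs
  exactly \<open>1 / \<rho>\<close>, and the maximum principle carries this inside.\<close>

lemma holomorphic_quotient_by_id_bound:
  assumes f: "f holomorphic_on ball 0 R" and g: "g holomorphic_on ball 0 R" and \<rho>: "0 < \<rho>" "\<rho> < R"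
    and eq: "\<And>s. s \<in> ball 0 R \<Longrightarrow> f s = s * g s" and b: "\<And>s. norm s \<le> \<rho> \<Longrightarrow> norm (f s) \<le> B"
    and s: "norm s \<le> \<rho>"
  shows "norm (g s) \<le> B / \<rho>"
proof (rule maximum_modulus_frontier[where S = "cball 0 \<rho>" and f = g and \<xi> = s])
  have sub: "ball 0 \<rho> \<subseteq> ball (0::complex) R" "cball 0 \<rho> \<subseteq> ball (0::complex) R" using \<rho> by auto
  show "g holomorphic_on interior (cball (0::complex) \<rho>)" using holomorphic_on_subset[OF g sub(1)] by simp
  show "continuous_on (closure (cball (0::complex) \<rho>)) g"
    using holomorphic_on_imp_continuous_on[OF holomorphic_on_subset[OF g sub(2)]] \<rho> by simp
  fix z :: complex assume "z \<in> frontier (cball 0 \<rho>)"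
  then have z: "norm z = \<rho>" using \<rho> by simp
  then have "norm (f z) = \<rho> * norm (g z)" using eq[of z] \<rho> by (simp add: norm_mult)
  then show "norm (g z) \<le> B / \<rho>" using b[of z] z \<rho> by (simp add: pos_le_divide_eq mult.commute)
qed (use s \<rho> in auto)

text \<open>Reduction of \<open>T(1/s) N(s)\<close> modulo \<open>D\<close>: the remainder \<open>P\<close> is the trial numerator, and the quotient \<open>R\<close>
  is small because the Blaschke product \<open>N / D\<close> is small near \<open>0\<close>. The constant \<open>C\<close> must not depend on the
  degree \<open>m\<close>.\<close>

lemma blaschke_division:
  fixes T :: "complex poly"
  shows "\<exists>C\<ge>0. \<forall>N D m \<eta>. m > 0 \<longrightarrow> degree N \<le> m \<longrightarrow> degree D \<le> m \<longrightarrow> poly D 0 = 1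
     \<longrightarrow> (\<forall>s. norm s < 1 \<longrightarrow> poly D s \<noteq> 0) \<longrightarrow> (\<forall>s. norm s \<le> 1/2 \<longrightarrow> norm (poly N s) \<le> \<eta> * norm (poly D s))
     \<longrightarrow> (\<exists>P R. degree P < m \<and> (\<forall>s. s \<noteq> 0 \<longrightarrow> poly T (1 / s) * poly N s = poly D s * poly R (1 / s) + s * poly P s)
          \<and> (\<forall>s. norm s \<le> 1 \<longrightarrow> norm (poly R s) \<le> C * \<eta>)
          \<and> (\<forall>s. norm s \<le> 1/2 \<longrightarrow> norm (poly P s) \<le> C * \<eta> * norm (poly D s)))"
proof (induction T)
  case 0
  show ?case by (intro exI[of _ 0]) (auto intro!: exI[of _ 0])
next
  case (pCons a T)
  then obtain C where C0: "C \<ge> 0" and C: "\<And>N D m \<eta>. m > 0 \<Longrightarrow> degree N \<le> m \<Longrightarrow> degree D \<le> m \<Longrightarrow> poly D 0 = 1 \<Longrightarrow>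
     (\<And>s. norm s < 1 \<Longrightarrow> poly D s \<noteq> 0) \<Longrightarrow> (\<And>s. norm s \<le> 1/2 \<Longrightarrow> norm (poly N s) \<le> \<eta> * norm (poly D s))
     \<Longrightarrow> \<exists>P R. degree P < m \<and> (\<forall>s. s \<noteq> 0 \<longrightarrow> poly T (1 / s) * poly N s = poly D s * poly R (1 / s) + s * poly P s)
          \<and> (\<forall>s. norm s \<le> 1 \<longrightarrow> norm (poly R s) \<le> C * \<eta>)
          \<and> (\<forall>s. norm s \<le> 1/2 \<longrightarrow> norm (poly P s) \<le> C * \<eta> * norm (poly D s))"
    by blast
  define C' where "C' = 4 * (norm a + C)"
  show ?case
  proof (intro exI[of _ C'] conjI allI impI)
    show "0 \<le> C'" using C0 by (simp add: C'_def)
    fix N D :: "complex poly" and m :: nat and \<eta> :: real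
    assume m: "m > 0" and dN: "degree N \<le> m" and dD: "degree D \<le> m" and D0: "poly D 0 = 1"
      and Dnz: "\<forall>s. norm s < 1 \<longrightarrow> poly D s \<noteq> 0" and ND: "\<forall>s. norm s \<le> 1/2 \<longrightarrow> norm (poly N s) \<le> \<eta> * norm (poly D s)"
    have \<eta>0: "0 \<le> \<eta>" using order_trans[OF norm_ge_zero ND[rule_format, of 0]] D0 by simp
    obtain P R where PR: "degree P < m" "\<And>s. s \<noteq> 0 \<Longrightarrow> poly T (1 / s) * poly N s = poly D s * poly R (1 / s) + s * poly P s"
      "\<And>s. norm s \<le> 1 \<Longrightarrow> norm (poly R s) \<le> C * \<eta>" "\<And>s. norm s \<le> 1/2 \<Longrightarrow> norm (poly P s) \<le> C * \<eta> * norm (poly D s)"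
      using C[OF m dN dD D0 Dnz[rule_format] ND[rule_format]] by blast
    \<comment> \<open>A new lowest coefficient \<open>a\<close> turns the old identity into
      \<open>a N + P\<close> plus \<open>D\<close> times a multiple of \<open>1 / s\<close>.
      Subtracting \<open>r D\<close>, with \<open>D(0) = 1\<close>, makes the rest divisible by
      \<open>s\<close>; \<open>r\<close> becomes the new constant term of the quotient.\<close>
    define r where "r = a * poly N 0 + poly P 0"
    define X where "X = smult a N + P - smult r D"
    have X0: "coeff X 0 = 0" using D0 by (simp add: X_def r_def poly_0_coeff_0)
    obtain P' where P': "X = pCons 0 P'" using X0 by (cases X) auto
    have dX: "degree X \<le> m" unfolding X_def using dN dD PR(1)
      by (intro degree_diff_le degree_add_le order_trans[OF degree_smult_le]) auto
    have dP': "degree P' < m"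
    proof (cases "P' = 0")
      case False
      then show ?thesis using dX P' by (simp add: degree_pCons_eq)
    qed (use m in simp)
    have r: "norm r \<le> (norm a + C) * \<eta>"
    proof -
      have "norm r \<le> norm a * norm (poly N 0) + norm (poly P 0)"
        unfolding r_def using norm_triangle_ineq[of "a * poly N 0" "poly P 0"] by (simp add: norm_mult)
      also have "\<dots> \<le> norm a * \<eta> + C * \<eta>"
        using ND[rule_format, of 0] PR(4)[of 0] D0 by (intro add_mono mult_left_mono) auto
      finally show ?thesis by (simp add: distrib_right)
    qed
    show "\<exists>P R. degree P < m \<and> (\<forall>s. s \<noteq> 0 \<longrightarrow> poly (pCons a T) (1 / s) * poly N s = poly D s * poly R (1 / s) + s * poly P s)
          \<and> (\<forall>s. norm s \<le> 1 \<longrightarrow> norm (poly R s) \<le> C' * \<eta>)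
          \<and> (\<forall>s. norm s \<le> 1/2 \<longrightarrow> norm (poly P s) \<le> C' * \<eta> * norm (poly D s))"
    proof (rule exI[of _ P'], rule exI[of _ "pCons r R"], intro conjI allI impI)
      show "degree P' < m" by (rule dP')
    next
      fix s :: complex assume s: "s \<noteq> 0"
      have "s * poly P' s = poly X s" by (simp add: P')
      then have "s * poly P' s = a * poly N s + poly P s - r * poly D s" by (simp add: X_def)
      moreover have "poly (pCons a T) (1 / s) * poly N s = a * poly N s + (1 / s) * (poly T (1 / s) * poly N s)"
        by (simp add: algebra_simps)
      moreover have "(1 / s) * (poly T (1 / s) * poly N s) = (1 / s) * (poly D s * poly R (1 / s)) + poly P s"
        unfolding PR(2)[OF s] using s by (simp add: distrib_left)
      ultimately show "poly (pCons a T) (1 / s) * poly N s = poly D s * poly (pCons r R) (1 / s) + s * poly P' s"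
        by (simp add: algebra_simps)
    next
      fix s :: complex assume s: "norm s \<le> 1"
      have "norm (poly (pCons r R) s) \<le> norm r + norm s * norm (poly R s)"
        using norm_triangle_ineq[of r "s * poly R s"] by (simp add: norm_mult)
      also have "norm s * norm (poly R s) \<le> 1 * (C * \<eta>)" using s PR(3)[OF s] C0 \<eta>0 by (intro mult_mono) auto
      finally have R: "norm (poly (pCons r R) s) \<le> norm r + 1 * (C * \<eta>)" by simp
      have "C * \<eta> \<le> (norm a + C) * \<eta>" using \<eta>0 by (intro mult_right_mono) auto
      with R r have "norm (poly (pCons r R) s) \<le> (norm a + C) * \<eta> + (norm a + C) * \<eta>" by linarith
      also have "\<dots> \<le> C' * \<eta>" unfolding C'_def using C0 \<eta>0 by (simp add: distrib_right)
      finally show "norm (poly (pCons r R) s) \<le> C' * \<eta>" .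
    next
      fix s :: complex assume s: "norm s \<le> 1/2"
      have bound: "norm (poly X z / poly D z) \<le> 2 * (norm a + C) * \<eta>" if z: "norm z \<le> 1/2" for z
      proof -
        have Dz: "poly D z \<noteq> 0" using Dnz z by auto
        have "norm (poly X z) \<le> norm a * norm (poly N z) + norm (poly P z) + norm r * norm (poly D z)"
          unfolding X_def using norm_triangle_ineq[of "a * poly N z" "poly P z"]
            norm_triangle_ineq4[of "a * poly N z + poly P z" "r * poly D z"] by (simp add: norm_mult)
        also have "\<dots> \<le> norm a * (\<eta> * norm (poly D z)) + C * \<eta> * norm (poly D z) + ((norm a + C) * \<eta>) * norm (poly D z)"
          using ND[rule_format, OF z] PR(4)[OF z] r by (intro add_mono mult_left_mono mult_right_mono) auto
        also have "\<dots> = 2 * (norm a + C) * \<eta> * norm (poly D z)" by (simp add: algebra_simps)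
        finally show ?thesis using Dz by (simp add: norm_divide pos_divide_le_eq)
      qed
      \<comment> \<open>Dividing by \<open>s\<close> on radius \<open>1/2\<close> doubles the bound;
        this and the estimate of \<open>r\<close> give the factor 4 in \<open>C'\<close>. Comparing
        with \<open>D\<close> instead of bounding \<open>D\<close> keeps the degree out of the
        constant.\<close>
      have "norm (poly P' s / poly D s) \<le> 2 * (norm a + C) * \<eta> / (1/2)"
      proof (rule holomorphic_quotient_by_id_bound[where f = "\<lambda>z. poly X z / poly D z" and g = "\<lambda>z. poly P' z / poly D z"
            and R = 1 and \<rho> = "1/2"])
        show "(\<lambda>z. poly X z / poly D z) holomorphic_on ball 0 1" "(\<lambda>z. poly P' z / poly D z) holomorphic_on ball 0 1"
          using Dnz by (intro holomorphic_intros; auto)+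
        show "poly X z / poly D z = z * (poly P' z / poly D z)" if "z \<in> ball 0 1" for z by (simp add: P')
        show "norm (poly X z / poly D z) \<le> 2 * (norm a + C) * \<eta>" if "norm z \<le> 1/2" for z
          by (rule bound[OF that])
      qed (use s in auto)
      moreover have "poly D s \<noteq> 0" using Dnz s by auto
      ultimately show "norm (poly P' s) \<le> C' * \<eta> * norm (poly D s)"
        unfolding C'_def by (simp add: norm_divide pos_divide_le_eq algebra_simps)
    qed
  qed
qed

subsection \<open>Conjugation-symmetric Blaschke products\<close>

definition nump :: "(nat \<Rightarrow> complex) \<Rightarrow> nat \<Rightarrow> complex poly" where
  "nump \<alpha> m = (\<Prod>j=1..m. [:- \<alpha> j, 1:])"

definition denp :: "(nat \<Rightarrow> complex) \<Rightarrow> nat \<Rightarrow> complex poly" where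
  "denp \<alpha> m = (\<Prod>j=1..m. [:1, - \<alpha> j:])"

lemma poly_nump: "poly (nump \<alpha> m) s = (\<Prod>j=1..m. s - \<alpha> j)"
  by (simp add: nump_def poly_prod)

lemma poly_denp: "poly (denp \<alpha> m) s = (\<Prod>j=1..m. 1 - \<alpha> j * s)"
  by (simp add: denp_def poly_prod mult.commute)

lemma degree_nump: "degree (nump \<alpha> m) \<le> m"
  using degree_prod_sum_le[of "{1..m}" "\<lambda>j. [:- \<alpha> j, 1:]"] by (simp add: nump_def)

lemma degree_denp: "degree (denp \<alpha> m) \<le> m"
proof -
  have "degree (denp \<alpha> m) \<le> (\<Sum>j=1..m. degree [:1, - \<alpha> j:])"
    unfolding denp_def by (rule degree_prod_sum_le[unfolded o_def]) simp
  also have "\<dots> \<le> (\<Sum>j=1..m. 1)" by (intro sum_mono) simp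
  finally show ?thesis by simp
qed

lemma nump_reflect: "s \<noteq> 0 \<Longrightarrow> poly (nump \<alpha> m) s = s ^ m * poly (denp \<alpha> m) (1 / s)"
proof -
  assume s: "s \<noteq> 0"
  have "(\<Prod>j=1..m. s - \<alpha> j) = (\<Prod>j=1..m. s * (1 - \<alpha> j * (1 / s)))"
    using s by (intro prod.cong) (auto simp: field_simps)
  also have "\<dots> = s ^ m * (\<Prod>j=1..m. 1 - \<alpha> j * (1 / s))" by (simp add: prod.distrib)
  finally show ?thesis by (simp add: poly_nump poly_denp)
qed

text \<open>From \<open>norm (1 - cnj \<alpha> * s)\<close> squared minus
  \<open>norm (s - \<alpha>)\<close> squared
  \<open>= (1 - norm s ^ 2) * (1 - norm \<alpha> ^ 2)\<close> and
  \<open>1 - x \<le> exp (- x)\<close>. The 8 is 4, bounding the squared denominator, times 2 from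
  the square root. In a product the exponents add up to the sum in hypothesis (D).\<close>

lemma blaschke_factor_bound:
  fixes s \<alpha> :: complex
  assumes "norm s \<le> 1" "norm \<alpha> < 1"
  shows "norm (s - \<alpha>) \<le> exp (- (1 - (norm s)\<^sup>2) / 8 * (1 - norm \<alpha>)) * norm (1 - cnj \<alpha> * s)"
proof -
  have id: "(norm (s - \<alpha>))\<^sup>2 = (norm (1 - cnj \<alpha> * s))\<^sup>2 - (1 - (norm s)\<^sup>2) * (1 - (norm \<alpha>)\<^sup>2)"
    unfolding cmod_power2 by (simp add: power2_eq_square algebra_simps)
  have le2: "norm (1 - cnj \<alpha> * s) \<le> 2"
  proof -
    have "norm \<alpha> * norm s \<le> 1 * 1" using assms by (intro mult_mono) auto
    then show ?thesis using norm_triangle_ineq4[of 1 "cnj \<alpha> * s"] by (simp add: norm_mult)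
  qed
  define A where "A = 1 - (norm s)\<^sup>2"
  have A: "0 \<le> A" using assms by (simp add: A_def power_le_one)
  have B: "1 - norm \<alpha> \<le> 1 - (norm \<alpha>)\<^sup>2" using assms by (simp add: power2_eq_square mult_left_le)
  have n4: "(norm (1 - cnj \<alpha> * s))\<^sup>2 \<le> 4" using le2 power_mono[OF le2, of 2] by simp
  have "A * (1 - norm \<alpha>) * ((norm (1 - cnj \<alpha> * s))\<^sup>2 / 4) \<le> A * (1 - norm \<alpha>) * 1"
    using A assms n4 by (intro mult_left_mono) auto
  also have "\<dots> \<le> A * (1 - (norm \<alpha>)\<^sup>2)" using A B by (simp add: mult_left_mono)
  finally have "(norm (s - \<alpha>))\<^sup>2 \<le> (norm (1 - cnj \<alpha> * s))\<^sup>2 * (1 - A * (1 - norm \<alpha>) / 4)"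
    unfolding id A_def[symmetric] by (simp add: algebra_simps)
  also have "\<dots> \<le> (norm (1 - cnj \<alpha> * s))\<^sup>2 * exp (- (A * (1 - norm \<alpha>) / 4))"
    using exp_ge_add_one_self[of "- (A * (1 - norm \<alpha>) / 4)"] by (intro mult_left_mono) auto
  also have "exp (- (A * (1 - norm \<alpha>) / 4)) = (exp (- A / 8 * (1 - norm \<alpha>)))\<^sup>2"
    by (simp flip: exp_double)
  finally have "(norm (s - \<alpha>))\<^sup>2 \<le> (exp (- A / 8 * (1 - norm \<alpha>)) * norm (1 - cnj \<alpha> * s))\<^sup>2"
    by (simp add: power_mult_distrib mult.commute)
  then show ?thesis unfolding A_def by (rule power2_le_imp_le) simp
qed

text \<open>Symmetry as an equality of multisets allows repeated nodes and is exactly what makes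
  every product over the nodes invariant under conjugation.\<close>

locale conj_nodes =
  fixes \<alpha> :: "nat \<Rightarrow> complex" and m :: nat
  assumes norm_node: "\<And>j. j \<in> {1..m} \<Longrightarrow> norm (\<alpha> j) < 1"
    and symmetric: "image_mset (\<lambda>j. cnj (\<alpha> j)) (mset_set {1..m}) = image_mset \<alpha> (mset_set {1..m})"
begin

abbreviation N :: "complex \<Rightarrow> complex" where "N \<equiv> poly (nump \<alpha> m)"
abbreviation D :: "complex \<Rightarrow> complex" where "D \<equiv> poly (denp \<alpha> m)"

text \<open>The constant of proportionality between the squared modulus of \<open>D\<close> on the
  circle and the denominator of the weight: the point \<open>\<i>\<close> lies over
  \<open>x = 0\<close>, where that denominator equals 1.\<close>

definition cc :: real where "cc = (norm (D \<i>))\<^sup>2"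

lemma prod_cnj_nodes: "(\<Prod>j=1..m. f (cnj (\<alpha> j))) = (\<Prod>j=1..m. f (\<alpha> j) :: complex)"
proof -
  have "(\<Prod>j=1..m. f (cnj (\<alpha> j))) = prod_mset (image_mset f (image_mset (\<lambda>j. cnj (\<alpha> j)) (mset_set {1..m})))"
    by (simp add: prod_unfold_prod_mset image_mset.compositionality o_def)
  also have "\<dots> = (\<Prod>j=1..m. f (\<alpha> j))"
    unfolding symmetric by (simp add: prod_unfold_prod_mset image_mset.compositionality o_def)
  finally show ?thesis .
qed

lemma D_cnj: "D (cnj s) = cnj (D s)"
proof -
  have "cnj (D s) = (\<Prod>j=1..m. 1 - cnj (\<alpha> j) * cnj s)" by (simp add: poly_denp)
  also have "\<dots> = D (cnj s)" unfolding poly_denp by (rule prod_cnj_nodes[of "\<lambda>a. 1 - a * cnj s"])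
  finally show ?thesis by simp
qed

lemma N_cnj: "N (cnj s) = cnj (N s)"
proof -
  have "cnj (N s) = (\<Prod>j=1..m. cnj s - cnj (\<alpha> j))" by (simp add: poly_nump)
  also have "\<dots> = N (cnj s)" unfolding poly_nump by (rule prod_cnj_nodes[of "\<lambda>a. cnj s - a"])
  finally show ?thesis by simp
qed

lemma D_alt: "D s = (\<Prod>j=1..m. 1 - cnj (\<alpha> j) * s)"
  unfolding poly_denp by (rule prod_cnj_nodes[of "\<lambda>a. 1 - a * s", symmetric])

lemma D_0 [simp]: "D 0 = 1"
  by (simp add: poly_denp)

lemma D_nonzero: "norm s \<le> 1 \<Longrightarrow> D s \<noteq> 0"
proof -
  assume s: "norm s \<le> 1"
  have "1 - \<alpha> j * s \<noteq> 0" if "j \<in> {1..m}" for j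
  proof
    assume "1 - \<alpha> j * s = 0"
    then have "norm (\<alpha> j) * norm s = 1" by (metis eq_iff_diff_eq_0 norm_mult norm_one)
    moreover have "norm (\<alpha> j) * norm s \<le> norm (\<alpha> j)" using s by (simp add: mult_left_le)
    ultimately show False using norm_node[OF that] by simp
  qed
  then show ?thesis by (simp add: poly_denp)
qed

text \<open>Room beyond the unit circle, so that the functions divided by \<open>D\<close> are
  holomorphic on a neighbourhood of the closed disc.\<close>

lemma D_nonzero_ball: obtains R where "R > 1" "\<And>s. s \<in> ball 0 R \<Longrightarrow> D s \<noteq> 0"
proof -
  \<comment> \<open>The extra \<open>1/2\<close> keeps \<open>M\<close> positive when there are no
    nodes or all of them are 0.\<close>
  define M where "M = Max (insert (1/2) ((\<lambda>j. norm (\<alpha> j)) ` {1..m}))"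
  have M: "1/2 \<le> M" "M < 1" "\<And>j. j \<in> {1..m} \<Longrightarrow> norm (\<alpha> j) \<le> M"
  proof -
    show "1/2 \<le> M" unfolding M_def by (intro Max_ge) auto
    show "M < 1" unfolding M_def using norm_node by (subst Max_less_iff) auto
    show "norm (\<alpha> j) \<le> M" if "j \<in> {1..m}" for j unfolding M_def using that by (intro Max_ge) auto
  qed
  show thesis
  proof (rule that[of "1 / M"])
    show "1 / M > 1" using M by simp
    fix s :: complex assume s: "s \<in> ball 0 (1 / M)"
    have "1 - \<alpha> j * s \<noteq> 0" if "j \<in> {1..m}" for j
    proof
      assume "1 - \<alpha> j * s = 0"
      then have "norm (\<alpha> j) * norm s = 1" by (metis eq_iff_diff_eq_0 norm_mult norm_one)
      moreover have "norm (\<alpha> j) * norm s \<le> M * norm s" using M(3)[OF that] by (intro mult_right_mono) auto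
      moreover have "M * norm s < M * (1 / M)" using s M by (intro mult_strict_left_mono) auto
      ultimately show False using M by simp
    qed
    then show "D s \<noteq> 0" by (simp add: poly_denp)
  qed
qed

lemma N_le_D:
  assumes "norm s \<le> 1"
  shows "norm (N s) \<le> exp (- (1 - (norm s)\<^sup>2) / 8 * (\<Sum>j=1..m. 1 - norm (\<alpha> j))) * norm (D s)"
proof -
  have "norm (N s) = (\<Prod>j=1..m. norm (s - \<alpha> j))" by (simp add: poly_nump prod_norm)
  also have "\<dots> \<le> (\<Prod>j=1..m. exp (- (1 - (norm s)\<^sup>2) / 8 * (1 - norm (\<alpha> j))) * norm (1 - cnj (\<alpha> j) * s))"
    by (intro prod_mono conjI blaschke_factor_bound assms norm_node) auto
  also have "\<dots> = exp (- (1 - (norm s)\<^sup>2) / 8 * (\<Sum>j=1..m. 1 - norm (\<alpha> j))) * norm (D s)"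
    unfolding D_alt prod.distrib by (simp only: exp_sum[symmetric] finite_atLeastAtMost sum_distrib_left prod_norm)
  finally show ?thesis .
qed

lemma N_le_D': "norm s \<le> 1 \<Longrightarrow> norm (N s) \<le> norm (D s)"
proof -
  assume s: "norm s \<le> 1"
  have "0 \<le> (\<Sum>j=1..m. 1 - norm (\<alpha> j))" using norm_node by (intro sum_nonneg) (simp add: less_imp_le)
  moreover have "- (1 - (norm s)\<^sup>2) / 8 \<le> 0" using s by (simp add: power_le_one)
  ultimately have "exp (- (1 - (norm s)\<^sup>2) / 8 * (\<Sum>j=1..m. 1 - norm (\<alpha> j))) \<le> 1"
    by (simp only: exp_le_one_iff mult_nonpos_nonneg)
  then have "exp (- (1 - (norm s)\<^sup>2) / 8 * (\<Sum>j=1..m. 1 - norm (\<alpha> j))) * norm (D s) \<le> 1 * norm (D s)"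
    by (intro mult_right_mono) auto
  then show ?thesis using N_le_D[OF s] by simp
qed

lemma N_circle: "N (ept t) = ept t ^ m * cnj (D (ept t))"
  using nump_reflect[of "ept t" \<alpha> m] D_cnj[of "ept t"] by (simp add: cnj_ept)

lemma norm_N_circle: "norm (N (ept t)) = norm (D (ept t))"
  by (simp add: N_circle norm_mult norm_power)

lemma cc_pos: "cc > 0"
  using D_nonzero[of \<i>] by (simp add: cc_def)

lemma cc_eq: "of_real cc = (\<Prod>j=1..m. 1 + (\<alpha> j)\<^sup>2)"
proof -
  have "of_real cc = D \<i> * cnj (D \<i>)" unfolding cc_def by (rule complex_norm_square)
  also have "\<dots> = D \<i> * D (- \<i>)" using D_cnj[of \<i>] by simp
  also have "\<dots> = (\<Prod>j=1..m. (1 - \<alpha> j * \<i>) * (1 - \<alpha> j * (- \<i>)))"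
    unfolding poly_denp by (simp add: prod.distrib)
  also have "\<dots> = (\<Prod>j=1..m. 1 + (\<alpha> j)\<^sup>2)"
    by (intro prod.cong refl) (simp add: algebra_simps power2_eq_square)
  finally show ?thesis .
qed

end

subsection \<open>The map \<open>\<phi>\<close>\<close>

lemma joukowski_inj:
  assumes "s \<noteq> 0" "t \<noteq> 0" "norm s < 1" "norm t < 1" "joukowski s = joukowski t"
  shows "s = t"
proof -
  have "s + 1 / s = t + 1 / t" using assms(5) by (simp only: divide_cancel_right) simp
  then have "(s - t) * (s * t - 1) = 0" using assms(1,2) by (simp add: field_simps)
  moreover have "s * t \<noteq> 1"
  proof
    assume "s * t = 1"
    then have "norm s * norm t = 1" by (metis norm_mult norm_one)
    moreover have "norm s * norm t \<le> norm s" using assms by (simp add: mult_left_le)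
    ultimately show False using assms by simp
  qed
  ultimately show ?thesis by simp
qed

lemma phi_Some:
  assumes z: "z \<notin> slit"
  shows "phi (Some z) \<noteq> 0" "norm (phi (Some z)) < 1" "z = joukowski (phi (Some z))"
    "w z = (1 / phi (Some z) - phi (Some z)) / 2"
proof -
  define s where "s = phi (Some z)"
  have sw: "(z - w z) * (z + w z) = 1"
    using w_square[OF z] by (simp add: power2_eq_square algebra_simps)
  have s_eq: "s = z - w z" by (simp add: s_def)
  have "s \<noteq> 0" using sw s_eq by auto
  then show s0: "phi (Some z) \<noteq> 0" unfolding s_def .
  have inv: "1 / s = z + w z" using sw \<open>s \<noteq> 0\<close> unfolding s_eq by (simp add: field_simps)
  have zj: "z = joukowski s" unfolding inv by (simp add: s_eq)
  then show "z = joukowski (phi (Some z))" by (simp only: s_def)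
  have "w z = (1 / s - s) / 2" unfolding inv by (simp add: s_eq)
  then show "w z = (1 / phi (Some z) - phi (Some z)) / 2" by (simp only: s_def)
  \<comment> \<open>\<open>csqrt\<close> has non-negative real part, so \<open>1 - c\<close> is no
    larger than \<open>1 + c\<close>. As \<open>z - w\<close> and \<open>z + w\<close> have product
    1, the smaller one lies in the closed disc.\<close>
  have "norm s \<le> norm (z + w z)"
  proof -
    define c where "c = csqrt (1 - 1 / z\<^sup>2)"
    have c: "0 \<le> Re c" unfolding c_def by (rule Re_csqrt)
    have "w z = z * c" by (simp add: w_def c_def)
    then have "norm s = norm z * norm (1 - c)" "norm (z + w z) = norm z * norm (1 + c)"
      unfolding s_eq by (simp_all add: right_diff_distrib distrib_left flip: norm_mult)
    moreover have "norm (1 - c) \<le> norm (1 + c)"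
      unfolding cmod_def using c by (intro real_sqrt_le_mono) (simp add: power2_eq_square algebra_simps)
    ultimately show ?thesis by (simp add: mult_left_mono)
  qed
  then have "norm s * norm s \<le> norm s * norm (z + w z)" by (intro mult_left_mono) auto
  also have "\<dots> = 1" using sw unfolding s_eq by (metis norm_mult norm_one)
  finally have "(norm s)\<^sup>2 \<le> 1\<^sup>2" by (simp add: power2_eq_square)
  then have le: "norm s \<le> 1" by (rule power2_le_imp_le) simp
  \<comment> \<open>On the circle \<open>1 / s\<close> is the conjugate of \<open>s\<close>, which
    would put \<open>z\<close> on the slit.\<close>
  moreover have "norm s \<noteq> 1"
  proof
    assume 1: "norm s = 1"
    then have "1 / s = cnj s" using complex_div_cnj[of 1 s] by simp
    then have "z = (s + cnj s) / 2" using zj by simp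
    then have "z = of_real (Re s)" using complex_add_cnj[of s] by simp
    moreover have "Re s \<in> {-1..1}" using abs_Re_le_cmod[of s] 1 by auto
    ultimately show False using z by (auto simp: slit_def)
  qed
  ultimately have "norm s < 1" by simp
  then show "norm (phi (Some z)) < 1" by (simp only: s_def)
qed

lemma norm_phi: "p \<notin> Some ` slit \<Longrightarrow> norm (phi p) < 1"
proof (cases p)
  case (Some z)
  moreover assume "p \<notin> Some ` slit"
  ultimately have "z \<notin> slit" by auto
  from phi_Some(2)[OF this] Some show ?thesis by (simp only:)
qed simp

lemma cnj_slit: "cnj z \<in> slit \<longleftrightarrow> z \<in> slit"
proof -
  have "cnj z \<in> slit" if "z \<in> slit" for z using that by (auto simp: slit_def)
  from this[of z] this[of "cnj z"] show ?thesis by auto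
qed

lemma phi_cnj:
  assumes "p \<notin> Some ` slit" shows "phi (map_option cnj p) = cnj (phi p)"
proof (cases p)
  case (Some z)
  then have z: "z \<notin> slit" "cnj z \<notin> slit" using assms cnj_slit by auto
  define s t where "s = phi (Some z)" and "t = phi (Some (cnj z))"
  have s: "s \<noteq> 0" "norm s < 1" "z = joukowski s" unfolding s_def by (rule phi_Some[OF z(1)])+
  have t: "t \<noteq> 0" "norm t < 1" "cnj z = joukowski t" unfolding t_def by (rule phi_Some[OF z(2)])+
  have e: "joukowski t = joukowski (cnj s)" unfolding t(3)[symmetric] by (subst s(3)) simp
  have "t = cnj s" by (rule joukowski_inj[OF t(1) _ t(2) _ e]) (use s(1,2) in simp_all)
  then have "phi (Some (cnj z)) = cnj (phi (Some z))" by (simp only: s_def t_def)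
  then show ?thesis using Some by simp
qed simp

lemma pk_phi:
  assumes "z \<notin> slit" shows "w z / (z - of_real x) = pk (phi (Some z)) x"
proof -
  define s where "s = phi (Some z)"
  have s: "s \<noteq> 0" "z = joukowski s" "w z = (1 / s - s) / 2"
    unfolding s_def by (rule phi_Some[OF assms])+
  have "w z = (1 - s\<^sup>2) / (2 * s)" unfolding s(3) using s(1) by (simp add: field_simps power2_eq_square)
  moreover have "z - of_real x = (1 + s\<^sup>2 - 2 * s * of_real x) / (2 * s)"
    by (subst s(2)) (use s(1) in \<open>simp add: field_simps power2_eq_square\<close>)
  ultimately show ?thesis unfolding s_def[symmetric] pk_def using s(1) by simp
qed

text \<open>One formula covers finite points and infinity, because the kernel at
  \<open>phi None = 0\<close> is identically 1.\<close>

lemma szego_pk: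
  assumes "p \<notin> Some ` slit"
  shows "szego \<nu> p = exp ((LINT x|arcsine. pk (phi p) x * of_real (ln (ac_deriv \<nu> x))) / 2)"
proof (cases p)
  case None
  then show ?thesis by (simp add: integral_complex_of_real)
next
  case (Some z)
  then have z: "z \<notin> slit" using assms by auto
  have "w z / 2 * (LINT x|arcsine. of_real (ln (ac_deriv \<nu> x)) / (z - of_real x))
     = (LINT x|arcsine. w z * (of_real (ln (ac_deriv \<nu> x)) / (z - of_real x))) / 2"
    by (subst integral_mult_right_zero) simp
  also have "(LINT x|arcsine. w z * (of_real (ln (ac_deriv \<nu> x)) / (z - of_real x)))
     = (LINT x|arcsine. pk (phi (Some z)) x * of_real (ln (ac_deriv \<nu> x)))"
    by (intro Bochner_Integration.integral_cong refl) (simp add: pk_phi[OF z, symmetric] del: phi.simps(2))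
  finally show ?thesis using Some by simp
qed

lemma phi_continuous: "continuous_on (- slit) (\<lambda>z. phi (Some z))"
  using holomorphic_on_imp_continuous_on[OF w_holomorphic] by (auto intro!: continuous_intros)

lemma compact_slit: "compact slit"
  unfolding slit_def by (intro compact_continuous_image continuous_intros) auto

lemma open_Compl_slit: "open (- slit)"
  using compact_imp_closed[OF compact_slit] by auto

lemma phi_at_infinity: "((\<lambda>z. phi (Some z)) \<longlongrightarrow> 0) at_infinity"
  using tendsto_minus[OF w_at_infinity] by simp

text \<open>The level sets of the modulus of \<open>phi\<close>, together with infinity, form an
  increasing open cover of the sphere without the slit. Openness at infinity needs bounded
  complements, which holds because \<open>phi\<close> tends to 0 there.\<close>

lemma phi_compact_bound:
  assumes Z: "compactin csphere Z" "Z \<inter> Some ` slit = {}"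
  obtains r where "0 \<le> r" "r < 1" "\<And>p. p \<in> Z \<Longrightarrow> norm (phi p) \<le> r"
proof -
  define q where "q k = 1 - 1 / real (Suc (Suc k))" for k
  have q: "0 < q k" "q k < 1" for k by (auto simp: q_def)
  have qm: "q i \<le> q j" if "i \<le> j" for i j using that by (auto simp: q_def frac_le)
  define C where "C k = slit \<union> {z. q k \<le> norm (phi (Some z))}" for k
  define U where "U k = insert None (Some ` (- C k))" for k
  have "openin csphere (U k)" for k
  proof -
    have "open (- slit \<inter> (\<lambda>z. norm (phi (Some z))) -` {..<q k})"
      by (rule continuous_open_preimage[OF continuous_on_norm[OF phi_continuous] open_Compl_slit open_lessThan])
    moreover have "- slit \<inter> (\<lambda>z. norm (phi (Some z))) -` {..<q k} = - C k"
      by (auto simp: C_def simp del: phi.simps(2))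
    ultimately have cl: "closed (C k)" by (simp add: closed_def)
    have "\<forall>\<^sub>F z in at_infinity. norm (phi (Some z)) < q k"
      using order_tendstoD(2)[OF tendsto_norm_zero[OF phi_at_infinity] q(1)] .
    then obtain b where b: "\<And>z. norm z \<ge> b \<Longrightarrow> norm (phi (Some z)) < q k"
      by (auto simp: eventually_at_infinity simp del: phi.simps(2))
    obtain B where B: "\<And>z. z \<in> slit \<Longrightarrow> norm z \<le> B"
      using compact_imp_bounded[OF compact_slit] by (auto simp: bounded_iff)
    have "norm z \<le> max b B" if "z \<in> C k" for z
      using that b[of z] B[of z] by (force simp: C_def simp del: phi.simps(2))
    then have "bounded (C k)" by (auto simp: bounded_iff)
    with cl have "compact (C k)" by (simp add: compact_eq_bounded_closed)
    then show ?thesis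
      unfolding openin_Alexandroff_compactification U_def
      by (intro disjI2 exI[of _ "C k"]) (auto simp: cl Compl_eq_Diff_UNIV)
  qed
  moreover have "Z \<subseteq> \<Union>(range U)"
  proof
    fix p assume p: "p \<in> Z"
    show "p \<in> \<Union>(range U)"
    proof (cases p)
      case (Some z)
      then have z: "z \<notin> slit" using p Z by auto
      have "0 < 1 - norm (phi (Some z))" using phi_Some(2)[OF z] by (simp del: phi.simps(2))
      then obtain k where "inverse (real (Suc k)) < 1 - norm (phi (Some z))" using reals_Archimedean by blast
      moreover have "1 / real (Suc (Suc k)) \<le> inverse (real (Suc k))" by (simp add: field_simps)
      ultimately have "norm (phi (Some z)) < q k" by (simp add: q_def del: phi.simps(2))
      then have "p \<in> U k" using z Some by (auto simp: U_def C_def simp del: phi.simps(2))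
      then show ?thesis by blast
    qed (auto simp: U_def)
  qed
  ultimately obtain F where F: "finite F" "F \<subseteq> range U" "Z \<subseteq> \<Union>F"
    using Z(1)[unfolded compactin_def, THEN conjunct2, rule_format, of "range U"] by blast
  obtain I where I: "finite I" "F = U ` I" using finite_subset_image[OF F(1,2)] by blast
  obtain M where M: "\<And>i. i \<in> I \<Longrightarrow> i \<le> M" using I(1) unfolding finite_nat_set_iff_bounded_le by auto
  show thesis
  proof (rule that[of "q M"])
    fix p assume "p \<in> Z"
    then obtain i where i: "i \<in> I" "p \<in> U i" using F(3) I(2) by blast
    show "norm (phi p) \<le> q M"
      using i(2) qm[OF M[OF i(1)]] q(1)[of M] by (auto simp: U_def C_def simp del: phi.simps(2))
  qed (use q[of M] in auto)
qed

subsection \<open>Rigidity on the circle\<close>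

lemma two_mult_le_weighted:
  fixes a b c :: real
  assumes "c > 0" shows "2 * (a * b) \<le> c * a\<^sup>2 + b\<^sup>2 / c"
proof -
  have "0 \<le> (c * a - b)\<^sup>2 / c" using assms by simp
  also have "\<dots> = c * a\<^sup>2 + b\<^sup>2 / c - 2 * (a * b)"
    using assms by (simp add: power2_diff power_mult_distrib field_simps) (simp add: power2_eq_square)
  finally show ?thesis by simp
qed

lemma le_weighted:
  fixes b c :: real
  assumes "c > 0" shows "b \<le> c / 2 + b\<^sup>2 / (2 * c)"
proof -
  have "2 * (1 * b) \<le> c * 1\<^sup>2 + b\<^sup>2 / c" by (rule two_mult_le_weighted[OF assms])
  then show ?thesis by (simp add: field_simps)
qed

lemma norm_diff_square_complex:
  fixes a b :: complex
  shows "(norm (a - b))\<^sup>2 = (norm a)\<^sup>2 + (norm b)\<^sup>2 - 2 * Re (a * cnj b)"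
  unfolding cmod_power2 by (simp add: power2_eq_square algebra_simps)

text \<open>The quotient is the discrepancy between \<open>f g cnj U\<close> and the conjugate of
  \<open>f g\<close>. When \<open>g\<close> is close to 0 the trivial bound 2 suffices, since then
  \<open>g\<close> is at distance more than \<open>1/2\<close> from 1.\<close>

lemma norm_quotient_cnj_le:
  fixes g :: complex
  assumes "g \<noteq> 0" shows "norm (g / cnj g - 1) \<le> 4 * norm (g - 1)"
proof (cases "norm g \<ge> 1/2")
  case True
  have "norm (g / cnj g - 1) = norm (g - cnj g) / norm g"
  proof -
    have "g / cnj g - 1 = (g - cnj g) / cnj g" using assms by (simp add: diff_divide_distrib)
    then show ?thesis by (simp add: norm_divide)
  qed
  also have "norm (g - cnj g) \<le> 2 * norm (g - 1)"
  proof -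
    have "g - cnj g = (g - 1) - cnj (g - 1)" by simp
    then show ?thesis using norm_triangle_ineq4[of "g - 1" "cnj (g - 1)"] by (simp only: complex_mod_cnj)
  qed
  also have "2 * norm (g - 1) / norm g \<le> 2 * norm (g - 1) / (1/2)" using True by (intro divide_left_mono) auto
  finally show ?thesis using True by (simp add: divide_right_mono)
next
  case False
  have "norm (g / cnj g - 1) \<le> norm (g / cnj g) + 1" using norm_triangle_ineq4[of "g / cnj g" 1] by simp
  also have "\<dots> = 2" using assms by (simp add: norm_divide)
  also have "\<dots> \<le> 4 * norm (g - 1)" using False norm_triangle_ineq2[of 1 g] by (simp add: norm_minus_commute)
  finally show ?thesis .
qed

lemma continuous_on_ept_compose:
  assumes "f holomorphic_on ball 0 R" "R > 1"
  shows "continuous_on A (\<lambda>t. f (ept t))"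
  by (rule continuous_on_compose2[OF holomorphic_on_imp_continuous_on[OF assms(1)] continuous_on_ept])
    (use assms(2) in auto)

lemma integrable_circ_holomorphic:
  assumes "f holomorphic_on ball 0 R" "R > 1"
  shows "integrable circ (\<lambda>t. f (ept t))" "integrable circ (\<lambda>t. (norm (f (ept t)))\<^sup>2)"
    "integrable circ (\<lambda>t. Re (f (ept t)))"
  by (intro integrable_circ_continuous continuous_intros continuous_on_ept_compose[OF assms])+

text \<open>The relation \<open>f = cnj f \<cdot> U\<close> gives \<open>\<integral> f g cnj U \<approx> \<integral> cnj (f g)\<close>, so every term of the expansion of
  \<open>\<integral> |f g - 1 - U|\<^sup>2\<close> is controlled by the values at \<open>0\<close> and by \<open>\<integral> U\<close>.\<close>

lemma circle_rigidity:
  fixes f g U :: "complex \<Rightarrow> complex"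
  assumes f: "f holomorphic_on ball 0 R" and g: "g holomorphic_on ball 0 R" and R: "R > 1"
    and \<delta>: "0 < \<delta>" "\<delta> \<le> 1"
    and U: "continuous_on {0..1} (\<lambda>t. U (ept t))" "\<And>t. norm (U (ept t)) = 1"
    and fU: "\<And>t. f (ept t) = cnj (f (ept t)) * U (ept t)" and g0: "\<And>t. g (ept t) \<noteq> 0"
    and fg: "(LINT t|circ. (norm (f (ept t) * g (ept t)))\<^sup>2) \<le> 2 + \<delta> ^ 4"
    and gg: "(LINT t|circ. (norm (g (ept t)))\<^sup>2) \<le> 1 + 2 * \<delta> ^ 4"
    and Reg: "Re (g 0) \<ge> 1 - \<delta> ^ 4" and Refg: "Re (f 0 * g 0) \<ge> 1 - 6 * \<delta>\<^sup>2"
    and U0: "norm (LINT t|circ. U (ept t)) \<le> \<delta>\<^sup>2"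
    and s: "norm s \<le> r" "r < 1" and small: "8 * \<delta>\<^sup>2 \<le> (1 - r)\<^sup>2"
    and Us: "norm (LINT t|circ. U (ept t) * pk s (ecos t)) \<le> \<delta>"
  shows "norm (f s - 1) \<le> 42 * \<delta> / (1 - r)\<^sup>2"
proof -
  define k where "k = (\<lambda>z. f z * g z)"
  have k: "k holomorphic_on ball 0 R" unfolding k_def by (intro holomorphic_intros f g)
  have \<delta>4: "0 < \<delta> ^ 4" "\<delta> ^ 4 \<le> \<delta>\<^sup>2" "\<delta>\<^sup>2 \<le> 1" "0 < \<delta>\<^sup>2" "\<delta>\<^sup>2 \<le> \<delta>"
    using \<delta> power_decreasing[of 2 4 \<delta>] power_decreasing[of 1 2 \<delta>] by (auto simp: power_le_one)
  note ik = integrable_circ_holomorphic[OF k R] and ig = integrable_circ_holomorphic[OF g R]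
  have g1h: "(\<lambda>z. g z - 1) holomorphic_on ball 0 R" by (intro holomorphic_intros g)
  note ig1 = integrable_circ_holomorphic[OF g1h R]
  have iU: "integrable circ (\<lambda>t. U (ept t))" by (rule integrable_circ_continuous[OF U(1)])
  then have iReU: "integrable circ (\<lambda>t. Re (U (ept t)))" by (rule integrable_Re)
  have ck: "continuous_on {0..1} (\<lambda>t. k (ept t))" by (rule continuous_on_ept_compose[OF k R])
  have Rek: "(LINT t|circ. Re (k (ept t))) = Re (k 0)"
    using circ_mean_value[OF k R] integral_Re[OF ik(1)] by simp
  have Reg0: "(LINT t|circ. Re (g (ept t))) = Re (g 0)"
    using circ_mean_value[OF g R] integral_Re[OF ig(1)] by simp
  have kk: "(LINT t|circ. (norm (k (ept t)))\<^sup>2) \<le> 2 + \<delta> ^ 4" using fg by (simp add: k_def)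
  \<comment> \<open>Expanding the square, the cross term is the mean value \<open>Re (g 0)\<close>:
    a function of norm about 1 with value about 1 at the origin is nearly constant.\<close>
  have g1: "(LINT t|circ. (norm (g (ept t) - 1))\<^sup>2) \<le> 4 * \<delta> ^ 4"
  proof -
    have "(LINT t|circ. (norm (g (ept t) - 1))\<^sup>2) = (LINT t|circ. (norm (g (ept t)))\<^sup>2 + 1 - 2 * Re (g (ept t)))"
      by (intro Bochner_Integration.integral_cong refl) (simp add: norm_diff_square_complex)
    also have "\<dots> = (LINT t|circ. (norm (g (ept t)))\<^sup>2) + 1 - 2 * Re (g 0)"
      using ig Reg0 by simp
    finally show ?thesis using gg Reg by simp
  qed
  have pointwise: "(norm (k (ept t) - (1 + U (ept t))))\<^sup>2
      \<le> (1 + 4 * \<delta>\<^sup>2) * (norm (k (ept t)))\<^sup>2 + 2 + 2 * Re (U (ept t)) - 4 * Re (k (ept t))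
        + 4 / \<delta>\<^sup>2 * (norm (g (ept t) - 1))\<^sup>2" for t
  proof -
    let ?f = "f (ept t)" and ?g = "g (ept t)" and ?k = "k (ept t)" and ?U = "U (ept t)"
    have UU: "?U * cnj ?U = 1" using U(2)[of t] complex_norm_square[of ?U] by simp
    have 1: "(norm (1 + ?U))\<^sup>2 = 2 + 2 * Re ?U"
      using norm_diff_square_complex[of ?U "-1"] U(2)[of t] by (simp add: add.commute)
    \<comment> \<open>This is where the phase relation is used: the cross term with \<open>U\<close>
      becomes the one with 1, up to the factor \<open>g / cnj g\<close>.\<close>
    have "?f * cnj ?U = cnj ?f" using arg_cong[OF fU[of t], of "\<lambda>x. x * cnj ?U"] UU by (simp add: mult.assoc)
    then have kU: "?k * cnj ?U = cnj ?k + cnj ?k * (?g / cnj ?g - 1)"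
      using g0[of t] by (simp add: k_def field_simps)
    have "- Re (cnj ?k * (?g / cnj ?g - 1)) \<le> norm (cnj ?k * (?g / cnj ?g - 1))"
      using abs_Re_le_cmod[of "cnj ?k * (?g / cnj ?g - 1)"] by linarith
    also have "\<dots> \<le> norm ?k * (4 * norm (?g - 1))"
      unfolding norm_mult complex_mod_cnj by (intro mult_left_mono norm_quotient_cnj_le g0) auto
    also have "\<dots> = 2 * (2 * (norm ?k * norm (?g - 1)))" by simp
    also have "\<dots> \<le> 2 * (\<delta>\<^sup>2 * (norm ?k)\<^sup>2 + (norm (?g - 1))\<^sup>2 / \<delta>\<^sup>2)"
      by (rule mult_left_mono[OF two_mult_le_weighted]) (use \<delta>4 in auto)
    finally have 2: "- Re (?k * cnj ?U) \<le> - Re ?k + 2 * (\<delta>\<^sup>2 * (norm ?k)\<^sup>2 + (norm (?g - 1))\<^sup>2 / \<delta>\<^sup>2)"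
      unfolding kU by simp
    have "Re (?k * cnj (1 + ?U)) = Re ?k + Re (?k * cnj ?U)" by (simp add: distrib_left algebra_simps)
    then have 3: "(norm (?k - (1 + ?U)))\<^sup>2 = (norm ?k)\<^sup>2 + (2 + 2 * Re ?U) - 2 * (Re ?k + Re (?k * cnj ?U))"
      unfolding norm_diff_square_complex[of ?k] 1 by simp
    have 4: "(1 + 4 * \<delta>\<^sup>2) * (norm ?k)\<^sup>2 = (norm ?k)\<^sup>2 + 4 * (\<delta>\<^sup>2 * (norm ?k)\<^sup>2)"
      "4 / \<delta>\<^sup>2 * (norm (?g - 1))\<^sup>2 = 4 * ((norm (?g - 1))\<^sup>2 / \<delta>\<^sup>2)"
      by (simp_all add: distrib_right)
    have arith: "e + (2 + 2 * h) - 2 * (b + a) \<le> e + 4 * c + 2 + 2 * h - 4 * b + 4 * d"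
      if "- a \<le> - b + 2 * (c + d)" for a b c d e h :: real using that by (simp add: algebra_simps)
    show ?thesis unfolding 3 4 by (rule arith[OF 2])
  qed
  \<comment> \<open>The main terms \<open>2 + 2 - 4\<close> cancel. The remainder is at most
    \<open>55 * \<delta>\<^sup>2\<close>, rounded up to 64 so that its root is
    \<open>8 * \<delta>\<close>.\<close>
  have E: "(LINT t|circ. (norm (k (ept t) - (1 + U (ept t))))\<^sup>2) \<le> 64 * \<delta>\<^sup>2"
  proof -
    have "(LINT t|circ. (norm (k (ept t) - (1 + U (ept t))))\<^sup>2)
        \<le> (LINT t|circ. (1 + 4 * \<delta>\<^sup>2) * (norm (k (ept t)))\<^sup>2 + 2 + 2 * Re (U (ept t)) - 4 * Re (k (ept t))
          + 4 / \<delta>\<^sup>2 * (norm (g (ept t) - 1))\<^sup>2)"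
    proof (rule integral_mono[OF _ _ pointwise])
      show "integrable circ (\<lambda>t. (norm (k (ept t) - (1 + U (ept t))))\<^sup>2)"
        by (intro integrable_circ_continuous continuous_intros ck U)
    qed (use ik ig1 iReU in simp)
    also have "\<dots> = (1 + 4 * \<delta>\<^sup>2) * (LINT t|circ. (norm (k (ept t)))\<^sup>2) + 2 + 2 * (LINT t|circ. Re (U (ept t)))
        - 4 * Re (k 0) + 4 / \<delta>\<^sup>2 * (LINT t|circ. (norm (g (ept t) - 1))\<^sup>2)"
      using ik ig1 iReU Rek by simp
    also have "\<dots> \<le> (1 + 4 * \<delta>\<^sup>2) * (2 + \<delta> ^ 4) + 2 + 2 * \<delta>\<^sup>2 - 4 * (1 - 6 * \<delta>\<^sup>2) + 4 / \<delta>\<^sup>2 * (4 * \<delta> ^ 4)"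
    proof (intro add_mono diff_mono mult_left_mono kk g1 order_refl)
      have "(LINT t|circ. Re (U (ept t))) = Re (LINT t|circ. U (ept t))" by (rule integral_Re[OF iU])
      also have "\<dots> \<le> \<delta>\<^sup>2" using U0 complex_Re_le_cmod order_trans by blast
      finally show "(LINT t|circ. Re (U (ept t))) \<le> \<delta>\<^sup>2" .
      show "1 - 6 * \<delta>\<^sup>2 \<le> Re (k 0)" using Refg by (simp add: k_def)
    qed (use \<delta>4 in auto)
    also have "4 / \<delta>\<^sup>2 * (4 * \<delta> ^ 4) = 16 * \<delta>\<^sup>2" using \<delta> by (simp add: power2_eq_square power4_eq_xxxx)
    also have "(1 + 4 * \<delta>\<^sup>2) * (2 + \<delta> ^ 4) + 2 + 2 * \<delta>\<^sup>2 - 4 * (1 - 6 * \<delta>\<^sup>2) + 16 * \<delta>\<^sup>2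
       = 50 * \<delta>\<^sup>2 + \<delta> ^ 4 + 4 * (\<delta>\<^sup>2 * \<delta> ^ 4)" by (simp add: algebra_simps)
    also have "\<delta>\<^sup>2 * \<delta> ^ 4 \<le> \<delta>\<^sup>2 * 1" using \<delta>4 by (intro mult_left_mono) auto
    finally show ?thesis using \<delta>4 by linarith
  qed
  have r0: "0 \<le> r" using s norm_ge_zero[of s] by linarith
  have s1: "norm s < 1" using s by simp
  have cpk: "continuous_on {0..1} (\<lambda>t. pk s (ecos t))" by (rule continuous_on_pk_ecos[OF s1])
  have pkb: "norm (pk s (ecos t)) \<le> 2 / (1 - r)\<^sup>2" for t by (intro norm_pk_le s) auto
  \<comment> \<open>Cauchy-Schwarz against the bounded kernel, in the form
    \<open>b \<le> c / 2 + b^2 / (2 * c)\<close>.\<close>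
  have ker: "norm (LINT t|circ. h t * pk s (ecos t)) \<le> 2 / (1 - r)\<^sup>2 * c"
    if h: "continuous_on {0..1} h" and c: "c > 0" and hc: "(LINT t|circ. (norm (h t))\<^sup>2) \<le> c\<^sup>2" for h :: "real \<Rightarrow> complex" and c
  proof -
    have "norm (LINT t|circ. h t * pk s (ecos t)) \<le> (LINT t|circ. norm (h t * pk s (ecos t)))"
      by (rule integral_norm_bound)
    also have "\<dots> \<le> (LINT t|circ. 2 / (1 - r)\<^sup>2 * (c / 2 + (norm (h t))\<^sup>2 / (2 * c)))"
    proof (rule integral_mono)
      show "integrable circ (\<lambda>t. norm (h t * pk s (ecos t)))"
        "integrable circ (\<lambda>t. 2 / (1 - r)\<^sup>2 * (c / 2 + (norm (h t))\<^sup>2 / (2 * c)))"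
        using c by (intro integrable_circ_continuous continuous_intros h cpk; simp)+
      show "norm (h t * pk s (ecos t)) \<le> 2 / (1 - r)\<^sup>2 * (c / 2 + (norm (h t))\<^sup>2 / (2 * c))" for t
        unfolding norm_mult mult.commute[of "norm (h t)"]
        by (intro mult_mono pkb le_weighted c) auto
    qed
    also have "\<dots> = 2 / (1 - r)\<^sup>2 * (c / 2 + (LINT t|circ. (norm (h t))\<^sup>2) / (2 * c))"
    proof -
      have "integrable circ (\<lambda>t. (norm (h t))\<^sup>2)" by (intro integrable_circ_continuous continuous_intros h)
      then show ?thesis by simp
    qed
    also have "\<dots> \<le> 2 / (1 - r)\<^sup>2 * (c / 2 + c\<^sup>2 / (2 * c))"
      using hc c by (intro mult_left_mono add_mono divide_right_mono) auto
    also have "c / 2 + c\<^sup>2 / (2 * c) = c" using c by (simp add: power2_eq_square)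
    finally show ?thesis .
  qed
  define A where "A = 1 / (1 - r)\<^sup>2"
  have A: "A \<ge> 1" "8 * \<delta>\<^sup>2 * A \<le> 1"
  proof -
    have "(1 - r)\<^sup>2 \<le> 1" using s r0 by (simp add: power_le_one)
    then show "A \<ge> 1" unfolding A_def using s by simp
    show "8 * \<delta>\<^sup>2 * A \<le> 1" unfolding A_def using small s by (simp add: pos_divide_le_eq)
  qed
  have ks: "norm (k s - 1) \<le> 17 * \<delta> * A"
  proof -
    have h: "(\<lambda>z. k z - 1) holomorphic_on ball 0 R" by (intro holomorphic_intros k)
    have "k s - 1 = (LINT t|circ. (k (ept t) - 1) * pk s (ecos t))"
      using schwarz_reproducing[OF h R s1] by simp
    also have "\<dots> = (LINT t|circ. (k (ept t) - (1 + U (ept t))) * pk s (ecos t) + U (ept t) * pk s (ecos t))"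
      by (intro Bochner_Integration.integral_cong refl) (simp add: algebra_simps)
    also have "\<dots> = (LINT t|circ. (k (ept t) - (1 + U (ept t))) * pk s (ecos t)) + (LINT t|circ. U (ept t) * pk s (ecos t))"
      by (intro Bochner_Integration.integral_add integrable_circ_continuous continuous_intros ck cpk U)
    finally have eq: "k s - 1 = (LINT t|circ. (k (ept t) - (1 + U (ept t))) * pk s (ecos t)) + (LINT t|circ. U (ept t) * pk s (ecos t))" .
    have b1: "norm (LINT t|circ. (k (ept t) - (1 + U (ept t))) * pk s (ecos t)) \<le> 2 / (1 - r)\<^sup>2 * (8 * \<delta>)"
      using E \<delta> by (intro ker continuous_intros ck U) (auto simp: power_mult_distrib)
    have "norm (k s - 1) \<le> 2 / (1 - r)\<^sup>2 * (8 * \<delta>) + \<delta>"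
      unfolding eq by (rule norm_triangle_le[OF add_mono[OF b1 Us]])
    also have "2 / (1 - r)\<^sup>2 * (8 * \<delta>) = 16 * \<delta> * A" by (simp add: A_def)
    also have "16 * \<delta> * A + \<delta> \<le> 17 * \<delta> * A" using A \<delta> by simp
    finally show ?thesis .
  qed
  have gs: "norm (g s - 1) \<le> 4 * \<delta>\<^sup>2 * A"
  proof -
    have "g s - 1 = (LINT t|circ. (g (ept t) - 1) * pk s (ecos t))"
      using schwarz_reproducing[OF g1h R s1] by simp
    also have "norm \<dots> \<le> 2 / (1 - r)\<^sup>2 * (2 * \<delta>\<^sup>2)"
      using g1 \<delta> by (intro ker continuous_intros continuous_on_ept_compose[OF g R])
        (auto simp: power_mult_distrib power2_eq_square power4_eq_xxxx)
    finally show ?thesis by (simp add: A_def)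
  qed
  \<comment> \<open>The hypothesis \<open>small\<close> is calibrated to give
    \<open>norm (g s - 1) \<le> 1/2\<close>, so that \<open>g\<close> can be divided out.\<close>
  have "norm (g s) \<ge> 1/2"
    using norm_triangle_ineq2[of 1 "1 - g s"] gs A(2) by (simp add: norm_minus_commute)
  then have gsn: "g s \<noteq> 0" "norm (g s) \<ge> 1/2" by auto
  have "norm (k s - g s) \<le> 17 * \<delta> * A + 4 * \<delta>\<^sup>2 * A"
    using norm_triangle_ineq4[of "k s - 1" "g s - 1"] ks gs by simp
  also have "\<dots> \<le> 17 * \<delta> * A + 4 * \<delta> * A" using A \<delta>4 by simp
  finally have kg: "norm (k s - g s) \<le> 21 * \<delta> * A" by (simp add: mult_ac)
  have "f s - 1 = (k s - g s) / g s" using gsn(1) by (simp add: k_def field_simps)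
  then have "norm (f s - 1) = norm (k s - g s) / norm (g s)" by (simp add: norm_divide)
  also have "\<dots> \<le> (21 * \<delta> * A) / (1/2)" using kg gsn A \<delta> by (intro frac_le) auto
  finally show ?thesis by (simp add: A_def)
qed

subsection \<open>Outer functions with polynomial logarithm\<close>

definition texp :: "real poly \<Rightarrow> complex \<Rightarrow> complex" where
  "texp Q s = exp (poly (cpoly Q) s)"

lemma texp_holomorphic [holomorphic_intros]: "texp Q holomorphic_on A"
  unfolding texp_def by (intro holomorphic_intros)

lemma texp_nonzero [simp]: "texp Q s \<noteq> 0"
  by (simp add: texp_def)

lemma texp_cnj: "texp Q (cnj s) = cnj (texp Q s)"
  by (simp add: texp_def poly_cpoly_cnj exp_cnj)

lemma texp_0: "texp Q 0 = of_real (exp (poly Q 0))"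
  using poly_cpoly_of_real[of Q 0] by (simp add: texp_def exp_of_real)

text \<open>Taylor sections of the exponential, composed with \<open>Q\<close>, converge uniformly
  on the disc; the Blaschke division needs a genuine polynomial.\<close>

lemma texp_poly_approx:
  assumes "d > 0"
  obtains T :: "complex poly" where "\<And>s. norm s \<le> 1 \<Longrightarrow> norm (poly T s - texp Q s) \<le> d"
proof -
  have "compact (poly (cpoly Q) ` cball 0 1)" by (intro compact_continuous_image continuous_intros) auto
  then have "bounded (poly (cpoly Q) ` cball 0 1)" by (rule compact_imp_bounded)
  then obtain B where B: "\<And>y. y \<in> poly (cpoly Q) ` cball 0 1 \<Longrightarrow> norm y \<le> B" unfolding bounded_iff by auto
  have B0: "0 \<le> B" using order_trans[OF norm_ge_zero B[of "poly (cpoly Q) 0"]] by auto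
  have "(\<lambda>n. exp B * (B * (inverse (fact n) * B ^ n))) \<longlonglongrightarrow> exp B * (B * 0)"
    by (intro tendsto_intros summable_LIMSEQ_zero[OF summable_exp])
  then have "\<forall>\<^sub>F n in sequentially. exp B * (B * (inverse (fact n) * B ^ n)) < d"
    using assms by (intro order_tendstoD) auto
  then obtain n where n: "exp B * (B * (inverse (fact n) * B ^ n)) < d" by (auto simp: eventually_sequentially)
  define T where "T = (\<Sum>k\<le>n. smult (1 / fact k) (cpoly Q ^ k))"
  show thesis
  proof (rule that[of T])
    fix s :: complex assume "norm s \<le> 1"
    define y where "y = poly (cpoly Q) s"
    have y: "norm y \<le> B" unfolding y_def using B \<open>norm s \<le> 1\<close> by auto
    have "norm (poly T s - texp Q s) = norm (exp y - (\<Sum>k\<le>n. y ^ k / fact k))"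
      by (simp add: T_def texp_def y_def poly_sum norm_minus_commute)
    also have "\<dots> \<le> exp \<bar>Re y\<bar> * norm y ^ Suc n / fact n" by (rule Taylor_exp)
    also have "\<dots> \<le> exp B * B ^ Suc n / fact n"
      using y abs_Re_le_cmod[of y] B0 by (intro divide_right_mono mult_mono power_mono) auto
    also have "\<dots> \<le> d" using n by (simp add: divide_inverse mult_ac)
    finally show "norm (poly T s - texp Q s) \<le> d" .
  qed
qed

locale analytic_half =
  fixes l Q :: "real poly"
  assumes half: "\<And>s. s \<noteq> 0 \<Longrightarrow> poly (cpoly l) (joukowski s) = poly (cpoly Q) s + poly (cpoly Q) (1 / s)"
begin

lemma half_ept: "complex_of_real (poly l (ecos t)) = poly (cpoly Q) (ept t) + cnj (poly (cpoly Q) (ept t))"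
  using half[of "ept t"] unfolding joukowski_ept by (simp flip: cnj_ept poly_cpoly_cnj)

lemma norm_texp_ept: "(norm (texp Q (ept t)))\<^sup>2 = exp (poly l (ecos t))"
proof -
  have "poly l (ecos t) = 2 * Re (poly (cpoly Q) (ept t))"
    using arg_cong[OF half_ept[of t], of Re] by simp
  then show ?thesis by (simp add: texp_def flip: exp_double)
qed

text \<open>On the circle \<open>l\<close> is \<open>Q\<close> plus its conjugate. The kernel
  reproduces the first summand directly and the second after conjugating \<open>s\<close>; real
  coefficients make the two contributions equal.\<close>

lemma schwarz_integral:
  assumes s: "norm s < 1"
  shows "(LINT x|arcsine. pk s x * of_real (poly l x)) = 2 * poly (cpoly Q) s"
proof -
  have hQ: "poly (cpoly Q) holomorphic_on ball 0 2" by (intro holomorphic_intros)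
  have cQ: "continuous_on {0..1} (\<lambda>t. poly (cpoly Q) (ept t))" by (intro continuous_intros)
  have cp: "continuous_on {0..1} (\<lambda>t. pk z (ecos t))" if "norm z < 1" for z by (rule continuous_on_pk_ecos[OF that])
  have pkc: "pk s (ecos t) = cnj (pk (cnj s) (ecos t))" for t by (simp add: pk_def)
  have lm: "(\<lambda>x. complex_of_real (poly l x)) \<in> borel_measurable borel"
    by (intro borel_measurable_continuous_onI continuous_intros)
  have "(LINT x|arcsine. pk s x * of_real (poly l x)) = (LINT t|circ. pk s (ecos t) * of_real (poly l (ecos t)))"
    using lm by (intro integral_arcsine) measurable
  also have "\<dots> = (LINT t|circ. poly (cpoly Q) (ept t) * pk s (ecos t)
      + cnj (poly (cpoly Q) (ept t) * pk (cnj s) (ecos t)))"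
  proof (intro Bochner_Integration.integral_cong refl)
    fix t
    have "cnj (poly (cpoly Q) (ept t) * pk (cnj s) (ecos t)) = pk s (ecos t) * cnj (poly (cpoly Q) (ept t))"
      unfolding complex_cnj_mult pkc[symmetric] by (rule mult.commute)
    then show "pk s (ecos t) * of_real (poly l (ecos t)) = poly (cpoly Q) (ept t) * pk s (ecos t)
      + cnj (poly (cpoly Q) (ept t) * pk (cnj s) (ecos t))"
      unfolding half_ept distrib_left by (simp only: mult.commute[of "poly (cpoly Q) (ept t)"])
  qed
  also have "\<dots> = (LINT t|circ. poly (cpoly Q) (ept t) * pk s (ecos t))
      + (LINT t|circ. cnj (poly (cpoly Q) (ept t) * pk (cnj s) (ecos t)))"
    using s by (intro Bochner_Integration.integral_add integrable_circ_continuous continuous_intros cQ cp) auto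
  also have "(LINT t|circ. cnj (poly (cpoly Q) (ept t) * pk (cnj s) (ecos t)))
      = cnj (LINT t|circ. poly (cpoly Q) (ept t) * pk (cnj s) (ecos t))"
    by (rule Bochner_Integration.integral_cnj)
  also have "(LINT t|circ. poly (cpoly Q) (ept t) * pk s (ecos t)) = poly (cpoly Q) s"
    by (rule schwarz_reproducing[OF hQ _ s]) simp
  also have "(LINT t|circ. poly (cpoly Q) (ept t) * pk (cnj s) (ecos t)) = poly (cpoly Q) (cnj s)"
    by (rule schwarz_reproducing[OF hQ]) (use s in auto)
  finally show ?thesis by (simp add: poly_cpoly_cnj)
qed

lemma texp_schwarz:
  "norm s < 1 \<Longrightarrow> texp Q s = exp ((LINT x|arcsine. pk s x * of_real (poly l x)) / 2)"
  by (simp add: schwarz_integral texp_def)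

lemma integral_half: "(LINT x|arcsine. poly l x) = 2 * poly Q 0"
proof -
  have "complex_of_real (LINT x|arcsine. poly l x) = (LINT x|arcsine. complex_of_real (poly l x))"
    by (rule integral_complex_of_real[symmetric])
  also have "\<dots> = 2 * poly (cpoly Q) 0" using schwarz_integral[of 0] by simp
  also have "\<dots> = complex_of_real (2 * poly Q 0)" using poly_cpoly_of_real[of Q 0] by simp
  finally show ?thesis by (simp only: of_real_eq_iff)
qed

end

subsection \<open>The phase function\<close>

context conj_nodes
begin

text \<open>On the circle \<open>phase Q\<close> is the unimodular function \<open>cnj T / T \<cdot> b\<close>; the expression with \<open>1 / s\<close> extends it
  analytically, so that the contour can be moved to a smaller circle where \<open>b\<close> is small.\<close>

definition phase :: "real poly \<Rightarrow> complex \<Rightarrow> complex" where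
  "phase Q s = texp Q (1 / s) * N s / (D s * texp Q s)"

lemma phase_ept: "phase Q (ept t) = cnj (texp Q (ept t)) / texp Q (ept t) * (N (ept t) / D (ept t))"
  by (simp add: phase_def cnj_ept flip: texp_cnj)

lemma norm_phase: "norm (phase Q (ept t)) = 1"
  using D_nonzero[of "ept t"] by (simp add: phase_ept norm_mult norm_divide norm_N_circle)

lemma continuous_phase: "continuous_on A (\<lambda>t. phase Q (ept t))"
proof -
  have c: "continuous_on A (\<lambda>t. texp Q (ept t))" unfolding texp_def by (intro continuous_intros)
  show ?thesis unfolding phase_ept using D_nonzero[of "ept _"] c
    by (intro continuous_intros) auto
qed

end

text \<open>The quantitative form of the weak decay of the phase. The circle halfway between
  \<open>r\<close> and 1 is fixed, and \<open>T(1/s) / T(s)\<close> is bounded there once and for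
  all, so \<open>K\<close> depends only on \<open>Q\<close> and \<open>r\<close>, while the Blaschke
  product contributes \<eta>.\<close>

lemma phase_integral_bound:
  assumes r: "0 \<le> r" "r < 1"
  obtains K where "K > 0" "\<And>\<alpha> m \<eta> (s :: complex). conj_nodes \<alpha> m \<Longrightarrow> 0 \<le> \<eta> \<Longrightarrow>
      (\<And>z. norm z \<le> (1 + r) / 2 \<Longrightarrow> norm (poly (nump \<alpha> m) z) \<le> \<eta> * norm (poly (denp \<alpha> m) z)) \<Longrightarrow>
      norm s \<le> r \<Longrightarrow> norm (LINT t|circ. conj_nodes.phase \<alpha> m Q (ept t) * pk s (ecos t)) \<le> K * \<eta>"
proof -
  define \<rho> where "\<rho> = (1 + r) / 2"
  have \<rho>: "0 < \<rho>" "r < \<rho>" "\<rho> < 1" using r by (auto simp: \<rho>_def)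
  have "continuous_on (sphere 0 \<rho>) (\<lambda>s. texp Q (1 / s) / texp Q s)"
    unfolding texp_def using \<rho> by (intro continuous_intros) auto
  then have "compact ((\<lambda>s. texp Q (1 / s) / texp Q s) ` sphere 0 \<rho>)" by (intro compact_continuous_image) auto
  then have "bounded ((\<lambda>s. texp Q (1 / s) / texp Q s) ` sphere 0 \<rho>)" by (rule compact_imp_bounded)
  then obtain M where M: "M > 0" "\<And>y. y \<in> (\<lambda>s. texp Q (1 / s) / texp Q s) ` sphere 0 \<rho> \<Longrightarrow> norm y \<le> M"
    unfolding bounded_pos by auto
  define K where "K = 2 * M / ((1 - \<rho>) * (\<rho> - r))"
  show thesis
  proof (rule that[of K])
    show "K > 0" unfolding K_def using M \<rho> by simp
    fix \<alpha> :: "nat \<Rightarrow> complex" and m \<eta> and s :: complex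
    assume cn: "conj_nodes \<alpha> m" and \<eta>: "0 \<le> \<eta>" and s: "norm s \<le> r"
      and ND: "\<And>z. norm z \<le> (1 + r) / 2 \<Longrightarrow> norm (poly (nump \<alpha> m) z) \<le> \<eta> * norm (poly (denp \<alpha> m) z)"
    interpret conj_nodes \<alpha> m by fact
    obtain R where R: "R > 1" "\<And>s. s \<in> ball 0 R \<Longrightarrow> D s \<noteq> 0" by (rule D_nonzero_ball) blast
    have h: "phase Q holomorphic_on ball 0 R - {0}"
    proof -
      have "(\<lambda>s. texp Q (1 / s)) holomorphic_on ball 0 R - {0}"
        unfolding texp_def by (intro holomorphic_intros) auto
      then show ?thesis unfolding phase_def using R(2)
        by (intro holomorphic_intros) auto
    qed
    have "norm (LINT t|circ. phase Q (ept t) * pk s (ecos t)) \<le> 2 * (M * \<eta>) / ((1 - \<rho>) * (\<rho> - r))"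
    proof (rule schwarz_annulus_bound[OF h R(1) s \<rho>(2,3)])
      fix z :: complex assume z: "norm z = \<rho>"
      have Dz: "D z \<noteq> 0" using D_nonzero z \<rho> by simp
      have "norm (phase Q z) = norm (texp Q (1 / z) / texp Q z) * (norm (N z) / norm (D z))"
        by (simp add: phase_def norm_mult norm_divide)
      also have "\<dots> \<le> M * \<eta>"
        using M z ND[of z] Dz by (intro mult_mono) (auto simp: \<rho>_def pos_divide_le_eq)
      finally show "norm (phase Q z) \<le> M * \<eta>" .
    qed
    then show "norm (LINT t|circ. conj_nodes.phase \<alpha> m Q (ept t) * pk s (ecos t)) \<le> K * \<eta>"
      by (simp add: K_def mult_ac)
  qed
qed

subsection \<open>The weight on the interval\<close>

text \<open>The point of the upper half circle over \<open>x\<close>. Functions commuting with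
  conjugation have the same modulus and real part at both points over \<open>x\<close>, so one
  branch suffices.\<close>

definition cpt :: "real \<Rightarrow> complex" where
  "cpt x = Complex x (sqrt (1 - x\<^sup>2))"

lemma cpt_measurable [measurable]: "cpt \<in> borel_measurable borel"
  unfolding cpt_def by (intro borel_measurable_continuous_onI continuous_intros)

lemma continuous_cpt: "continuous_on A cpt"
  unfolding cpt_def by (intro continuous_intros)

lemma cpt_ecos: "cpt (ecos t) = ept t \<or> cpt (ecos t) = cnj (ept t)"
proof -
  have "sqrt (1 - (ecos t)\<^sup>2) = \<bar>sin (2 * pi * t)\<bar>" by (simp flip: sin_squared_eq)
  then show ?thesis by (auto simp: cpt_def ept_def complex_eq_iff abs_if)
qed

lemma cpt_symmetric:
  assumes "\<And>s. F (cnj s) = cnj (F s)"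
  shows "norm (F (cpt (ecos t))) = norm (F (ept t))" "Re (F (cpt (ecos t))) = Re (F (ept t))"
  using cpt_ecos[of t] assms[of "ept t"] by auto

context conj_nodes
begin

text \<open>The values of \<open>1 / \<tau>\<close> on \<open>[-1,1]\<close>, with \<open>\<phi>(a\<^sub>j) = \<alpha> j\<close>.\<close>

definition wt :: "real \<Rightarrow> real" where
  "wt x = cc / (norm (D (cpt x)))\<^sup>2"

lemma wt_ecos: "wt (ecos t) = cc / (norm (D (ept t)))\<^sup>2"
  by (simp add: wt_def cpt_symmetric(1)[of D, OF D_cnj])

lemma wt_measurable [measurable]: "wt \<in> borel_measurable borel"
proof -
  have "D \<in> borel_measurable borel" by (intro borel_measurable_continuous_onI continuous_intros)
  then show ?thesis unfolding wt_def by measurable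
qed

lemma norm_cpt: "x \<in> {-1..1} \<Longrightarrow> norm (cpt x) = 1"
proof -
  assume "x \<in> {-1..1}"
  then have "-1 \<le> x" "x \<le> 1" by auto
  then obtain t where "x = ecos t" by (rule obtain_circle_angle)
  then show ?thesis using cpt_ecos[of t] by auto
qed

lemma wt_pos: "x \<in> {-1..1} \<Longrightarrow> wt x > 0"
  using D_nonzero[of "cpt x"] norm_cpt[of x] cc_pos by (simp add: wt_def)

lemma wt_nonneg: "wt x \<ge> 0"
  using cc_pos by (simp add: wt_def)

lemma continuous_wt: "continuous_on {-1..1} wt"
  unfolding wt_def using D_nonzero norm_cpt
  by (intro continuous_intros continuous_on_compose2[OF continuous_on_poly[OF continuous_on_id] continuous_cpt]) auto

definition orth_real :: "real measure \<Rightarrow> nat \<Rightarrow> real poly \<Rightarrow> bool" where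
  "orth_real \<nu> n p \<longleftrightarrow> degree p = n \<and> 0 < lead_coeff p
     \<and> (\<forall>k<n. (LINT x|\<nu>. poly p x * x ^ k * wt x) = 0) \<and> (LINT x|\<nu>. (poly p x)\<^sup>2 * wt x) = 1"

lemma integrable_wt:
  fixes f :: "real \<Rightarrow> real"
  assumes "finite_measure_on_interval \<nu>" "continuous_on UNIV f"
  shows "integrable \<nu> (\<lambda>x. f x * wt x)"
proof (rule integrable_poly_on_interval[OF assms(1)])
  show "continuous_on {-1..1} (\<lambda>x. f x * wt x)"
    by (intro continuous_intros continuous_wt continuous_on_subset[OF assms(2)]) auto
  have "f \<in> borel_measurable borel" by (rule borel_measurable_continuous_onI[OF assms(2)])
  then show "(\<lambda>x. f x * wt x) \<in> borel_measurable borel" by measurable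
qed

lemma orth_real_lower:
  assumes \<nu>: "finite_measure_on_interval \<nu>" and p: "orth_real \<nu> n p" and q: "degree q < n"
  shows "(LINT x|\<nu>. poly p x * poly q x * wt x) = 0"
proof -
  have "(LINT x|\<nu>. poly p x * poly q x * wt x) = (LINT x|\<nu>. (\<Sum>k\<le>degree q. coeff q k * (poly p x * x ^ k * wt x)))"
    by (intro Bochner_Integration.integral_cong refl)
      (simp add: poly_altdef[of q] sum_distrib_left sum_distrib_right mult_ac)
  also have "\<dots> = (\<Sum>k\<le>degree q. coeff q k * (LINT x|\<nu>. poly p x * x ^ k * wt x))"
    by (subst Bochner_Integration.integral_sum)
      (auto intro!: integrable_mult_right integrable_wt[OF \<nu>] continuous_intros)
  also have "\<dots> = 0" using p q by (intro sum.neutral) (auto simp: orth_real_def)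
  finally show ?thesis .
qed

text \<open>The dual form of the extremality of the orthonormal polynomial: the component of
  \<open>q\<close> along \<open>p\<close> is the ratio of the coefficients of degree
  \<open>n\<close>, and Cauchy-Schwarz bounds it by the norm of \<open>q\<close>.\<close>

lemma extremal_inequality:
  assumes \<nu>: "finite_measure_on_interval \<nu>" and p: "orth_real \<nu> n p" and q: "degree q \<le> n"
    and B: "(LINT x|\<nu>. (poly q x)\<^sup>2 * wt x) \<le> B" "B > 0"
  shows "\<bar>coeff q n\<bar> \<le> lead_coeff p * sqrt B"
proof -
  have dp: "degree p = n" and lp: "lead_coeff p > 0" and p1: "(LINT x|\<nu>. (poly p x)\<^sup>2 * wt x) = 1"
    using p by (auto simp: orth_real_def)
  define c where "c = coeff q n / lead_coeff p"
  have pq: "(LINT x|\<nu>. poly p x * poly q x * wt x) = c"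
  proof -
    have z: "(LINT x|\<nu>. poly p x * poly (q - smult c p) x * wt x) = 0"
    proof (cases "q - smult c p = 0")
      case False
      have "coeff (q - smult c p) n = 0" using lp dp by (simp add: c_def)
      moreover have "degree (q - smult c p) \<le> n" using q dp by (intro degree_diff_le) auto
      ultimately have "degree (q - smult c p) < n"
        using False by (metis leading_coeff_0_iff le_neq_implies_less)
      then show ?thesis by (rule orth_real_lower[OF \<nu> p])
    qed simp
    have "(LINT x|\<nu>. poly p x * poly q x * wt x)
        = (LINT x|\<nu>. poly p x * poly (q - smult c p) x * wt x + c * ((poly p x)\<^sup>2 * wt x))"
      by (intro Bochner_Integration.integral_cong refl) (simp add: algebra_simps power2_eq_square)
    also have "\<dots> = (LINT x|\<nu>. poly p x * poly (q - smult c p) x * wt x) + (LINT x|\<nu>. c * ((poly p x)\<^sup>2 * wt x))"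
      by (intro Bochner_Integration.integral_add integrable_mult_right integrable_wt[OF \<nu>] continuous_intros)
    finally show ?thesis using z p1 by simp
  qed
  have "\<bar>c\<bar> \<le> (LINT x|\<nu>. \<bar>poly p x * poly q x * wt x\<bar>)" unfolding pq[symmetric] by (rule integral_abs_bound)
  also have "\<dots> \<le> (LINT x|\<nu>. sqrt B / 2 * ((poly p x)\<^sup>2 * wt x) + 1 / (2 * sqrt B) * ((poly q x)\<^sup>2 * wt x))"
  proof (rule integral_mono)
    show "integrable \<nu> (\<lambda>x. \<bar>poly p x * poly q x * wt x\<bar>)"
      by (intro integrable_abs integrable_wt[OF \<nu>] continuous_intros)
    show "integrable \<nu> (\<lambda>x. sqrt B / 2 * ((poly p x)\<^sup>2 * wt x) + 1 / (2 * sqrt B) * ((poly q x)\<^sup>2 * wt x))"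
      by (intro Bochner_Integration.integrable_add integrable_mult_right integrable_wt[OF \<nu>] continuous_intros)
    fix x
    have "2 * (\<bar>poly p x\<bar> * \<bar>poly q x\<bar>) \<le> sqrt B * \<bar>poly p x\<bar>\<^sup>2 + \<bar>poly q x\<bar>\<^sup>2 / sqrt B"
      using B(2) by (intro two_mult_le_weighted) simp
    then have "\<bar>poly p x * poly q x\<bar> \<le> sqrt B / 2 * (poly p x)\<^sup>2 + 1 / (2 * sqrt B) * (poly q x)\<^sup>2"
      by (simp add: abs_mult field_simps)
    then have "\<bar>poly p x * poly q x\<bar> * wt x \<le> (sqrt B / 2 * (poly p x)\<^sup>2 + 1 / (2 * sqrt B) * (poly q x)\<^sup>2) * wt x"
      by (rule mult_right_mono) (rule wt_nonneg)
    then show "\<bar>poly p x * poly q x * wt x\<bar> \<le> sqrt B / 2 * ((poly p x)\<^sup>2 * wt x) + 1 / (2 * sqrt B) * ((poly q x)\<^sup>2 * wt x)"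
      using wt_nonneg[of x] by (simp only: abs_mult abs_of_nonneg distrib_right mult.assoc)
  qed
  also have "\<dots> = sqrt B / 2 * (LINT x|\<nu>. (poly p x)\<^sup>2 * wt x) + 1 / (2 * sqrt B) * (LINT x|\<nu>. (poly q x)\<^sup>2 * wt x)"
    by (subst Bochner_Integration.integral_add)
      (auto intro!: integrable_mult_right integrable_wt[OF \<nu>] continuous_intros)
  also have "\<dots> \<le> sqrt B / 2 * 1 + 1 / (2 * sqrt B) * B"
    unfolding p1 using B by (intro add_mono mult_left_mono) auto
  also have "\<dots> = sqrt B" using B(2) by (simp add: field_simps)
  finally show ?thesis using lp unfolding c_def by (simp add: abs_divide pos_divide_le_eq mult.commute)
qed

end

section \<open>The trial polynomial and the lower bound for the leading coefficient\<close>

lemma compact_bound_pos: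
  fixes f :: "'a::topological_space \<Rightarrow> 'b::real_normed_vector"
  assumes "compact S" "continuous_on S f"
  obtains M where "M \<ge> 1" "\<And>x. x \<in> S \<Longrightarrow> norm (f x) \<le> M"
proof -
  have "bounded (f ` S)" by (intro compact_imp_bounded compact_continuous_image assms)
  then obtain B where B: "\<And>y. y \<in> f ` S \<Longrightarrow> norm y \<le> B" unfolding bounded_iff by auto
  show thesis
    by (rule that[of "max 1 B"]) (use B in \<open>auto simp: le_max_iff_disj\<close>)
qed

lemma poly_Re_part: "poly (map_poly Re q) x = Re (poly q (of_real x))"
  by (induction q) (simp_all add: map_poly_pCons)

context conj_nodes
begin

lemma phase_cnj: "phase Q (cnj s) = cnj (phase Q s)"
  using texp_cnj[of Q "1 / s"] by (simp add: phase_def texp_cnj D_cnj N_cnj)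

lemma phase_cpt_measurable: "(\<lambda>x. Re (phase Q (cpt x))) \<in> borel_measurable borel"
proof -
  have t: "texp Q \<in> borel_measurable borel" unfolding texp_def
    by (intro borel_measurable_continuous_onI continuous_intros)
  have d: "D \<in> borel_measurable borel" "N \<in> borel_measurable borel"
    by (intro borel_measurable_continuous_onI continuous_intros)+
  note [measurable] = t d
  show ?thesis unfolding phase_def by measurable
qed

lemma integral_phase_cpt: "(LINT x|arcsine. Re (phase Q (cpt x))) = Re (LINT t|circ. phase Q (ept t))"
proof -
  have "(LINT x|arcsine. Re (phase Q (cpt x))) = (LINT t|circ. Re (phase Q (cpt (ecos t))))"
    by (rule integral_arcsine[OF phase_cpt_measurable])
  also have "\<dots> = (LINT t|circ. Re (phase Q (ept t)))"
    by (intro Bochner_Integration.integral_cong refl) (rule cpt_symmetric(2)[of "phase Q", OF phase_cnj])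
  also have "\<dots> = Re (LINT t|circ. phase Q (ept t))"
    by (intro integral_Re integrable_circ_continuous continuous_phase)
  finally show ?thesis .
qed

lemma abs_Re_phase_le: "x \<in> {-1..1} \<Longrightarrow> \<bar>Re (phase Q (cpt x))\<bar> \<le> 1"
proof -
  assume "x \<in> {-1..1}"
  then have "-1 \<le> x" "x \<le> 1" by auto
  then obtain t where "x = ecos t" by (rule obtain_circle_angle)
  then show ?thesis
    using cpt_symmetric(2)[of "phase Q", OF phase_cnj, of t] abs_Re_le_cmod[of "phase Q (ept t)"] norm_phase[of Q t] by simp
qed

text \<open>The ideal boundary form of the trial polynomial is \<open>T (1 + U)\<close>. Its squared
  modulus splits into a main term and a term linear in the phase, which is later small on
  average.\<close>

lemma norm_texp_add_phase:
  assumes "analytic_half l Q"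
  shows "(norm (texp Q (ept t) + N (ept t) / D (ept t) * texp Q (1 / ept t)))\<^sup>2
    = exp (poly l (ecos t)) * (2 + 2 * Re (phase Q (ept t)))"
proof -
  interpret analytic_half l Q by fact
  have "texp Q (ept t) + N (ept t) / D (ept t) * texp Q (1 / ept t) = texp Q (ept t) * (1 + phase Q (ept t))"
    by (simp add: phase_def distrib_left)
  then have "(norm (texp Q (ept t) + N (ept t) / D (ept t) * texp Q (1 / ept t)))\<^sup>2
      = exp (poly l (ecos t)) * (norm (1 + phase Q (ept t)))\<^sup>2"
    by (simp add: norm_mult power_mult_distrib norm_texp_ept)
  also have "(norm (1 + phase Q (ept t)))\<^sup>2 = 2 + 2 * Re (phase Q (ept t))"
    using norm_diff_square_complex[of "phase Q (ept t)" "-1"] norm_phase[of Q t] by (simp add: add.commute)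
  finally show ?thesis .
qed

text \<open>Replacing \<open>s\<close> by \<open>1 / s\<close> and multiplying by the power
  \<open>m\<close> exchanges \<open>N\<close> and \<open>D\<close>. The identity becomes
  \<open>P' = T D - N R\<close> with \<open>P'\<close> the reversal of \<open>P\<close>, and its
  value at 0 is the top coefficient.\<close>

lemma trial_coefficient:
  assumes P: "degree P < m"
    and id: "\<And>s. s \<noteq> 0 \<Longrightarrow> poly T (1 / s) * N s = D s * poly R (1 / s) + s * poly P s"
  shows "coeff P (m - 1) = poly T 0 - N 0 * poly R 0"
proof -
  define P' where "P' = (\<Sum>i<m. monom (coeff P i) (m - 1 - i))"
  have P'0: "poly P' 0 = coeff P (m - 1)"
  proof -
    have "poly P' 0 = (\<Sum>i<m. if i = m - 1 then coeff P (m - 1) else 0)"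
      unfolding P'_def poly_sum poly_monom by (intro sum.cong) (auto simp: power_0_left)
    then show ?thesis using P by simp
  qed
  have eq: "poly P' s = poly T s * D s - N s * poly R s" if s: "s \<noteq> 0" for s
  proof -
    have "poly P (1 / s) = (\<Sum>i\<le>degree P. coeff P i * (1 / s) ^ i)" by (rule poly_altdef)
    also have "\<dots> = (\<Sum>i<m. coeff P i * (1 / s) ^ i)"
      using P by (intro sum.mono_neutral_left) (auto simp: coeff_eq_0)
    finally have "s ^ m * (1 / s * poly P (1 / s)) = (\<Sum>i<m. s ^ m * (1 / s * (coeff P i * (1 / s) ^ i)))"
      by (simp only: sum_distrib_left)
    also have "\<dots> = poly P' s" unfolding P'_def poly_sum poly_monom
    proof (rule sum.cong[OF refl])
      fix i assume "i \<in> {..<m}"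
      then have m: "s ^ m = s ^ Suc i * s ^ (m - 1 - i)" by (simp flip: power_add power_Suc)
      have 1: "s ^ Suc i * (1 / s) ^ Suc i = 1" unfolding power_mult_distrib[symmetric] using s by simp
      have "s ^ m * (1 / s * (coeff P i * (1 / s) ^ i)) = (s ^ Suc i * (1 / s) ^ Suc i) * (coeff P i * s ^ (m - 1 - i))"
        unfolding m power_Suc[of "1 / s"] by (simp only: mult_ac)
      then show "s ^ m * (1 / s * (coeff P i * (1 / s) ^ i)) = coeff P i * s ^ (m - 1 - i)"
        unfolding 1 by simp
    qed
    finally have 1: "poly P' s = s ^ m * (1 / s * poly P (1 / s))" ..
    have i1: "poly T s * N (1 / s) = D (1 / s) * poly R s + 1 / s * poly P (1 / s)"
      using id[of "1 / s"] s by simp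
    have i2: "s ^ m * N (1 / s) = D s" "s ^ m * D (1 / s) = N s"
      using nump_reflect[of "1 / s" \<alpha> m] nump_reflect[of s \<alpha> m] s by (simp_all add: power_one_over)
    have "poly P' s = s ^ m * (poly T s * N (1 / s) - D (1 / s) * poly R s)" unfolding 1 using i1 by simp
    also have "\<dots> = poly T s * (s ^ m * N (1 / s)) - (s ^ m * D (1 / s)) * poly R s" by (simp add: algebra_simps)
    finally show ?thesis unfolding i2 .
  qed
  \<comment> \<open>The reflected identity is known only for \<open>s \<noteq> 0\<close>; agreement
    at infinitely many points extends it to 0.\<close>
  have "P' = T * denp \<alpha> m - nump \<alpha> m * R"
  proof (rule ccontr)
    let ?Z = "P' - (T * denp \<alpha> m - nump \<alpha> m * R)"
    assume "P' \<noteq> T * denp \<alpha> m - nump \<alpha> m * R"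
    then have "finite {s. poly ?Z s = 0}" by (intro poly_roots_finite) simp
    moreover have "UNIV - {0} \<subseteq> {s. poly ?Z s = 0}" using eq by auto
    ultimately have "finite (UNIV - {0 :: complex})" by (rule finite_subset[rotated])
    then show False using infinite_UNIV_char_0[where 'a = complex] by simp
  qed
  then show ?thesis using P'0 by simp
qed

text \<open>Both halves of the symmetrised remainder are rewritten by the division identity at
  \<open>s\<close> and \<open>1 / s\<close>. After dividing by \<open>D\<close> there remains
  \<open>T(s) + b T(1/s)\<close>, with errors from \<open>R\<close> and from the polynomial
  approximation of \<open>texp Q\<close>.\<close>

lemma trial_pointwise:
  assumes half: "analytic_half l Q"
    and id: "\<And>s. s \<noteq> 0 \<Longrightarrow> poly T (1 / s) * N s = D s * poly R (1 / s) + s * poly P s"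
    and T: "\<And>s. norm s \<le> 1 \<Longrightarrow> norm (poly T s - texp Q s) \<le> d" and R: "\<And>s. norm s \<le> 1 \<Longrightarrow> norm (poly R s) \<le> \<kappa>"
    and M: "\<And>s. norm s \<le> 1 \<Longrightarrow> norm (texp Q s) \<le> M"
    and q: "\<And>s. s \<noteq> 0 \<Longrightarrow> poly q (joukowski s) = s ^ n * (1 / s) * poly P (1 / s) + (1 / s) ^ n * s * poly P s"
    and m: "m = 2 * n" and e: "2 * (d + \<kappa>) \<le> 1"
  shows "(norm (poly q (of_real (ecos t))))\<^sup>2 * wt (ecos t)
    \<le> cc * (exp (poly l (ecos t)) * (2 + 2 * Re (phase Q (ept t))) + (4 * M + 1) * (2 * (d + \<kappa>)))"
proof -
  let ?e = "ept t"
  define y where "y = 1 / ?e"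
  define b where "b = N ?e / D ?e"
  have Dn: "D ?e \<noteq> 0" by (rule D_nonzero) simp
  have ye: "?e * y = 1" by (simp add: y_def)
  have ny: "norm y = 1" by (simp add: y_def norm_divide)
  have nb: "norm b = 1" using Dn norm_N_circle[of t] by (simp add: b_def norm_divide)
  have e0: "0 \<le> d" "0 \<le> \<kappa>" using order_trans[OF norm_ge_zero T[of 0]] order_trans[OF norm_ge_zero R[of 0]] by simp_all
  have i1: "?e * poly P ?e = poly T y * N ?e - D ?e * poly R y" using id[of ?e] by (simp add: y_def)
  have i2: "y * poly P y = poly T ?e * N y - D y * poly R ?e" using id[of y] by (simp add: y_def)
  have r1: "N ?e = ?e ^ m * D y" using nump_reflect[of ?e \<alpha> m] by (simp add: y_def)
  have r2: "?e ^ m * N y = D ?e" using nump_reflect[of y \<alpha> m] by (simp add: y_def power_one_over)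
  have pw: "?e ^ n * y ^ n = 1" unfolding power_mult_distrib[symmetric] ye by simp
  have em: "?e ^ n * ?e ^ n = ?e ^ m" by (simp add: m power_add mult_2)
  have "poly q (of_real (ecos t)) * ?e ^ n = (?e ^ n * ?e ^ n) * (y * poly P y) + (?e ^ n * y ^ n) * (?e * poly P ?e)"
  proof -
    have "poly q (of_real (ecos t)) = ?e ^ n * y * poly P y + y ^ n * ?e * poly P ?e"
      using q[of ?e, OF ept_nonzero, unfolded joukowski_ept] unfolding y_def .
    moreover have "(A * y * B + C * ?e * F) * A = (A * A) * (y * B) + (A * C) * (?e * F)" for A B C F
      by (simp add: algebra_simps)
    ultimately show ?thesis by simp
  qed
  \<comment> \<open>Uses \<open>m = 2 * n\<close> in \<open>em\<close>; the reflections
    \<open>r1\<close> and \<open>r2\<close> then trade \<open>N\<close> and \<open>D\<close>, so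
    that \<open>D\<close> factors out and cancels against the weight.\<close>
  also have "\<dots> = poly T ?e * (?e ^ m * N y) - (?e ^ m * D y) * poly R ?e + (poly T y * N ?e - D ?e * poly R y)"
    unfolding em pw i1 i2 by (simp add: algebra_simps)
  also have "\<dots> = D ?e * (poly T ?e - b * poly R ?e + poly T y * b - poly R y)"
    unfolding r2 r1[symmetric] using Dn by (simp add: b_def algebra_simps)
  finally have qX: "poly q (of_real (ecos t)) * ?e ^ n = D ?e * (poly T ?e - b * poly R ?e + poly T y * b - poly R y)"
    (is "_ = _ * ?X") .
  define A where "A = norm (texp Q ?e + b * texp Q y)"
  define \<epsilon> where "\<epsilon> = 2 * (d + \<kappa>)"
  have A2: "A\<^sup>2 = exp (poly l (ecos t)) * (2 + 2 * Re (phase Q ?e))"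
    unfolding A_def b_def y_def by (rule norm_texp_add_phase[OF half])
  have AM: "A \<le> 2 * M"
  proof -
    have "A \<le> norm (texp Q ?e) + norm b * norm (texp Q y)"
      unfolding A_def by (rule order_trans[OF norm_triangle_ineq]) (simp add: norm_mult)
    then show ?thesis using M[of ?e] M[of y] ny nb by simp
  qed
  have X: "norm ?X \<le> A + \<epsilon>"
  proof -
    have "?X = (texp Q ?e + b * texp Q y) + (poly T ?e - texp Q ?e) + b * (poly T y - texp Q y) + - (b * poly R ?e) + - poly R y"
      by (simp add: algebra_simps)
    also have "norm \<dots> \<le> A + d + d + \<kappa> + \<kappa>"
      unfolding A_def using T[of ?e] T[of y] R[of ?e] R[of y] ny nb
      by (intro norm_triangle_mono) (simp_all add: norm_mult)
    finally show ?thesis by (simp add: \<epsilon>_def)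
  qed
  have \<epsilon>: "0 \<le> \<epsilon>" "\<epsilon> \<le> 1" using e e0 by (auto simp: \<epsilon>_def)
  have "(norm ?X)\<^sup>2 \<le> (A + \<epsilon>)\<^sup>2" using X by (intro power_mono) auto
  also have "\<dots> = A\<^sup>2 + (2 * A + \<epsilon>) * \<epsilon>" by (simp add: power2_eq_square algebra_simps)
  also have "\<dots> \<le> A\<^sup>2 + (4 * M + 1) * \<epsilon>" using AM \<epsilon> by (intro add_left_mono mult_right_mono) auto
  finally have X2: "(norm ?X)\<^sup>2 \<le> A\<^sup>2 + (4 * M + 1) * \<epsilon>" .
  have "norm (poly q (of_real (ecos t))) = norm (D ?e) * norm ?X"
    using arg_cong[OF qX, of norm] by (simp add: norm_mult norm_power)
  then have "(norm (poly q (of_real (ecos t))))\<^sup>2 * wt (ecos t) = cc * (norm ?X)\<^sup>2"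
    unfolding wt_ecos using Dn by (simp add: power_mult_distrib)
  also have "\<dots> \<le> cc * (A\<^sup>2 + (4 * M + 1) * \<epsilon>)" using X2 cc_pos by (intro mult_left_mono) auto
  finally show ?thesis unfolding A2 \<epsilon>_def .
qed

end

text \<open>The trial polynomial has leading coefficient about \<open>2 ^ n * T(0)\<close> and
  squared norm about \<open>2 * cc\<close>; extremality converts this into a bound for
  \<open>p\<close>. The choice of \<eta> precedes nodes, degree and weight.\<close>

lemma leading_coeff_lower_bound:
  assumes half: "analytic_half l Q" and \<delta>: "0 < \<delta>" "\<delta> \<le> 1"
  obtains \<eta> where "\<eta> > 0" "\<And>\<alpha> n \<nu> p. n > 0 \<Longrightarrow> conj_nodes \<alpha> (2 * n) \<Longrightarrow>
      (\<And>s. norm s \<le> 1/2 \<Longrightarrow> norm (poly (nump \<alpha> (2 * n)) s) \<le> \<eta> * norm (poly (denp \<alpha> (2 * n)) s)) \<Longrightarrow>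
      finite_measure_on_interval \<nu> \<Longrightarrow> log_integrable \<nu> \<Longrightarrow> (LINT x|\<nu>. exp (poly l x)) \<le> 1 + \<delta> ^ 4 \<Longrightarrow>
      (LINT x|arcsine. poly l x + ln (ac_deriv \<nu> x)) \<ge> - (\<delta> ^ 4) \<Longrightarrow>
      conj_nodes.orth_real \<alpha> (2 * n) \<nu> n p \<Longrightarrow>
      (1 - 5 * \<delta>\<^sup>2) * exp (poly Q 0) \<le> sqrt (2 * conj_nodes.cc \<alpha> (2 * n)) * lead_coeff p / 2 ^ n"
proof -
  have \<delta>4: "0 < \<delta> ^ 4" "\<delta> ^ 4 \<le> \<delta>\<^sup>2" "\<delta>\<^sup>2 \<le> 1" "0 < \<delta>\<^sup>2"
    using \<delta> power_decreasing[of 2 4 \<delta>] by (auto simp: power_le_one)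
  define t0 where "t0 = exp (poly Q 0)"
  have t0: "t0 > 0" by (simp add: t0_def)
  have ct: "continuous_on (cball 0 1) (texp Q)" unfolding texp_def by (intro continuous_intros)
  obtain M where M: "M \<ge> 1" "\<And>s. s \<in> cball 0 1 \<Longrightarrow> norm (texp Q s) \<le> M"
    by (rule compact_bound_pos[OF compact_cball ct]) blast
  have cl: "continuous_on {-1..1} (\<lambda>x. exp (- poly l x))" by (intro continuous_intros)
  obtain L where L: "L \<ge> 1" "\<And>x. x \<in> {-1..1} \<Longrightarrow> norm (exp (- poly l x)) \<le> L"
    by (rule compact_bound_pos[OF compact_Icc cl]) blast
  obtain K where K: "K > 0" "\<And>\<alpha> m \<eta> (s :: complex). conj_nodes \<alpha> m \<Longrightarrow> 0 \<le> \<eta> \<Longrightarrow>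
      (\<And>z. norm z \<le> (1 + 0) / 2 \<Longrightarrow> norm (poly (nump \<alpha> m) z) \<le> \<eta> * norm (poly (denp \<alpha> m) z)) \<Longrightarrow>
      norm s \<le> 0 \<Longrightarrow> norm (LINT t|circ. conj_nodes.phase \<alpha> m Q (ept t) * pk s (ecos t)) \<le> K * \<eta>"
    by (rule phase_integral_bound[of 0 Q]) (simp, simp, blast)
  \<comment> \<open>The pointwise error \<open>(4 * M + 1) * e0\<close> is integrated against a
    measure of mass at most \<open>2 * L\<close>, which leaves
    \<open>\<delta>\<^sup>2 / 2\<close>.\<close>
  define e0 where "e0 = min 1 (\<delta>\<^sup>2 / (4 * L * (4 * M + 1)))"
  have e0: "0 < e0" "e0 \<le> 1" "(4 * M + 1) * e0 * L \<le> \<delta>\<^sup>2 / 4"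
  proof -
    show "0 < e0" using \<delta>4 L M by (simp add: e0_def)
    have "(4 * M + 1) * e0 * L \<le> (4 * M + 1) * (\<delta>\<^sup>2 / (4 * L * (4 * M + 1))) * L"
      using L M by (intro mult_right_mono mult_left_mono) (auto simp: e0_def)
    also have "\<dots> = \<delta>\<^sup>2 / 4"
    proof -
      have "W * (\<delta>\<^sup>2 / (4 * L * W)) * L = \<delta>\<^sup>2 / 4" if "W > 0" for W :: real using that L(1) by simp
      from this[of "4 * M + 1"] show ?thesis using M(1) by linarith
    qed
    finally show "(4 * M + 1) * e0 * L \<le> \<delta>\<^sup>2 / 4" .
  qed (simp add: e0_def)
  \<comment> \<open>Three uses: the error \<open>4 * e1\<close> in the trial function, the deviation
    \<open>2 * e1\<close> of its leading coefficient from \<open>t0\<close>, and the mean of the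
    phase.\<close>
  define e1 where "e1 = Min {e0 / 4, t0 * \<delta>\<^sup>2 / 2, \<delta>\<^sup>2 / 2}"
  have e1: "e1 > 0" "e1 \<le> e0 / 4" "e1 \<le> t0 * \<delta>\<^sup>2 / 2" "e1 \<le> \<delta>\<^sup>2 / 2"
    using e0 t0 \<delta>4 by (auto simp: e1_def)
  obtain T where T: "\<And>s. norm s \<le> 1 \<Longrightarrow> norm (poly T s - texp Q s) \<le> e1"
    by (rule texp_poly_approx[OF e1(1), of Q]) blast
  obtain C where C: "C \<ge> 0" "\<And>N D m \<eta>. m > 0 \<Longrightarrow> degree N \<le> m \<Longrightarrow> degree D \<le> m \<Longrightarrow> poly D 0 = 1 \<Longrightarrow>
     (\<And>s. norm s < 1 \<Longrightarrow> poly D s \<noteq> 0) \<Longrightarrow> (\<And>s. norm s \<le> 1/2 \<Longrightarrow> norm (poly N s) \<le> \<eta> * norm (poly D s))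
     \<Longrightarrow> \<exists>P R. degree P < m \<and> (\<forall>s. s \<noteq> 0 \<longrightarrow> poly T (1 / s) * poly N s = poly D s * poly R (1 / s) + s * poly P s)
          \<and> (\<forall>s. norm s \<le> 1 \<longrightarrow> norm (poly R s) \<le> C * \<eta>)
          \<and> (\<forall>s. norm s \<le> 1/2 \<longrightarrow> norm (poly P s) \<le> C * \<eta> * norm (poly D s))"
    using blaschke_division[of T] by blast
  define \<eta> where "\<eta> = e1 / (C + K + 1)"
  have CK: "C + K + 1 > 0" using C K by simp
  have \<eta>: "\<eta> > 0" "C * \<eta> \<le> e1" "K * \<eta> \<le> e1"
  proof -
    show "\<eta> > 0" using e1 CK by (simp add: \<eta>_def)
    have "C * e1 \<le> e1 * (C + K + 1)" "K * e1 \<le> e1 * (C + K + 1)" using e1 C K by (simp_all add: algebra_simps)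
    then show "C * \<eta> \<le> e1" "K * \<eta> \<le> e1" unfolding \<eta>_def using CK by (simp_all add: pos_divide_le_eq)
  qed
  show thesis
  proof (rule that[OF \<eta>(1)])
    fix \<alpha> n \<nu> p
    assume n: "n > 0" and cn: "conj_nodes \<alpha> (2 * n)"
      and ND: "\<And>s. norm s \<le> 1/2 \<Longrightarrow> norm (poly (nump \<alpha> (2 * n)) s) \<le> \<eta> * norm (poly (denp \<alpha> (2 * n)) s)"
      and \<nu>: "finite_measure_on_interval \<nu>" "log_integrable \<nu>" "(LINT x|\<nu>. exp (poly l x)) \<le> 1 + \<delta> ^ 4"
        "(LINT x|arcsine. poly l x + ln (ac_deriv \<nu> x)) \<ge> - (\<delta> ^ 4)"
      and orth: "conj_nodes.orth_real \<alpha> (2 * n) \<nu> n p"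
    interpret conj_nodes \<alpha> "2 * n" by fact
    interpret \<nu>: finite_measure \<nu> using \<nu>(1) by (rule finite_on_interval)
    have "\<exists>P R. degree P < 2 * n \<and> (\<forall>s. s \<noteq> 0 \<longrightarrow> poly T (1 / s) * N s = D s * poly R (1 / s) + s * poly P s)
          \<and> (\<forall>s. norm s \<le> 1 \<longrightarrow> norm (poly R s) \<le> C * \<eta>) \<and> (\<forall>s. norm s \<le> 1/2 \<longrightarrow> norm (poly P s) \<le> C * \<eta> * norm (D s))"
      by (rule C(2)) (use n ND degree_nump degree_denp D_nonzero in auto)
    then obtain P R where P: "degree P < 2 * n" and id: "\<And>s. s \<noteq> 0 \<Longrightarrow> poly T (1 / s) * N s = D s * poly R (1 / s) + s * poly P s"
      and R: "\<And>s. norm s \<le> 1 \<Longrightarrow> norm (poly R s) \<le> C * \<eta>" by blast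
    have R': "norm (poly R s) \<le> e1" if "norm s \<le> 1" for s using R[OF that] \<eta>(2) by linarith
    obtain q where q: "degree q \<le> n" "coeff q n = 2 ^ n * coeff P (2 * n - 1)"
      "\<And>s. s \<noteq> 0 \<Longrightarrow> poly q (joukowski s) = s ^ n * (1 / s) * poly P (1 / s) + (1 / s) ^ n * s * poly P s"
      by (rule laurent_symmetrisation[OF n P]) blast
    \<comment> \<open>Real parts of the coefficients give a real competitor that is no larger on the
      real line and keeps the real part of the top coefficient.\<close>
    define qr where "qr = map_poly Re q"
    have qrd: "degree qr \<le> n" unfolding qr_def
      by (rule degree_le) (use q(1) in \<open>auto simp: coeff_map_poly coeff_eq_0\<close>)
    have cP: "Re (coeff P (2 * n - 1)) \<ge> t0 * (1 - \<delta>\<^sup>2)"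
    proof -
      have eq: "coeff P (2 * n - 1) = poly T 0 - N 0 * poly R 0" by (rule trial_coefficient[OF P id])
      have "norm (N 0) \<le> 1" using N_le_D'[of 0] by simp
      then have "norm (N 0) * norm (poly R 0) \<le> 1 * e1" using R'[of 0] by (intro mult_mono) auto
      then have "norm (coeff P (2 * n - 1) - of_real t0) \<le> e1 + e1"
        unfolding eq using T[of 0] norm_triangle_ineq4[of "poly T 0 - of_real t0" "N 0 * poly R 0"]
        by (simp add: texp_0 t0_def norm_mult algebra_simps)
      then have "\<bar>Re (coeff P (2 * n - 1) - of_real t0)\<bar> \<le> e1 + e1" using abs_Re_le_cmod order_trans by blast
      then show ?thesis using e1(3) by (simp add: algebra_simps abs_le_iff)
    qed
    have qrn: "coeff qr n = 2 ^ n * Re (coeff P (2 * n - 1))"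
    proof -
      have r: "Re (of_real a * z) = a * Re z" for a z by simp
      have "coeff qr n = Re (coeff q n)" by (simp add: qr_def coeff_map_poly)
      also have "coeff q n = of_real (2 ^ n) * coeff P (2 * n - 1)" using q(2) by simp
      finally show ?thesis unfolding r .
    qed
    define \<psi> where "\<psi> x = Re (phase Q (cpt x))" for x
    have \<psi>m: "\<psi> \<in> borel_measurable borel" unfolding \<psi>_def by (rule phase_cpt_measurable)
    have \<psi>1: "\<bar>\<psi> x\<bar> \<le> 1" if "x \<in> {-1..1}" for x unfolding \<psi>_def by (rule abs_Re_phase_le[OF that])
    have pw: "(poly qr x)\<^sup>2 * wt x \<le> cc * (2 * exp (poly l x) + 2 * (\<psi> x * exp (poly l x)) + (4 * M + 1) * e0)"
      if x: "x \<in> {-1..1}" for x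
    proof -
      have "-1 \<le> x" "x \<le> 1" using x by auto
      then obtain t where t: "x = ecos t" by (rule obtain_circle_angle)
      have "(poly qr x)\<^sup>2 \<le> (norm (poly q (of_real x)))\<^sup>2"
        unfolding qr_def poly_Re_part using abs_Re_le_cmod[of "poly q (of_real x)"] by (metis abs_ge_zero power2_abs power_mono)
      then have "(poly qr x)\<^sup>2 * wt x \<le> (norm (poly q (of_real x)))\<^sup>2 * wt x" by (rule mult_right_mono) (rule wt_nonneg)
      also have "\<dots> \<le> cc * (exp (poly l x) * (2 + 2 * Re (phase Q (ept t))) + (4 * M + 1) * (2 * (e1 + e1)))"
        unfolding t by (rule trial_pointwise[OF half id T R' _ q(3)]) (use M e0 e1 in auto)
      also have "Re (phase Q (ept t)) = \<psi> x" unfolding \<psi>_def t by (rule cpt_symmetric(2)[of "phase Q", OF phase_cnj, symmetric])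
      also have "cc * (exp (poly l x) * (2 + 2 * \<psi> x) + (4 * M + 1) * (2 * (e1 + e1)))
          \<le> cc * (exp (poly l x) * (2 + 2 * \<psi> x) + (4 * M + 1) * e0)"
        using cc_pos M e1 by (intro mult_left_mono add_left_mono) auto
      finally show ?thesis by (simp add: algebra_simps)
    qed
    have iel: "integrable \<nu> (\<lambda>x. exp (poly l x))"
      by (intro integrable_poly_on_interval[OF \<nu>(1)] continuous_intros) measurable
    have i\<psi>: "integrable \<nu> (\<lambda>x. \<psi> x * exp (poly l x))"
    proof (rule Bochner_Integration.integrable_bound[OF iel])
      show "(\<lambda>x. \<psi> x * exp (poly l x)) \<in> borel_measurable \<nu>"
        unfolding measurable_on_interval[OF \<nu>(1)] using \<psi>m by measurable
      show "AE x in \<nu>. norm (\<psi> x * exp (poly l x)) \<le> norm (exp (poly l x))"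
        using AE_on_interval[OF \<nu>(1)]
      proof eventually_elim
        case (elim x)
        show ?case using \<psi>1[OF elim] by (simp add: abs_mult)
      qed
    qed
    \<comment> \<open>The bound on the integral of \<open>exp l\<close> controls the total mass,
      since \<open>exp l \<ge> 1 / L\<close> on the interval.\<close>
    have mass: "measure \<nu> UNIV \<le> 2 * L"
    proof -
      have "measure \<nu> UNIV = (LINT x|\<nu>. 1)" by (simp add: space_on_interval[OF \<nu>(1)])
      also have "\<dots> \<le> (LINT x|\<nu>. L * exp (poly l x))"
      proof (rule integral_mono_AE)
        show "AE x in \<nu>. 1 \<le> L * exp (poly l x)"
          using AE_on_interval[OF \<nu>(1)]
        proof eventually_elim
          case (elim x)
          have "exp (- poly l x) * exp (poly l x) \<le> L * exp (poly l x)"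
            using L(2)[OF elim] by (intro mult_right_mono) auto
          then show ?case by (simp flip: exp_add)
        qed
      qed (use iel in auto)
      also have "\<dots> = L * (LINT x|\<nu>. exp (poly l x))" by simp
      also have "\<dots> \<le> L * 2" using \<nu>(3) \<delta>4 L by (intro mult_left_mono) auto
      finally show ?thesis by simp
    qed
    have \<psi>int: "(LINT x|\<nu>. \<psi> x * exp (poly l x)) \<le> 6 * \<delta>\<^sup>2 + \<delta>\<^sup>2 / 2"
    proof -
      have "norm (LINT t|circ. phase Q (ept t) * pk 0 (ecos t)) \<le> K * \<eta>"
        by (rule K(2)[OF cn]) (use \<eta>(1) ND in auto)
      then have "(LINT x|arcsine. \<psi> x) \<le> K * \<eta>"
        unfolding \<psi>_def integral_phase_cpt using complex_Re_le_cmod[of "LINT t|circ. phase Q (ept t)"] by simp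
      then show ?thesis
        using near_extremal_estimates(10)[OF \<nu>(1,2) \<delta> \<nu>(3,4) \<psi>m \<psi>1] \<eta>(3) e1(4) by (simp add: abs_le_iff)
    qed
    \<comment> \<open>The 8 collects, after halving, \<open>2\<close> from the mass,
      \<open>13\<close> from the phase term and \<open>1/2\<close> from the pointwise error, rounded
      up.\<close>
    define B where "B = 2 * cc * (1 + 8 * \<delta>\<^sup>2)"
    have qB: "(LINT x|\<nu>. (poly qr x)\<^sup>2 * wt x) \<le> B"
    proof -
      have "(LINT x|\<nu>. (poly qr x)\<^sup>2 * wt x)
          \<le> (LINT x|\<nu>. cc * (2 * exp (poly l x) + 2 * (\<psi> x * exp (poly l x)) + (4 * M + 1) * e0))"
        by (rule integral_mono_AE[OF integrable_wt[OF \<nu>(1)] _ eventually_mono[OF AE_on_interval[OF \<nu>(1)] pw]])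
          (use iel i\<psi> in \<open>auto intro!: continuous_intros\<close>)
      also have "\<dots> = cc * (2 * (LINT x|\<nu>. exp (poly l x)) + 2 * (LINT x|\<nu>. \<psi> x * exp (poly l x)) + (4 * M + 1) * e0 * measure \<nu> UNIV)"
        using iel i\<psi> by (simp add: space_on_interval[OF \<nu>(1)] mult.commute[of "measure \<nu> UNIV"])
      also have "\<dots> \<le> cc * (2 * (1 + \<delta> ^ 4) + 2 * (6 * \<delta>\<^sup>2 + \<delta>\<^sup>2 / 2) + (4 * M + 1) * e0 * (2 * L))"
        using cc_pos \<nu>(3) \<psi>int mass M e0 by (intro mult_left_mono add_mono) auto
      also have "\<dots> \<le> cc * (2 * (1 + 8 * \<delta>\<^sup>2))"
      proof (rule mult_left_mono)
        have eq: "(4 * M + 1) * e0 * (2 * L) = 2 * ((4 * M + 1) * e0 * L)" by (simp only: mult_ac)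
        have arith: "2 * (1 + a) + 2 * (6 * b + b / 2) + 2 * y \<le> 2 * (1 + 8 * b)"
          if "a \<le> b" "y \<le> b / 4" "0 < b" for a b y :: real using that by argo
        show "2 * (1 + \<delta> ^ 4) + 2 * (6 * \<delta>\<^sup>2 + \<delta>\<^sup>2 / 2) + (4 * M + 1) * e0 * (2 * L) \<le> 2 * (1 + 8 * \<delta>\<^sup>2)"
          unfolding eq by (rule arith[OF \<delta>4(2) e0(3) \<delta>4(4)])
      qed (use cc_pos in simp)
      also have "\<dots> = B" by (simp add: B_def)
      finally show ?thesis .
    qed
    have B0: "B > 0" using cc_pos \<delta>4 by (simp add: B_def add_pos_pos)
    have "coeff qr n \<le> lead_coeff p * sqrt B"
      using extremal_inequality[OF \<nu>(1) orth qrd qB B0] by linarith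
    also have "sqrt B = sqrt (2 * cc) * sqrt (1 + 8 * \<delta>\<^sup>2)" by (simp add: B_def real_sqrt_mult)
    finally have up: "2 ^ n * Re (coeff P (2 * n - 1)) \<le> lead_coeff p * (sqrt (2 * cc) * sqrt (1 + 8 * \<delta>\<^sup>2))"
      unfolding qrn .
    have "2 ^ n * (t0 * (1 - \<delta>\<^sup>2)) \<le> 2 ^ n * Re (coeff P (2 * n - 1))" by (rule mult_left_mono[OF cP]) simp
    then have "2 ^ n * (t0 * (1 - \<delta>\<^sup>2)) \<le> lead_coeff p * (sqrt (2 * cc) * sqrt (1 + 8 * \<delta>\<^sup>2))"
      using up by (rule order_trans)
    moreover have "a \<le> S * b / 2 ^ n * W" if "2 ^ n * a \<le> b * (S * W)" for a b S W :: real
      using that by (simp add: field_simps)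
    ultimately have fin: "t0 * (1 - \<delta>\<^sup>2) \<le> (sqrt (2 * cc) * lead_coeff p / 2 ^ n) * sqrt (1 + 8 * \<delta>\<^sup>2)"
      by blast
    define X where "X = sqrt (2 * cc) * lead_coeff p / 2 ^ n"
    have lp: "lead_coeff p > 0" using orth unfolding orth_real_def by blast
    have X: "X > 0" unfolding X_def using cc_pos by (intro divide_pos_pos mult_pos_pos lp) simp_all
    \<comment> \<open>The constant 5 arises from \<open>(1 - 5 x) (1 + 4 x) \<le> 1 - x\<close> with
      \<open>x = \<delta>\<^sup>2\<close>.\<close>
    have "sqrt (1 + 8 * \<delta>\<^sup>2) \<le> 1 + 4 * \<delta>\<^sup>2"
      by (rule real_le_lsqrt) (use \<delta> in \<open>simp_all add: power2_eq_square algebra_simps\<close>)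
    then have "X * sqrt (1 + 8 * \<delta>\<^sup>2) \<le> X * (1 + 4 * \<delta>\<^sup>2)" using X by (intro mult_left_mono) auto
    with fin[folded X_def] have "t0 * (1 - \<delta>\<^sup>2) \<le> X * (1 + 4 * \<delta>\<^sup>2)" by (rule order_trans)
    moreover have "t0 * ((1 - 5 * \<delta>\<^sup>2) * (1 + 4 * \<delta>\<^sup>2)) \<le> t0 * (1 - \<delta>\<^sup>2)"
      using t0 by (intro mult_left_mono) (simp_all add: algebra_simps)
    ultimately have "t0 * ((1 - 5 * \<delta>\<^sup>2) * (1 + 4 * \<delta>\<^sup>2)) \<le> X * (1 + 4 * \<delta>\<^sup>2)" by (rule order_trans[rotated])
    then have "((1 - 5 * \<delta>\<^sup>2) * t0) * (1 + 4 * \<delta>\<^sup>2) \<le> X * (1 + 4 * \<delta>\<^sup>2)" by (simp only: mult_ac)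
    moreover have "1 + 4 * \<delta>\<^sup>2 > 0" using \<delta>4 by linarith
    ultimately have "(1 - 5 * \<delta>\<^sup>2) * t0 \<le> X" by (rule mult_right_le_imp_le)
    then show "(1 - 5 * \<delta>\<^sup>2) * exp (poly Q 0) \<le> sqrt (2 * conj_nodes.cc \<alpha> (2 * n)) * lead_coeff p / 2 ^ n"
      by (simp add: X_def t0_def)
  qed
qed

text \<open>The Szego function in the disc variable, by \<open>szego_pk\<close>; it is also
  meaningful at \<open>s = 0\<close>.\<close>

definition outer :: "real measure \<Rightarrow> complex \<Rightarrow> complex" where
  "outer \<nu> s = exp ((LINT x|arcsine. pk s x * of_real (ln (ac_deriv \<nu> x))) / 2)"

lemma (in conj_nodes) lift_circle:
  assumes "degree p \<le> n"
  shows "lift_poly (cpoly p) n (ept t) = ept t ^ n * of_real (poly p (ecos t))"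
proof -
  have "degree (cpoly p) \<le> n"
    by (rule degree_le) (use assms in \<open>auto simp: coeff_map_poly coeff_eq_0\<close>)
  then show ?thesis by (subst lift_poly_eq) (simp_all only: joukowski_ept poly_cpoly_of_real ept_nonzero not_False_eq_True)
qed

text \<open>The factor \<open>sqrt (2 * cc)\<close> makes the squared modulus on the circle twice
  \<open>p^2\<close> times the weight, so its mean against the measure is 2.\<close>

definition (in conj_nodes) Hn :: "real poly \<Rightarrow> nat \<Rightarrow> complex \<Rightarrow> complex" where
  "Hn p n s = of_real (sqrt (2 * cc)) * lift_poly (cpoly p) n s / D s"

lemma (in conj_nodes) norm_Hn_circle:
  assumes "degree p \<le> n"
  shows "(norm (Hn p n (ept t)))\<^sup>2 = 2 * ((poly p (ecos t))\<^sup>2 * wt (ecos t))"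
  using cc_pos by (simp add: Hn_def lift_circle[OF assms] norm_mult norm_divide norm_power wt_ecos power_mult_distrib power_divide)

text \<open>\<open>p\<close> is real on the interval, so the numerator is a real number times
  \<open>e ^ n\<close>. Dividing by the conjugate yields \<open>e ^ (2 * n) * cnj D / D\<close>,
  which is the Blaschke product when the number of nodes is \<open>2 * n\<close>.\<close>

lemma (in conj_nodes) Hn_circle_phase:
  assumes "degree p \<le> n" "m = 2 * n"
  shows "Hn p n (ept t) / texp Q (ept t) = cnj (Hn p n (ept t) / texp Q (ept t)) * phase Q (ept t)"
proof -
  define e where "e = ept t"
  have Dn: "D e \<noteq> 0" "cnj (D e) \<noteq> 0" unfolding e_def using D_nonzero[of "ept t"] by simp_all
  have en: "cnj (e ^ n) * e ^ n = 1"
    unfolding e_def by (simp add: cnj_ept flip: power_mult_distrib)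
  have e2: "e ^ m = e ^ n * e ^ n" by (simp add: assms(2) mult_2 power_add)
  have H: "Hn p n e = of_real (sqrt (2 * cc)) * (e ^ n * of_real (poly p (ecos t))) / D e"
    unfolding Hn_def e_def lift_circle[OF assms(1)] ..
  have "cnj (Hn p n e / texp Q e) * phase Q e
      = of_real (sqrt (2 * cc)) * (cnj (e ^ n) * of_real (poly p (ecos t))) / (cnj (D e) * cnj (texp Q e))
        * (cnj (texp Q e) / texp Q e * (e ^ m * cnj (D e) / D e))"
    unfolding H unfolding e_def phase_ept N_circle by simp
  also have "\<dots> = of_real (sqrt (2 * cc)) * ((cnj (e ^ n) * e ^ n) * e ^ n * of_real (poly p (ecos t))) / (D e * texp Q e)"
    unfolding e2 using Dn by (simp add: field_simps)
  also have "\<dots> = Hn p n e / texp Q e" unfolding en H by simp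
  finally show ?thesis unfolding e_def ..
qed

section \<open>Convergence inside the disc\<close>

lemma norm_exp_diff_one_le:
  fixes z :: complex
  assumes "norm z \<le> 1" shows "norm (exp z - 1) \<le> 3 * norm z"
proof -
  have "norm (exp z - 1) \<le> exp \<bar>Re z\<bar> * norm z" using Taylor_exp[of z 0] by simp
  also have "exp \<bar>Re z\<bar> \<le> exp 1" using abs_Re_le_cmod[of z] assms by simp
  also have "exp 1 \<le> (3::real)" by (rule exp_le)
  finally show ?thesis by (simp add: mult_right_mono)
qed

text \<open>Supplies the hypotheses of \<open>circle_rigidity\<close> for \<open>f = H / T\<close>.
  Integrals against \<open>u\<close> may not be treated as values of a holomorphic function, so
  \<open>u\<close> is replaced by the squared modulus of an outer function with polynomial
  logarithm.\<close>

lemma interior_convergence: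
  assumes half: "analytic_half l Q" and \<delta>: "0 < \<delta>" "\<delta> \<le> 1" and r: "0 \<le> r" "r < 1" and small: "27 * \<delta> \<le> (1 - r)\<^sup>2"
  obtains \<eta> where "\<eta> > 0" "\<And>\<alpha> n \<nu> p s. n > 0 \<Longrightarrow> conj_nodes \<alpha> (2 * n) \<Longrightarrow>
      (\<And>s. norm s \<le> (1 + r) / 2 \<Longrightarrow> norm (poly (nump \<alpha> (2 * n)) s) \<le> \<eta> * norm (poly (denp \<alpha> (2 * n)) s)) \<Longrightarrow>
      finite_measure_on_interval \<nu> \<Longrightarrow> log_integrable \<nu> \<Longrightarrow> (LINT x|\<nu>. exp (poly l x)) \<le> 1 + \<delta> ^ 4 \<Longrightarrow>
      (LINT x|arcsine. poly l x + ln (ac_deriv \<nu> x)) \<ge> - (\<delta> ^ 4) \<Longrightarrow>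
      conj_nodes.orth_real \<alpha> (2 * n) \<nu> n p \<Longrightarrow> norm s \<le> r \<Longrightarrow>
      norm (outer \<nu> s * conj_nodes.Hn \<alpha> (2 * n) p n s - 1) \<le> 111 * \<delta> / (1 - r)\<^sup>2"
proof -
  have \<delta>4: "0 < \<delta> ^ 4" "\<delta> ^ 4 \<le> \<delta>\<^sup>2" "\<delta>\<^sup>2 \<le> 1" "0 < \<delta>\<^sup>2" "\<delta>\<^sup>2 \<le> \<delta>"
    using \<delta> power_decreasing[of 2 4 \<delta>] power_decreasing[of 1 2 \<delta>] by (auto simp: power_le_one)
  obtain \<eta>1 where \<eta>1: "\<eta>1 > 0" "\<And>\<alpha> n \<nu> p. n > 0 \<Longrightarrow> conj_nodes \<alpha> (2 * n) \<Longrightarrow>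
      (\<And>s. norm s \<le> 1/2 \<Longrightarrow> norm (poly (nump \<alpha> (2 * n)) s) \<le> \<eta>1 * norm (poly (denp \<alpha> (2 * n)) s)) \<Longrightarrow>
      finite_measure_on_interval \<nu> \<Longrightarrow> log_integrable \<nu> \<Longrightarrow> (LINT x|\<nu>. exp (poly l x)) \<le> 1 + \<delta> ^ 4 \<Longrightarrow>
      (LINT x|arcsine. poly l x + ln (ac_deriv \<nu> x)) \<ge> - (\<delta> ^ 4) \<Longrightarrow>
      conj_nodes.orth_real \<alpha> (2 * n) \<nu> n p \<Longrightarrow>
      (1 - 5 * \<delta>\<^sup>2) * exp (poly Q 0) \<le> sqrt (2 * conj_nodes.cc \<alpha> (2 * n)) * lead_coeff p / 2 ^ n"
    by (rule leading_coeff_lower_bound[OF half \<delta>]) blast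
  obtain K where K: "K > 0" "\<And>\<alpha> m \<eta> (s :: complex). conj_nodes \<alpha> m \<Longrightarrow> 0 \<le> \<eta> \<Longrightarrow>
      (\<And>z. norm z \<le> (1 + r) / 2 \<Longrightarrow> norm (poly (nump \<alpha> m) z) \<le> \<eta> * norm (poly (denp \<alpha> m) z)) \<Longrightarrow>
      norm s \<le> r \<Longrightarrow> norm (LINT t|circ. conj_nodes.phase \<alpha> m Q (ept t) * pk s (ecos t)) \<le> K * \<eta>"
    by (rule phase_integral_bound[OF r, of Q]) blast
  define \<eta> where "\<eta> = min \<eta>1 (\<delta>\<^sup>2 / K)"
  have \<eta>: "\<eta> > 0" "\<eta> \<le> \<eta>1" "K * \<eta> \<le> \<delta>\<^sup>2"
  proof -
    have "K * \<eta> \<le> K * (\<delta>\<^sup>2 / K)" using K by (intro mult_left_mono) (auto simp: \<eta>_def)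
    then show "K * \<eta> \<le> \<delta>\<^sup>2" using K by simp
  qed (use \<eta>1 K \<delta>4 in \<open>auto simp: \<eta>_def\<close>)
  define A where "A = 1 / (1 - r)\<^sup>2"
  have A: "A \<ge> 1" "27 * \<delta> * A \<le> 1"
  proof -
    have "(1 - r)\<^sup>2 \<le> 1" using r by (simp add: power_le_one)
    then show "A \<ge> 1" unfolding A_def using r by simp
    show "27 * \<delta> * A \<le> 1" unfolding A_def using small r by (simp add: pos_divide_le_eq)
  qed
  show thesis
  proof (rule that[OF \<eta>(1)])
    fix \<alpha> n \<nu> p and s :: complex
    assume n: "n > 0" and cn: "conj_nodes \<alpha> (2 * n)"
      and ND: "\<And>s. norm s \<le> (1 + r) / 2 \<Longrightarrow> norm (poly (nump \<alpha> (2 * n)) s) \<le> \<eta> * norm (poly (denp \<alpha> (2 * n)) s)"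
      and \<nu>: "finite_measure_on_interval \<nu>" "log_integrable \<nu>" "(LINT x|\<nu>. exp (poly l x)) \<le> 1 + \<delta> ^ 4"
        "(LINT x|arcsine. poly l x + ln (ac_deriv \<nu> x)) \<ge> - (\<delta> ^ 4)"
      and orth: "conj_nodes.orth_real \<alpha> (2 * n) \<nu> n p" and s: "norm s \<le> r"
    interpret conj_nodes \<alpha> "2 * n" by fact
    interpret analytic_half l Q by fact
    have dp: "degree p \<le> n" and p1: "(LINT x|\<nu>. (poly p x)\<^sup>2 * wt x) = 1" and dpn: "degree p = n"
      using orth by (auto simp: orth_real_def)
    define u where "u x = ac_deriv \<nu> x * exp (poly l x)" for x
    note ne = near_extremal_estimates[OF \<nu>(1,2) \<delta> \<nu>(3,4), folded u_def]
    obtain R where R: "R > 1" "\<And>s. s \<in> ball 0 R \<Longrightarrow> D s \<noteq> 0" by (rule D_nonzero_ball) blast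
    define f where "f = (\<lambda>s. Hn p n s / texp Q s)"
    have f: "f holomorphic_on ball 0 R"
      unfolding f_def Hn_def using R(2) by (intro holomorphic_intros) auto
    have cf: "continuous_on {0..1} (\<lambda>t. f (ept t))" by (rule continuous_on_ept_compose[OF f R(1)])
    have cf2: "continuous_on {0..1} (\<lambda>t. (norm (f (ept t)))\<^sup>2)" by (intro continuous_intros cf)
    obtain M where M: "M \<ge> 1" "\<And>t. t \<in> {0..1} \<Longrightarrow> norm ((norm (f (ept t)))\<^sup>2) \<le> M"
      by (rule compact_bound_pos[OF compact_Icc cf2]) blast
    have fu: "(norm (f (ept t)))\<^sup>2 * u (ecos t) = 2 * (ac_deriv \<nu> (ecos t) * ((poly p (ecos t))\<^sup>2 * wt (ecos t)))" for t
      unfolding f_def u_def norm_divide power_divide norm_Hn_circle[OF dp] norm_texp_ept by simp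
    have pwm: "(\<lambda>x. (poly p x)\<^sup>2 * wt x) \<in> borel_measurable borel" by measurable
    have ipw: "integrable \<nu> (\<lambda>x. (poly p x)\<^sup>2 * wt x)" by (intro integrable_wt[OF \<nu>(1)] continuous_intros)
    note ipa = integral_ac_deriv_le[OF \<nu>(1) pwm ipw]
    have ipa1: "integrable arcsine (\<lambda>x. ac_deriv \<nu> x * ((poly p x)\<^sup>2 * wt x))"
      and ipa2: "(LINT x|arcsine. ac_deriv \<nu> x * ((poly p x)\<^sup>2 * wt x)) \<le> 1"
      using ipa wt_nonneg p1 by auto
    have am: "(\<lambda>x. ac_deriv \<nu> x * ((poly p x)\<^sup>2 * wt x)) \<in> borel_measurable borel" by measurable
    have ifu: "integrable circ (\<lambda>t. (norm (f (ept t)))\<^sup>2 * u (ecos t))"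
      unfolding fu using ipa1 integrable_arcsine_iff[OF am] by simp
    have fu2: "(LINT t|circ. (norm (f (ept t)))\<^sup>2 * u (ecos t)) \<le> 2"
      unfolding fu using ipa2 integral_arcsine[OF am] by simp
    \<comment> \<open>\<open>M\<close> depends on the degree and on \<open>p\<close>, hence so do
      \<open>lg\<close> and \<open>g\<close>. This is harmless: the rigidity estimate uses only
      integrals of \<open>g\<close> and its value at 0.\<close>
    define d where "d = \<delta> ^ 4 / M"
    have d: "0 < d" "d \<le> \<delta> ^ 4" "M * d = \<delta> ^ 4"
      using \<delta>4 M(1) by (auto simp: d_def pos_divide_le_eq)
    obtain lg :: "real poly" where lg: "(LINT x|arcsine. \<bar>exp (poly lg x) - u x\<bar>) \<le> d"
        "(LINT x|arcsine. \<bar>poly lg x - ln (u x)\<bar>) \<le> d"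
      by (rule log_poly_approx[OF ne(3,2,1,5) d(1)])
    obtain Qg where Qg: "\<And>s. s \<noteq> 0 \<Longrightarrow> poly (cpoly lg) (joukowski s) = poly (cpoly Qg) s + poly (cpoly Qg) (1 / s)"
      using analytic_half_exists[of lg] by blast
    interpret G: analytic_half lg Qg by unfold_locales (rule Qg)
    have elm: "(\<lambda>x. exp (poly lg x)) \<in> borel_measurable borel" by measurable
    have iel: "integrable arcsine (\<lambda>x. exp (poly lg x))"
      by (intro integrable_poly_on_interval[OF finite_measure_on_interval_arcsine _ elm] continuous_intros)
    have il: "integrable arcsine (poly lg)"
      by (intro integrable_poly_on_interval[OF finite_measure_on_interval_arcsine] continuous_intros) measurable
    have g: "texp Qg holomorphic_on ball 0 R" by (intro holomorphic_intros)
    \<comment> \<open>The value at 0 is the exponential of half the mean of \<open>lg\<close>, which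
      is close to the mean of \<open>ln u\<close> and therefore nearly non-negative.\<close>
    have Reg: "Re (texp Qg 0) \<ge> 1 - \<delta> ^ 4"
    proof -
      have "(LINT x|arcsine. ln (u x) - \<bar>poly lg x - ln (u x)\<bar>) \<le> (LINT x|arcsine. poly lg x)"
        using ne(5) il by (intro integral_mono) auto
      moreover have "(LINT x|arcsine. ln (u x) - \<bar>poly lg x - ln (u x)\<bar>)
          = (LINT x|arcsine. ln (u x)) - (LINT x|arcsine. \<bar>poly lg x - ln (u x)\<bar>)"
        using ne(5) il by (intro Bochner_Integration.integral_diff) auto
      ultimately have "- (\<delta> ^ 4) \<le> poly Qg 0" using ne(7) lg(2) d(2) unfolding G.integral_half by linarith
      then have "1 - \<delta> ^ 4 \<le> exp (poly Qg 0)" using exp_ge_add_one_self[of "poly Qg 0"] by linarith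
      then show ?thesis by (simp add: texp_0)
    qed
    have gg: "(LINT t|circ. (norm (texp Qg (ept t)))\<^sup>2) \<le> 1 + 2 * \<delta> ^ 4"
    proof -
      have "(LINT t|circ. (norm (texp Qg (ept t)))\<^sup>2) = (LINT x|arcsine. exp (poly lg x))"
        unfolding G.norm_texp_ept by (rule integral_arcsine[OF elm, symmetric])
      also have "\<dots> \<le> (LINT x|arcsine. u x + \<bar>exp (poly lg x) - u x\<bar>)"
        using ne(1) iel by (intro integral_mono) auto
      also have "\<dots> = (LINT x|arcsine. u x) + (LINT x|arcsine. \<bar>exp (poly lg x) - u x\<bar>)"
        using ne(1) iel by (intro Bochner_Integration.integral_add) auto
      finally show ?thesis using ne(6) lg(1) d(2) by linarith
    qed
    have fg: "(LINT t|circ. (norm (f (ept t) * texp Qg (ept t)))\<^sup>2) \<le> 2 + \<delta> ^ 4"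
    proof -
      have dm: "(\<lambda>x. \<bar>exp (poly lg x) - u x\<bar>) \<in> borel_measurable borel" using elm ne(3) by measurable
      have "integrable arcsine (\<lambda>x. \<bar>exp (poly lg x) - u x\<bar>)" using iel ne(1) by auto
      then have id: "integrable circ (\<lambda>t. \<bar>exp (poly lg (ecos t)) - u (ecos t)\<bar>)"
        unfolding integrable_arcsine_iff[OF dm] .
      have "(LINT t|circ. (norm (f (ept t) * texp Qg (ept t)))\<^sup>2)
          = (LINT t|circ. (norm (f (ept t)))\<^sup>2 * exp (poly lg (ecos t)))"
        by (simp only: norm_mult power_mult_distrib G.norm_texp_ept)
      also have "\<dots> \<le> (LINT t|circ. (norm (f (ept t)))\<^sup>2 * u (ecos t) + M * \<bar>exp (poly lg (ecos t)) - u (ecos t)\<bar>)"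
      proof (rule integral_mono)
        show "integrable circ (\<lambda>t. (norm (f (ept t)))\<^sup>2 * exp (poly lg (ecos t)))"
          by (intro integrable_circ_continuous continuous_intros cf)
        show "integrable circ (\<lambda>t. (norm (f (ept t)))\<^sup>2 * u (ecos t) + M * \<bar>exp (poly lg (ecos t)) - u (ecos t)\<bar>)"
          by (intro Bochner_Integration.integrable_add ifu integrable_mult_right id)
        fix t assume "t \<in> space circ"
        then have b: "(norm (f (ept t)))\<^sup>2 \<le> M" using M(2)[of t] by simp
        have "(norm (f (ept t)))\<^sup>2 * (exp (poly lg (ecos t)) - u (ecos t)) \<le> (norm (f (ept t)))\<^sup>2 * \<bar>exp (poly lg (ecos t)) - u (ecos t)\<bar>"
          by (intro mult_left_mono) auto
        also have "\<dots> \<le> M * \<bar>exp (poly lg (ecos t)) - u (ecos t)\<bar>" by (rule mult_right_mono[OF b]) simp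
        finally show "(norm (f (ept t)))\<^sup>2 * exp (poly lg (ecos t)) \<le> (norm (f (ept t)))\<^sup>2 * u (ecos t) + M * \<bar>exp (poly lg (ecos t)) - u (ecos t)\<bar>"
          by (simp only: right_diff_distrib)
      qed
      also have "\<dots> = (LINT t|circ. (norm (f (ept t)))\<^sup>2 * u (ecos t)) + M * (LINT t|circ. \<bar>exp (poly lg (ecos t)) - u (ecos t)\<bar>)"
        by (subst Bochner_Integration.integral_add[OF ifu integrable_mult_right[OF id]]) simp
      also have "(LINT t|circ. \<bar>exp (poly lg (ecos t)) - u (ecos t)\<bar>) = (LINT x|arcsine. \<bar>exp (poly lg x) - u x\<bar>)"
        by (rule integral_arcsine[OF dm, symmetric])
      also have "M * (LINT x|arcsine. \<bar>exp (poly lg x) - u x\<bar>) \<le> M * d" using lg(1) M(1) by (intro mult_left_mono) auto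
      finally show ?thesis using fu2 d(3) by linarith
    qed
    have f0: "f 0 = of_real (sqrt (2 * cc) * lead_coeff p / 2 ^ n / exp (poly Q 0))"
      using dpn by (simp add: f_def Hn_def texp_0 lift_poly_0 coeff_map_poly)
    define F0 where "F0 = sqrt (2 * cc) * lead_coeff p / 2 ^ n / exp (poly Q 0)"
    have ND': "norm (N z) \<le> \<eta>1 * norm (D z)" if "norm z \<le> 1/2" for z
      using ND[of z] that r mult_right_mono[OF \<eta>(2), of "norm (D z)"] by (simp add: order_trans)
    have F0: "F0 \<ge> 1 - 5 * \<delta>\<^sup>2"
      unfolding F0_def using \<eta>1(2)[OF n cn ND' \<nu> orth] by (simp only: pos_le_divide_eq exp_gt_zero)
    have Refg: "Re (f 0 * texp Qg 0) \<ge> 1 - 6 * \<delta>\<^sup>2"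
    proof -
      have e: "Re (f 0 * texp Qg 0) = F0 * Re (texp Qg 0)"
        unfolding f0 F0_def[symmetric] texp_0 by (simp only: Re_complex_of_real flip: of_real_mult)
      show ?thesis
      \<comment> \<open>Multiplying the two lower bounds needs a non-negative factor; in the
        degenerate case the sign of the product is enough.\<close>
      proof (cases "1 - 6 * \<delta>\<^sup>2 \<le> 0")
        case True
        have "0 \<le> F0 * Re (texp Qg 0)"
        proof (rule mult_nonneg_nonneg)
          have "lead_coeff p > 0" using orth unfolding orth_real_def by blast
          then show "0 \<le> F0" unfolding F0_def using cc_pos by (intro divide_nonneg_nonneg mult_nonneg_nonneg) simp_all
        qed (simp add: texp_0)
        then show ?thesis unfolding e using True by linarith
      next
        case False
        have "1 - 6 * \<delta>\<^sup>2 \<le> (1 - 5 * \<delta>\<^sup>2) * (1 - \<delta> ^ 4)"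
        proof -
          have "0 \<le> \<delta>\<^sup>2 * \<delta> ^ 4" using \<delta> by simp
          moreover have "(1 - 5 * \<delta>\<^sup>2) * (1 - \<delta> ^ 4) = 1 - 5 * \<delta>\<^sup>2 - \<delta> ^ 4 + 5 * (\<delta>\<^sup>2 * \<delta> ^ 4)"
            by (simp only: left_diff_distrib right_diff_distrib mult.assoc mult_1_left mult_1_right)
          ultimately show ?thesis using \<delta>4(2) by linarith
        qed
        also have "\<dots> \<le> F0 * Re (texp Qg 0)"
          using F0 Reg False \<delta>4 by (intro mult_mono) auto
        finally show ?thesis unfolding e .
      qed
    qed
    have phK: "norm (LINT t|circ. phase Q (ept t) * pk z (ecos t)) \<le> \<delta>\<^sup>2" if "norm z \<le> r" for z
    proof -
      have "norm (LINT t|circ. phase Q (ept t) * pk z (ecos t)) \<le> K * \<eta>"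
        by (rule K(2)[OF cn _ ND that]) (use \<eta>(1) in auto)
      then show ?thesis using \<eta>(3) by linarith
    qed
    have fs: "norm (f s - 1) \<le> 42 * \<delta> / (1 - r)\<^sup>2"
    proof (rule circle_rigidity[OF f g R(1) \<delta> continuous_phase norm_phase _ _ fg gg Reg Refg _ s r(2)])
      show "f (ept t) = cnj (f (ept t)) * phase Q (ept t)" for t
        unfolding f_def by (rule Hn_circle_phase[OF dp refl])
      show "norm (LINT t|circ. phase Q (ept t)) \<le> \<delta>\<^sup>2" using phK[of 0] r by simp
      show "8 * \<delta>\<^sup>2 \<le> (1 - r)\<^sup>2" using small \<delta>4 \<delta> by linarith
      show "norm (LINT t|circ. phase Q (ept t) * pk s (ecos t)) \<le> \<delta>" using phK[OF s] \<delta>4(5) by linarith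
    qed simp
    have s1: "norm s < 1" using s r by simp
    have pkb: "norm (pk s x) \<le> 2 / (1 - r)\<^sup>2" if "x \<in> {-1..1}" for x using that by (intro norm_pk_le s r) auto
    have ipk: "integrable arcsine (\<lambda>x. pk s x * of_real (h x))" if "integrable arcsine h" "h \<in> borel_measurable borel" for h
    proof (rule Bochner_Integration.integrable_bound[of _ "\<lambda>x. 2 / (1 - r)\<^sup>2 * h x"])
      show "integrable arcsine (\<lambda>x. 2 / (1 - r)\<^sup>2 * h x)" by (intro integrable_mult_right that)
      show "(\<lambda>x. pk s x * of_real (h x)) \<in> borel_measurable arcsine"
        unfolding measurable_arcsine_eq using that(2) by measurable
      show "AE x in arcsine. norm (pk s x * of_real (h x)) \<le> norm (2 / (1 - r)\<^sup>2 * h x)"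
        using AE_on_interval[OF finite_measure_on_interval_arcsine]
      proof eventually_elim
        case (elim x)
        have "norm (pk s x) * \<bar>h x\<bar> \<le> 2 / (1 - r)\<^sup>2 * \<bar>h x\<bar>" by (rule mult_right_mono[OF pkb[OF elim]]) simp
        then show ?case by (simp add: norm_mult abs_mult)
      qed
    qed
    define J where "J = (LINT x|arcsine. pk s x * of_real (ln (u x)))"
    have lv: "integrable arcsine (\<lambda>x. ln (ac_deriv \<nu> x))" using \<nu>(2) by (simp add: log_integrable_def)
    have lvm: "(\<lambda>x. ln (ac_deriv \<nu> x)) \<in> borel_measurable borel" by measurable
    have lum: "(\<lambda>x. ln (u x)) \<in> borel_measurable borel" using ne(3) by measurable
    have ill: "integrable arcsine (poly l)"
      by (intro integrable_poly_on_interval[OF finite_measure_on_interval_arcsine] continuous_intros) measurable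
    \<comment> \<open>Logarithms of outer functions add: the product is the outer function of
      \<open>u\<close>, close to 1 because \<open>ln u\<close> is small in the mean.\<close>
    have GT: "outer \<nu> s * texp Q s = exp (J / 2)"
    proof -
      have "J = (LINT x|arcsine. pk s x * of_real (ln (ac_deriv \<nu> x)) + pk s x * of_real (poly l x))"
        unfolding J_def
      proof (rule integral_cong_AE)
        show "AE x in arcsine. pk s x * of_real (ln (u x)) = pk s x * of_real (ln (ac_deriv \<nu> x)) + pk s x * of_real (poly l x)"
          using ne(4) by eventually_elim (simp add: algebra_simps)
        show "(\<lambda>x. pk s x * of_real (ln (u x))) \<in> borel_measurable arcsine"
          unfolding measurable_arcsine_eq using lum by measurable
        show "(\<lambda>x. pk s x * of_real (ln (ac_deriv \<nu> x)) + pk s x * of_real (poly l x)) \<in> borel_measurable arcsine"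
          unfolding measurable_arcsine_eq by measurable
      qed
      also have "\<dots> = (LINT x|arcsine. pk s x * of_real (ln (ac_deriv \<nu> x))) + (LINT x|arcsine. pk s x * of_real (poly l x))"
        by (intro Bochner_Integration.integral_add ipk lv lvm ill) measurable
      finally show ?thesis unfolding outer_def texp_schwarz[OF s1] by (simp add: add_divide_distrib flip: exp_add)
    qed
    have Jb: "norm (J / 2) \<le> 9 * \<delta> * A"
    proof -
      have "norm J \<le> (LINT x|arcsine. norm (pk s x * of_real (ln (u x))))" unfolding J_def by (rule integral_norm_bound)
      also have "\<dots> \<le> (LINT x|arcsine. 2 / (1 - r)\<^sup>2 * \<bar>ln (u x)\<bar>)"
      proof (rule integral_mono_AE)
        show "AE x in arcsine. norm (pk s x * of_real (ln (u x))) \<le> 2 / (1 - r)\<^sup>2 * \<bar>ln (u x)\<bar>"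
          using AE_on_interval[OF finite_measure_on_interval_arcsine]
        proof eventually_elim
          case (elim x)
          show ?case unfolding norm_mult norm_of_real by (rule mult_right_mono[OF pkb[OF elim]]) simp
        qed
      qed (use ipk[OF ne(5) lum] ne(5) in auto)
      also have "\<dots> = 2 / (1 - r)\<^sup>2 * (LINT x|arcsine. \<bar>ln (u x)\<bar>)" by simp
      also have "\<dots> \<le> 2 / (1 - r)\<^sup>2 * (9 * \<delta>\<^sup>2)" using ne(9) by (intro mult_left_mono) auto
      also have "\<dots> \<le> 2 / (1 - r)\<^sup>2 * (9 * \<delta>)" using \<delta>4 by (intro mult_left_mono) auto
      finally show ?thesis by (simp add: A_def norm_divide)
    qed
    have GT1: "norm (exp (J / 2) - 1) \<le> 27 * \<delta> * A"
    proof -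
      have "norm (J / 2) \<le> 1" using Jb A \<delta> by linarith
      from norm_exp_diff_one_le[OF this] show ?thesis using Jb by linarith
    qed
    \<comment> \<open>Here the 27 in the hypothesis \<open>small\<close> is used. The final constant
      is \<open>2 * 42 + 27 = 111\<close>.\<close>
    have GT2: "norm (exp (J / 2)) \<le> 2" using GT1 A(2) norm_triangle_ineq2[of "exp (J / 2)" 1] by simp
    have "outer \<nu> s * Hn p n s = exp (J / 2) * f s" unfolding GT[symmetric] f_def by simp
    then have e: "outer \<nu> s * Hn p n s - 1 = exp (J / 2) * (f s - 1) + (exp (J / 2) - 1)" by (simp add: algebra_simps)
    have "norm (outer \<nu> s * Hn p n s - 1) \<le> norm (exp (J / 2)) * norm (f s - 1) + norm (exp (J / 2) - 1)"
      unfolding e norm_mult[symmetric] by (rule norm_triangle_ineq)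
    also have "\<dots> \<le> 2 * (42 * \<delta> / (1 - r)\<^sup>2) + 27 * \<delta> * A"
      using GT1 GT2 fs by (intro add_mono mult_mono) auto
    also have "\<dots> = 111 * \<delta> / (1 - r)\<^sup>2" by (simp add: A_def)
    finally show "norm (outer \<nu> s * conj_nodes.Hn \<alpha> (2 * n) p n s - 1) \<le> 111 * \<delta> / (1 - r)\<^sup>2" .
  qed
qed

subsection \<open>The nodes\<close>

lemma conj_nodes_phi:
  assumes nodes: "\<And>j. j \<in> {1..m} \<Longrightarrow> a j \<notin> Some ` slit"
    and sym: "image_mset (\<lambda>j. map_option cnj (a j)) (mset_set {1..m}) = image_mset a (mset_set {1..m})"
  shows "conj_nodes (\<lambda>j. phi (a j)) m"
proof
  show "norm (phi (a j)) < 1" if "j \<in> {1..m}" for j by (rule norm_phi[OF nodes[OF that]])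
  have "image_mset (\<lambda>j. cnj (phi (a j))) (mset_set {1..m}) = image_mset (\<lambda>j. phi (map_option cnj (a j))) (mset_set {1..m})"
    by (intro image_mset_cong) (use phi_cnj nodes in auto)
  also have "\<dots> = image_mset phi (image_mset (\<lambda>j. map_option cnj (a j)) (mset_set {1..m}))"
    by (simp add: image_mset.compositionality o_def)
  also have "\<dots> = image_mset (\<lambda>j. phi (a j)) (mset_set {1..m})"
    unfolding sym by (simp add: image_mset.compositionality o_def)
  finally show "image_mset (\<lambda>j. cnj (phi (a j))) (mset_set {1..m}) = image_mset (\<lambda>j. phi (a j)) (mset_set {1..m})" .
qed

text \<open>If \<open>b\<close> is the Joukowski image of \<beta>, then
  \<open>2 * \<beta> * b = 1 + \<beta>^2\<close>, and each factor of \<open>tau\<close> splits into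
  a zero at \<beta> and one at \<open>1 / \<beta>\<close>. A node at infinity has \<beta> equal to 0
  and both sides reduce to \<open>s\<close>.\<close>

lemma node_factor:
  assumes "p \<notin> Some ` slit" "s \<noteq> 0"
  shows "(case p of None \<Rightarrow> 1 | Some b \<Rightarrow> 1 - joukowski s / b) * (1 + (phi p)\<^sup>2) * s = (s - phi p) * (1 - phi p * s)"
proof (cases p)
  case (Some b)
  then have b: "b \<notin> slit" using assms by auto
  define \<beta> where "\<beta> = phi (Some b)"
  have \<beta>: "\<beta> \<noteq> 0" "b = joukowski \<beta>" unfolding \<beta>_def by (rule phi_Some[OF b])+
  have b0: "b \<noteq> 0" using b by (force simp: slit_def)
  have bb: "2 * \<beta> * b = 1 + \<beta>\<^sup>2" by (subst \<beta>(2)) (use \<beta>(1) in \<open>simp add: power2_eq_square field_simps\<close>)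
  have ss: "2 * (s * joukowski s) = s * s + 1" using assms(2) by (simp add: field_simps)
  have "(1 - joukowski s / b) * (1 + \<beta>\<^sup>2) * s = ((1 - joukowski s / b) * b) * (2 * \<beta> * s)"
    unfolding bb[symmetric] by (simp only: mult_ac)
  also have "(1 - joukowski s / b) * b = b - joukowski s" using b0 by (simp only: left_diff_distrib) simp
  also have "(b - joukowski s) * (2 * \<beta> * s) = (2 * \<beta> * b) * s - \<beta> * (2 * (s * joukowski s))"
  proof -
    have "(x - y) * (2 * \<beta> * s) = (2 * \<beta> * x) * s - \<beta> * (2 * (s * y))" for x y
      by (simp add: algebra_simps)
    then show ?thesis .
  qed
  also have "\<dots> = (s - \<beta>) * (1 - \<beta> * s)" unfolding bb ss by (simp add: algebra_simps power2_eq_square)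
  finally show ?thesis unfolding \<beta>_def Some by (simp only: option.case)
qed simp

context
  fixes a :: "nat \<Rightarrow> complex option" and n :: nat
  assumes nodes: "\<And>j. j \<in> {1..2*n} \<Longrightarrow> a j \<notin> Some ` slit"
    and sym: "image_mset (\<lambda>j. map_option cnj (a j)) (mset_set {1..2*n}) = image_mset a (mset_set {1..2*n})"
begin

interpretation conj_nodes "\<lambda>j. phi (a j)" "2 * n"
  by (rule conj_nodes_phi[OF nodes sym])

lemma tau_identity:
  assumes "s \<noteq> 0" shows "tau a n (joukowski s) * of_real cc * s ^ (2 * n) = N s * D s"
proof -
  have "tau a n (joukowski s) * of_real cc * s ^ (2 * n)
      = (\<Prod>j=1..2*n. (case a j of None \<Rightarrow> 1 | Some b \<Rightarrow> 1 - joukowski s / b) * (1 + (phi (a j))\<^sup>2) * s)"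
    unfolding tau_def cc_eq by (simp add: prod.distrib)
  also have "\<dots> = (\<Prod>j=1..2*n. (s - phi (a j)) * (1 - phi (a j) * s))"
    by (intro prod.cong refl node_factor nodes assms)
  finally show ?thesis unfolding poly_nump poly_denp by (simp add: prod.distrib)
qed

lemma tau_wt:
  assumes x: "x \<in> {-1..1}" shows "tau a n (of_real x) \<noteq> 0" "1 / tau a n (of_real x) = of_real (wt x)"
proof -
  have "-1 \<le> x" "x \<le> 1" using x by auto
  then obtain t where t: "x = ecos t" by (rule obtain_circle_angle)
  define e where "e = ept t"
  have Dn: "D e \<noteq> 0" unfolding e_def by (rule D_nonzero) simp
  have "tau a n (of_real x) * of_real cc * e ^ (2 * n) = e ^ (2 * n) * cnj (D e) * D e"
    using tau_identity[of e] unfolding e_def joukowski_ept t N_circle by simp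
  then have "e ^ (2 * n) * (tau a n (of_real x) * of_real cc) = e ^ (2 * n) * (D e * cnj (D e))"
    by (simp only: mult_ac)
  moreover have "e ^ (2 * n) \<noteq> 0" by (simp add: e_def)
  ultimately have T: "tau a n (of_real x) * of_real cc = of_real ((norm (D e))\<^sup>2)"
    unfolding complex_norm_square using mult_left_cancel by blast
  then show "tau a n (of_real x) \<noteq> 0" using Dn by auto
  have c0: "complex_of_real cc \<noteq> 0" using cc_pos by simp
  then have "tau a n (of_real x) = of_real ((norm (D e))\<^sup>2) / of_real cc"
    using T by (simp add: nonzero_eq_divide_eq del: of_real_power)
  then have "1 / tau a n (of_real x) = of_real (cc / (norm (D e))\<^sup>2)"
    by (simp del: of_real_power)
  then show "1 / tau a n (of_real x) = of_real (wt x)" unfolding t wt_ecos e_def .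
qed

lemma integral_div_tau:
  assumes \<nu>: "finite_measure_on_interval \<nu>" and q: "continuous_on UNIV q"
  shows "(LINT x|\<nu>. q x / tau a n (of_real x)) = (LINT x|\<nu>. q x * of_real (wt x) :: complex)"
proof (rule integral_cong_AE)
  have qm: "q \<in> borel_measurable borel" by (rule borel_measurable_continuous_onI[OF q])
  have tm: "(\<lambda>x. tau a n (of_real x)) \<in> borel_measurable borel"
    unfolding tau_def
  proof (rule borel_measurable_prod)
    fix j show "(\<lambda>x. case a j of None \<Rightarrow> 1 | Some b \<Rightarrow> 1 - complex_of_real x / b) \<in> borel_measurable borel"
      by (cases "a j") simp_all
  qed
  show "(\<lambda>x. q x / tau a n (of_real x)) \<in> borel_measurable \<nu>" "(\<lambda>x. q x * of_real (wt x)) \<in> borel_measurable \<nu>"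
    unfolding measurable_on_interval[OF \<nu>] using qm tm by measurable
  show "AE x in \<nu>. q x / tau a n (of_real x) = q x * of_real (wt x)"
    using AE_on_interval[OF \<nu>]
  proof eventually_elim
    case (elim x)
    show ?case unfolding tau_wt(2)[OF elim, symmetric] by simp
  qed
qed

section \<open>Reality of the orthonormal polynomial\<close>

lemma poly_zero_if_AE:
  fixes p :: "real poly"
  assumes "AE x in arcsine. poly p x = 0" shows "p = 0"
proof (rule ccontr)
  assume "p \<noteq> 0"
  then have "finite {x. poly p x = 0}" by (rule poly_roots_finite)
  then have "{x. poly p x = 0} \<in> null_sets lborel" by (intro countable_imp_null_set_lborel countable_finite)
  moreover have "absolutely_continuous lborel arcsine" unfolding arcsine_def
    by (rule absolutely_continuousI_density) measurable
  ultimately have "{x. poly p x = 0} \<in> null_sets arcsine" by (auto simp: absolutely_continuous_def)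
  then have "AE x in arcsine. x \<notin> {x. poly p x = 0}" by (rule AE_not_in)
  with assms have "AE x in arcsine. False" by eventually_elim simp
  then have "emeasure arcsine UNIV = 0" by (simp add: AE_iff_measurable[OF _ refl])
  then show False using emeasure_arcsine_UNIV by simp
qed

text \<open>Orthonormality is stated with \<open>p^2\<close>, so reality must be derived. The weight
  is real, hence real and imaginary parts are separately orthogonal to lower powers. The leading
  coefficient is real, so the imaginary part has degree below \<open>n\<close> and is orthogonal to
  itself; positivity of the density forces it to vanish.\<close>

lemma orthonormal_poly_real:
  assumes \<nu>: "finite_measure_on_interval \<nu>" and log: "log_integrable \<nu>" and p: "orthonormal_poly a \<nu> n p"
  obtains pr where "p = cpoly pr" "orth_real \<nu> n pr"
proof -
  define p1 p2 where "p1 = map_poly Re p" and "p2 = map_poly Im p"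
  have Im: "poly p2 x = Im (poly p (of_real x))" for x
    unfolding p2_def by (induction p) (simp_all add: map_poly_pCons)
  have Re: "poly p1 x = Re (poly p (of_real x))" for x unfolding p1_def by (rule poly_Re_part)
  have dp: "degree p = n" and orth: "\<And>k. k < n \<Longrightarrow> (LINT x|\<nu>. poly p (of_real x) * of_real x ^ k / tau a n (of_real x)) = 0"
    and nrm: "(LINT x|\<nu>. (poly p (of_real x))\<^sup>2 / tau a n (of_real x)) = 1"
    using p by (auto simp: orthonormal_poly_def)
  obtain \<gamma> where \<gamma>: "\<gamma> > 0" "lead_coeff p = of_real \<gamma>" using p by (auto simp: orthonormal_poly_def)
  have ic: "integrable \<nu> (\<lambda>x. q x * of_real (wt x) :: complex)" if "continuous_on UNIV q" for q
  proof (rule integrable_poly_on_interval[OF \<nu>])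
    show "continuous_on {-1..1} (\<lambda>x. q x * of_real (wt x))"
      by (intro continuous_intros continuous_wt continuous_on_subset[OF that]) auto
    have "q \<in> borel_measurable borel" by (rule borel_measurable_continuous_onI[OF that])
    then show "(\<lambda>x. q x * of_real (wt x)) \<in> borel_measurable borel" by measurable
  qed
  have key: "(LINT x|\<nu>. poly p1 x * x ^ k * wt x) = 0" "(LINT x|\<nu>. poly p2 x * x ^ k * wt x) = 0" if k: "k < n" for k
  proof -
    have c: "continuous_on UNIV (\<lambda>x. poly p (of_real x) * of_real x ^ k)" by (intro continuous_intros)
    have z: "(LINT x|\<nu>. poly p (of_real x) * of_real x ^ k * of_real (wt x)) = 0"
      using integral_div_tau[OF \<nu> c] orth[OF k] by simp
    have pt: "Re (poly p (of_real x) * of_real x ^ k * of_real (wt x)) = poly p1 x * x ^ k * wt x"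
      "Im (poly p (of_real x) * of_real x ^ k * of_real (wt x)) = poly p2 x * x ^ k * wt x" for x
      unfolding Re Im by (simp_all flip: of_real_power)
    show "(LINT x|\<nu>. poly p1 x * x ^ k * wt x) = 0" unfolding pt[symmetric] integral_Re[OF ic[OF c]] z by simp
    show "(LINT x|\<nu>. poly p2 x * x ^ k * wt x) = 0" unfolding pt[symmetric] integral_Im[OF ic[OF c]] z by simp
  qed
  have p2: "p2 = 0"
  proof (rule ccontr)
    assume ne: "p2 \<noteq> 0"
    have c2n: "coeff p2 n = 0" using \<gamma> dp by (simp add: p2_def coeff_map_poly)
    have "degree p2 \<le> n" unfolding p2_def
      by (rule degree_le) (use dp in \<open>auto simp: coeff_map_poly coeff_eq_0\<close>)
    with c2n ne have d2: "degree p2 < n" by (metis leading_coeff_0_iff le_neq_implies_less)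
    have "(LINT x|\<nu>. (poly p2 x)\<^sup>2 * wt x) = (LINT x|\<nu>. (\<Sum>k\<le>degree p2. coeff p2 k * (poly p2 x * x ^ k * wt x)))"
    proof (intro Bochner_Integration.integral_cong refl)
      fix x
      have "(poly p2 x)\<^sup>2 * wt x = poly p2 x * wt x * (\<Sum>k\<le>degree p2. coeff p2 k * x ^ k)"
        unfolding power2_eq_square poly_altdef[of p2, symmetric] by (simp only: mult_ac)
      also have "\<dots> = (\<Sum>k\<le>degree p2. coeff p2 k * (poly p2 x * x ^ k * wt x))"
        unfolding sum_distrib_left by (intro sum.cong refl) (simp only: mult_ac)
      finally show "(poly p2 x)\<^sup>2 * wt x = (\<Sum>k\<le>degree p2. coeff p2 k * (poly p2 x * x ^ k * wt x))" .
    qed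
    also have "\<dots> = (\<Sum>k\<le>degree p2. coeff p2 k * (LINT x|\<nu>. poly p2 x * x ^ k * wt x))"
      by (subst Bochner_Integration.integral_sum)
        (auto intro!: integrable_mult_right integrable_wt[OF \<nu>] continuous_intros)
    also have "\<dots> = 0" using key(2) d2 by (intro sum.neutral) auto
    finally have z: "(LINT x|\<nu>. (poly p2 x)\<^sup>2 * wt x) = 0" .
    have m: "(\<lambda>x. (poly p2 x)\<^sup>2 * wt x) \<in> borel_measurable borel" by measurable
    have i: "integrable \<nu> (\<lambda>x. (poly p2 x)\<^sup>2 * wt x)" by (intro integrable_wt[OF \<nu>] continuous_intros)
    have nn: "0 \<le> (poly p2 x)\<^sup>2 * wt x" for x using wt_nonneg by simp
    note le = integral_ac_deriv_le[OF \<nu> m i nn]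
    have "0 \<le> (LINT x|arcsine. ac_deriv \<nu> x * ((poly p2 x)\<^sup>2 * wt x))"
      by (intro Bochner_Integration.integral_nonneg) (simp add: nn)
    with le(2) z have "(LINT x|arcsine. ac_deriv \<nu> x * ((poly p2 x)\<^sup>2 * wt x)) = 0" by simp
    then have "AE x in arcsine. ac_deriv \<nu> x * ((poly p2 x)\<^sup>2 * wt x) = 0"
      by (subst (asm) integral_nonneg_eq_0_iff_AE[OF le(1)]) (simp_all add: nn)
    moreover have "AE x in arcsine. 0 < ac_deriv \<nu> x" using log by (simp add: log_integrable_def)
    ultimately have "AE x in arcsine. poly p2 x = 0"
      using AE_on_interval[OF finite_measure_on_interval_arcsine]
    proof eventually_elim
      case (elim x)
      then show ?case using wt_pos[of x] by simp
    qed
    then show False using poly_zero_if_AE ne by blast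
  qed
  have pc: "p = cpoly p1"
  proof (rule poly_eqI)
    fix k
    have "Im (coeff p k) = coeff p2 k" by (simp add: p2_def coeff_map_poly)
    then show "coeff p k = coeff (cpoly p1) k"
      using p2 by (simp add: p1_def coeff_map_poly complex_eq_iff)
  qed
  have d1: "degree p1 = n"
  proof (rule antisym)
    show "degree p1 \<le> n" unfolding p1_def by (rule degree_le) (use dp in \<open>auto simp: coeff_map_poly coeff_eq_0\<close>)
    show "n \<le> degree p1" by (rule le_degree) (use \<gamma> dp in \<open>simp add: p1_def coeff_map_poly\<close>)
  qed
  have "orth_real \<nu> n p1"
    unfolding orth_real_def
  proof (intro conjI allI impI)
    show "0 < lead_coeff p1" unfolding d1 using \<gamma> dp by (simp add: p1_def coeff_map_poly)
    have c: "continuous_on UNIV (\<lambda>x. (poly p (of_real x))\<^sup>2)" by (intro continuous_intros)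
    have "complex_of_real (LINT x|\<nu>. (poly p1 x)\<^sup>2 * wt x) = (LINT x|\<nu>. complex_of_real ((poly p1 x)\<^sup>2 * wt x))"
      by (rule integral_complex_of_real[symmetric])
    also have "\<dots> = (LINT x|\<nu>. (poly p (of_real x))\<^sup>2 * of_real (wt x))" by (subst pc) simp
    also have "\<dots> = 1" using integral_div_tau[OF \<nu> c] nrm by simp
    finally show "(LINT x|\<nu>. (poly p1 x)\<^sup>2 * wt x) = 1" by (simp only: of_real_eq_1_iff)
  qed (use d1 key in auto)
  then show thesis using that pc by blast
qed

section \<open>The left-hand sides of both formulas in the disc variable\<close>

definition limit_fun :: "real measure \<Rightarrow> real poly \<Rightarrow> complex \<Rightarrow> complex" where
  "limit_fun \<nu> pr s = (outer \<nu> s * Hn pr n s)\<^sup>2"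

lemma Hn_square:
  "(Hn pr n s)\<^sup>2 = 2 * of_real cc * (lift_poly (cpoly pr) n s)\<^sup>2 / (D s)\<^sup>2"
proof -
  have "(complex_of_real (sqrt (2 * cc)))\<^sup>2 = of_real (2 * cc)"
    unfolding of_real_power[symmetric] using cc_pos by simp
  then show ?thesis unfolding Hn_def power_divide power_mult_distrib by simp
qed

text \<open>\<open>tau\<close> contributes \<open>N D\<close> to the denominator and the Blaschke
  product contributes \<open>N / D\<close>, so \<open>N\<close> cancels and \<open>D^2\<close>
  remains. Away from the nodes \<open>N\<close> is nonzero and the cancellation is
  legitimate.\<close>

lemma formula_eq_limit_fun:
  assumes z: "z \<notin> slit" and zn: "Some z \<notin> a ` {1..2*n}" and d: "degree pr \<le> n"
  shows "2 * (szego \<nu> (Some z))\<^sup>2 * ((poly (cpoly pr) z)\<^sup>2 / tau a n z)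
      * (\<Prod>j=1..2*n. (phi (Some z) - phi (a j)) / (1 - cnj (phi (a j)) * phi (Some z)))
    = limit_fun \<nu> pr (phi (Some z))"
proof -
  define s where "s = phi (Some z)"
  have s: "s \<noteq> 0" "norm s < 1" "z = joukowski s" unfolding s_def by (rule phi_Some[OF z])+
  have zs: "Some z \<notin> Some ` slit" using z by auto
  have Nn: "N s \<noteq> 0"
  proof -
    have "s - phi (a j) \<noteq> 0" if j: "j \<in> {1..2*n}" for j
    proof
      assume "s - phi (a j) = 0"
      then have e: "phi (a j) = s" by simp
      show False
      proof (cases "a j")
        case (Some b)
        then have "b \<notin> slit" using nodes[OF j] by auto
        from phi_Some(3)[OF this] have "b = joukowski s" using e Some by metis
        then have "Some z = a j" using Some s(3) by metis
        then show False using zn j by blast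
      qed (use e s in auto)
    qed
    then show ?thesis unfolding poly_nump by simp
  qed
  have Dn: "D s \<noteq> 0" using s by (intro D_nonzero) simp
  have cc0: "complex_of_real cc \<noteq> 0" using cc_pos by simp
  have sz: "szego \<nu> (Some z) = outer \<nu> s" unfolding szego_pk[OF zs] outer_def s_def ..
  have pd: "(\<Prod>j=1..2*n. (s - phi (a j)) / (1 - cnj (phi (a j)) * s)) = N s / D s"
    unfolding D_alt poly_nump by (rule prod_dividef)
  have T: "tau a n z = N s * D s / (of_real cc * s ^ (2 * n))"
    using tau_identity[OF s(1)] cc0 s(1) unfolding s(3)[symmetric] by (simp add: field_simps)
  have d': "degree (cpoly pr) \<le> n"
    by (rule degree_le) (use d in \<open>auto simp: coeff_map_poly coeff_eq_0\<close>)
  have lp: "lift_poly (cpoly pr) n s = s ^ n * poly (cpoly pr) z"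
    using lift_poly_eq[OF s(1) d'] unfolding s(3)[symmetric] .
  have "2 * (outer \<nu> s)\<^sup>2 * ((poly (cpoly pr) z)\<^sup>2 / tau a n z) * (N s / D s)
      = (outer \<nu> s)\<^sup>2 * (2 * of_real cc * (s ^ n * poly (cpoly pr) z)\<^sup>2 / (D s)\<^sup>2)"
  proof -
    have "2 * G\<^sup>2 * (P\<^sup>2 / (A * B / (C * S\<^sup>2))) * (A / B) = G\<^sup>2 * (2 * C * (S * P)\<^sup>2 / B\<^sup>2)"
      if "A \<noteq> 0" "B \<noteq> 0" for G P A B C S :: complex
      using that by (simp add: power_mult_distrib power2_eq_square)
    moreover have "s ^ (2 * n) = (s ^ n)\<^sup>2" by (simp add: mult.commute flip: power_mult)
    ultimately show ?thesis unfolding T using Nn Dn by metis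
  qed
  then show ?thesis
    unfolding s_def[symmetric] pd sz limit_fun_def power_mult_distrib[of "outer \<nu> s"] Hn_square lp .
qed

text \<open>Each finite node gives \<open>2 b phi(b) = 1 + phi(b)^2\<close>, and infinite nodes
  would give 1, so the product is \<open>cc\<close>. Positivity of \<open>n\<close> matters for the
  truncated exponent \<open>2 * n - 1\<close>.\<close>

lemma formula_at_infinity:
  assumes d: "degree pr = n" and n: "n > 0"
  shows "(szego \<nu> None)\<^sup>2 * ((lead_coeff (cpoly pr))\<^sup>2 / 2 ^ (2 * n - 1))
      * (\<Prod>j\<in>{j\<in>{1..2*n}. a j \<noteq> None}. 2 * the (a j) * phi (a j)) = limit_fun \<nu> pr 0"
proof -
  have sz: "szego \<nu> None = outer \<nu> 0" using szego_pk[of None \<nu>] by (simp add: outer_def)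
  have "(\<Prod>j\<in>{j\<in>{1..2*n}. a j \<noteq> None}. 2 * the (a j) * phi (a j)) = (\<Prod>j\<in>{j\<in>{1..2*n}. a j \<noteq> None}. 1 + (phi (a j))\<^sup>2)"
  proof (rule prod.cong[OF refl])
    fix j assume "j \<in> {j\<in>{1..2*n}. a j \<noteq> None}"
    then obtain b where b: "a j = Some b" and j: "j \<in> {1..2*n}" by auto
    have bs: "b \<notin> slit" using nodes[OF j] b by auto
    define \<beta> where "\<beta> = phi (Some b)"
    have \<beta>: "\<beta> \<noteq> 0" "b = joukowski \<beta>" unfolding \<beta>_def by (rule phi_Some[OF bs])+
    have "2 * b * \<beta> = 1 + \<beta>\<^sup>2" by (subst \<beta>(2)) (use \<beta>(1) in \<open>simp add: power2_eq_square field_simps\<close>)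
    then show "2 * the (a j) * phi (a j) = 1 + (phi (a j))\<^sup>2" unfolding b \<beta>_def by (simp only: option.sel)
  qed
  also have "\<dots> = (\<Prod>j=1..2*n. 1 + (phi (a j))\<^sup>2)"
    by (rule prod.mono_neutral_left) auto
  also have "\<dots> = of_real cc" by (rule cc_eq[symmetric])
  finally have P: "(\<Prod>j\<in>{j\<in>{1..2*n}. a j \<noteq> None}. 2 * the (a j) * phi (a j)) = of_real cc" .
  have dc: "degree (cpoly pr) = n" using d degree_map_poly[of complex_of_real pr] by simp
  have p2: "(2 ^ n)\<^sup>2 = (2 :: complex) * 2 ^ (2 * n - 1)"
    using n by (simp add: power_mult[symmetric] power_Suc[symmetric] mult.commute del: power_Suc)
  show ?thesis unfolding P sz limit_fun_def power_mult_distrib[of "outer \<nu> 0"] Hn_square lift_poly_0 D_0 dc power_divide p2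
    by simp
qed

lemma Hn_continuous: "continuous_on (ball 0 1) (Hn pr n)"
  unfolding Hn_def using D_nonzero
  by (intro continuous_intros holomorphic_on_imp_continuous_on lift_poly_holomorphic) (auto simp: less_imp_le)

end

text \<open>Dominated convergence on each smaller disc, where the kernel is bounded uniformly in
  \<open>s\<close>; only the integrable logarithm is left as majorant.\<close>

lemma outer_continuous:
  assumes "integrable arcsine (\<lambda>x. ln (ac_deriv \<nu> x))"
  shows "continuous_on (ball 0 1) (outer \<nu>)"
proof -
  have lm: "(\<lambda>x. ln (ac_deriv \<nu> x)) \<in> borel_measurable borel" by measurable
  have "continuous_on (ball 0 r) (outer \<nu>)" if r: "r < 1" for r
  proof (rule continuous_on_sequentiallyI)
    fix u :: "nat \<Rightarrow> complex" and s assume u: "\<forall>n. u n \<in> ball 0 r" and s: "s \<in> ball 0 r" and lim: "u \<longlonglongrightarrow> s"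
    have "(\<lambda>n. LINT x|arcsine. pk (u n) x * of_real (ln (ac_deriv \<nu> x))) \<longlonglongrightarrow> (LINT x|arcsine. pk s x * of_real (ln (ac_deriv \<nu> x)))"
    proof (rule integral_dominated_convergence[where w = "\<lambda>x. 2 / (1 - r)\<^sup>2 * \<bar>ln (ac_deriv \<nu> x)\<bar>"])
      show "integrable arcsine (\<lambda>x. 2 / (1 - r)\<^sup>2 * \<bar>ln (ac_deriv \<nu> x)\<bar>)" using assms by simp
      show "AE x in arcsine. (\<lambda>n. pk (u n) x * of_real (ln (ac_deriv \<nu> x))) \<longlonglongrightarrow> pk s x * of_real (ln (ac_deriv \<nu> x))"
        using AE_on_interval[OF finite_measure_on_interval_arcsine]
      proof eventually_elim
        case (elim x)
        have "norm (1 + s\<^sup>2 - 2 * s * of_real x) \<ge> (1 - norm s)\<^sup>2"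
          using elim s r by (intro pk_denominator_ge) auto
        moreover have "(1 - norm s)\<^sup>2 > 0" using s r by simp
        ultimately have "1 + s\<^sup>2 - 2 * s * of_real x \<noteq> 0" by (metis norm_zero not_less)
        then show ?case unfolding pk_def by (intro tendsto_intros lim)
      qed
      show "AE x in arcsine. norm (pk (u n) x * of_real (ln (ac_deriv \<nu> x))) \<le> 2 / (1 - r)\<^sup>2 * \<bar>ln (ac_deriv \<nu> x)\<bar>" for n
        using AE_on_interval[OF finite_measure_on_interval_arcsine]
      proof eventually_elim
        case (elim x)
        have "norm (u n) \<le> r" using u[rule_format, of n] by simp
        then have "norm (pk (u n) x) \<le> 2 / (1 - r)\<^sup>2" using elim r by (intro norm_pk_le) auto
        then show ?case unfolding norm_mult norm_of_real by (rule mult_right_mono) simp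
      qed
    qed (unfold measurable_arcsine_eq, use lm in measurable)
    then show "(\<lambda>n. outer \<nu> (u n)) \<longlonglongrightarrow> outer \<nu> s" unfolding outer_def by (intro tendsto_intros) auto
  qed
  note c = this
  have "isCont (outer \<nu>) x" if x: "x \<in> ball 0 1" for x
  proof -
    have "(1 + norm x) / 2 < 1" "x \<in> ball 0 ((1 + norm x) / 2)" using x by auto
    then show ?thesis using c[of "(1 + norm x) / 2"] by (simp add: continuous_on_eq_continuous_at)
  qed
  then show ?thesis by (simp add: continuous_on_eq_continuous_at)
qed

subsection \<open>Removal of the singularities at the nodes\<close>

text \<open>At a finite node the written expression is a division by zero. It agrees off the finite
  set of nodes with \<open>limit_fun\<close> composed with \<open>phi\<close>, which is continuous,
  so every limit, also the one at infinity, is the value of that composition.\<close>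

lemma remove_sings_formula:
  assumes nodes: "\<And>j. j \<in> {1..2*n} \<Longrightarrow> a j \<notin> Some ` slit"
    and sym: "image_mset (\<lambda>j. map_option cnj (a j)) (mset_set {1..2*n}) = image_mset a (mset_set {1..2*n})"
    and log: "log_integrable \<nu>" and d: "degree pr \<le> n" and \<zeta>: "\<zeta> \<notin> Some ` slit"
  shows "remove_sings_sphere (\<lambda>z. 2 * (szego \<nu> (Some z))\<^sup>2 * ((poly (cpoly pr) z)\<^sup>2 / tau a n z)
      * (\<Prod>j=1..2*n. (phi (Some z) - phi (a j)) / (1 - cnj (phi (a j)) * phi (Some z)))) \<zeta>
    = limit_fun a n \<nu> pr (phi \<zeta>)" (is "remove_sings_sphere ?E \<zeta> = _")
proof -
  define F where "F = {z. Some z \<in> a ` {1..2*n}}"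
  have "F \<subseteq> the ` (a ` {1..2*n})"
  proof
    fix z assume "z \<in> F"
    then have "the (Some z) \<in> the ` (a ` {1..2*n})" unfolding F_def by (intro imageI) simp
    then show "z \<in> the ` (a ` {1..2*n})" by simp
  qed
  then have F: "finite F" by (rule finite_subset) simp
  have EL: "?E z = limit_fun a n \<nu> pr (phi (Some z))" if "z \<notin> slit" "z \<notin> F" for z
    by (rule formula_eq_limit_fun[OF nodes sym that(1) _ d]) (use that(2) in \<open>simp_all add: F_def\<close>)
  have lf: "limit_fun a n \<nu> pr = (\<lambda>s. (outer \<nu> s * conj_nodes.Hn (\<lambda>j. phi (a j)) (2 * n) pr n s)\<^sup>2)"
    by (rule ext) (rule limit_fun_def[OF nodes sym])
  have co: "continuous_on (ball 0 1) (outer \<nu>)"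
    using log by (intro outer_continuous) (simp add: log_integrable_def)
  have "continuous_on (ball 0 1) (limit_fun a n \<nu> pr)"
    unfolding lf by (intro continuous_intros co Hn_continuous[OF nodes sym])
  then have cont: "isCont (limit_fun a n \<nu> pr) s" if "norm s < 1" for s
    using that by (simp add: continuous_on_eq_continuous_at)
  show ?thesis
  proof (cases \<zeta>)
    case (Some z)
    then have z: "z \<notin> slit" using \<zeta> by auto
    have "isCont (\<lambda>z. phi (Some z)) z"
      using phi_continuous z open_Compl_slit by (simp only: continuous_on_eq_continuous_at Compl_iff) blast
    then have "((\<lambda>z. phi (Some z)) \<longlongrightarrow> phi (Some z)) (at z)" by (simp only: isCont_def)
    then have t: "((\<lambda>z. limit_fun a n \<nu> pr (phi (Some z))) \<longlongrightarrow> limit_fun a n \<nu> pr (phi (Some z))) (at z)"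
      by (rule isCont_tendsto_compose[OF cont[OF phi_Some(2)[OF z]]])
    have "\<forall>\<^sub>F y in at z. limit_fun a n \<nu> pr (phi (Some y)) = ?E y"
      unfolding eventually_at_topological
    proof (intro exI[of _ "- slit \<inter> - (F - {z})"] conjI ballI impI)
      show "open (- slit \<inter> - (F - {z}))"
        using F by (intro open_Int open_Compl_slit open_Compl finite_imp_closed) auto
      show "z \<in> - slit \<inter> - (F - {z})" using z by simp
      fix y assume "y \<in> - slit \<inter> - (F - {z})" "y \<noteq> z"
      then show "limit_fun a n \<nu> pr (phi (Some y)) = ?E y" by (intro EL[symmetric]) auto
    qed
    with t have "(?E \<longlongrightarrow> limit_fun a n \<nu> pr (phi (Some z))) (at z)" by (rule Lim_transform_eventually)
    then have "remove_sings ?E z = limit_fun a n \<nu> pr (phi (Some z))" by (rule remove_sings_eqI)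
    then show ?thesis unfolding Some by (simp only: remove_sings_sphere.simps)
  next
    case None
    have t: "((\<lambda>z. limit_fun a n \<nu> pr (phi (Some z))) \<longlongrightarrow> limit_fun a n \<nu> pr 0) at_infinity"
      by (rule isCont_tendsto_compose[OF cont phi_at_infinity]) simp
    have "bounded (slit \<union> F)" using F compact_slit by (simp add: compact_imp_bounded finite_imp_bounded)
    then obtain B where B: "\<And>z. z \<in> slit \<union> F \<Longrightarrow> norm z \<le> B" unfolding bounded_iff by auto
    have "\<forall>\<^sub>F z in at_infinity. limit_fun a n \<nu> pr (phi (Some z)) = ?E z"
      unfolding eventually_at_infinity
    proof (intro exI[of _ "B + 1"] allI impI)
      fix z :: complex assume "B + 1 \<le> norm z"
      then have "z \<notin> slit \<union> F" using B[of z] by fastforce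
      then show "limit_fun a n \<nu> pr (phi (Some z)) = ?E z" by (intro EL[symmetric]) auto
    qed
    with t have "(?E \<longlongrightarrow> limit_fun a n \<nu> pr 0) at_infinity" by (rule Lim_transform_eventually)
    then have "Lim at_infinity ?E = limit_fun a n \<nu> pr 0" by (rule tendsto_Lim[OF trivial_limit_at_infinity])
    then show ?thesis unfolding None by (simp only: remove_sings_sphere.simps phi.simps(1))
  qed
qed

subsection \<open>Uniformity over the compact set of weights\<close>

text \<open>Elements are \<open>undefined\<close> off the interval, so they are constant there; this
  gives Borel measurability on the whole line.\<close>

lemma C_interval_D:
  assumes "h \<in> mspace C_interval"
  shows "continuous_on {-1..1} h" "h \<in> borel_measurable borel"
    "\<exists>B. \<forall>x\<in>{-1..1}. \<bar>h x\<bar> \<le> B"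
proof -
  have cm: "continuous_map (top_of_set {-1..1}) euclidean h" and ext: "h \<in> extensional {-1..1}"
    using assms by auto
  show c: "continuous_on {-1..1} h" using cm by simp
  have "(\<lambda>x. if x \<in> {-1..1} then h x else undefined) \<in> borel_measurable borel"
    by (rule borel_measurable_continuous_on_if[OF _ c]) auto
  moreover have "(\<lambda>x. if x \<in> {-1..1} then h x else undefined) = h"
    using ext by (auto simp: extensional_def fun_eq_iff)
  ultimately show "h \<in> borel_measurable borel" by simp
  obtain B where "B \<ge> 1" "\<And>x. x \<in> {-1..1} \<Longrightarrow> norm (h x) \<le> B"
    by (rule compact_bound_pos[OF compact_Icc c]) blast
  then have "\<forall>x\<in>{-1..1}. \<bar>h x\<bar> \<le> B" by simp
  then show "\<exists>B. \<forall>x\<in>{-1..1}. \<bar>h x\<bar> \<le> B" by blast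
qed

lemma C_interval_net:
  assumes K: "compactin (mtopology_of C_interval) K" and e: "e > 0"
  obtains F where "finite F" "F \<subseteq> K" "\<And>h. h \<in> K \<Longrightarrow> \<exists>h0\<in>F. \<forall>x\<in>{-1..1}. \<bar>h x - h0 x\<bar> \<le> e"
proof -
  interpret M: Metric_space "mspace C_interval" "mdist C_interval" by (rule Metric_space_mspace_mdist)
  have K': "compactin M.mtopology K" using K by (simp add: mtopology_of_def)
  have sub: "K \<subseteq> mspace C_interval" using compactin_subset_topspace[OF K'] by (simp only: M.topspace_mtopology)
  have tb: "M.mtotally_bounded K" by (rule M.compactin_imp_mtotally_bounded[OF K'])
  have "\<exists>F. finite F \<and> F \<subseteq> K \<and> K \<subseteq> (\<Union>h0\<in>F. M.mball h0 e)"
    by (rule tb[unfolded M.mtotally_bounded_def, rule_format, OF e])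
  then obtain F where F: "finite F" "F \<subseteq> K" "K \<subseteq> (\<Union>h0\<in>F. M.mball h0 e)" by (elim exE conjE)
  show thesis
  proof (rule that[OF F(1,2)])
    fix h assume h: "h \<in> K"
    from subsetD[OF F(3) h] obtain h0 where h0: "h0 \<in> F" "h \<in> M.mball h0 e" by (rule UN_E)
    note ball = h0(2)[unfolded M.in_mball]
    note m = ball[THEN conjunct1] ball[THEN conjunct2, THEN conjunct1]
    have d: "mdist C_interval h0 h \<le> e" by (rule less_imp_le[OF ball[THEN conjunct2, THEN conjunct2]])
    have "\<bar>h x - h0 x\<bar> \<le> e" if "x \<in> {-1..1}" for x
      using mdist_cfunspace_imp_mdist_le[OF m d, of x] that by (simp add: dist_real_def abs_minus_commute)
    then show "\<exists>h0\<in>F. \<forall>x\<in>{-1..1}. \<bar>h x - h0 x\<bar> \<le> e" by (intro bexI[OF _ h0(1)] ballI)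
  qed
qed

text \<open>The error budget: replacing \<open>h0\<close> by \<open>h\<close> costs a factor at most
  \<open>1 + e / 4\<close>, so the first integral stays below \<open>1 + 7 e / 8\<close>; in the
  second the losses are \<open>e / 4\<close>, \<open>e / 8\<close> and \<open>e / 4\<close>.\<close>

lemma near_extremal_transfer:
  assumes \<nu>: "finite_measure_on_interval \<nu>" "log_integrable \<nu>" and \<mu>: "finite_measure_on_interval \<mu>" "log_integrable \<mu>"
    and h0: "h0 \<in> mspace C_interval" and h: "h \<in> mspace C_interval"
    and hh: "\<And>x. x \<in> {-1..1} \<Longrightarrow> \<bar>h x - h0 x\<bar> \<le> e / 8" and e: "0 < e" "e \<le> 1"
    and 1: "(LINT x|\<nu>. exp (h0 x) * exp (poly l x)) \<le> 1 + e / 2"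
    and 2: "(LINT x|arcsine. poly l x + ln (ac_deriv (exp_weighted h0 \<mu>) x)) \<ge> - (e / 4)"
    and 3: "(LINT x|arcsine. \<bar>ln (ac_deriv \<nu> x) - ln (ac_deriv \<mu> x)\<bar>) \<le> e / 4"
  shows "(LINT x|exp_weighted h \<nu>. exp (poly l x)) \<le> 1 + e"
    "(LINT x|arcsine. poly l x + ln (ac_deriv (exp_weighted h \<nu>) x)) \<ge> - e"
proof -
  note hc = C_interval_D[OF h] and h0c = C_interval_D[OF h0]
  have elm: "(\<lambda>x. exp (poly l x)) \<in> borel_measurable borel" by measurable
  have ie: "integrable \<nu> (\<lambda>x. exp (k x) * exp (poly l x))" if "continuous_on {-1..1} k" "k \<in> borel_measurable borel" for k
  proof (rule integrable_poly_on_interval[OF \<nu>(1)])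
    show "continuous_on {-1..1} (\<lambda>x. exp (k x) * exp (poly l x))" by (intro continuous_intros that)
    show "(\<lambda>x. exp (k x) * exp (poly l x)) \<in> borel_measurable borel" using that(2) by measurable
  qed
  have "(LINT x|exp_weighted h \<nu>. exp (poly l x)) = (LINT x|\<nu>. exp (h x) * exp (poly l x))"
    using integral_exp_weighted[OF \<nu>(1) hc(2) elm] by simp
  also have "\<dots> \<le> (LINT x|\<nu>. exp (e / 8) * (exp (h0 x) * exp (poly l x)))"
  proof (rule integral_mono_AE[OF ie[OF hc(1,2)] integrable_mult_right[OF ie[OF h0c(1,2)]]])
    show "AE x in \<nu>. exp (h x) * exp (poly l x) \<le> exp (e / 8) * (exp (h0 x) * exp (poly l x))"
      using AE_on_interval[OF \<nu>(1)]
    proof eventually_elim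
      case (elim x)
      have "h x \<le> e / 8 + h0 x" using hh[OF elim] by linarith
      then show ?case by (simp flip: exp_add)
    qed
  qed
  also have "\<dots> = exp (e / 8) * (LINT x|\<nu>. exp (h0 x) * exp (poly l x))" by simp
  also have "\<dots> \<le> (1 + 2 * (e / 8)) * (1 + e / 2)"
  proof (rule mult_mono)
    have "exp (e / 8) \<le> 1 + e / 8 + (e / 8)\<^sup>2" using e by (intro exp_bound) auto
    moreover have "(e / 8)\<^sup>2 \<le> e / 8" using e by (simp add: power2_eq_square)
    ultimately show "exp (e / 8) \<le> 1 + 2 * (e / 8)" by linarith
  qed (use 1 e in \<open>auto intro!: Bochner_Integration.integral_nonneg\<close>)
  also have "\<dots> = 1 + 3 * e / 4 + e * e / 8" by (simp add: field_simps)
  also have "e * e / 8 \<le> e * 1 / 8" using e by (intro divide_right_mono mult_left_mono) auto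
  finally show "(LINT x|exp_weighted h \<nu>. exp (poly l x)) \<le> 1 + e" using e by simp
  obtain B0 where B0: "\<And>x. x \<in> {-1..1} \<Longrightarrow> \<bar>h0 x\<bar> \<le> B0" using h0c(3) by blast
  obtain B where B: "\<And>x. x \<in> {-1..1} \<Longrightarrow> \<bar>h x\<bar> \<le> B" using hc(3) by blast
  have lh: "log_integrable (exp_weighted h \<nu>)" "AE x in arcsine. ln (ac_deriv (exp_weighted h \<nu>) x) = h x + ln (ac_deriv \<nu> x)"
    by (rule log_exp_weighted[OF \<nu> hc(2) B], assumption)+
  have lh0: "log_integrable (exp_weighted h0 \<mu>)" "AE x in arcsine. ln (ac_deriv (exp_weighted h0 \<mu>) x) = h0 x + ln (ac_deriv \<mu> x)"
    by (rule log_exp_weighted[OF \<mu> h0c(2) B0], assumption)+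
  have il: "integrable arcsine (poly l)"
    by (intro integrable_poly_on_interval[OF finite_measure_on_interval_arcsine] continuous_intros) measurable
  have iln: "integrable arcsine (\<lambda>x. ln (ac_deriv \<kappa> x))" if "log_integrable \<kappa>" for \<kappa>
    using that by (simp add: log_integrable_def)
  note i1 = iln[OF lh(1)] and i2 = iln[OF lh0(1)] and i3 = iln[OF \<nu>(2)] and i4 = iln[OF \<mu>(2)]
  have "(LINT x|arcsine. (poly l x + ln (ac_deriv (exp_weighted h0 \<mu>) x)) - (e / 8 + \<bar>ln (ac_deriv \<nu> x) - ln (ac_deriv \<mu> x)\<bar>))
      \<le> (LINT x|arcsine. poly l x + ln (ac_deriv (exp_weighted h \<nu>) x))"
  proof (rule integral_mono_AE)
    show "AE x in arcsine. (poly l x + ln (ac_deriv (exp_weighted h0 \<mu>) x)) - (e / 8 + \<bar>ln (ac_deriv \<nu> x) - ln (ac_deriv \<mu> x)\<bar>)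
        \<le> poly l x + ln (ac_deriv (exp_weighted h \<nu>) x)"
      using lh(2) lh0(2) AE_on_interval[OF finite_measure_on_interval_arcsine]
    proof eventually_elim
      case (elim x)
      show ?case unfolding elim(1,2) using hh[OF elim(3)] by (simp add: abs_if split: if_splits)
    qed
  qed (use il i1 i2 i3 i4 in auto)
  moreover have "(LINT x|arcsine. (poly l x + ln (ac_deriv (exp_weighted h0 \<mu>) x)) - (e / 8 + \<bar>ln (ac_deriv \<nu> x) - ln (ac_deriv \<mu> x)\<bar>))
      = (LINT x|arcsine. poly l x + ln (ac_deriv (exp_weighted h0 \<mu>) x)) - (e / 8 + (LINT x|arcsine. \<bar>ln (ac_deriv \<nu> x) - ln (ac_deriv \<mu> x)\<bar>))"
    using il i2 i3 i4 by (simp add: Bochner_Integration.integral_diff)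
  ultimately show "(LINT x|arcsine. poly l x + ln (ac_deriv (exp_weighted h \<nu>) x)) \<ge> - e"
    using 2 3 e by linarith
qed

text \<open>The exponent \<open>l\<close> is extremal for the limiting weight \<open>exp h0\<close>
  times \<mu>. Hypothesis (A) is needed for the single function \<open>exp (h0 + l)\<close> and (B)
  handles the logarithms, so one \<open>l\<close> and one threshold serve the whole ball around
  \<open>h0\<close>.\<close>

lemma weights_eventually_near_extremal:
  fixes \<mu>t :: "nat \<Rightarrow> real measure"
  assumes \<mu>t: "\<And>n. finite_measure_on_interval (\<mu>t n)" "\<And>n. log_integrable (\<mu>t n)"
    and \<mu>: "finite_measure_on_interval \<mu>" "log_integrable \<mu>"
    and A: "\<And>f :: real \<Rightarrow> real. continuous_on {-1..1} f \<Longrightarrow> (\<And>x. x \<in> {-1..1} \<Longrightarrow> 0 \<le> f x) \<Longrightarrow>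
              limsup (\<lambda>n. ereal (LINT x:{-1..1}|\<mu>t n. f x)) \<le> ereal (LINT x:{-1..1}|\<mu>. f x)"
    and B: "(\<lambda>n. LINT x|arcsine. \<bar>ln (ac_deriv (\<mu>t n) x) - ln (ac_deriv \<mu> x)\<bar>) \<longlonglongrightarrow> 0"
    and h0: "h0 \<in> mspace C_interval" and e: "0 < e" "e \<le> 1"
  obtains l where "\<forall>\<^sub>F n in sequentially. \<forall>h\<in>mspace C_interval. (\<forall>x\<in>{-1..1}. \<bar>h x - h0 x\<bar> \<le> e / 8) \<longrightarrow>
      (LINT x|exp_weighted h (\<mu>t n). exp (poly l x)) \<le> 1 + e
      \<and> (LINT x|arcsine. poly l x + ln (ac_deriv (exp_weighted h (\<mu>t n)) x)) \<ge> - e"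
proof -
  note h0c = C_interval_D[OF h0]
  obtain B0 where B0: "\<And>x. x \<in> {-1..1} \<Longrightarrow> \<bar>h0 x\<bar> \<le> B0" using h0c(3) by blast
  have B0': "h0 x \<le> B0" if "x \<in> {-1..1}" for x using B0[OF that] by simp
  have e4: "e / 4 > 0" using e by simp
  obtain l :: "real poly" where l: "(LINT x|exp_weighted h0 \<mu>. exp (poly l x)) \<le> 1 + e / 4"
    "(LINT x|arcsine. poly l x + ln (ac_deriv (exp_weighted h0 \<mu>) x)) \<ge> - (e / 4)"
    by (rule szego_extremal_poly[OF finite_measure_on_interval_exp_weighted[OF \<mu>(1) h0c(2) B0']
          log_exp_weighted(1)[OF \<mu> h0c(2) B0] e4])
  define f where "f x = exp (h0 x) * exp (poly l x)" for x
  have fc: "continuous_on {-1..1} f" unfolding f_def by (intro continuous_intros h0c)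
  have elm: "(\<lambda>x. exp (poly l x)) \<in> borel_measurable borel" by measurable
  have set: "(LINT x:{-1..1}|\<kappa>. f x) = (LINT x|\<kappa>. f x)" if \<kappa>: "finite_measure_on_interval \<kappa>" for \<kappa>
    unfolding set_lebesgue_integral_def
  proof (rule integral_cong_AE)
    have fm: "f \<in> borel_measurable borel" unfolding f_def using h0c(2) by measurable
    then show "f \<in> borel_measurable \<kappa>" "(\<lambda>x. indicator {-1..1} x *\<^sub>R f x) \<in> borel_measurable \<kappa>"
      unfolding measurable_on_interval[OF \<kappa>] by measurable
    show "AE x in \<kappa>. indicator {-1..1} x *\<^sub>R f x = f x"
      using AE_on_interval[OF \<kappa>] by eventually_elim simp
  qed
  have "(LINT x|\<mu>. f x) \<le> 1 + e / 4"
    using l(1) integral_exp_weighted[OF \<mu>(1) h0c(2) elm] by (simp add: f_def)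
  then have "limsup (\<lambda>n. ereal (LINT x:{-1..1}|\<mu>t n. f x)) < ereal (1 + e / 2)"
    using A[OF fc] e by (intro le_less_trans[OF A[OF fc]]) (auto simp: f_def set[OF \<mu>(1), unfolded f_def])
  then have "\<forall>\<^sub>F n in sequentially. ereal (LINT x:{-1..1}|\<mu>t n. f x) < ereal (1 + e / 2)"
    by (rule Limsup_lessD)
  then have ev1: "\<forall>\<^sub>F n in sequentially. (LINT x|\<mu>t n. exp (h0 x) * exp (poly l x)) \<le> 1 + e / 2"
  proof eventually_elim
    case (elim n)
    from elim have "(LINT x:{-1..1}|\<mu>t n. f x) < 1 + e / 2" by (simp only: ereal_less_eq less_ereal.simps)
    then have "(LINT x|\<mu>t n. f x) < 1 + e / 2" unfolding set[OF \<mu>t(1)[of n]] .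
    then show ?case unfolding f_def by (rule less_imp_le)
  qed
  have ev2: "\<forall>\<^sub>F n in sequentially. (LINT x|arcsine. \<bar>ln (ac_deriv (\<mu>t n) x) - ln (ac_deriv \<mu> x)\<bar>) < e / 4"
    using e by (intro order_tendstoD(2)[OF B]) simp
  show thesis
  proof (rule that[of l])
    show "\<forall>\<^sub>F n in sequentially. \<forall>h\<in>mspace C_interval. (\<forall>x\<in>{-1..1}. \<bar>h x - h0 x\<bar> \<le> e / 8) \<longrightarrow>
      (LINT x|exp_weighted h (\<mu>t n). exp (poly l x)) \<le> 1 + e
      \<and> (LINT x|arcsine. poly l x + ln (ac_deriv (exp_weighted h (\<mu>t n)) x)) \<ge> - e"
      using ev1 ev2
    proof eventually_elim
      case (elim n)
      show ?case
      proof (intro ballI impI)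
        fix h assume h: "h \<in> mspace C_interval" and hh: "\<forall>x\<in>{-1..1}. \<bar>h x - h0 x\<bar> \<le> e / 8"
        note t = near_extremal_transfer[OF \<mu>t(1)[of n] \<mu>t(2)[of n] \<mu> h0 h hh[rule_format] e elim(1) l(2) less_imp_le[OF elim(2)]]
        show "(LINT x|exp_weighted h (\<mu>t n). exp (poly l x)) \<le> 1 + e
          \<and> (LINT x|arcsine. poly l x + ln (ac_deriv (exp_weighted h (\<mu>t n)) x)) \<ge> - e"
          using t by blast
      qed
    qed
  qed
qed

lemma blaschke_eventually_small:
  assumes cn: "\<And>n. conj_nodes (\<lambda>j. phi (a n j)) (2 * n)"
    and D: "filterlim (\<lambda>n. \<Sum>j=1..2*n. 1 - norm (phi (a n j))) at_top sequentially"
    and \<rho>: "0 \<le> \<rho>" "\<rho> < 1" and \<eta>: "\<eta> > 0"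
  shows "\<forall>\<^sub>F n in sequentially. \<forall>s. norm s \<le> \<rho> \<longrightarrow>
    norm (poly (nump (\<lambda>j. phi (a n j)) (2 * n)) s) \<le> \<eta> * norm (poly (denp (\<lambda>j. phi (a n j)) (2 * n)) s)"
proof -
  define c where "c = (1 - \<rho>\<^sup>2) / 8"
  have c: "c > 0" using \<rho> by (simp add: c_def power_less_one_iff abs_square_less_1)
  \<comment> \<open>The threshold solves \<open>exp (- c * S) = \<eta>\<close> for the exponent in
    \<open>N_le_D\<close>; the maximum with 0 ensures that points closer to the origin only improve
    the bound.\<close>
  have "\<forall>\<^sub>F n in sequentially. (\<Sum>j=1..2*n. 1 - norm (phi (a n j))) \<ge> max 0 (- ln \<eta> / c)"
    using D unfolding filterlim_at_top by blast
  then show ?thesis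
  proof eventually_elim
    case (elim n)
    interpret conj_nodes "\<lambda>j. phi (a n j)" "2 * n" by (rule cn)
    let ?S = "\<Sum>j=1..2*n. 1 - norm (phi (a n j))"
    show ?case
    proof (intro allI impI)
      fix s :: complex assume s: "norm s \<le> \<rho>"
      have "c \<le> (1 - (norm s)\<^sup>2) / 8" unfolding c_def using s power_mono[OF s, of 2] by simp
      then have "c * ?S \<le> (1 - (norm s)\<^sup>2) / 8 * ?S" using elim by (intro mult_right_mono) auto
      moreover have "- ln \<eta> \<le> c * ?S"
      proof -
        have "- ln \<eta> / c \<le> ?S" using elim by (simp only: max.bounded_iff)
        then show ?thesis unfolding pos_divide_le_eq[OF c] by (simp only: mult.commute)
      qed
      moreover have "- (1 - (norm s)\<^sup>2) / 8 * ?S = - ((1 - (norm s)\<^sup>2) / 8 * ?S)"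
        by (simp only: minus_divide_left[symmetric] mult_minus_left)
      ultimately have "- (1 - (norm s)\<^sup>2) / 8 * ?S \<le> ln \<eta>" by linarith
      then have "exp (- (1 - (norm s)\<^sup>2) / 8 * ?S) \<le> exp (ln \<eta>)" by (simp only: exp_le_cancel_iff)
      then have "exp (- (1 - (norm s)\<^sup>2) / 8 * ?S) \<le> \<eta>" using \<eta> by simp
      then have "exp (- (1 - (norm s)\<^sup>2) / 8 * ?S) * norm (D s) \<le> \<eta> * norm (D s)" by (intro mult_right_mono) auto
      moreover have "norm (N s) \<le> exp (- (1 - (norm s)\<^sup>2) / 8 * ?S) * norm (D s)"
        using s \<rho> by (intro N_le_D) simp
      ultimately show "norm (N s) \<le> \<eta> * norm (D s)" by linarith
    qed
  qed
qed

text \<open>The threshold for \<open>n\<close> is uniform in \<open>h\<close>, \<open>p\<close> and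
  \<open>s\<close> simultaneously. Compactness of \<open>K\<close> enters only through a finite net:
  each centre has its own exponent, and finitely many thresholds are combined.\<close>

lemma limit_fun_eventually_near_one:
  fixes \<mu>t :: "nat \<Rightarrow> real measure" and a :: "nat \<Rightarrow> nat \<Rightarrow> complex option"
  assumes \<mu>t: "\<And>n. finite_measure_on_interval (\<mu>t n)" "\<And>n. log_integrable (\<mu>t n)"
    and \<mu>: "finite_measure_on_interval \<mu>" "log_integrable \<mu>"
    and nodes: "\<And>n j. j \<in> {1..2*n} \<Longrightarrow> a n j \<notin> Some ` slit"
    and sym: "\<And>n. image_mset (\<lambda>j. map_option cnj (a n j)) (mset_set {1..2*n}) = image_mset (a n) (mset_set {1..2*n})"
    and A: "\<And>f :: real \<Rightarrow> real. continuous_on {-1..1} f \<Longrightarrow> (\<And>x. x \<in> {-1..1} \<Longrightarrow> 0 \<le> f x) \<Longrightarrow>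
              limsup (\<lambda>n. ereal (LINT x:{-1..1}|\<mu>t n. f x)) \<le> ereal (LINT x:{-1..1}|\<mu>. f x)"
    and B: "(\<lambda>n. LINT x|arcsine. \<bar>ln (ac_deriv (\<mu>t n) x) - ln (ac_deriv \<mu> x)\<bar>) \<longlonglongrightarrow> 0"
    and C: "compactin (mtopology_of C_interval) K"
    and D: "filterlim (\<lambda>n. \<Sum>j=1..2*n. 1 - norm (phi (a n j))) at_top sequentially"
    and r: "0 \<le> r" "r < 1" and e: "e > 0"
  shows "\<forall>\<^sub>F n in sequentially. \<forall>h\<in>K. \<forall>p. orthonormal_poly (a n) (exp_weighted h (\<mu>t n)) n p \<longrightarrow>
    n > 0 \<and> log_integrable (exp_weighted h (\<mu>t n)) \<and>
    (\<exists>pr. p = cpoly pr \<and> degree pr = n \<and>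
       (\<forall>s. norm s \<le> r \<longrightarrow> norm (limit_fun (a n) n (exp_weighted h (\<mu>t n)) pr s - 1) < e))"
proof -
  define e' where "e' = min 1 (e / 6)"
  have e': "0 < e'" "e' \<le> 1" "6 * e' \<le> e" using e by (auto simp: e'_def)
  \<comment> \<open>Makes \<open>27 * \<delta> \<le> (1 - r)\<^sup>2\<close> and
    \<open>111 * \<delta> / (1 - r)\<^sup>2 \<le> e'\<close>. The reserve 6 in \<open>e'\<close>
    covers the factor 3 lost in squaring and yields a strict inequality.\<close>
  define \<delta> where "\<delta> = min (1/27) (e' / 111) * (1 - r)\<^sup>2"
  have r2: "0 < (1 - r)\<^sup>2" "(1 - r)\<^sup>2 \<le> 1" using r by (simp_all add: power_le_one)
  have \<delta>0: "0 < \<delta>" unfolding \<delta>_def using r2 e' by (intro mult_pos_pos) auto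
  have "\<delta> \<le> 1/27 * (1 - r)\<^sup>2" "\<delta> \<le> e' / 111 * (1 - r)\<^sup>2"
    unfolding \<delta>_def using r2 by (intro mult_right_mono; simp)+
  then have small: "27 * \<delta> \<le> (1 - r)\<^sup>2" and \<delta>1: "\<delta> \<le> 1" and \<delta>e: "111 * \<delta> / (1 - r)\<^sup>2 \<le> e'"
    using r2 by (simp_all add: pos_divide_le_eq)
  have \<delta>4: "0 < \<delta> ^ 4" "\<delta> ^ 4 \<le> 1" using \<delta>0 \<delta>1 by (simp_all add: power_le_one)
  have cn: "conj_nodes (\<lambda>j. phi (a n j)) (2 * n)" for n by (rule conj_nodes_phi[OF nodes sym])
  have KC: "K \<subseteq> mspace C_interval" using compactin_subset_topspace[OF C] by (simp only: topspace_mtopology_of)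
  define good where "good n h \<longleftrightarrow> (\<forall>p. orthonormal_poly (a n) (exp_weighted h (\<mu>t n)) n p \<longrightarrow>
    n > 0 \<and> log_integrable (exp_weighted h (\<mu>t n)) \<and>
    (\<exists>pr. p = cpoly pr \<and> degree pr = n \<and>
       (\<forall>s. norm s \<le> r \<longrightarrow> norm (limit_fun (a n) n (exp_weighted h (\<mu>t n)) pr s - 1) < e)))" for n h
  have local: "\<forall>\<^sub>F n in sequentially. \<forall>h\<in>K. (\<forall>x\<in>{-1..1}. \<bar>h x - h0 x\<bar> \<le> \<delta> ^ 4 / 8) \<longrightarrow> good n h"
    if h0: "h0 \<in> mspace C_interval" for h0
  proof -
    obtain l where l: "\<forall>\<^sub>F n in sequentially. \<forall>h\<in>mspace C_interval. (\<forall>x\<in>{-1..1}. \<bar>h x - h0 x\<bar> \<le> \<delta> ^ 4 / 8) \<longrightarrow>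
        (LINT x|exp_weighted h (\<mu>t n). exp (poly l x)) \<le> 1 + \<delta> ^ 4
        \<and> (LINT x|arcsine. poly l x + ln (ac_deriv (exp_weighted h (\<mu>t n)) x)) \<ge> - (\<delta> ^ 4)"
      by (rule weights_eventually_near_extremal[OF \<mu>t \<mu> _ B h0 \<delta>4]) ((rule A, assumption, blast) | blast)+
    obtain Q where Q: "\<And>s. s \<noteq> 0 \<Longrightarrow> poly (cpoly l) (joukowski s) = poly (cpoly Q) s + poly (cpoly Q) (1 / s)"
      using analytic_half_exists[of l] by blast
    have half: "analytic_half l Q" by unfold_locales (rule Q)
    obtain \<eta> where \<eta>: "\<eta> > 0" "\<And>\<alpha> n \<nu> p s. n > 0 \<Longrightarrow> conj_nodes \<alpha> (2 * n) \<Longrightarrow>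
      (\<And>s. norm s \<le> (1 + r) / 2 \<Longrightarrow> norm (poly (nump \<alpha> (2 * n)) s) \<le> \<eta> * norm (poly (denp \<alpha> (2 * n)) s)) \<Longrightarrow>
      finite_measure_on_interval \<nu> \<Longrightarrow> log_integrable \<nu> \<Longrightarrow> (LINT x|\<nu>. exp (poly l x)) \<le> 1 + \<delta> ^ 4 \<Longrightarrow>
      (LINT x|arcsine. poly l x + ln (ac_deriv \<nu> x)) \<ge> - (\<delta> ^ 4) \<Longrightarrow>
      conj_nodes.orth_real \<alpha> (2 * n) \<nu> n p \<Longrightarrow> norm s \<le> r \<Longrightarrow>
      norm (outer \<nu> s * conj_nodes.Hn \<alpha> (2 * n) p n s - 1) \<le> 111 * \<delta> / (1 - r)\<^sup>2"
      by (rule interior_convergence[OF half \<delta>0 \<delta>1 r small]) blast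
    have \<rho>: "0 \<le> (1 + r) / 2" "(1 + r) / 2 < 1" using r by auto
    show ?thesis
      using l blaschke_eventually_small[OF cn D \<rho> \<eta>(1)] eventually_gt_at_top[of 0]
    proof eventually_elim
      case (elim n)
      show ?case
      proof (intro ballI impI)
        fix h assume hK: "h \<in> K" and hh: "\<forall>x\<in>{-1..1}. \<bar>h x - h0 x\<bar> \<le> \<delta> ^ 4 / 8"
        have h: "h \<in> mspace C_interval" using hK KC by (rule rev_subsetD)
        define \<sigma> where "\<sigma> = exp_weighted h (\<mu>t n)"
        have near: "(LINT x|\<sigma>. exp (poly l x)) \<le> 1 + \<delta> ^ 4"
          "(LINT x|arcsine. poly l x + ln (ac_deriv \<sigma> x)) \<ge> - (\<delta> ^ 4)"
          using elim(1)[rule_format, OF h hh[rule_format]] unfolding \<sigma>_def by blast+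
        obtain b where b: "\<And>x. x \<in> {-1..1} \<Longrightarrow> \<bar>h x\<bar> \<le> b" using C_interval_D(3)[OF h] by blast
        have b': "h x \<le> b" if "x \<in> {-1..1}" for x using b[OF that] by simp
        have \<sigma>: "finite_measure_on_interval \<sigma>" "log_integrable \<sigma>" unfolding \<sigma>_def
          by (rule finite_measure_on_interval_exp_weighted[OF \<mu>t(1) C_interval_D(2)[OF h] b'], assumption)
            (rule log_exp_weighted(1)[OF \<mu>t C_interval_D(2)[OF h] b], assumption)
        show "good n h"
          unfolding good_def \<sigma>_def[symmetric]
        proof (intro allI impI conjI)
          fix p assume op: "orthonormal_poly (a n) \<sigma> n p"
          obtain pr where pr: "p = cpoly pr" "conj_nodes.orth_real (\<lambda>j. phi (a n j)) (2 * n) \<sigma> n pr"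
            by (rule orthonormal_poly_real[OF nodes sym \<sigma> op])
          have "degree pr = n" using pr(2) unfolding conj_nodes.orth_real_def[OF cn] by blast
          moreover have "norm (limit_fun (a n) n \<sigma> pr s - 1) < e" if s: "norm s \<le> r" for s
          proof -
            define X where "X = outer \<sigma> s * conj_nodes.Hn (\<lambda>j. phi (a n j)) (2 * n) pr n s"
            have X: "norm (X - 1) \<le> e'"
              using \<eta>(2)[OF elim(3) cn elim(2)[rule_format] \<sigma> near pr(2) s] \<delta>e unfolding X_def by linarith
            have "norm (X + 1) = norm ((X - 1) + 2)" by (simp add: add.commute)
            also have "\<dots> \<le> norm (X - 1) + norm (2 :: complex)" by (rule norm_triangle_ineq)
            finally have X1: "norm (X + 1) \<le> 3" using X e' by simp
            have lim: "limit_fun (a n) n \<sigma> pr s = X\<^sup>2" unfolding X_def by (rule limit_fun_def[OF nodes sym])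
            have "limit_fun (a n) n \<sigma> pr s - 1 = (X - 1) * (X + 1)"
              unfolding lim by (simp add: power2_eq_square algebra_simps)
            then have "norm (limit_fun (a n) n \<sigma> pr s - 1) \<le> e' * 3"
              using mult_mono[OF X X1] e' by (simp add: norm_mult)
            then show ?thesis using e' by linarith
          qed
          ultimately show "\<exists>pr. p = cpoly pr \<and> degree pr = n \<and> (\<forall>s. norm s \<le> r \<longrightarrow> norm (limit_fun (a n) n \<sigma> pr s - 1) < e)"
            using pr(1) by blast
        qed (rule elim(3) \<sigma>(2))+
      qed
    qed
  qed
  \<comment> \<open>The mesh of the net is the perturbation that
    \<open>near_extremal_transfer\<close> tolerates for the tolerance
    \<open>\<delta> ^ 4\<close>.\<close>
  have "\<delta> ^ 4 / 8 > 0" using \<delta>4 by simp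
  from C_interval_net[OF C this] obtain F where F: "finite F" "F \<subseteq> K"
      "\<And>h. h \<in> K \<Longrightarrow> \<exists>h0\<in>F. \<forall>x\<in>{-1..1}. \<bar>h x - h0 x\<bar> \<le> \<delta> ^ 4 / 8" by blast
  have "\<forall>\<^sub>F n in sequentially. \<forall>h0\<in>F. \<forall>h\<in>K. (\<forall>x\<in>{-1..1}. \<bar>h x - h0 x\<bar> \<le> \<delta> ^ 4 / 8) \<longrightarrow> good n h"
  proof (rule eventually_ball_finite[OF F(1)], rule ballI)
    fix h0 assume "h0 \<in> F"
    then have "h0 \<in> mspace C_interval" using F(2) KC by (meson subsetD)
    then show "\<forall>\<^sub>F n in sequentially. \<forall>h\<in>K. (\<forall>x\<in>{-1..1}. \<bar>h x - h0 x\<bar> \<le> \<delta> ^ 4 / 8) \<longrightarrow> good n h" by (rule local)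
  qed
  then have "\<forall>\<^sub>F n in sequentially. \<forall>h\<in>K. good n h"
  proof eventually_elim
    case (elim n)
    show ?case
    proof (rule ballI)
      fix h assume h: "h \<in> K"
      from F(3)[OF h] obtain h0 where "h0 \<in> F" "\<forall>x\<in>{-1..1}. \<bar>h x - h0 x\<bar> \<le> \<delta> ^ 4 / 8" by (rule bexE)
      then show "good n h" using elim[THEN bspec, THEN bspec[OF _ h]] by (simp only: simp_thms)
    qed
  qed
  then show ?thesis unfolding good_def .
qed

section \<open>Locally uniform convergence on the sphere\<close>

theorem theorem5p8:
  fixes \<mu>t :: "nat \<Rightarrow> real measure" and \<mu> :: "real measure"
    and K :: "(real \<Rightarrow> real) set"
    and a :: "nat \<Rightarrow> nat \<Rightarrow> complex option"
  assumes "\<And>n. finite_measure_on_interval (\<mu>t n)" and "finite_measure_on_interval \<mu>"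
    and nodes: "\<And>n j. j \<in> {1..2*n} \<Longrightarrow> a n j \<notin> Some ` slit"
    and conj_symmetric: "\<And>n. image_mset (\<lambda>j. map_option cnj (a n j)) (mset_set {1..2*n})
                             = image_mset (a n) (mset_set {1..2*n})"
    and A: "\<And>f :: real \<Rightarrow> real. continuous_on {-1..1} f \<Longrightarrow> (\<And>x. x \<in> {-1..1} \<Longrightarrow> 0 \<le> f x) \<Longrightarrow>
              limsup (\<lambda>n. ereal (LINT x:{-1..1}|\<mu>t n. f x)) \<le> ereal (LINT x:{-1..1}|\<mu>. f x)"
    and B: "\<And>n. log_integrable (\<mu>t n)" "log_integrable \<mu>"
           "(\<lambda>n. LINT x|arcsine. \<bar>ln (ac_deriv (\<mu>t n) x) - ln (ac_deriv \<mu> x)\<bar>) \<longlonglongrightarrow> 0"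
    and C: "compactin (mtopology_of C_interval) K"
    and D: "filterlim (\<lambda>n. \<Sum>j=1..2*n. 1 - norm (phi (a n j))) at_top sequentially"
  shows "(\<forall>Z. compactin csphere Z \<and> Z \<inter> Some ` slit = {} \<longrightarrow>
           uniform_limit (admissible K a \<mu>t \<times> Z)
             (\<lambda>n ((h, p), \<zeta>). remove_sings_sphere
                (\<lambda>z. 2 * (szego (exp_weighted (h n) (\<mu>t n)) (Some z))\<^sup>2
                       * ((poly (p n) z)\<^sup>2 / tau (a n) n z)
                       * (\<Prod>j=1..2*n. (phi (Some z) - phi (a n j))
                                      / (1 - cnj (phi (a n j)) * phi (Some z)))) \<zeta>)
             (\<lambda>_. 1) sequentially)
       \<and> uniform_limit (admissible K a \<mu>t)
           (\<lambda>n (h, p). (szego (exp_weighted (h n) (\<mu>t n)) None)\<^sup>2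
                       * ((lead_coeff (p n))\<^sup>2 / 2 ^ (2 * n - 1))
                       * (\<Prod>j\<in>{j\<in>{1..2*n}. a n j \<noteq> None}. 2 * the (a n j) * phi (a n j)))
           (\<lambda>_. 1) sequentially"
proof -
  \<comment> \<open>At index \<open>n\<close> an admissible pair enters only through its
    \<open>n\<close>-th members, so a bound over all \<open>h\<close> in \<open>K\<close> and all
    orthonormal \<open>p\<close> gives a rate independent of the sequences.\<close>
  have near: "\<forall>\<^sub>F n in sequentially. \<forall>h\<in>K. \<forall>p. orthonormal_poly (a n) (exp_weighted h (\<mu>t n)) n p \<longrightarrow>
    n > 0 \<and> log_integrable (exp_weighted h (\<mu>t n)) \<and>
    (\<exists>pr. p = cpoly pr \<and> degree pr = n \<and>
       (\<forall>s. norm s \<le> r \<longrightarrow> norm (limit_fun (a n) n (exp_weighted h (\<mu>t n)) pr s - 1) < e))"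
    if "0 \<le> r" "r < 1" "e > 0" for r e
    by (rule limit_fun_eventually_near_one[where \<mu> = \<mu>]) (fact assms that)+
  show ?thesis
  proof (intro conjI allI impI)
    fix Z assume "compactin csphere Z \<and> Z \<inter> Some ` slit = {}"
    then have Z: "compactin csphere Z" "Z \<inter> Some ` slit = {}" by blast+
    obtain r where r: "0 \<le> r" "r < 1" "\<And>p. p \<in> Z \<Longrightarrow> norm (phi p) \<le> r"
      by (rule phi_compact_bound[OF Z]) blast
    show "uniform_limit (admissible K a \<mu>t \<times> Z)
             (\<lambda>n ((h, p), \<zeta>). remove_sings_sphere
                (\<lambda>z. 2 * (szego (exp_weighted (h n) (\<mu>t n)) (Some z))\<^sup>2
                       * ((poly (p n) z)\<^sup>2 / tau (a n) n z)
                       * (\<Prod>j=1..2*n. (phi (Some z) - phi (a n j))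
                                      / (1 - cnj (phi (a n j)) * phi (Some z)))) \<zeta>)
             (\<lambda>_. 1) sequentially"
      unfolding uniform_limit_iff
    proof (intro allI impI)
      fix e :: real assume "e > 0"
      from near[OF r(1,2) this]
      show "\<forall>\<^sub>F n in sequentially. \<forall>y\<in>admissible K a \<mu>t \<times> Z. dist ((\<lambda>((h, p), \<zeta>). remove_sings_sphere
                (\<lambda>z. 2 * (szego (exp_weighted (h n) (\<mu>t n)) (Some z))\<^sup>2
                       * ((poly (p n) z)\<^sup>2 / tau (a n) n z)
                       * (\<Prod>j=1..2*n. (phi (Some z) - phi (a n j))
                                      / (1 - cnj (phi (a n j)) * phi (Some z)))) \<zeta>) y) 1 < e"
      proof eventually_elim
        case (elim n)
        show ?case
        proof (rule ballI)
          fix y assume "y \<in> admissible K a \<mu>t \<times> Z"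
          then obtain h p \<zeta> where y: "y = ((h, p), \<zeta>)" and hp: "(h, p) \<in> admissible K a \<mu>t" and \<zeta>: "\<zeta> \<in> Z"
            by (metis mem_Times_iff prod.collapse)
          have hK: "h n \<in> K" and p: "orthonormal_poly (a n) (exp_weighted (h n) (\<mu>t n)) n (p n)"
            using hp unfolding admissible_def mem_Collect_eq prod.case by blast+
          from elim[rule_format, OF hK p] obtain pr where log: "log_integrable (exp_weighted (h n) (\<mu>t n))"
            and pr: "p n = cpoly pr" "degree pr = n"
              "\<And>s. norm s \<le> r \<Longrightarrow> norm (limit_fun (a n) n (exp_weighted (h n) (\<mu>t n)) pr s - 1) < e" by blast
          have \<zeta>s: "\<zeta> \<notin> Some ` slit" using \<zeta> Z(2) by blast
          have d: "degree pr \<le> n" by (simp only: pr(2))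
          show "dist ((\<lambda>((h, p), \<zeta>). remove_sings_sphere
                (\<lambda>z. 2 * (szego (exp_weighted (h n) (\<mu>t n)) (Some z))\<^sup>2
                       * ((poly (p n) z)\<^sup>2 / tau (a n) n z)
                       * (\<Prod>j=1..2*n. (phi (Some z) - phi (a n j))
                                      / (1 - cnj (phi (a n j)) * phi (Some z)))) \<zeta>) y) 1 < e"
            unfolding y prod.case pr(1)
            by (subst remove_sings_formula[OF _ conj_symmetric log d \<zeta>s])
              (fact nodes | (unfold dist_norm, rule pr(3)[OF r(3)[OF \<zeta>]]))+
        qed
      qed
    qed
  next
    show "uniform_limit (admissible K a \<mu>t)
             (\<lambda>n (h, p). (szego (exp_weighted (h n) (\<mu>t n)) None)\<^sup>2
                       * ((lead_coeff (p n))\<^sup>2 / 2 ^ (2 * n - 1))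
                       * (\<Prod>j\<in>{j\<in>{1..2*n}. a n j \<noteq> None}. 2 * the (a n j) * phi (a n j)))
             (\<lambda>_. 1) sequentially"
      unfolding uniform_limit_iff
    proof (intro allI impI)
      fix e :: real assume "e > 0"
      \<comment> \<open>Radius 0 suffices, since infinity corresponds to
        \<open>s = 0\<close>.\<close>
      from near[OF order_refl zero_less_one this]
      show "\<forall>\<^sub>F n in sequentially. \<forall>y\<in>admissible K a \<mu>t. dist ((\<lambda>(h, p). (szego (exp_weighted (h n) (\<mu>t n)) None)\<^sup>2
                       * ((lead_coeff (p n))\<^sup>2 / 2 ^ (2 * n - 1))
                       * (\<Prod>j\<in>{j\<in>{1..2*n}. a n j \<noteq> None}. 2 * the (a n j) * phi (a n j))) y) 1 < e"
      proof eventually_elim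
        case (elim n)
        show ?case
        proof (rule ballI)
          fix y assume hp: "y \<in> admissible K a \<mu>t"
          obtain h p where y: "y = (h, p)" by (cases y)
          have hK: "h n \<in> K" and p: "orthonormal_poly (a n) (exp_weighted (h n) (\<mu>t n)) n (p n)"
            using hp unfolding y admissible_def mem_Collect_eq prod.case by blast+
          from elim[rule_format, OF hK p] obtain pr where n: "n > 0"
            and pr: "p n = cpoly pr" "degree pr = n"
              "\<And>s. norm s \<le> 0 \<Longrightarrow> norm (limit_fun (a n) n (exp_weighted (h n) (\<mu>t n)) pr s - 1) < e" by blast
          show "dist ((\<lambda>(h, p). (szego (exp_weighted (h n) (\<mu>t n)) None)\<^sup>2
                       * ((lead_coeff (p n))\<^sup>2 / 2 ^ (2 * n - 1))
                       * (\<Prod>j\<in>{j\<in>{1..2*n}. a n j \<noteq> None}. 2 * the (a n j) * phi (a n j))) y) 1 < e"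
            unfolding y prod.case pr(1)
            by (subst formula_at_infinity[OF _ conj_symmetric pr(2) n])
              (fact nodes | (unfold dist_norm, rule pr(3), simp))+
        qed
      qed
    qed
  qed
qed

end
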